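(* Let $Q$ be a smooth manifold, let $R_d\colon TQ\to Q\times Q$ be a discretization map on $Q$ with cotangent lift $R_d^{T^*}$, and let $L\colon TQ\to\mathbb{R}$ be a regular Lagrangian function with Legendre map $\mathcal{F}L\colon TQ\to T^*Q$. Then: (a) the map $R_d^{L}=(\mathcal{F}L^{-1},\mathcal{F}L^{-1})\circ R_d^{T^*}\circ T\mathcal{F}L\colon TTQ\to TQ\times TQ$ defines a symplectic numerical integrator of the Euler--Lagrange equations for $L$, through the equation $$R_d^{L}\Bigl(h\,\Gamma_L\bigl(\bigl(\tau_{TQ}\circ(R_d^{L})^{-1}\bigr)(q_0,v_0;q_1,v_1)\bigr)\Bigr)=(q_0,v_0;q_1,v_1)$$ with step size $h$; (b) the map $R_d^{L}$ is a discretization map on $TQ$.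
   Context: Discretization map: let $M$ be a smooth manifold and $U\subset TM$ an open neighborhood of the zero section. A smooth map $R_d\colon U\to M\times M$, $R_d(x,v)=(R^1(x,v),R^2(x,v))$, is a discretization map on $M$ if (1) $R_d(x,0)=(x,x)$ for all $x\in M$; and (2) for every $x\in M$, $T_{0_x}R^2_x-T_{0_x}R^1_x\colon T_{0_x}T_xM\simeq T_xM\to T_xM$ is the identity map of $T_xM$, where $R^a_x$ is the restriction of $R^a$ to (the part in $U$ of) $T_xM$, $a=1,2$. Every discretization map is a local diffeomorphism near the zero section, and its inverse is understood near the diagonal. Cotangent lift: $R_d^{T^*}=\Phi^{-1}\circ\widehat{R_d}\circ\alpha_Q$, a discretization map on $T^*Q$ (defined near the zero section of $TT^*Q\to T^*Q$), where - $\alpha_Q\colon TT^*Q\to T^*TQ$ is the canonical diffeomorphism, locally $\alpha_Q(q,p,\dot q,\dot p)=(q,\dot q,\dot p,p)$ in coordinates $(q,v,p_q,p_v)$ of $T^*TQ$; - for a (local) diffeomorphism $F\colon M_1\to M_2$, $\widehat F\colon T^*M_1\to T^*M_2$ is $\widehat F(\alpha_x)=\alpha_x\circ(T_xF)^{-1}\in T^*_{F(x)}M_2$; - $\Phi\colon T^*Q\times T^*Q\to T^*(Q\times Q)$, $\Phi(q_0,p_0;q_1,p_1)=(q_0,q_1,-p_0,p_1)$. Lagrangian setting: $L$ is smooth and $\mathcal{F}L(q,v)=(q,\partial L/\partial v)$. Regular means that the matrix $(\partial^2L/\partial v^i\partial v^j)$ is everywhere nonsingular, so $\mathcal{F}L$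 is a local diffeomorphism. $\Omega_L=(\mathcal{F}L)^*\omega_Q$, with $\omega_Q$ the canonical symplectic form of $T^*Q$ (locally $\mathrm{d}q\wedge\mathrm{d}p$), $E_L(v_q)=\langle\mathcal{F}L(v_q),v_q\rangle-L(v_q)$ is the energy, and $\Gamma_L$ is the second-order vector field on $TQ$ determined by $i_{\Gamma_L}\Omega_L=\mathrm{d}E_L$, whose integral curves are the solutions of the Euler--Lagrange equations. Here $\mathcal{F}L^{-1}$ is a local inverse: near the zero vector at $v_q\in TQ$, $R_d^L$ is formed with the local inverse of $\mathcal{F}L$ taking $\mathcal{F}L(v_q)$ to $v_q$; so $R_d^L$ is defined near the zero section of $\tau_{TQ}\colon TTQ\to TQ$. Symplectic integrator: a one-step method is symplectic if its one-step map is symplectic. For an implicit method this is understood locally: for every point of $TQ$ there are open neighborhoods $W,W'$ of it and $h_0>0$ such that, for $0<h<h_0$, the equation determines for each $(q_0,v_0)\in W$ a unique $(q_1,v_1)\in W'$, and the resulting smooth map $\varphi_h\colon W\to W'$ satisfies $\varphi_h^*\Omega_L=\Omega_L$. *)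

theory Defs
  imports "HOL-Analysis.Analysis"
begin

section \<open>Smooth manifolds given by an atlas\<close>

primrec Ck_on :: "nat \<Rightarrow> 'a::euclidean_space set \<Rightarrow> ('a \<Rightarrow> 'b::real_normed_vector) \<Rightarrow> bool" where
  "Ck_on 0 S f \<longleftrightarrow> continuous_on S f"
| "Ck_on (Suc k) S f \<longleftrightarrow>
     (\<forall>x\<in>S. f differentiable (at x)) \<and> (\<forall>v. Ck_on k S (\<lambda>x. frechet_derivative f (at x) v))"

text \<open>Only used for open \<open>S\<close>.\<close>
definition smooth_on :: "'a::euclidean_space set \<Rightarrow> ('a \<Rightarrow> 'b::real_normed_vector) \<Rightarrow> bool" where
  "smooth_on S f \<longleftrightarrow> (\<forall>k. Ck_on k S f)"

text \<open>A chart is a pair of its domain and its coordinate map. The manifold is the union of the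
  chart domains, not the whole type, and carries the topology induced by the atlas.\<close>
type_synonym ('m, 'e) chart = "'m set \<times> ('m \<Rightarrow> 'e)"
type_synonym ('m, 'e) atlas = "('m, 'e) chart set"

definition carrier :: "('m, 'e) atlas \<Rightarrow> 'm set" where
  "carrier A = \<Union> (fst ` A)"

definition charts_at :: "('m, 'e) atlas \<Rightarrow> 'm \<Rightarrow> ('m, 'e) chart set" where
  "charts_at A x = {c \<in> A. x \<in> fst c}"

definition chart_at :: "('m, 'e) atlas \<Rightarrow> 'm \<Rightarrow> ('m, 'e) chart" where
  "chart_at A x = (SOME c. c \<in> charts_at A x)"

definition chart_inv :: "('m, 'e) chart \<Rightarrow> 'e \<Rightarrow> 'm" where
  "chart_inv c = inv_into (fst c) (snd c)"

definition mtop :: "('m, 'e::euclidean_space) atlas \<Rightarrow> 'm topology" where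
  "mtop A = topology (\<lambda>S. S \<subseteq> carrier A \<and> (\<forall>c\<in>A. open (snd c ` (S \<inter> fst c))))"

definition smooth_atlas :: "('m, 'e::euclidean_space) atlas \<Rightarrow> bool" where
  "smooth_atlas A \<longleftrightarrow>
     (\<forall>c\<in>A. inj_on (snd c) (fst c)) \<and>
     (\<forall>c\<in>A. \<forall>d\<in>A. open (snd c ` (fst c \<inter> fst d)) \<and>
        smooth_on (snd c ` (fst c \<inter> fst d)) (snd d \<circ> chart_inv c))"

definition smooth_manifold :: "('m, 'e::euclidean_space) atlas \<Rightarrow> bool" where
  "smooth_manifold A \<longleftrightarrow>
     smooth_atlas A \<and> Hausdorff_space (mtop A) \<and> second_countable (mtop A)"

lemma istopology_mtop:
  assumes "smooth_atlas A"
  shows "istopology (\<lambda>S. S \<subseteq> carrier A \<and> (\<forall>c\<in>A. open (snd c ` (S \<inter> fst c))))"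
proof -
  have "open (snd c ` (S \<inter> T \<inter> fst c))"
    if "c \<in> A" "open (snd c ` (S \<inter> fst c))" "open (snd c ` (T \<inter> fst c))" for S T c
  proof -
    have "inj_on (snd c) (fst c)"
      using assms that by (auto simp: smooth_atlas_def)
    then have "snd c ` (S \<inter> T \<inter> fst c) = snd c ` (S \<inter> fst c) \<inter> snd c ` (T \<inter> fst c)"
      by (auto simp: inj_on_def)
    then show ?thesis using that by auto
  qed
  moreover have "open (snd c ` (\<Union>K \<inter> fst c))"
    if "\<And>S. S \<in> K \<Longrightarrow> open (snd c ` (S \<inter> fst c))" for K c
  proof -
    have "snd c ` (\<Union>K \<inter> fst c) = (\<Union>S\<in>K. snd c ` (S \<inter> fst c))" by auto
    then show ?thesis using that by auto
  qed
  ultimately show ?thesis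
    unfolding istopology_def by (intro conjI allI impI ballI; (blast | simp))
qed

definition smooth_map ::
  "('m, 'e::euclidean_space) atlas \<Rightarrow> ('k, 'f::euclidean_space) atlas \<Rightarrow> 'm set \<Rightarrow> ('m \<Rightarrow> 'k) \<Rightarrow> bool" where
  "smooth_map A B S F \<longleftrightarrow>
     openin (mtop A) S \<and> F ` S \<subseteq> carrier B \<and>
     (\<forall>c\<in>A. \<forall>d\<in>B. open (snd c ` (S \<inter> fst c \<inter> F -` fst d)) \<and>
        smooth_on (snd c ` (S \<inter> fst c \<inter> F -` fst d)) (snd d \<circ> F \<circ> chart_inv c))"

definition real_atlas :: "(real, real) atlas" where
  "real_atlas = {(UNIV, id)}"

definition diffeo_on ::
  "('m, 'e::euclidean_space) atlas \<Rightarrow> ('k, 'f::euclidean_space) atlas \<Rightarrow> 'm set \<Rightarrow> ('m \<Rightarrow> 'k) \<Rightarrow> bool" where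
  "diffeo_on A B S F \<longleftrightarrow>
     smooth_map A B S F \<and> inj_on F S \<and> smooth_map B A (F ` S) (inv_into S F)"

definition prod_chart :: "('m, 'e) chart \<Rightarrow> ('k, 'f) chart \<Rightarrow> ('m \<times> 'k, 'e \<times> 'f) chart" where
  "prod_chart c d = (fst c \<times> fst d, \<lambda>(x, y). (snd c x, snd d y))"

definition prod_atlas :: "('m, 'e) atlas \<Rightarrow> ('k, 'f) atlas \<Rightarrow> ('m \<times> 'k, 'e \<times> 'f) atlas" where
  "prod_atlas A B = (\<lambda>(c, d). prod_chart c d) ` (A \<times> B)"


section \<open>Tangent and cotangent bundles\<close>

text \<open>A tangent vector at \<open>x\<close> is the family of its components in all charts at \<open>x\<close>, subject to the
  usual transformation rule. Linear operations are pointwise, and the family is \<open>0\<close> on charts not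
  containing \<open>x\<close>. Points of the tangent bundle are pairs \<open>(x, \<xi>)\<close>.\<close>
type_synonym ('m, 'e) tvec = "('m, 'e) chart \<Rightarrow> 'e"
type_synonym ('m, 'e) tbundle = "'m \<times> ('m, 'e) tvec"

definition tspace :: "('m, 'e::euclidean_space) atlas \<Rightarrow> 'm \<Rightarrow> ('m, 'e) tvec set" where
  "tspace A x = {\<xi>.
     (\<forall>c\<in>charts_at A x. \<forall>d\<in>charts_at A x.
        \<xi> d = frechet_derivative (snd d \<circ> chart_inv c) (at (snd c x)) (\<xi> c)) \<and>
     (\<forall>c. c \<notin> charts_at A x \<longrightarrow> \<xi> c = 0)}"

text \<open>The tangent vector at \<open>x\<close> with component \<open>u\<close> in the chart \<open>c\<close>.\<close>
definition tvec_of :: "('m, 'e::euclidean_space) atlas \<Rightarrow> ('m, 'e) chart \<Rightarrow> 'm \<Rightarrow> 'e \<Rightarrow> ('m, 'e) tvec" where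
  "tvec_of A c x u = (\<lambda>d. if d \<in> charts_at A x
     then frechet_derivative (snd d \<circ> chart_inv c) (at (snd c x)) u else 0)"

definition tcarrier :: "('m, 'e::euclidean_space) atlas \<Rightarrow> ('m, 'e) tbundle set" where
  "tcarrier A = Sigma (carrier A) (tspace A)"

definition tchart ::
  "('m, 'e::euclidean_space) atlas \<Rightarrow> ('m, 'e) chart \<Rightarrow> (('m, 'e) tbundle, 'e \<times> 'e) chart" where
  "tchart A c = ({w \<in> tcarrier A. fst w \<in> fst c}, \<lambda>(x, \<xi>). (snd c x, \<xi> c))"

definition tan_atlas :: "('m, 'e::euclidean_space) atlas \<Rightarrow> (('m, 'e) tbundle, 'e \<times> 'e) atlas" where
  "tan_atlas A = tchart A ` A"

definition zero_at :: "'m \<Rightarrow> ('m, 'e::euclidean_space) tbundle" where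
  "zero_at x = (x, \<lambda>_. 0)"

definition scale :: "real \<Rightarrow> ('m, 'e::euclidean_space) tbundle \<Rightarrow> ('m, 'e) tbundle" where
  "scale h w = (fst w, \<lambda>c. h *\<^sub>R snd w c)"

text \<open>A cotangent vector at \<open>x\<close> is a linear functional on \<open>tspace A x\<close>, extensional off it.\<close>
type_synonym ('m, 'e) ctvec = "('m, 'e) tvec \<Rightarrow> real"
type_synonym ('m, 'e) ctbundle = "'m \<times> ('m, 'e) ctvec"

definition cspace :: "('m, 'e::euclidean_space) atlas \<Rightarrow> 'm \<Rightarrow> ('m, 'e) ctvec set" where
  "cspace A x = {\<mu> \<in> extensional (tspace A x).
     \<forall>\<xi>\<in>tspace A x. \<forall>\<eta>\<in>tspace A x. \<forall>a b.
       \<mu> (\<lambda>c. a *\<^sub>R \<xi> c + b *\<^sub>R \<eta> c) = a * \<mu> \<xi> + b * \<mu> \<eta>}"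

definition ccarrier :: "('m, 'e::euclidean_space) atlas \<Rightarrow> ('m, 'e) ctbundle set" where
  "ccarrier A = Sigma (carrier A) (cspace A)"

text \<open>The coordinates \<open>(q, p)\<close>, where \<open>p\<close> has the components \<open>p\<^sub>i = \<lambda>(\<partial>/\<partial>q\<^sup>i)\<close>.\<close>
definition cchart ::
  "('m, 'e::euclidean_space) atlas \<Rightarrow> ('m, 'e) chart \<Rightarrow> (('m, 'e) ctbundle, 'e \<times> 'e) chart" where
  "cchart A c = ({w \<in> ccarrier A. fst w \<in> fst c},
     \<lambda>(x, p). (snd c x, \<Sum>b\<in>Basis. p (tvec_of A c x b) *\<^sub>R b))"

definition cot_atlas :: "('m, 'e::euclidean_space) atlas \<Rightarrow> (('m, 'e) ctbundle, 'e \<times> 'e) atlas" where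
  "cot_atlas A = cchart A ` A"

text \<open>From here on, some notions are written in the chart \<open>chart_at A x\<close>; they do not depend on
  which chart at \<open>x\<close> is taken.\<close>

definition tmap_at ::
  "('m, 'e::euclidean_space) atlas \<Rightarrow> ('k, 'f::euclidean_space) atlas \<Rightarrow> ('m \<Rightarrow> 'k) \<Rightarrow> 'm
     \<Rightarrow> ('m, 'e) tvec \<Rightarrow> ('k, 'f) tvec" where
  "tmap_at A B F x \<xi> = (let c = chart_at A x in
     (\<lambda>d. if d \<in> charts_at B (F x)
       then frechet_derivative (snd d \<circ> F \<circ> chart_inv c) (at (snd c x)) (\<xi> c) else 0))"

definition tmap ::
  "('m, 'e::euclidean_space) atlas \<Rightarrow> ('k, 'f::euclidean_space) atlas \<Rightarrow> ('m \<Rightarrow> 'k)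
     \<Rightarrow> ('m, 'e) tbundle \<Rightarrow> ('k, 'f) tbundle" where
  "tmap A B F w = (F (fst w), tmap_at A B F (fst w) (snd w))"

definition differential ::
  "('m, 'e::euclidean_space) atlas \<Rightarrow> ('m \<Rightarrow> real) \<Rightarrow> 'm \<Rightarrow> ('m, 'e) tvec \<Rightarrow> real" where
  "differential A f x \<xi> = (let c = chart_at A x in
     frechet_derivative (f \<circ> chart_inv c) (at (snd c x)) (\<xi> c))"


section \<open>Discretization maps and their cotangent lifts\<close>

text \<open>\<open>T\<^bsub>0\<^sub>x\<^esub>f : T\<^bsub>0\<^sub>x\<^esub>T\<^sub>xM \<simeq> T\<^sub>xM \<rightarrow> T\<^bsub>f 0\<^esub>M\<close> for \<open>f\<close> defined near \<open>0\<close> on the vector space \<open>T\<^sub>xM\<close>,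
  in the linear coordinates of \<open>T\<^sub>xM\<close> given by a chart at \<open>x\<close>.\<close>
definition fibre_deriv ::
  "('m, 'e::euclidean_space) atlas \<Rightarrow> 'm \<Rightarrow> (('m, 'e) tvec \<Rightarrow> 'm) \<Rightarrow> ('m, 'e) tvec \<Rightarrow> ('m, 'e) tvec" where
  "fibre_deriv A x f \<xi> = (let c = chart_at A x in
     (\<lambda>d. if d \<in> charts_at A (f (\<lambda>_. 0))
       then frechet_derivative (\<lambda>u. snd d (f (tvec_of A c x u))) (at 0) (\<xi> c) else 0))"

definition discretization_map ::
  "('m, 'e::euclidean_space) atlas \<Rightarrow> ('m, 'e) tbundle set \<Rightarrow> (('m, 'e) tbundle \<Rightarrow> 'm \<times> 'm) \<Rightarrow> bool" where
  "discretization_map A U R \<longleftrightarrow>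
     openin (mtop (tan_atlas A)) U \<and> zero_at ` carrier A \<subseteq> U \<and>
     smooth_map (tan_atlas A) (prod_atlas A A) U R \<and>
     (\<forall>x\<in>carrier A. R (zero_at x) = (x, x)) \<and>
     (\<forall>x\<in>carrier A. \<forall>\<xi>\<in>tspace A x.
        (\<lambda>d. fibre_deriv A x (\<lambda>\<eta>. snd (R (x, \<eta>))) \<xi> d
            - fibre_deriv A x (\<lambda>\<eta>. fst (R (x, \<eta>))) \<xi> d) = \<xi>)"

definition alpha ::
  "('m, 'e::euclidean_space) atlas
     \<Rightarrow> (('m, 'e) ctbundle, 'e \<times> 'e) tbundle \<Rightarrow> (('m, 'e) tbundle, 'e \<times> 'e) ctbundle" where
  "alpha A w = (let c = chart_at A (fst (fst w));
       ((q, p), (q', p')) = snd (tchart (cot_atlas A) (cchart A c)) w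
     in chart_inv (cchart (tan_atlas A) (tchart A c)) ((q, q'), (p', p)))"

definition tinvertible ::
  "('m, 'e::euclidean_space) atlas \<Rightarrow> ('k, 'f::euclidean_space) atlas \<Rightarrow> ('m \<Rightarrow> 'k) \<Rightarrow> 'm \<Rightarrow> bool" where
  "tinvertible A B F x \<longleftrightarrow> bij_betw (tmap_at A B F x) (tspace A x) (tspace B (F x))"

text \<open>\<open>\<alpha>\<^sub>x \<mapsto> \<alpha>\<^sub>x \<circ> (T\<^sub>xF)\<^sup>-\<^sup>1\<close>, meaningful where \<open>T\<^sub>xF\<close> is invertible.\<close>
definition hat ::
  "('m, 'e::euclidean_space) atlas \<Rightarrow> ('k, 'f::euclidean_space) atlas \<Rightarrow> ('m \<Rightarrow> 'k)
     \<Rightarrow> ('m, 'e) ctbundle \<Rightarrow> ('k, 'f) ctbundle" where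
  "hat A B F w = (F (fst w),
     \<lambda>\<eta>\<in>tspace B (F (fst w)). snd w (inv_into (tspace A (fst w)) (tmap_at A B F (fst w)) \<eta>))"

definition Phi ::
  "('m, 'e::euclidean_space) atlas
     \<Rightarrow> ('m, 'e) ctbundle \<times> ('m, 'e) ctbundle \<Rightarrow> ('m \<times> 'm, 'e \<times> 'e) ctbundle" where
  "Phi A = (\<lambda>((q0, p0), (q1, p1)). ((q0, q1),
     \<lambda>\<zeta>\<in>tspace (prod_atlas A A) (q0, q1).
       - p0 (tmap_at (prod_atlas A A) A fst (q0, q1) \<zeta>)
       + p1 (tmap_at (prod_atlas A A) A snd (q0, q1) \<zeta>)))"

definition cot_lift ::
  "('m, 'e::euclidean_space) atlas \<Rightarrow> (('m, 'e) tbundle \<Rightarrow> 'm \<times> 'm)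
     \<Rightarrow> (('m, 'e) ctbundle, 'e \<times> 'e) tbundle \<Rightarrow> ('m, 'e) ctbundle \<times> ('m, 'e) ctbundle" where
  "cot_lift A R w =
     inv_into (ccarrier A \<times> ccarrier A) (Phi A) (hat (tan_atlas A) (prod_atlas A A) R (alpha A w))"

text \<open>Where \<open>cot_lift\<close> is meaningful, for \<open>R\<close> defined on \<open>U\<close>.\<close>
definition cot_lift_dom ::
  "('m, 'e::euclidean_space) atlas \<Rightarrow> ('m, 'e) tbundle set \<Rightarrow> (('m, 'e) tbundle \<Rightarrow> 'm \<times> 'm)
     \<Rightarrow> (('m, 'e) ctbundle, 'e \<times> 'e) tbundle set" where
  "cot_lift_dom A U R = {w \<in> tcarrier (cot_atlas A).
     fst (alpha A w) \<in> U \<and> tinvertible (tan_atlas A) (prod_atlas A A) R (fst (alpha A w))}"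


section \<open>Lagrangian mechanics\<close>

definition smooth_function :: "('m, 'e::euclidean_space) atlas \<Rightarrow> ('m \<Rightarrow> real) \<Rightarrow> bool" where
  "smooth_function A f \<longleftrightarrow> smooth_map A real_atlas (carrier A) f"

text \<open>\<open>L(q, \<cdot>)\<close> in the linear coordinates of \<open>T\<^sub>qQ\<close> given by the chart \<open>c\<close>.\<close>
definition fibre_rep ::
  "('q, 'e::euclidean_space) atlas \<Rightarrow> (('q, 'e) tbundle \<Rightarrow> real) \<Rightarrow> ('q, 'e) chart \<Rightarrow> 'q \<Rightarrow> 'e \<Rightarrow> real" where
  "fibre_rep A L c q u = L (q, tvec_of A c q u)"

definition legendre ::
  "('q, 'e::euclidean_space) atlas \<Rightarrow> (('q, 'e) tbundle \<Rightarrow> real) \<Rightarrow> ('q, 'e) tbundle \<Rightarrow> ('q, 'e) ctbundle" where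
  "legendre A L = (\<lambda>(q, v). (q, let c = chart_at A q in
     (\<lambda>\<xi>\<in>tspace A q. frechet_derivative (fibre_rep A L c q) (at (v c)) (\<xi> c))))"

definition fibre_hessian ::
  "('q, real^'n) atlas \<Rightarrow> (('q, real^'n) tbundle \<Rightarrow> real) \<Rightarrow> ('q, real^'n) chart
     \<Rightarrow> ('q, real^'n) tbundle \<Rightarrow> real^'n^'n" where
  "fibre_hessian A L c = (\<lambda>(q, v). \<chi> i j.
     frechet_derivative
       (\<lambda>u. frechet_derivative (fibre_rep A L c q) (at u) (axis j 1)) (at (v c)) (axis i 1))"

definition regular :: "('q, real^'n) atlas \<Rightarrow> (('q, real^'n) tbundle \<Rightarrow> real) \<Rightarrow> bool" where
  "regular A L \<longleftrightarrow>
     (\<forall>w\<in>tcarrier A. \<forall>c\<in>charts_at A (fst w). invertible (fibre_hessian A L c w))"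

text \<open>\<open>\<omega>\<^sub>Q = dq \<and> dp\<close>, evaluated at the point \<open>w\<close> of \<open>T\<^sup>*Q\<close>.\<close>
definition omega ::
  "('q, 'e::euclidean_space) atlas \<Rightarrow> ('q, 'e) ctbundle
     \<Rightarrow> (('q, 'e) ctbundle, 'e \<times> 'e) tvec \<Rightarrow> (('q, 'e) ctbundle, 'e \<times> 'e) tvec \<Rightarrow> real" where
  "omega A w X Y = (let c = cchart A (chart_at A (fst w)) in
     fst (X c) \<bullet> snd (Y c) - fst (Y c) \<bullet> snd (X c))"

definition pullback2 ::
  "('m, 'e::euclidean_space) atlas \<Rightarrow> ('k, 'f::euclidean_space) atlas \<Rightarrow> ('m \<Rightarrow> 'k)
     \<Rightarrow> ('k \<Rightarrow> ('k, 'f) tvec \<Rightarrow> ('k, 'f) tvec \<Rightarrow> real)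
     \<Rightarrow> 'm \<Rightarrow> ('m, 'e) tvec \<Rightarrow> ('m, 'e) tvec \<Rightarrow> real" where
  "pullback2 A B F w x X Y = w (F x) (tmap_at A B F x X) (tmap_at A B F x Y)"

definition Omega_L ::
  "('q, 'e::euclidean_space) atlas \<Rightarrow> (('q, 'e) tbundle \<Rightarrow> real) \<Rightarrow> ('q, 'e) tbundle
     \<Rightarrow> (('q, 'e) tbundle, 'e \<times> 'e) tvec \<Rightarrow> (('q, 'e) tbundle, 'e \<times> 'e) tvec \<Rightarrow> real" where
  "Omega_L A L = pullback2 (tan_atlas A) (cot_atlas A) (legendre A L) (omega A)"

definition energy :: "('q, 'e::euclidean_space) atlas \<Rightarrow> (('q, 'e) tbundle \<Rightarrow> real) \<Rightarrow> ('q, 'e) tbundle \<Rightarrow> real" where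
  "energy A L w = snd (legendre A L w) (snd w) - L w"

definition Gamma_L ::
  "('q, 'e::euclidean_space) atlas \<Rightarrow> (('q, 'e) tbundle \<Rightarrow> real) \<Rightarrow> ('q, 'e) tbundle
     \<Rightarrow> (('q, 'e) tbundle, 'e \<times> 'e) tbundle" where
  "Gamma_L A L w = (w, THE X. X \<in> tspace (tan_atlas A) w \<and>
     (\<forall>Y\<in>tspace (tan_atlas A) w. Omega_L A L w X Y = differential (tan_atlas A) (energy A L) w Y))"

text \<open>\<open>S\<close>, on the open neighbourhood \<open>D\<close> of the zero section, is
  \<open>(FL\<^sup>-\<^sup>1, FL\<^sup>-\<^sup>1) \<circ> R\<^sup>T\<^sup>* \<circ> T FL\<close>. Locally it is formed with the inverse of \<open>FL\<close> restricted to an open set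
  \<open>N\<close>; the requirement \<open>fst ` P \<subseteq> N\<close> says that at a vector based at \<open>v\<close> this is the local
  inverse taking \<open>FL v\<close> back to \<open>v\<close>.\<close>
definition lagrangian_lift ::
  "('q, 'e::euclidean_space) atlas \<Rightarrow> ('q, 'e) tbundle set \<Rightarrow> (('q, 'e) tbundle \<Rightarrow> 'q \<times> 'q)
     \<Rightarrow> (('q, 'e) tbundle \<Rightarrow> real) \<Rightarrow> (('q, 'e) tbundle, 'e \<times> 'e) tbundle set
     \<Rightarrow> ((('q, 'e) tbundle, 'e \<times> 'e) tbundle \<Rightarrow> ('q, 'e) tbundle \<times> ('q, 'e) tbundle) \<Rightarrow> bool" where
  "lagrangian_lift A U R L D S \<longleftrightarrow>
     openin (mtop (tan_atlas (tan_atlas A))) D \<and> zero_at ` tcarrier A \<subseteq> D \<and>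
     (\<forall>w\<in>D. \<exists>N P.
        diffeo_on (tan_atlas A) (cot_atlas A) N (legendre A L) \<and>
        openin (mtop (tan_atlas (tan_atlas A))) P \<and> w \<in> P \<and> P \<subseteq> D \<and> fst ` P \<subseteq> N \<and>
        (\<forall>y\<in>P. let t = tmap (tan_atlas A) (cot_atlas A) (legendre A L) y in
           t \<in> cot_lift_dom A U R \<and>
           cot_lift A R t \<in> legendre A L ` N \<times> legendre A L ` N \<and>
           S y = map_prod (inv_into N (legendre A L)) (inv_into N (legendre A L)) (cot_lift A R t)))"


section \<open>The implicit one-step method of a discretization map\<close>

text \<open>The equation \<open>R (h \<Gamma> ((\<tau> \<circ> R\<^sup>-\<^sup>1) (x0, x1))) = (x0, x1)\<close> for \<open>R\<close> defined on \<open>D\<close>, where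
  \<open>R\<^sup>-\<^sup>1\<close> is the inverse of the restriction of \<open>R\<close> to \<open>V\<close>.\<close>
definition step_equation ::
  "('m, 'e::euclidean_space) tbundle set \<Rightarrow> (('m, 'e) tbundle \<Rightarrow> 'm \<times> 'm) \<Rightarrow> ('m, 'e) tbundle set
     \<Rightarrow> ('m \<Rightarrow> ('m, 'e) tbundle) \<Rightarrow> real \<Rightarrow> 'm \<Rightarrow> 'm \<Rightarrow> bool" where
  "step_equation D R V \<Gamma> h x0 x1 \<longleftrightarrow>
     (let w = scale h (\<Gamma> (fst (inv_into V R (x0, x1)))) in w \<in> D \<and> R w = (x0, x1))"

text \<open>\<open>R\<close> is a diffeomorphism from \<open>V\<close> onto an open neighbourhood of \<open>(z, z)\<close>.\<close>
definition invertible_near ::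
  "('m, 'e::euclidean_space) atlas \<Rightarrow> ('m, 'e) tbundle set \<Rightarrow> (('m, 'e) tbundle \<Rightarrow> 'm \<times> 'm)
     \<Rightarrow> 'm \<Rightarrow> ('m, 'e) tbundle set \<Rightarrow> bool" where
  "invertible_near A D R z V \<longleftrightarrow>
     V \<subseteq> D \<and> zero_at z \<in> V \<and> diffeo_on (tan_atlas A) (prod_atlas A A) V R"

definition symplectic_integrator ::
  "('m, 'e::euclidean_space) atlas \<Rightarrow> ('m \<Rightarrow> ('m, 'e) tvec \<Rightarrow> ('m, 'e) tvec \<Rightarrow> real)
     \<Rightarrow> ('m \<Rightarrow> ('m, 'e) tbundle) \<Rightarrow> ('m, 'e) tbundle set \<Rightarrow> (('m, 'e) tbundle \<Rightarrow> 'm \<times> 'm) \<Rightarrow> bool" where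
  "symplectic_integrator A \<Omega> \<Gamma> D R \<longleftrightarrow>
     (\<forall>z\<in>carrier A. (\<exists>V. invertible_near A D R z V) \<and>
       (\<forall>V. invertible_near A D R z V \<longrightarrow>
         (\<exists>W W' h0. openin (mtop A) W \<and> openin (mtop A) W' \<and> z \<in> W \<and> z \<in> W' \<and>
            W \<times> W' \<subseteq> R ` V \<and> 0 < h0 \<and>
            (\<forall>h. 0 < h \<and> h < h0 \<longrightarrow>
               (\<forall>x0\<in>W. \<exists>!x1. x1 \<in> W' \<and> step_equation D R V \<Gamma> h x0 x1) \<and>
               (let \<phi> = (\<lambda>x0. THE x1. x1 \<in> W' \<and> step_equation D R V \<Gamma> h x0 x1) in
                  smooth_map A A W \<phi> \<and>
                  (\<forall>x\<in>W. \<forall>X\<in>tspace A x. \<forall>Y\<in>tspace A x.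
                     pullback2 A A \<phi> \<Omega> x X Y = \<Omega> x X Y))))))"

end

theory Submission
  imports Defs
begin

text \<open>In charts the cotangent lift sends \<open>(q, p, q', p')\<close> to \<open>(q\<^sub>0, p\<^sub>0; q\<^sub>1, p\<^sub>1)\<close> with
  \<open>(q\<^sub>0, q\<^sub>1) = R\<^sub>d(q, q')\<close> and \<open>p\<^sub>1 dR\<^sup>2 - p\<^sub>0 dR\<^sup>1 = p' dq + p dv\<close> at \<open>(q, q')\<close>. For (a), \<open>T FL (h \<Gamma>\<^sub>L)\<close> is
  \<open>(q, L\<^sub>v, h v, h L\<^sub>q)\<close>, so along a step this equation reads \<open>p\<^sub>1 dq\<^sub>1 - p\<^sub>0 dq\<^sub>0 = h dL\<close>, and its exterior
  derivative is symplecticity; the step is solved for by the inverse function theorem applied to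
  \<open>(h, x) \<mapsto> (h, R\<^sup>1(h \<Gamma>\<^sub>L(x)))\<close>. For (b), differentiating the equation along the fibre at the zero
  section leaves only mixed second derivatives of \<open>R\<^sup>2 - R\<^sup>1\<close>, which vanish there since its fibre
  derivative is the identity at every point. The local branches of \<open>R\<^sub>d\<^sup>L\<close> fit together because each of
  them lifts the path \<open>s \<mapsto> R\<^sub>d\<^sup>T\<^sup>*(s T FL (y))\<close> through the local diffeomorphism \<open>FL\<close>, starting at the base
  point, and such lifts are unique in a Hausdorff space.\<close>

section \<open>Calculus of smooth maps\<close>

text \<open>The map \<open>R\<^sub>d\<^sup>L\<close> has no global formula; it is known only through
  local branches of the inverse Legendre map. The momentum balance mentions just the two end points
  and their momenta \<partial>L/\<partial>v, so it does not see the branch, and both parts of the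
  theorem are drawn from it. Regularity acts as injectivity of the vertical derivative of
  \<partial>L/\<partial>v: it makes the Legendre map a local diffeomorphism and
  \<open>\<Gamma>\<^sub>L\<close> well defined and smooth, and in (b) it forces the momentum part of
  the error to vanish once the base part does. With \<open>h\<close> as a further variable in the
  inverse function theorem, the neighbourhoods do not shrink with \<open>h\<close>. The base point,
  the start and the end of a step may lie in different charts, so the balance is stated with
  independent charts at the three points. Chart independence of the symplectic form and of
  \<open>\<alpha>\<^sub>Q\<close> comes each time from the symmetry of the second derivatives of a
  transition map.\<close>

abbreviation fderiv :: "('a::euclidean_space \<Rightarrow> 'b::real_normed_vector) \<Rightarrow> 'a \<Rightarrow> 'a \<Rightarrow> 'b" where
  "fderiv f x \<equiv> frechet_derivative f (at x)"

lemma fderiv_eq: "(f has_derivative f') (at x) \<Longrightarrow> fderiv f x = f'"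
  by (metis frechet_derivative_at)

section \<open>Closure properties of finite differentiability\<close>

lemma Ck_on_imp_continuous: "Ck_on k S f \<Longrightarrow> continuous_on S f"
proof (cases k)
  case (Suc n)
  assume "Ck_on k S f"
  then have "\<forall>x\<in>S. continuous (at x) f" unfolding Suc by (auto intro: differentiable_imp_continuous_within)
  then show ?thesis by (rule continuous_at_imp_continuous_on)
qed auto

lemma Ck_on_SucD: "Ck_on (Suc k) S f \<Longrightarrow> Ck_on k S f"
proof (induction k arbitrary: f)
  case 0
  then show ?case using Ck_on_imp_continuous[of "Suc 0"] by auto
next
  case (Suc k)
  from Suc.prems show ?case
    by (auto simp: Ck_on.simps(2)[of "Suc k"] Ck_on.simps(2)[of k] simp del: Ck_on.simps intro: Suc.IH)
qed

lemma Ck_on_subset: "Ck_on k S f \<Longrightarrow> T \<subseteq> S \<Longrightarrow> Ck_on k T f"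
  by (induction k arbitrary: f) (auto intro: continuous_on_subset)

lemma fderiv_cong:
  "open S \<Longrightarrow> x \<in> S \<Longrightarrow> (\<And>y. y \<in> S \<Longrightarrow> f y = g y) \<Longrightarrow> fderiv f x = fderiv g x"
  unfolding frechet_derivative_def
  by (intro arg_cong[where f = Eps] ext) (metis has_derivative_transform_within_open)

text \<open>Openness of \<open>S\<close> makes \<open>f\<close> and \<open>g\<close> agree near each
  point, so the full derivatives \<open>at x\<close> agree as well.\<close>

lemma Ck_on_cong:
  assumes "open S" and "\<And>x. x \<in> S \<Longrightarrow> f x = g x"
  shows "Ck_on k S f \<longleftrightarrow> Ck_on k S g"
  using assms(2)
proof (induction k arbitrary: f g)
  case 0
  then show ?case by (simp cong: continuous_on_cong_simp)
next
  case (Suc k)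
  have "f differentiable (at x) \<longleftrightarrow> g differentiable (at x)" if "x \<in> S" for x
    using assms(1) that Suc.prems unfolding differentiable_def
    by (metis has_derivative_transform_within_open)
  moreover have "Ck_on k S (\<lambda>x. fderiv f x v) \<longleftrightarrow> Ck_on k S (\<lambda>x. fderiv g x v)" for v
    by (rule Suc.IH) (metis Suc.prems assms(1) fderiv_cong)
  ultimately show ?case by simp
qed

text \<open>\<open>frechet_derivative\<close> is defined by choice; this rule lets an induction step
  run on an explicit formula for the derivative instead.\<close>

lemma Ck_on_SucI:
  assumes "open S" and "\<And>x. x \<in> S \<Longrightarrow> (f has_derivative f' x) (at x)"
    and "\<And>v. Ck_on k S (\<lambda>x. f' x v)"
  shows "Ck_on (Suc k) S f"
proof -
  have "fderiv f x = f' x" if "x \<in> S" for x using assms(2) that by (intro fderiv_eq)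
  then have "Ck_on k S (\<lambda>x. fderiv f x v)" for v
    using assms(3)[of v] Ck_on_cong[OF assms(1), of "\<lambda>x. fderiv f x v" "\<lambda>x. f' x v" k] by auto
  then show ?thesis using assms(2) by (auto simp: differentiable_def)
qed

lemma Ck_on_SucD_deriv:
  assumes "Ck_on (Suc k) S f" "x \<in> S"
  shows "(f has_derivative fderiv f x) (at x)"
  using assms by (auto simp: frechet_derivative_works)

lemma Ck_on_const: "open S \<Longrightarrow> Ck_on k S (\<lambda>x. c)"
  by (induction k arbitrary: c) auto

lemma Ck_on_bounded_linear:
  assumes "bounded_linear h" "open S"
  shows "Ck_on k S f \<Longrightarrow> Ck_on k S (\<lambda>x. h (f x))"
proof (induction k arbitrary: f)
  case 0
  then show ?case using assms(1) by (auto intro: linear_continuous_on_compose bounded_linear.continuous_on)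
next
  case (Suc k)
  show ?case
  proof (rule Ck_on_SucI[OF assms(2)])
    show "((\<lambda>x. h (f x)) has_derivative (\<lambda>v. h (fderiv f x v))) (at x)" if "x \<in> S" for x
      by (rule bounded_linear.has_derivative[OF assms(1) Ck_on_SucD_deriv[OF Suc.prems that]])
    show "Ck_on k S (\<lambda>x. h (fderiv f x v))" for v using Suc by auto
  qed
qed

lemma Ck_on_add:
  assumes "open S"
  shows "Ck_on k S f \<Longrightarrow> Ck_on k S g \<Longrightarrow> Ck_on k S (\<lambda>x. f x + g x)"
proof (induction k arbitrary: f g)
  case 0
  then show ?case by (auto intro: continuous_on_add)
next
  case (Suc k)
  show ?case
  proof (rule Ck_on_SucI[OF assms])
    show "((\<lambda>x. f x + g x) has_derivative (\<lambda>v. fderiv f x v + fderiv g x v)) (at x)" if "x \<in> S" for x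
      using Ck_on_SucD_deriv[OF Suc.prems(1) that] Ck_on_SucD_deriv[OF Suc.prems(2) that]
      by (rule has_derivative_add)
    show "Ck_on k S (\<lambda>x. fderiv f x v + fderiv g x v)" for v using Suc by auto
  qed
qed

lemma Ck_on_sum:
  assumes "open S"
  shows "(\<And>i. i \<in> I \<Longrightarrow> Ck_on k S (f i)) \<Longrightarrow> Ck_on k S (\<lambda>x. \<Sum>i\<in>I. f i x)"
  by (induction I rule: infinite_finite_induct) (auto intro: Ck_on_const Ck_on_add assms)

text \<open>The Leibniz formula is again a sum of values of the same bilinear \<open>h\<close>, so
  the induction hypothesis applies to both summands.\<close>

lemma Ck_on_bilinear:
  assumes "bounded_bilinear h" "open S"
  shows "Ck_on k S f \<Longrightarrow> Ck_on k S g \<Longrightarrow> Ck_on k S (\<lambda>x. h (f x) (g x))"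
proof (induction k arbitrary: f g)
  case 0
  then show ?case using assms(1) by (auto intro: bounded_bilinear.continuous_on)
next
  case (Suc k)
  show ?case
  proof (rule Ck_on_SucI[OF assms(2)])
    show "((\<lambda>x. h (f x) (g x)) has_derivative (\<lambda>v. h (f x) (fderiv g x v) + h (fderiv f x v) (g x))) (at x)"
      if "x \<in> S" for x
      by (rule bounded_bilinear.FDERIV[OF assms(1)])
        (use Suc.prems that in \<open>auto intro: Ck_on_SucD_deriv\<close>)
    show "Ck_on k S (\<lambda>x. h (f x) (fderiv g x v) + h (fderiv f x v) (g x))" for v
    proof -
      have "Ck_on k S f" "Ck_on k S g" "Ck_on k S (\<lambda>x. fderiv f x v)" "Ck_on k S (\<lambda>x. fderiv g x v)"
        using Ck_on_SucD[OF Suc.prems(1)] Ck_on_SucD[OF Suc.prems(2)] Suc.prems by simp_all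
      then show ?thesis by (intro Ck_on_add assms(2) Suc.IH)
    qed
  qed
qed

text \<open>\<open>Ck_on\<close> controls derivatives in fixed directions; expansion in a basis is
  how later proofs treat a direction that varies with the point.\<close>

lemma linear_expand:
  fixes f :: "'a::euclidean_space \<Rightarrow> 'b::real_normed_vector"
  assumes "linear f"
  shows "f v = (\<Sum>b\<in>Basis. (v \<bullet> b) *\<^sub>R f b)"
proof -
  have "f v = f (\<Sum>b\<in>Basis. (v \<bullet> b) *\<^sub>R b)" by (simp add: euclidean_representation)
  then show ?thesis using assms by (simp add: linear_sum linear_cmul)
qed

lemma Ck_on_compose:
  fixes f :: "'a::euclidean_space \<Rightarrow> 'b::euclidean_space" and g :: "'b \<Rightarrow> 'c::real_normed_vector"
  assumes "open S" "open T" "f ` S \<subseteq> T"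
  shows "Ck_on k S f \<Longrightarrow> Ck_on k T g \<Longrightarrow> Ck_on k S (\<lambda>x. g (f x))"
proof (induction k arbitrary: g)
  case 0
  then show ?case using assms(3) by (auto intro: continuous_on_compose2)
next
  case (Suc k)
  have d: "((\<lambda>x. g (f x)) has_derivative (\<lambda>v. fderiv g (f x) (fderiv f x v))) (at x)" if "x \<in> S" for x
  proof (rule has_derivative_compose[of f "fderiv f x" x UNIV g "fderiv g (f x)"])
    show "(f has_derivative fderiv f x) (at x)" by (rule Ck_on_SucD_deriv[OF Suc.prems(1) that])
    show "(g has_derivative fderiv g (f x)) (at (f x))"
      by (rule Ck_on_SucD_deriv[OF Suc.prems(2)]) (use assms(3) that in auto)
  qed
  show ?case
  proof (rule Ck_on_SucI[OF assms(1) d])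
    fix v
    \<comment> \<open>The chain rule applies the derivative of \<open>g\<close> to a moving vector.
      Expanded in a basis it is a sum of products, and the induction hypothesis applies to the
      functions \<open>fderiv g _ b\<close>.\<close>
    have "Ck_on k S (\<lambda>x. \<Sum>b\<in>Basis. (fderiv f x v \<bullet> b) *\<^sub>R fderiv g (f x) b)"
    proof (rule Ck_on_sum[OF assms(1)], rule Ck_on_bilinear[OF bounded_bilinear_scaleR assms(1)])
      fix b :: 'b
      have "Ck_on k S (\<lambda>x. fderiv f x v)" using Suc.prems(1) by simp
      then show "Ck_on k S (\<lambda>x. fderiv f x v \<bullet> b)"
        by (rule Ck_on_bounded_linear[OF bounded_linear_inner_left assms(1)])
      show "Ck_on k S (\<lambda>x. fderiv g (f x) b)"
        by (rule Suc.IH[OF Ck_on_SucD[OF Suc.prems(1)]]) (use Suc.prems(2) in simp)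
    qed
    moreover have "(\<Sum>b\<in>Basis. (fderiv f x v \<bullet> b) *\<^sub>R fderiv g (f x) b) = fderiv g (f x) (fderiv f x v)"
      if "x \<in> S" for x
      using Suc.prems(2) assms(3) that by (intro linear_expand[symmetric] linear_frechet_derivative) auto
    ultimately show "Ck_on k S (\<lambda>x. fderiv g (f x) (fderiv f x v))"
      using Ck_on_cong[OF assms(1)] by (metis (no_types, lifting))
  qed
qed

section \<open>Smooth functions on open sets\<close>

lemma smooth_on_subset: "smooth_on S f \<Longrightarrow> T \<subseteq> S \<Longrightarrow> smooth_on T f"
  by (auto simp: smooth_on_def intro: Ck_on_subset)

lemma smooth_on_cong:
  "open S \<Longrightarrow> (\<And>x. x \<in> S \<Longrightarrow> f x = g x) \<Longrightarrow> smooth_on S f \<longleftrightarrow> smooth_on S g"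
  unfolding smooth_on_def using Ck_on_cong by blast

lemma smooth_on_continuous: "smooth_on S f \<Longrightarrow> continuous_on S f"
  by (auto simp: smooth_on_def intro: Ck_on_imp_continuous)

lemma smooth_on_has_derivative:
  "smooth_on S f \<Longrightarrow> x \<in> S \<Longrightarrow> (f has_derivative fderiv f x) (at x)"
  by (meson Ck_on_SucD_deriv smooth_on_def)

lemma smooth_on_linear: "smooth_on S f \<Longrightarrow> x \<in> S \<Longrightarrow> linear (fderiv f x)"
  using smooth_on_has_derivative has_derivative_linear by blast

lemma smooth_on_fderiv: "smooth_on S f \<Longrightarrow> smooth_on S (\<lambda>x. fderiv f x v)"
  unfolding smooth_on_def using Ck_on.simps(2) by blast

lemma smooth_onI_local:
  assumes "\<And>x. x \<in> S \<Longrightarrow> \<exists>T. open T \<and> x \<in> T \<and> smooth_on T f"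
  shows "smooth_on S f"
proof -
  have "Ck_on k S f" if "\<And>x. x \<in> S \<Longrightarrow> \<exists>T. open T \<and> x \<in> T \<and> Ck_on k T f" for k
    using that
  proof (induction k arbitrary: f)
    case 0
    show ?case unfolding Ck_on.simps
    proof (rule continuous_at_imp_continuous_on, rule ballI)
      fix x assume "x \<in> S"
      then show "continuous (at x) f" using 0 unfolding Ck_on.simps by (metis continuous_on_eq_continuous_at)
    qed
  next
    case (Suc k)
    have "f differentiable (at x)" if "x \<in> S" for x using Suc.prems[OF that] by auto
    moreover have "Ck_on k S (\<lambda>x. fderiv f x v)" for v
      by (rule Suc.IH) (use Suc.prems in fastforce)
    ultimately show ?case by simp
  qed
  then show ?thesis using assms unfolding smooth_on_def by meson
qed

lemma smooth_on_const: "open S \<Longrightarrow> smooth_on S (\<lambda>x. c)"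
  by (simp add: smooth_on_def Ck_on_const)

lemma smooth_on_bounded_linear:
  "bounded_linear h \<Longrightarrow> open S \<Longrightarrow> smooth_on S f \<Longrightarrow> smooth_on S (\<lambda>x. h (f x))"
  by (simp add: smooth_on_def Ck_on_bounded_linear)

lemma smooth_on_ident: "open S \<Longrightarrow> smooth_on S (\<lambda>x. x)"
  unfolding smooth_on_def
proof
  fix k assume S: "open S"
  show "Ck_on k S (\<lambda>x. x)"
  proof (cases k)
    case (Suc n)
    show ?thesis unfolding Suc
      by (rule Ck_on_SucI[OF S has_derivative_ident]) (rule Ck_on_const[OF S])
  qed auto
qed

lemma smooth_on_add: "open S \<Longrightarrow> smooth_on S f \<Longrightarrow> smooth_on S g \<Longrightarrow> smooth_on S (\<lambda>x. f x + g x)"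
  by (simp add: smooth_on_def Ck_on_add)

lemma smooth_on_minus: "open S \<Longrightarrow> smooth_on S f \<Longrightarrow> smooth_on S (\<lambda>x. - f x)"
  by (rule smooth_on_bounded_linear[OF bounded_linear_minus[OF bounded_linear_ident]])

lemma smooth_on_diff: "open S \<Longrightarrow> smooth_on S f \<Longrightarrow> smooth_on S g \<Longrightarrow> smooth_on S (\<lambda>x. f x - g x)"
  using smooth_on_add[of S f "\<lambda>x. - g x"] smooth_on_minus[of S g] by simp

lemma smooth_on_sum:
  "open S \<Longrightarrow> (\<And>i. i \<in> I \<Longrightarrow> smooth_on S (f i)) \<Longrightarrow> smooth_on S (\<lambda>x. \<Sum>i\<in>I. f i x)"
  by (simp add: smooth_on_def Ck_on_sum)

lemma smooth_on_scaleR: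
  "open S \<Longrightarrow> smooth_on S f \<Longrightarrow> smooth_on S g \<Longrightarrow> smooth_on S (\<lambda>x. f x *\<^sub>R g x)"
  by (simp add: smooth_on_def Ck_on_bilinear bounded_bilinear_scaleR)

lemma smooth_on_inner:
  fixes f g :: "'a::euclidean_space \<Rightarrow> 'b::euclidean_space"
  shows "open S \<Longrightarrow> smooth_on S f \<Longrightarrow> smooth_on S g \<Longrightarrow> smooth_on S (\<lambda>x. f x \<bullet> g x)"
  by (simp add: smooth_on_def Ck_on_bilinear bounded_bilinear_inner)

lemma smooth_on_fst: "open S \<Longrightarrow> smooth_on S f \<Longrightarrow> smooth_on S (\<lambda>x. fst (f x))"
  by (rule smooth_on_bounded_linear[OF bounded_linear_fst])

lemma smooth_on_snd: "open S \<Longrightarrow> smooth_on S f \<Longrightarrow> smooth_on S (\<lambda>x. snd (f x))"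
  by (rule smooth_on_bounded_linear[OF bounded_linear_snd])

lemma smooth_on_Pair:
  assumes "open S" "smooth_on S f" "smooth_on S g"
  shows "smooth_on S (\<lambda>x. (f x, g x))"
proof -
  have "smooth_on S (\<lambda>x. (f x, 0) + (0, g x))"
    by (intro smooth_on_add assms smooth_on_bounded_linear[where f = f] smooth_on_bounded_linear[where f = g]
        bounded_linear_Pair bounded_linear_ident bounded_linear_zero)
  then show ?thesis by simp
qed

lemma smooth_on_compose:
  fixes f :: "'a::euclidean_space \<Rightarrow> 'b::euclidean_space"
  shows "open S \<Longrightarrow> open T \<Longrightarrow> smooth_on T g \<Longrightarrow> smooth_on S f \<Longrightarrow> (\<And>x. x \<in> S \<Longrightarrow> f x \<in> T) \<Longrightarrow> smooth_on S (\<lambda>x. g (f x))"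
  unfolding smooth_on_def using Ck_on_compose[of S T f _ g] by (simp add: image_subset_iff)

text \<open>Joint smoothness in point and direction: this is what makes the tangent map of a smooth
  map smooth.\<close>

lemma smooth_on_fderiv_apply:
  fixes f :: "'a::euclidean_space \<Rightarrow> 'b::real_normed_vector" and g :: "'c::euclidean_space \<Rightarrow> 'a"
  assumes "open S" "open T" "smooth_on T f" "smooth_on S g" "smooth_on S u" "\<And>x. x \<in> S \<Longrightarrow> g x \<in> T"
  shows "smooth_on S (\<lambda>x. fderiv f (g x) (u x))"
proof -
  have "smooth_on S (\<lambda>x. \<Sum>b\<in>Basis. (u x \<bullet> b) *\<^sub>R fderiv f (g x) b)"
    by (intro smooth_on_sum smooth_on_scaleR smooth_on_inner smooth_on_const assms
        smooth_on_compose[OF assms(1,2) smooth_on_fderiv[OF assms(3)] assms(4,6)])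
  moreover have "(\<Sum>b\<in>Basis. (u x \<bullet> b) *\<^sub>R fderiv f (g x) b) = fderiv f (g x) (u x)" if "x \<in> S" for x
    using assms that by (intro linear_expand[symmetric] smooth_on_linear) auto
  ultimately show ?thesis using smooth_on_cong[OF assms(1)] by (metis (no_types, lifting))
qed

lemma fderiv_compose:
  assumes "smooth_on S f" "x \<in> S" "smooth_on T g" "f x \<in> T"
  shows "fderiv (\<lambda>x. g (f x)) x v = fderiv g (f x) (fderiv f x v)"
  using fderiv_eq[OF has_derivative_compose[OF smooth_on_has_derivative[OF assms(1,2)]
        smooth_on_has_derivative[OF assms(3,4)]]] by simp

section \<open>The smooth inverse function theorem and inverses of families of linear maps\<close>

text \<open>The library inverse function theorem wants the derivative continuous in operator norm;
  in finite dimension continuity on each vector is enough.\<close>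

lemma continuous_on_Blinfun_fderiv:
  assumes "smooth_on S f"
  shows "continuous_on S (\<lambda>x. Blinfun (fderiv f x))"
proof (rule continuous_on_blinfun_componentwise)
  fix i
  have "blinfun_apply (Blinfun (fderiv f x)) i = fderiv f x i" if "x \<in> S" for x
    using smooth_on_has_derivative[OF assms that]
    by (simp add: bounded_linear_Blinfun_apply has_derivative_bounded_linear)
  moreover have "continuous_on S (\<lambda>x. fderiv f x i)"
    by (intro smooth_on_continuous smooth_on_fderiv assms)
  ultimately show "continuous_on S (\<lambda>x. blinfun_apply (Blinfun (fderiv f x)) i)"
    by (metis (no_types, lifting) continuous_on_cong)
qed

text \<open>In finite dimension an injective derivative has a linear left inverse, which is the
  hypothesis that the library theorem takes; the rest is translation between bounded linear
  functions and \<open>frechet_derivative\<close>.\<close>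

lemma inverse_function_C1:
  fixes f :: "'a::euclidean_space \<Rightarrow> 'a"
  assumes "open U" "smooth_on U f" "x0 \<in> U" "inj (fderiv f x0)"
  obtains U' V g where "open U'" "U' \<subseteq> U" "x0 \<in> U'" "open V" "f x0 \<in> V" "homeomorphism U' V f g"
    "\<And>y. y \<in> V \<Longrightarrow> (g has_derivative inv (fderiv f (g y))) (at y)"
    "\<And>y. y \<in> V \<Longrightarrow> bij (fderiv f (g y))"
proof -
  define f' where "f' x = Blinfun (fderiv f x)" for x
  have f': "blinfun_apply (f' x) = fderiv f x" if "x \<in> U" for x
    using smooth_on_has_derivative[OF assms(2) that]
    by (simp add: f'_def bounded_linear_Blinfun_apply has_derivative_bounded_linear)
  have lin: "linear (fderiv f x0)" by (rule smooth_on_linear[OF assms(2,3)])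
  obtain h where h: "linear h" "h \<circ> fderiv f x0 = id"
    using linear_injective_left_inverse[OF lin assms(4)] by blast
  have h': "blinfun_apply (Blinfun h) = h"
    using h(1) by (simp add: bounded_linear_Blinfun_apply linear_conv_bounded_linear)
  have id: "Blinfun h o\<^sub>L f' x0 = id_blinfun"
    using h(2) by (intro blinfun_eqI) (simp add: h' f'[OF assms(3)] fun_eq_iff)
  obtain U' V g g' where *: "open U'" "U' \<subseteq> U" "x0 \<in> U'" "open V" "f x0 \<in> V" "homeomorphism U' V f g"
    "\<And>y. y \<in> V \<Longrightarrow> (g has_derivative (g' y)) (at y)"
    "\<And>y. y \<in> V \<Longrightarrow> g' y = inv (blinfun_apply (f'(g y)))"
    "\<And>y. y \<in> V \<Longrightarrow> bij (blinfun_apply (f'(g y)))"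
  proof -
    have "(f has_derivative blinfun_apply (f' x)) (at x)" if "x \<in> U" for x
      using smooth_on_has_derivative[OF assms(2) that] f'[OF that] by simp
    moreover have "continuous_on U f'"
      unfolding f'_def by (rule continuous_on_Blinfun_fderiv[OF assms(2)])
    ultimately show ?thesis
      by (rule inverse_function_theorem[where f = f and f' = f', OF assms(1) _ _ assms(3) id]) (use that in blast)+
  qed
  have "g y \<in> U" if "y \<in> V" for y
    using *(2,6) that unfolding homeomorphism_def by blast
  then have "blinfun_apply (f' (g y)) = fderiv f (g y)" if "y \<in> V" for y
    using f' that by blast
  with * show ?thesis by (intro that[of U' V g]) metis+
qed

lemma fderiv_Pair:
  assumes "smooth_on S f" "smooth_on S g" "x \<in> S"
  shows "fderiv (\<lambda>x. (f x, g x)) x v = (fderiv f x v, fderiv g x v)"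
  using fderiv_eq[OF has_derivative_Pair[OF smooth_on_has_derivative[OF assms(1,3)]
        smooth_on_has_derivative[OF assms(2,3)]]] by simp

text \<open>Differentiability of \<open>x \<mapsto> (A x)\<^sup>-\<^sup>1 w\<close> comes from the inverse function theorem for
  \<open>(x, u) \<mapsto> (x, A x u)\<close>.\<close>
lemma has_derivative_inv_apply:
  fixes A :: "'a::euclidean_space \<Rightarrow> 'b::euclidean_space \<Rightarrow> 'b"
  assumes S: "open S" and A: "\<And>x. x \<in> S \<Longrightarrow> linear (A x)" "\<And>x. x \<in> S \<Longrightarrow> inj (A x)"
    and sm: "\<And>u. smooth_on S (\<lambda>x. A x u)" and x: "x \<in> S"
  shows "((\<lambda>x. inv (A x) w) has_derivative
    (\<lambda>v. - inv (A x) (fderiv (\<lambda>y. A y (inv (A x) w)) x v))) (at x)"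
proof -
  define f where "f = (\<lambda>(y, u). (y, A y u))"
  have bijA: "bij (A y)" if "y \<in> S" for y
    using A that linear_injective_imp_surjective[of "A y"] by (auto simp: bij_def)
  have oS: "open (S \<times> (UNIV :: 'b set))" using S by (intro open_Times) auto
  have expand: "A y u = (\<Sum>b\<in>Basis. (u \<bullet> b) *\<^sub>R A y b)" if "y \<in> S" for y u
    by (rule linear_expand[OF A(1)[OF that]])
  have smA: "smooth_on (S \<times> UNIV) (\<lambda>p. A (fst p) (snd p))"
  proof -
    have "smooth_on (S \<times> UNIV) (\<lambda>p. \<Sum>b\<in>Basis. (snd p \<bullet> b) *\<^sub>R A (fst p) b)"
      by (intro smooth_on_sum smooth_on_scaleR smooth_on_inner smooth_on_const oS smooth_on_snd
          smooth_on_fst smooth_on_ident smooth_on_compose[OF oS S sm]) auto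
    moreover have "A (fst p) (snd p) = (\<Sum>b\<in>Basis. (snd p \<bullet> b) *\<^sub>R A (fst p) b)" if "p \<in> S \<times> UNIV" for p
      using that by (intro expand) auto
    ultimately show ?thesis using smooth_on_cong[OF oS] by (metis (no_types, lifting))
  qed
  have f_eq: "f = (\<lambda>p. (fst p, A (fst p) (snd p)))" by (auto simp: f_def)
  have smf: "smooth_on (S \<times> UNIV) f" unfolding f_eq
    by (intro smooth_on_Pair oS smooth_on_fst smooth_on_ident smA)
  define u where "u = inv (A x) w"
  have Au: "A x u = w" using bijA[OF x] by (simp add: u_def bij_is_surj surj_f_inv_f)
  have p: "(x, u) \<in> S \<times> UNIV" using x by simp
  \<comment> \<open>Each partial derivative is found by freezing the other variable. In
    \<open>u\<close> the map is linear, hence its own derivative.\<close>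
  have d: "(f has_derivative (\<lambda>(v, \<mu>). (v, fderiv (\<lambda>y. A y u) x v + A x \<mu>))) (at (x, u))"
  proof -
    let ?F = "\<lambda>p. A (fst p) (snd p)"
    have D: "(?F has_derivative fderiv ?F (x, u)) (at (x, u))"
      by (rule smooth_on_has_derivative[OF smA p])
    have D1: "((\<lambda>y. ?F (y, u)) has_derivative (\<lambda>v. fderiv ?F (x, u) (v, 0))) (at x)"
      by (rule has_derivative_compose[of "\<lambda>y. (y, u)" "\<lambda>v. (v, 0)", OF _ D])
        (intro has_derivative_Pair has_derivative_ident has_derivative_const)
    have D2: "((\<lambda>y. ?F (x, y)) has_derivative (\<lambda>v. fderiv ?F (x, u) (0, v))) (at u)"
      by (rule has_derivative_compose[of "\<lambda>y. (x, y)" "\<lambda>v. (0, v)", OF _ D])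
        (intro has_derivative_Pair has_derivative_ident has_derivative_const)
    have D2': "((\<lambda>y. A x y) has_derivative A x) (at u)"
      using A(1)[OF x] by (intro bounded_linear_imp_has_derivative) (simp add: linear_conv_bounded_linear)
    have e1: "fderiv ?F (x, u) (v, 0) = fderiv (\<lambda>y. A y u) x v" for v
      using fderiv_eq[OF D1] by (simp add: fun_eq_iff)
    have e2: "fderiv ?F (x, u) (0, v) = A x v" for v
      using fun_cong[OF has_derivative_unique[OF D2']] D2 by fastforce
    have "fderiv ?F (x, u) (v, \<mu>) = fderiv (\<lambda>y. A y u) x v + A x \<mu>" for v \<mu>
      using linear_add[OF has_derivative_linear[OF D], of "(v, 0)" "(0, \<mu>)"] e1 e2 by simp
    then have "fderiv ?F (x, u) = (\<lambda>(v, \<mu>). fderiv (\<lambda>y. A y u) x v + A x \<mu>)" by auto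
    then have "(?F has_derivative (\<lambda>(v, \<mu>). fderiv (\<lambda>y. A y u) x v + A x \<mu>)) (at (x, u))" using D by simp
    then have "(f has_derivative (\<lambda>q. (fst q, (\<lambda>(v, \<mu>). fderiv (\<lambda>y. A y u) x v + A x \<mu>) q))) (at (x, u))"
      unfolding f_eq by (intro has_derivative_Pair has_derivative_fst has_derivative_ident)
    then show ?thesis by (simp add: case_prod_unfold)
  qed
  have fd: "fderiv f (x, u) (v, \<mu>) = (v, fderiv (\<lambda>y. A y u) x v + A x \<mu>)" for v \<mu>
    using fderiv_eq[OF d] by simp
  have linA': "linear (fderiv (\<lambda>y. A y u) x)" by (rule smooth_on_linear[OF sm x])
  have injA: "A x a = A x b \<Longrightarrow> a = b" for a b using A(2)[OF x] by (auto dest: injD)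
  \<comment> \<open>The derivative is block triangular, with the identity and \<open>A x\<close> on
    the diagonal.\<close>
  have "inj (fderiv f (x, u))"
    by (rule injI) (auto simp: fd dest!: injA split: prod.splits)
  from inverse_function_C1[OF oS smf p this] obtain U' V g where
    g: "open U'" "U' \<subseteq> S \<times> UNIV" "(x, u) \<in> U'" "open V" "f (x, u) \<in> V" "homeomorphism U' V f g"
    "\<And>y. y \<in> V \<Longrightarrow> (g has_derivative inv (fderiv f (g y))) (at y)"
    "\<And>y. y \<in> V \<Longrightarrow> bij (fderiv f (g y))" by blast
  have fxu: "f (x, u) = (x, w)" by (simp add: f_def Au)
  then have gx: "g (x, w) = (x, u)" using g(3,6) by (metis homeomorphism_apply1)
  have gd: "((\<lambda>y. snd (g (y, w))) has_derivative (\<lambda>v. snd (inv (fderiv f (x, u)) (v, 0)))) (at x)"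
  proof (rule has_derivative_snd, rule has_derivative_compose[of "\<lambda>y. (y, w)" "\<lambda>v. (v, 0)"])
    show "((\<lambda>y. (y, w)) has_derivative (\<lambda>v. (v, 0))) (at x)"
      by (intro has_derivative_Pair has_derivative_ident has_derivative_const)
    show "(g has_derivative inv (fderiv f (x, u))) (at (x, w))"
      using g(7)[of "(x, w)"] g(5) by (simp add: fxu gx)
  qed
  have gd': "snd (inv (fderiv f (x, u)) (v, 0)) = - inv (A x) (fderiv (\<lambda>y. A y u) x v)" for v
  proof -
    define \<mu> where "\<mu> = inv (A x) (fderiv (\<lambda>y. A y u) x v)"
    have "A x \<mu> = fderiv (\<lambda>y. A y u) x v"
      using bijA[OF x] by (simp add: \<mu>_def bij_is_surj surj_f_inv_f)
    then have "fderiv f (x, u) (v, - \<mu>) = (v, 0)" by (simp add: fd linear_neg[OF A(1)[OF x]])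
    then have "inv (fderiv f (x, u)) (v, 0) = (v, - \<mu>)"
      using \<open>inj (fderiv f (x, u))\<close> by (metis inv_f_f)
    then show ?thesis by (simp add: \<mu>_def)
  qed
  \<comment> \<open>On the slice with second coordinate \<open>w\<close>, the local inverse
    \<open>g\<close> has second component \<open>inv (A y) w\<close>.\<close>
  have "\<exists>T. open T \<and> x \<in> T \<and> (\<forall>y\<in>T. (y, w) \<in> V)"
  proof (intro exI conjI)
    show "open ((\<lambda>y. (y, w)) -` V)" using g(4) by (intro open_vimage continuous_intros)
  qed (use g(5) fxu in auto)
  then obtain T where T: "open T" "x \<in> T" "\<And>y. y \<in> T \<Longrightarrow> (y, w) \<in> V" by blast
  have "snd (g (y, w)) = inv (A y) w" if "y \<in> T" for y
  proof -
    have "g (y, w) \<in> S \<times> UNIV" "f (g (y, w)) = (y, w)"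
      using g(2,6) T(3)[OF that] by (auto simp: homeomorphism_def)
    then have "fst (g (y, w)) = y" "A y (snd (g (y, w))) = w" "y \<in> S"
      by (auto simp: f_def split: prod.splits)
    then show ?thesis using A(2) by (metis inv_f_f)
  qed
  then show ?thesis
    using has_derivative_transform_within_open[OF gd T(1,2), of "\<lambda>y. inv (A y) w"]
    unfolding gd' unfolding u_def by simp
qed

text \<open>Bootstrapping: the derivative of \<open>x \<mapsto> inv (A x) w\<close> is built from
  maps of the same kind with other vectors in place of \<open>w\<close>. One more degree of
  differentiability therefore follows as soon as the present degree is known for all
  \<open>w\<close>.\<close>

lemma smooth_on_inv_apply_const:
  fixes A :: "'a::euclidean_space \<Rightarrow> 'b::euclidean_space \<Rightarrow> 'b"
  assumes S: "open S" and A: "\<And>x. x \<in> S \<Longrightarrow> linear (A x)" "\<And>x. x \<in> S \<Longrightarrow> inj (A x)"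
    and sm: "\<And>u. smooth_on S (\<lambda>x. A x u)"
  shows "smooth_on S (\<lambda>x. inv (A x) w)"
proof -
  note der = has_derivative_inv_apply[OF S A sm]
  have lin': "linear (inv (A x))" if "x \<in> S" for x
    using A that by (simp add: inj_linear_imp_inv_linear)
  have "Ck_on k S (\<lambda>x. inv (A x) w)" for k w
  proof (induction k arbitrary: w)
    case 0
    show ?case unfolding Ck_on.simps
      by (rule continuous_at_imp_continuous_on) (use der has_derivative_continuous in blast)
  next
    case (Suc k)
    show ?case
    proof (rule Ck_on_SucI[OF S der])
      fix v
      \<comment> \<open>The derivative formula \<open>der\<close>, expanded twice so that
        \<open>inv (A x)\<close> meets only the fixed vectors \<open>w\<close> and \<open>b\<close>,
        for which the induction hypothesis is available.\<close>
      let ?d = "\<lambda>x. \<Sum>b\<in>Basis. \<Sum>c\<in>Basis. ((inv (A x) w \<bullet> c) * (fderiv (\<lambda>y. A y c) x v \<bullet> b)) *\<^sub>R inv (A x) b"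
      have "Ck_on k S ?d"
        by (intro Ck_on_sum Ck_on_bilinear[OF bounded_bilinear_scaleR S] Ck_on_bilinear[OF bounded_bilinear_mult S]
            Ck_on_bounded_linear[OF bounded_linear_inner_left S] Suc.IH S)
          (use smooth_on_fderiv[OF sm] in \<open>auto simp: smooth_on_def\<close>)
      then have "Ck_on k S (\<lambda>x. - ?d x)"
        by (rule Ck_on_bounded_linear[OF bounded_linear_minus[OF bounded_linear_ident] S])
      moreover have "?d x = inv (A x) (fderiv (\<lambda>y. A y (inv (A x) w)) x v)" if "x \<in> S" for x
      proof -
        define u where "u = inv (A x) w"
        have "fderiv (\<lambda>y. A y u) x v = fderiv (\<lambda>y. \<Sum>c\<in>Basis. (u \<bullet> c) *\<^sub>R A y c) x v"
          by (subst fderiv_cong[OF S that]) (use linear_expand[OF A(1)] in auto)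
        also have "\<dots> = (\<Sum>c\<in>Basis. (u \<bullet> c) *\<^sub>R fderiv (\<lambda>y. A y c) x v)"
          by (subst fderiv_eq, rule has_derivative_sum, rule has_derivative_scaleR_right,
              rule smooth_on_has_derivative[OF sm that]) simp
        finally have e: "fderiv (\<lambda>y. A y u) x v = (\<Sum>c\<in>Basis. (u \<bullet> c) *\<^sub>R fderiv (\<lambda>y. A y c) x v)" .
        have "inv (A x) (fderiv (\<lambda>y. A y u) x v) =
            (\<Sum>b\<in>Basis. (fderiv (\<lambda>y. A y u) x v \<bullet> b) *\<^sub>R inv (A x) b)"
          by (rule linear_expand[OF lin'[OF that]])
        also have "\<dots> = (\<Sum>b\<in>Basis. \<Sum>c\<in>Basis. ((u \<bullet> c) * (fderiv (\<lambda>y. A y c) x v \<bullet> b)) *\<^sub>R inv (A x) b)"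
          by (simp add: e inner_sum_left scaleR_left.sum)
        finally show ?thesis by (simp add: u_def)
      qed
      ultimately show "Ck_on k S (\<lambda>x. - inv (A x) (fderiv (\<lambda>y. A y (inv (A x) w)) x v))"
        using Ck_on_cong[OF S] by (metis (no_types, lifting))
    qed
  qed
  then show ?thesis by (simp add: smooth_on_def)
qed

text \<open>The derivative of \<open>g\<close> is the pointwise inverse of the derivative of
  \<open>f\<close>, composed with \<open>g\<close>, so each degree of differentiability of
  \<open>g\<close> yields the next.\<close>

lemma smooth_inverse_function:
  fixes f :: "'a::euclidean_space \<Rightarrow> 'a"
  assumes "open U" "smooth_on U f" "x0 \<in> U" "inj (fderiv f x0)"
  obtains U' V g where "open U'" "U' \<subseteq> U" "x0 \<in> U'" "open V" "f x0 \<in> V" "homeomorphism U' V f g"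
    "smooth_on V g"
proof -
  obtain U' V g where g: "open U'" "U' \<subseteq> U" "x0 \<in> U'" "open V" "f x0 \<in> V" "homeomorphism U' V f g"
    "\<And>y. y \<in> V \<Longrightarrow> (g has_derivative inv (fderiv f (g y))) (at y)"
    "\<And>y. y \<in> V \<Longrightarrow> bij (fderiv f (g y))"
    by (rule inverse_function_C1[OF assms]) blast
  have gV: "g ` V = U'" "f ` U' = V" and gf: "\<And>x. x \<in> U' \<Longrightarrow> g (f x) = x" using g(6) by (auto simp: homeomorphism_def)
  have b: "bij (fderiv f x)" if "x \<in> U'" for x
    using g(8)[of "f x"] gV(2) gf that by auto
  have sm: "smooth_on U' (\<lambda>x. inv (fderiv f x) v)" for v
    using b smooth_on_subset[OF assms(2) g(2)]
    by (intro smooth_on_inv_apply_const g(1) smooth_on_fderiv) (auto intro: smooth_on_linear bij_is_inj)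
  have "Ck_on k V g" for k
  proof (induction k)
    case 0
    then show ?case using g(6) by (simp add: homeomorphism_def)
  next
    case (Suc k)
    show ?case
    proof (rule Ck_on_SucI[OF g(4,7)])
      show "Ck_on k V (\<lambda>y. inv (fderiv f (g y)) v)" for v
        using sm gV by (intro Ck_on_compose[OF g(4,1) _ Suc]) (auto simp: smooth_on_def)
    qed
  qed
  then show ?thesis using g by (intro that[of U' V g]) (auto simp: smooth_on_def)
qed

text \<open>The second difference of \<open>f\<close> over a small parallelogram is symmetric in
  \<open>u\<close> and \<open>v\<close>. Two mean value theorems express it by a mixed derivative at
  a nearby point, in either order of differentiation, and continuity gives equality at
  \<open>x\<close>.\<close>

lemma fderiv_symmetric_real:
  fixes f :: "'a::euclidean_space \<Rightarrow> real"
  assumes S: "open S" and f: "smooth_on S f" and x: "x \<in> S"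
  shows "fderiv (\<lambda>y. fderiv f y u) x v = fderiv (\<lambda>y. fderiv f y v) x u"
proof -
  obtain r where r: "r > 0" "ball x r \<subseteq> S" using S x openE by blast
  have key: "\<exists>y. dist x y \<le> s * (norm u + norm v) \<and>
      f (x + s *\<^sub>R u + s *\<^sub>R v) - f (x + s *\<^sub>R u) - f (x + s *\<^sub>R v) + f x = s * (s * fderiv (\<lambda>y. fderiv f y u) y v)"
    if s: "0 < s" "s * (norm u + norm v) < r" for s u v
  proof -
    have inS: "x + a *\<^sub>R u + b *\<^sub>R v \<in> S" "dist x (x + a *\<^sub>R u + b *\<^sub>R v) \<le> s * (norm u + norm v)"
      if "0 \<le> a" "a \<le> s" "0 \<le> b" "b \<le> s" for a b
    proof -
      have "norm (a *\<^sub>R u + b *\<^sub>R v) \<le> a * norm u + b * norm v"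
        using that norm_triangle_ineq[of "a *\<^sub>R u" "b *\<^sub>R v"] by simp
      also have "\<dots> \<le> s * norm u + s * norm v" using that by (intro add_mono mult_right_mono) auto
      finally have "norm (a *\<^sub>R u + b *\<^sub>R v) \<le> s * (norm u + norm v)" by (simp add: algebra_simps)
      moreover have "dist x (x + a *\<^sub>R u + b *\<^sub>R v) = norm (a *\<^sub>R u + b *\<^sub>R v)"
        by (metis add.assoc add_diff_cancel_left' dist_commute dist_norm)
      ultimately show "dist x (x + a *\<^sub>R u + b *\<^sub>R v) \<le> s * (norm u + norm v)" by simp
      with s r show "x + a *\<^sub>R u + b *\<^sub>R v \<in> S" by (auto simp: subset_iff)
    qed
    \<comment> \<open>The increment of \<open>f\<close> along \<open>v\<close>, as a function of the
      displacement along \<open>u\<close>. The term \<open>0 *\<^sub>R v\<close> keeps both summands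
      in the form of \<open>d1\<close>.\<close>
    define \<phi> where "\<phi> t = f (x + t *\<^sub>R u + s *\<^sub>R v) - f (x + t *\<^sub>R u + 0 *\<^sub>R v)" for t
    have d1: "((\<lambda>t. g (x + t *\<^sub>R u + b *\<^sub>R v)) has_real_derivative fderiv g (x + t *\<^sub>R u + b *\<^sub>R v) u) (at t)"
      if "0 \<le> t" "t \<le> s" "0 \<le> b" "b \<le> s" "smooth_on S g" for t b and g :: "'a \<Rightarrow> real"
    proof -
      let ?y = "x + t *\<^sub>R u + b *\<^sub>R v"
      note G = smooth_on_has_derivative[OF that(5) inS(1)[OF that(1-4)]]
      have "((\<lambda>t. x + t *\<^sub>R u + b *\<^sub>R v) has_derivative (\<lambda>h. h *\<^sub>R u)) (at t)"
        by (auto intro!: derivative_eq_intros)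
      from has_derivative_compose[OF this G]
      have "((\<lambda>t. g (x + t *\<^sub>R u + b *\<^sub>R v)) has_derivative (\<lambda>h. fderiv g ?y (h *\<^sub>R u))) (at t)" .
      moreover have "fderiv g ?y (h *\<^sub>R u) = fderiv g ?y u * h" for h
        using linear_cmul[OF has_derivative_linear[OF G]] by simp
      ultimately show ?thesis by (simp add: has_field_derivative_def)
    qed
    have d2: "((\<lambda>b. g (x + t *\<^sub>R u + b *\<^sub>R v)) has_real_derivative fderiv g (x + t *\<^sub>R u + b *\<^sub>R v) v) (at b)"
      if "0 \<le> t" "t \<le> s" "0 \<le> b" "b \<le> s" "smooth_on S g" for t b and g :: "'a \<Rightarrow> real"
    proof -
      let ?y = "x + t *\<^sub>R u + b *\<^sub>R v"
      note G = smooth_on_has_derivative[OF that(5) inS(1)[OF that(1-4)]]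
      have "((\<lambda>b. x + t *\<^sub>R u + b *\<^sub>R v) has_derivative (\<lambda>h. h *\<^sub>R v)) (at b)"
        by (auto intro!: derivative_eq_intros)
      from has_derivative_compose[OF this G]
      have "((\<lambda>b. g (x + t *\<^sub>R u + b *\<^sub>R v)) has_derivative (\<lambda>h. fderiv g ?y (h *\<^sub>R v))) (at b)" .
      moreover have "fderiv g ?y (h *\<^sub>R v) = fderiv g ?y v * h" for h
        using linear_cmul[OF has_derivative_linear[OF G]] by simp
      ultimately show ?thesis by (simp add: has_field_derivative_def)
    qed
    have "\<exists>t. 0 < t \<and> t < s \<and> \<phi> s - \<phi> 0 =
        (s - 0) * (fderiv f (x + t *\<^sub>R u + s *\<^sub>R v) u - fderiv f (x + t *\<^sub>R u + 0 *\<^sub>R v) u)"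
      unfolding \<phi>_def by (rule MVT2[OF s(1)], intro DERIV_diff d1) (use s f in auto)
    then obtain t where t: "0 < t" "t < s" "\<phi> s - \<phi> 0 =
        (s - 0) * (fderiv f (x + t *\<^sub>R u + s *\<^sub>R v) u - fderiv f (x + t *\<^sub>R u + 0 *\<^sub>R v) u)" by blast
    have "\<exists>b. 0 < b \<and> b < s \<and> fderiv f (x + t *\<^sub>R u + s *\<^sub>R v) u - fderiv f (x + t *\<^sub>R u + 0 *\<^sub>R v) u =
        (s - 0) * fderiv (\<lambda>y. fderiv f y u) (x + t *\<^sub>R u + b *\<^sub>R v) v"
      by (rule MVT2[OF s(1)], rule d2) (use t smooth_on_fderiv[OF f] in auto)
    then obtain b where b: "0 < b" "b < s" "fderiv f (x + t *\<^sub>R u + s *\<^sub>R v) u - fderiv f (x + t *\<^sub>R u + 0 *\<^sub>R v) u =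
        (s - 0) * fderiv (\<lambda>y. fderiv f y u) (x + t *\<^sub>R u + b *\<^sub>R v) v" by blast
    have "f (x + s *\<^sub>R u + s *\<^sub>R v) - f (x + s *\<^sub>R u) - f (x + s *\<^sub>R v) + f x = \<phi> s - \<phi> 0"
      by (simp add: \<phi>_def)
    also have "\<dots> = s * (s * fderiv (\<lambda>y. fderiv f y u) (x + t *\<^sub>R u + b *\<^sub>R v) v)"
      unfolding t(3) b(3) by simp
    finally have "f (x + s *\<^sub>R u + s *\<^sub>R v) - f (x + s *\<^sub>R u) - f (x + s *\<^sub>R v) + f x =
        s * (s * fderiv (\<lambda>y. fderiv f y u) (x + t *\<^sub>R u + b *\<^sub>R v) v)" .
    moreover have "dist x (x + t *\<^sub>R u + b *\<^sub>R v) \<le> s * (norm u + norm v)"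
      by (rule inS(2)) (use t(1,2) b(1,2) in linarith)+
    ultimately show ?thesis by (intro exI[where x = "x + t *\<^sub>R u + b *\<^sub>R v"] conjI)
  qed
  define g1 g2 where "g1 y = fderiv (\<lambda>y. fderiv f y u) y v" and "g2 y = fderiv (\<lambda>y. fderiv f y v) y u" for y
  have cont: "continuous (at x) g1" "continuous (at x) g2"
    unfolding g1_def g2_def using S x f
    by (metis continuous_on_eq_continuous_at smooth_on_continuous smooth_on_fderiv)+
  define M where "M = norm u + norm v"
  have "\<bar>g1 x - g2 x\<bar> \<le> e" if e: "e > 0" for e
  proof -
    have "e / 2 > 0" using e by simp
    then have "\<exists>d1>0. \<forall>y. dist y x < d1 \<longrightarrow> dist (g1 y) (g1 x) < e / 2"
      "\<exists>d2>0. \<forall>y. dist y x < d2 \<longrightarrow> dist (g2 y) (g2 x) < e / 2"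
      using cont unfolding continuous_at_eps_delta by fast+
    then obtain d1 d2 where d: "d1 > 0" "\<And>y. dist y x < d1 \<Longrightarrow> dist (g1 y) (g1 x) < e / 2"
      "d2 > 0" "\<And>y. dist y x < d2 \<Longrightarrow> dist (g2 y) (g2 x) < e / 2"
      by auto
    define m where "m = min r (min d1 d2)"
    have m: "m > 0" "m \<le> r" "m \<le> d1" "m \<le> d2" using r d by (auto simp: m_def)
    \<comment> \<open>Adding 1 avoids division by zero for \<open>u = v = 0\<close>. The choice
      gives \<open>s * M < m\<close>, so both intermediate points are within \<open>r\<close>,
      \<open>d1\<close> and \<open>d2\<close> of \<open>x\<close>.\<close>
    define s where "s = m / (M + 1) / 2"
    have M: "M \<ge> 0" by (simp add: M_def)
    have s: "s > 0" "s * M < m"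
    proof -
      show "s > 0" using M m by (simp add: s_def)
      have "M / (M + 1) / 2 < 1" using M by (simp add: field_simps)
      then have "m * (M / (M + 1) / 2) < m * 1" using m(1) by (intro mult_strict_left_mono)
      then show "s * M < m" by (simp add: s_def)
    qed
    have sr: "s * (norm u + norm v) < r" "s * (norm v + norm u) < r" using s m by (auto simp: M_def add.commute)
    from key[OF s(1) sr(1)] obtain y where y: "dist x y \<le> s * M"
      "f (x + s *\<^sub>R u + s *\<^sub>R v) - f (x + s *\<^sub>R u) - f (x + s *\<^sub>R v) + f x = s * (s * g1 y)"
      by (auto simp: g1_def M_def)
    from key[OF s(1) sr(2)] obtain z where z: "dist x z \<le> s * M"
      "f (x + s *\<^sub>R v + s *\<^sub>R u) - f (x + s *\<^sub>R v) - f (x + s *\<^sub>R u) + f x = s * (s * g2 z)"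
      by (auto simp: g2_def M_def add.commute)
    have e: "x + s *\<^sub>R v + s *\<^sub>R u = x + s *\<^sub>R u + s *\<^sub>R v" by simp
    have "s * (s * g1 y) = s * (s * g2 z)" using y(2) z(2) unfolding e by linarith
    then have "g1 y = g2 z" using s(1) by simp
    moreover have "dist (g1 y) (g1 x) < e / 2" "dist (g2 z) (g2 x) < e / 2"
      using d(2)[of y] d(4)[of z] y(1) z(1) s m by (auto simp: dist_commute)
    ultimately show ?thesis unfolding dist_real_def by linarith
  qed
  then have "\<bar>g1 x - g2 x\<bar> \<le> 0" by (rule field_le_epsilon[of _ 0, simplified]) auto
  then show ?thesis by (simp add: g1_def g2_def)
qed

lemma fderiv_symmetric:
  fixes f :: "'a::euclidean_space \<Rightarrow> 'b::euclidean_space"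
  assumes S: "open S" and f: "smooth_on S f" and x: "x \<in> S"
  shows "fderiv (\<lambda>y. fderiv f y u) x v = fderiv (\<lambda>y. fderiv f y v) x u"
proof (rule euclidean_eqI)
  fix b :: 'b assume "b \<in> Basis"
  have fb: "smooth_on S (\<lambda>y. f y \<bullet> b)"
    by (intro smooth_on_inner S f smooth_on_const)
  have d: "fderiv (\<lambda>y. g y \<bullet> b) y w = fderiv g y w \<bullet> b" if "smooth_on S g" "y \<in> S" for g :: "'a \<Rightarrow> 'b" and y w
    using fderiv_eq[OF bounded_linear.has_derivative[OF bounded_linear_inner_left smooth_on_has_derivative[OF that]]]
    by simp
  have "fderiv (\<lambda>y. fderiv f y w) x w' \<bullet> b = fderiv (\<lambda>y. fderiv (\<lambda>y. f y \<bullet> b) y w) x w'" for w w'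
  proof -
    have "fderiv (\<lambda>y. fderiv (\<lambda>y. f y \<bullet> b) y w) x = fderiv (\<lambda>y. fderiv f y w \<bullet> b) x"
      by (rule fderiv_cong[OF S x]) (simp add: d[OF f])
    then show ?thesis using d[OF smooth_on_fderiv[OF f] x] by simp
  qed
  then show "fderiv (\<lambda>y. fderiv f y u) x v \<bullet> b = fderiv (\<lambda>y. fderiv f y v) x u \<bullet> b"
    using fderiv_symmetric_real[OF S fb x] by simp
qed

lemma fderiv_inner:
  fixes f g :: "'a::euclidean_space \<Rightarrow> 'b::euclidean_space"
  assumes "smooth_on S f" "smooth_on S g" "x \<in> S"
  shows "fderiv (\<lambda>x. f x \<bullet> g x) x v = f x \<bullet> fderiv g x v + fderiv f x v \<bullet> g x"
  using fderiv_eq[OF bounded_bilinear.FDERIV[OF bounded_bilinear_inner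
        smooth_on_has_derivative[OF assms(1,3)] smooth_on_has_derivative[OF assms(2,3)]]] by simp

lemma smooth_on_inv_apply:
  fixes A :: "'a::euclidean_space \<Rightarrow> 'b::euclidean_space \<Rightarrow> 'b"
  assumes S: "open S" and A: "\<And>x. x \<in> S \<Longrightarrow> linear (A x)" "\<And>x. x \<in> S \<Longrightarrow> inj (A x)"
    and sm: "\<And>u. smooth_on S (\<lambda>x. A x u)" "smooth_on S w"
  shows "smooth_on S (\<lambda>x. inv (A x) (w x))"
proof -
  have "smooth_on S (\<lambda>x. \<Sum>b\<in>Basis. (w x \<bullet> b) *\<^sub>R inv (A x) b)"
    by (intro smooth_on_sum smooth_on_scaleR smooth_on_inner smooth_on_const sm smooth_on_inv_apply_const S A)
  moreover have "(\<Sum>b\<in>Basis. (w x \<bullet> b) *\<^sub>R inv (A x) b) = inv (A x) (w x)" if "x \<in> S" for x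
    by (rule linear_expand[symmetric]) (use A that in \<open>auto intro: inj_linear_imp_inv_linear\<close>)
  ultimately show ?thesis using smooth_on_cong[OF S] by (metis (no_types, lifting))
qed

text \<open>Where the derivative is injective, the inverse function theorem makes it bijective on a
  whole neighbourhood. This will give the cotangent lift an open domain.\<close>

lemma open_inj_fderiv:
  fixes f :: "'a::euclidean_space \<Rightarrow> 'a"
  assumes S: "open S" and f: "smooth_on S f"
  shows "open {x \<in> S. inj (fderiv f x)}"
proof (subst open_subopen, intro ballI)
  fix x assume "x \<in> {x \<in> S. inj (fderiv f x)}"
  then have x: "x \<in> S" "inj (fderiv f x)" by auto
  obtain U' V g where g: "open U'" "U' \<subseteq> S" "x \<in> U'" "open V" "f x \<in> V" "homeomorphism U' V f g"
    "\<And>y. y \<in> V \<Longrightarrow> (g has_derivative inv (fderiv f (g y))) (at y)"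
    "\<And>y. y \<in> V \<Longrightarrow> bij (fderiv f (g y))"
    by (rule inverse_function_C1[OF S f x]) blast
  have "inj (fderiv f y)" if "y \<in> U'" for y
    using g(6) g(8)[of "f y"] that by (auto simp: homeomorphism_def bij_is_inj)
  then show "\<exists>T. open T \<and> x \<in> T \<and> T \<subseteq> {x \<in> S. inj (fderiv f x)}"
    using g by (intro exI[of _ U']) auto
qed

text \<open>The map is linear in \<open>v\<close>, so its partial derivative there is
  \<open>fderiv f q\<close> itself. The other partial derivative is the second-order term in the
  transition maps of an iterated tangent bundle.\<close>

lemma fderiv_apply_derivative:
  fixes f :: "'a::euclidean_space \<Rightarrow> 'b::euclidean_space"
  assumes S: "open S" and f: "smooth_on S f" and q: "q \<in> S"
  shows "fderiv (\<lambda>u. fderiv f (fst u) (snd u)) (q, v) (a, b) = fderiv (\<lambda>q. fderiv f q v) q a + fderiv f q b"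
proof -
  let ?F = "\<lambda>u. fderiv f (fst u) (snd u)"
  have o: "open (S \<times> (UNIV :: 'a set))" by (intro open_Times S open_UNIV)
  have sm: "smooth_on (S \<times> UNIV) ?F"
    by (rule smooth_on_fderiv_apply[OF o S f]) (auto intro!: smooth_on_fst smooth_on_snd smooth_on_ident o)
  have D: "(?F has_derivative fderiv ?F (q, v)) (at (q, v))"
    by (rule smooth_on_has_derivative[OF sm]) (use q in auto)
  have D1: "((\<lambda>q. ?F (q, v)) has_derivative (\<lambda>a. fderiv ?F (q, v) (a, 0))) (at q)"
    by (rule has_derivative_compose[of "\<lambda>q. (q, v)" "\<lambda>a. (a, 0)", OF _ D])
      (intro has_derivative_Pair has_derivative_ident has_derivative_const)
  have D2: "((\<lambda>v. ?F (q, v)) has_derivative (\<lambda>b. fderiv ?F (q, v) (0, b))) (at v)"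
    by (rule has_derivative_compose[of "\<lambda>v. (q, v)" "\<lambda>b. (0, b)", OF _ D])
      (intro has_derivative_Pair has_derivative_ident has_derivative_const)
  have D2': "((\<lambda>v. ?F (q, v)) has_derivative fderiv f q) (at v)"
    using linear_imp_has_derivative[OF smooth_on_linear[OF f q]] by simp
  have "fderiv ?F (q, v) (a, b) = fderiv ?F (q, v) (a, 0) + fderiv ?F (q, v) (0, b)"
    using linear_add[OF has_derivative_linear[OF D], of "(a, 0)" "(0, b)"] by simp
  moreover have "fderiv ?F (q, v) (a, 0) = fderiv (\<lambda>q. fderiv f q v) q a"
    using fderiv_eq[OF D1] by (simp add: fun_eq_iff)
  moreover have "fderiv ?F (q, v) (0, b) = fderiv f q b"
    using fun_cong[OF has_derivative_unique[OF D2 D2'], of b] by simp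
  ultimately show ?thesis by simp
qed

lemma linear_inj_imp_surj_self:
  fixes f :: "'a::euclidean_space \<Rightarrow> 'a"
  assumes "linear f" "inj f"
  shows "surj f"
  using assms linear_injective_imp_surjective[of f] by auto

lemma inj_adjoint:
  fixes f :: "'a::euclidean_space \<Rightarrow> 'a"
  assumes "linear f" "inj f"
  shows "inj (adjoint f)"
  using inj_adjoint_iff_surj[OF assms(1)] linear_inj_imp_surj_self[OF assms] by simp

text \<open>Inner products with the images of basis vectors show how the adjoint depends on a
  parameter, so its smoothness can be read off.\<close>

lemma adjoint_expand:
  fixes f :: "'a::euclidean_space \<Rightarrow> 'b::euclidean_space"
  assumes "linear f"
  shows "adjoint f w = (\<Sum>b\<in>Basis. (w \<bullet> f b) *\<^sub>R b)"
proof -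
  have "adjoint f w \<bullet> b = w \<bullet> f b" for b using adjoint_works[OF assms, of b w] by (simp add: inner_commute)
  then show ?thesis by (metis (no_types, lifting) euclidean_representation sum.cong)
qed

section \<open>Smooth maps between manifolds\<close>

lemma atlas_inj: "smooth_atlas A \<Longrightarrow> c \<in> A \<Longrightarrow> inj_on (snd c) (fst c)"
  by (auto simp: smooth_atlas_def)

lemma atlas_open: "smooth_atlas A \<Longrightarrow> c \<in> A \<Longrightarrow> d \<in> A \<Longrightarrow> open (snd c ` (fst c \<inter> fst d))"
  by (auto simp: smooth_atlas_def)

lemma atlas_open_dom: "smooth_atlas A \<Longrightarrow> c \<in> A \<Longrightarrow> open (snd c ` fst c)"
  using atlas_open[of A c c] by simp

lemma chart_inv_left: "smooth_atlas A \<Longrightarrow> c \<in> A \<Longrightarrow> x \<in> fst c \<Longrightarrow> chart_inv c (snd c x) = x"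
  by (simp add: chart_inv_def atlas_inj)

lemma chart_inv_right: "u \<in> snd c ` fst c \<Longrightarrow> snd c (chart_inv c u) = u"
  by (simp add: chart_inv_def f_inv_into_f)

lemma chart_inv_mem: "u \<in> snd c ` fst c \<Longrightarrow> chart_inv c u \<in> fst c"
  by (simp add: chart_inv_def inv_into_into)

lemma chart_image_iff:
  assumes "smooth_atlas A" "c \<in> A"
  shows "u \<in> snd c ` (S \<inter> fst c) \<longleftrightarrow> u \<in> snd c ` fst c \<and> chart_inv c u \<in> S"
    and "u \<in> snd c ` (fst c \<inter> S) \<longleftrightarrow> u \<in> snd c ` fst c \<and> chart_inv c u \<in> S"
proof -
  show *: "u \<in> snd c ` (S \<inter> fst c) \<longleftrightarrow> u \<in> snd c ` fst c \<and> chart_inv c u \<in> S"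
  proof
    assume "u \<in> snd c ` fst c \<and> chart_inv c u \<in> S"
    then have "u = snd c (chart_inv c u)" "chart_inv c u \<in> S \<inter> fst c"
      by (auto simp: chart_inv_right chart_inv_mem)
    then show "u \<in> snd c ` (S \<inter> fst c)" by (rule image_eqI)
  qed (auto simp: chart_inv_left[OF assms])
  show "u \<in> snd c ` (fst c \<inter> S) \<longleftrightarrow> u \<in> snd c ` fst c \<and> chart_inv c u \<in> S"
    using * by (simp add: Int_commute)
qed

lemma chart_image_iff3:
  assumes "smooth_atlas A" "c \<in> A"
  shows "u \<in> snd c ` (S \<inter> fst c \<inter> T) \<longleftrightarrow> u \<in> snd c ` fst c \<and> chart_inv c u \<in> S \<and> chart_inv c u \<in> T"
  using chart_image_iff(1)[OF assms, of u "S \<inter> T"] by (simp add: Int_ac)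

lemma transition_smooth:
  "smooth_atlas A \<Longrightarrow> c \<in> A \<Longrightarrow> d \<in> A \<Longrightarrow> smooth_on (snd c ` (fst c \<inter> fst d)) (\<lambda>u. snd d (chart_inv c u))"
  by (auto simp: smooth_atlas_def o_def)

lemma carrierI: "c \<in> A \<Longrightarrow> x \<in> fst c \<Longrightarrow> x \<in> carrier A"
  by (auto simp: carrier_def)

lemma carrierE: "x \<in> carrier A \<Longrightarrow> (\<And>c. c \<in> A \<Longrightarrow> x \<in> fst c \<Longrightarrow> P) \<Longrightarrow> P"
  by (auto simp: carrier_def)

lemma chart_at_in: "x \<in> carrier A \<Longrightarrow> chart_at A x \<in> A \<and> x \<in> fst (chart_at A x)"
proof -
  assume "x \<in> carrier A"
  then have "\<exists>c. c \<in> charts_at A x" by (auto simp: charts_at_def carrier_def)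
  then have "chart_at A x \<in> charts_at A x" unfolding chart_at_def by (rule someI_ex)
  then show ?thesis by (simp add: charts_at_def)
qed

lemma openin_mtop:
  "smooth_atlas A \<Longrightarrow> openin (mtop A) S \<longleftrightarrow> S \<subseteq> carrier A \<and> (\<forall>c\<in>A. open (snd c ` (S \<inter> fst c)))"
  unfolding mtop_def by (simp add: topology_inverse'[OF istopology_mtop])

lemma openin_mtop_subset: "smooth_atlas A \<Longrightarrow> openin (mtop A) S \<Longrightarrow> S \<subseteq> carrier A"
  by (simp add: openin_mtop)

lemma openin_mtop_image: "smooth_atlas A \<Longrightarrow> openin (mtop A) S \<Longrightarrow> c \<in> A \<Longrightarrow> open (snd c ` (S \<inter> fst c))"
  by (simp add: openin_mtop)

lemma openin_carrier: "smooth_atlas A \<Longrightarrow> openin (mtop A) (carrier A)"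
proof -
  assume A: "smooth_atlas A"
  have "carrier A \<inter> fst c = fst c" if "c \<in> A" for c using that by (auto simp: carrier_def)
  then show ?thesis using atlas_open_dom[OF A] by (simp add: openin_mtop[OF A])
qed

lemma topspace_mtop: "smooth_atlas A \<Longrightarrow> topspace (mtop A) = carrier A"
  by (meson openin_carrier openin_mtop openin_subset openin_topspace subset_antisym)

text \<open>Read in any other chart, the set is a preimage under a transition map, which is
  continuous.\<close>

lemma openin_chart_preimage:
  assumes A: "smooth_atlas A" and c: "c \<in> A" and N: "open N"
  shows "openin (mtop A) {x \<in> fst c. snd c x \<in> N}"
proof -
  have "open (snd d ` ({x \<in> fst c. snd c x \<in> N} \<inter> fst d))" if d: "d \<in> A" for d
  proof -
    have "snd d ` ({x \<in> fst c. snd c x \<in> N} \<inter> fst d) =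
        snd d ` (fst d \<inter> fst c) \<inter> (\<lambda>u. snd c (chart_inv d u)) -` N"
      by (intro set_eqI) (auto simp: chart_image_iff[OF A d])
    moreover have "open \<dots>"
      by (intro continuous_open_preimage smooth_on_continuous transition_smooth[OF A d c] atlas_open[OF A d c] N)
    ultimately show ?thesis by simp
  qed
  then show ?thesis using A c by (auto simp: openin_mtop intro: carrierI)
qed

lemma openin_chart_dom: "smooth_atlas A \<Longrightarrow> c \<in> A \<Longrightarrow> openin (mtop A) (fst c)"
  using openin_chart_preimage[of A c UNIV] by simp

section \<open>Smooth maps and their local representatives\<close>

lemma smooth_mapD_openin: "smooth_map A B S F \<Longrightarrow> openin (mtop A) S"
  by (simp add: smooth_map_def)

lemma smooth_mapD_carrier: "smooth_map A B S F \<Longrightarrow> x \<in> S \<Longrightarrow> F x \<in> carrier B"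
  by (auto simp: smooth_map_def)

definition rep_dom :: "('m, 'e) chart \<Rightarrow> ('k, 'f) chart \<Rightarrow> 'm set \<Rightarrow> ('m \<Rightarrow> 'k) \<Rightarrow> 'e set" where
  "rep_dom c d S F = snd c ` (S \<inter> fst c \<inter> F -` fst d)"

lemma rep_dom_iff:
  "smooth_atlas A \<Longrightarrow> c \<in> A \<Longrightarrow>
    u \<in> rep_dom c d S F \<longleftrightarrow> u \<in> snd c ` fst c \<and> chart_inv c u \<in> S \<and> F (chart_inv c u) \<in> fst d"
  unfolding rep_dom_def by (subst chart_image_iff3) auto

lemma rep_domI: "x \<in> S \<Longrightarrow> x \<in> fst c \<Longrightarrow> F x \<in> fst d \<Longrightarrow> snd c x \<in> rep_dom c d S F"
  unfolding rep_dom_def by auto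

lemma open_rep_dom: "smooth_map A B S F \<Longrightarrow> c \<in> A \<Longrightarrow> d \<in> B \<Longrightarrow> open (rep_dom c d S F)"
  by (auto simp: smooth_map_def rep_dom_def)

lemma smooth_map_rep:
  "smooth_map A B S F \<Longrightarrow> c \<in> A \<Longrightarrow> d \<in> B \<Longrightarrow> smooth_on (rep_dom c d S F) (\<lambda>u. snd d (F (chart_inv c u)))"
  by (auto simp: smooth_map_def rep_dom_def o_def)

text \<open>\<open>smooth_map\<close> quantifies over all pairs of charts, but one pair at each
  point is enough: any other representative is this one between two transition maps. Openness of the
  representative domains comes out of the same argument.\<close>

lemma smooth_mapI_local:
  assumes A: "smooth_atlas A" and B: "smooth_atlas B" and S: "openin (mtop A) S"
    and loc: "\<And>x. x \<in> S \<Longrightarrow> \<exists>c d N. c \<in> A \<and> d \<in> B \<and> x \<in> fst c \<and> open N \<and> snd c x \<in> N \<and>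
      (\<forall>u\<in>N. u \<in> snd c ` fst c \<longrightarrow> chart_inv c u \<in> S \<longrightarrow> F (chart_inv c u) \<in> fst d) \<and>
      smooth_on N (\<lambda>u. snd d (F (chart_inv c u)))"
  shows "smooth_map A B S F"
proof -
  have FB: "F ` S \<subseteq> carrier B"
  proof
    fix y assume "y \<in> F ` S"
    then obtain x where x: "x \<in> S" "y = F x" by auto
    from loc[OF x(1)] obtain c d N where *: "c \<in> A" "d \<in> B" "x \<in> fst c" "open N" "snd c x \<in> N"
      "\<forall>u\<in>N. u \<in> snd c ` fst c \<longrightarrow> chart_inv c u \<in> S \<longrightarrow> F (chart_inv c u) \<in> fst d" by blast
    then have "F (chart_inv c (snd c x)) \<in> fst d" using x chart_inv_left[OF A *(1,3)] by auto
    then show "y \<in> carrier B" using *(2) x(2) chart_inv_left[OF A *(1,3)] by (auto intro: carrierI)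
  qed
  have key: "\<exists>T. open T \<and> u \<in> T \<and> T \<subseteq> rep_dom c' d' S F \<and> smooth_on T (\<lambda>u. snd d' (F (chart_inv c' u)))"
    if c': "c' \<in> A" and d': "d' \<in> B" and u: "u \<in> rep_dom c' d' S F" for c' d' u
  proof -
    define x where "x = chart_inv c' u"
    have x: "x \<in> S" "x \<in> fst c'" "F x \<in> fst d'" "snd c' x = u"
      using u by (auto simp: rep_dom_iff[OF A c'] x_def intro: chart_inv_mem chart_inv_right)
    from loc[OF x(1)] obtain c d N where c: "c \<in> A" and d: "d \<in> B" and xc: "x \<in> fst c" and N: "open N" "snd c x \<in> N"
      and FO: "\<forall>u\<in>N. u \<in> snd c ` fst c \<longrightarrow> chart_inv c u \<in> S \<longrightarrow> F (chart_inv c u) \<in> fst d"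
      and sm: "smooth_on N (\<lambda>u. snd d (F (chart_inv c u)))" by blast
    \<comment> \<open>\<open>T1\<close>, \<open>T2\<close> and \<open>T3\<close> are where, in turn,
      the source transition is defined, it lands in \<open>N\<close>, and the target transition is
      defined. On \<open>T3\<close> the representative in \<open>c'\<close> and \<open>d'\<close> is
      the composite of the three maps.\<close>
    define T1 where "T1 = snd c' ` ((S \<inter> fst c) \<inter> fst c')"
    have T1: "open T1" unfolding T1_def
      by (intro openin_mtop_image[OF A] openin_Int S openin_chart_dom A c c')
    have T1_iff: "w \<in> T1 \<longleftrightarrow> w \<in> snd c' ` fst c' \<and> chart_inv c' w \<in> S \<and> chart_inv c' w \<in> fst c" for w
      unfolding T1_def using chart_image_iff(1)[OF A c', of w "S \<inter> fst c"] by auto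
    have tr: "smooth_on T1 (\<lambda>w. snd c (chart_inv c' w))"
      by (rule smooth_on_subset[OF transition_smooth[OF A c' c]]) (auto simp: T1_def)
    define T2 where "T2 = T1 \<inter> (\<lambda>w. snd c (chart_inv c' w)) -` N"
    have T2: "open T2" unfolding T2_def
      by (intro continuous_open_preimage smooth_on_continuous tr T1 N)
    have eq: "chart_inv c (snd c (chart_inv c' w)) = chart_inv c' w" if "w \<in> T1" for w
      using that chart_inv_left[OF A c] by (auto simp: T1_iff)
    have tr2: "smooth_on T2 (\<lambda>w. snd c (chart_inv c' w))"
      by (rule smooth_on_subset[OF tr]) (auto simp: T2_def)
    have sm2: "smooth_on T2 (\<lambda>w. snd d (F (chart_inv c (snd c (chart_inv c' w)))))"
      by (rule smooth_on_compose[OF T2 N(1) sm tr2]) (auto simp: T2_def)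
    have Fd: "F (chart_inv c' w) \<in> fst d" if "w \<in> T2" for w
    proof -
      have w: "w \<in> T1" "snd c (chart_inv c' w) \<in> N" using that by (auto simp: T2_def)
      then have "snd c (chart_inv c' w) \<in> snd c ` fst c" by (auto simp: T1_iff)
      then show ?thesis using FO w eq[OF w(1)] by (auto simp: T1_iff)
    qed
    define T3 where "T3 = T2 \<inter> (\<lambda>w. snd d (F (chart_inv c (snd c (chart_inv c' w))))) -` (snd d ` (fst d \<inter> fst d'))"
    have T3: "open T3" unfolding T3_def
      by (intro continuous_open_preimage smooth_on_continuous sm2 T2 atlas_open[OF B d d'])
    have sm3: "smooth_on T3 (\<lambda>w. snd d' (chart_inv d (snd d (F (chart_inv c (snd c (chart_inv c' w)))))))"
      by (rule smooth_on_compose[OF T3 atlas_open[OF B d d'] transition_smooth[OF B d d']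
            smooth_on_subset[OF sm2]]) (auto simp: T3_def)
    have e3: "chart_inv d (snd d (F (chart_inv c (snd c (chart_inv c' w))))) = F (chart_inv c' w)"
      if "w \<in> T2" for w
      using eq[of w] Fd[OF that] that chart_inv_left[OF B d] by (auto simp: T2_def)
    have "smooth_on T3 (\<lambda>w. snd d' (F (chart_inv c' w)))"
    proof (subst smooth_on_cong[OF T3])
      show "snd d' (F (chart_inv c' w)) =
        snd d' (chart_inv d (snd d (F (chart_inv c (snd c (chart_inv c' w))))))" if "w \<in> T3" for w
        using e3[of w] that by (simp add: T3_def)
    qed (rule sm3)
    moreover have "u \<in> T1" using x xc chart_inv_left[OF A c' x(2)] by (auto simp: T1_iff)
    then have "u \<in> T2" using x N(2) chart_inv_left[OF A c' x(2)] by (auto simp: T2_def)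
    then have "u \<in> T3" using x Fd[of u] eq[OF \<open>u \<in> T1\<close>] by (auto simp: T3_def x_def[symmetric])
    moreover have "T3 \<subseteq> rep_dom c' d' S F"
    proof
      fix w assume "w \<in> T3"
      then have w: "w \<in> T2" "w \<in> T1" by (auto simp: T3_def T2_def)
      have "snd d (F (chart_inv c' w)) \<in> snd d ` (fst d \<inter> fst d')"
        using \<open>w \<in> T3\<close> eq[OF w(2)] by (auto simp: T3_def)
      then have "chart_inv d (snd d (F (chart_inv c' w))) \<in> fst d'"
        by (simp add: chart_image_iff[OF B d])
      then show "w \<in> rep_dom c' d' S F"
        using w Fd[OF w(1)] chart_inv_left[OF B d] by (auto simp: rep_dom_iff[OF A c'] T1_iff)
    qed
    ultimately show ?thesis using T3 by blast
  qed
  show ?thesis unfolding smooth_map_def rep_dom_def[symmetric]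
  proof (intro conjI ballI S FB)
    fix c d assume cd: "c \<in> A" "d \<in> B"
    show "open (rep_dom c d S F)" using key[OF cd] by (subst open_subopen) blast
    show "smooth_on (rep_dom c d S F) (snd d \<circ> F \<circ> chart_inv c)"
      unfolding o_def by (rule smooth_onI_local) (use key[OF cd] in blast)
  qed
qed

lemma smooth_mapE:
  assumes "smooth_atlas A" "smooth_map A B S F" "x \<in> S"
  obtains c d where "c \<in> A" "d \<in> B" "x \<in> fst c" "F x \<in> fst d"
  using assms smooth_mapD_carrier[OF assms(2,3)] openin_mtop_subset[OF assms(1) smooth_mapD_openin[OF assms(2)]]
  by (meson carrierE subsetD)

lemma smooth_map_preimage_open:
  assumes A: "smooth_atlas A" and B: "smooth_atlas B" and F: "smooth_map A B S F" and T: "openin (mtop B) T"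
  shows "openin (mtop A) (S \<inter> F -` T)"
proof -
  have "open (snd c ` ((S \<inter> F -` T) \<inter> fst c))" if c: "c \<in> A" for c
  proof (subst open_subopen, intro ballI)
    fix u assume u: "u \<in> snd c ` ((S \<inter> F -` T) \<inter> fst c)"
    then have u': "u \<in> snd c ` fst c" "chart_inv c u \<in> S" "F (chart_inv c u) \<in> T"
      by (auto simp: chart_image_iff[OF A c] simp del: image_Int)
    obtain d where d: "d \<in> B" "F (chart_inv c u) \<in> fst d"
      using smooth_mapD_carrier[OF F u'(2)] by (rule carrierE)
    let ?T = "rep_dom c d S F \<inter> (\<lambda>w. snd d (F (chart_inv c w))) -` (snd d ` (T \<inter> fst d))"
    have "open ?T"
      by (intro continuous_open_preimage smooth_on_continuous smooth_map_rep[OF F c d(1)] open_rep_dom[OF F c d(1)]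
          openin_mtop_image[OF B T d(1)])
    moreover have "u \<in> ?T" using u' d by (auto simp: rep_dom_iff[OF A c])
    moreover have "?T \<subseteq> snd c ` ((S \<inter> F -` T) \<inter> fst c)"
    proof
      fix w assume w: "w \<in> ?T"
      then have "chart_inv d (snd d (F (chart_inv c w))) \<in> T"
        using chart_image_iff(1)[OF B d(1)] by blast
      then show "w \<in> snd c ` ((S \<inter> F -` T) \<inter> fst c)"
        using w unfolding chart_image_iff[OF A c] by (auto simp: rep_dom_iff[OF A c] chart_inv_left[OF B d(1)])
    qed
    ultimately show "\<exists>Z. open Z \<and> u \<in> Z \<and> Z \<subseteq> snd c ` ((S \<inter> F -` T) \<inter> fst c)" by blast
  qed
  then show ?thesis using openin_mtop_subset[OF A smooth_mapD_openin[OF F]] by (auto simp: openin_mtop[OF A])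
qed

lemma smooth_map_subset:
  assumes A: "smooth_atlas A" and B: "smooth_atlas B" and F: "smooth_map A B S F"
    and T: "openin (mtop A) T" "T \<subseteq> S"
  shows "smooth_map A B T F"
proof (rule smooth_mapI_local[OF A B T(1)])
  fix x assume x: "x \<in> T"
  with T have "x \<in> S" by auto
  from smooth_mapE[OF A F this] obtain c d where "c \<in> A" "d \<in> B" "x \<in> fst c" "F x \<in> fst d" .
  then show "\<exists>c d N. c \<in> A \<and> d \<in> B \<and> x \<in> fst c \<and> open N \<and> snd c x \<in> N \<and>
      (\<forall>u\<in>N. u \<in> snd c ` fst c \<longrightarrow> chart_inv c u \<in> T \<longrightarrow> F (chart_inv c u) \<in> fst d) \<and>
      smooth_on N (\<lambda>u. snd d (F (chart_inv c u)))"
    using \<open>x \<in> S\<close>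
    by (intro exI[of _ c] exI[of _ d] exI[of _ "rep_dom c d S F"])
      (auto simp: rep_dom_iff[OF A] chart_inv_left[OF A] intro: open_rep_dom[OF F] smooth_map_rep[OF F] rep_domI)
qed

lemma smooth_map_cong:
  assumes A: "smooth_atlas A" and B: "smooth_atlas B" and F: "smooth_map A B S F"
    and eq: "\<And>x. x \<in> S \<Longrightarrow> F x = G x"
  shows "smooth_map A B S G"
proof (rule smooth_mapI_local[OF A B smooth_mapD_openin[OF F]])
  fix x assume x: "x \<in> S"
  from smooth_mapE[OF A F this] obtain c d where cd: "c \<in> A" "d \<in> B" "x \<in> fst c" "F x \<in> fst d" .
  have "smooth_on (rep_dom c d S F) (\<lambda>u. snd d (G (chart_inv c u)))"
    using smooth_map_rep[OF F cd(1,2)] eq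
    by (subst smooth_on_cong[OF open_rep_dom[OF F cd(1,2)], where g = "\<lambda>u. snd d (F (chart_inv c u))"])
      (auto simp: rep_dom_iff[OF A cd(1)])
  moreover have "\<forall>u\<in>rep_dom c d S F. G (chart_inv c u) \<in> fst d"
    using eq by (auto simp: rep_dom_iff[OF A cd(1)])
  ultimately show "\<exists>c d N. c \<in> A \<and> d \<in> B \<and> x \<in> fst c \<and> open N \<and> snd c x \<in> N \<and>
      (\<forall>u\<in>N. u \<in> snd c ` fst c \<longrightarrow> chart_inv c u \<in> S \<longrightarrow> G (chart_inv c u) \<in> fst d) \<and>
      smooth_on N (\<lambda>u. snd d (G (chart_inv c u)))"
    using x cd open_rep_dom[OF F cd(1,2)]
    by (intro exI[of _ c] exI[of _ d] exI[of _ "rep_dom c d S F"]) (auto intro: rep_domI)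
qed

text \<open>Serves maps known only through local formulas, such as the lift along the Legendre
  map.\<close>

lemma smooth_mapI_cover:
  assumes A: "smooth_atlas A" and B: "smooth_atlas B"
    and loc: "\<And>x. x \<in> S \<Longrightarrow> \<exists>T. T \<subseteq> S \<and> x \<in> T \<and> smooth_map A B T F"
  shows "smooth_map A B S F"
proof (rule smooth_mapI_local[OF A B])
  show "openin (mtop A) S"
    by (subst openin_subopen) (meson loc smooth_mapD_openin)
  fix x assume "x \<in> S"
  from loc[OF this] obtain T where T: "T \<subseteq> S" "x \<in> T" "smooth_map A B T F" by blast
  from smooth_mapE[OF A T(3,2)] obtain c d where cd: "c \<in> A" "d \<in> B" "x \<in> fst c" "F x \<in> fst d" .
  then show "\<exists>c d N. c \<in> A \<and> d \<in> B \<and> x \<in> fst c \<and> open N \<and> snd c x \<in> N \<and>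
      (\<forall>u\<in>N. u \<in> snd c ` fst c \<longrightarrow> chart_inv c u \<in> S \<longrightarrow> F (chart_inv c u) \<in> fst d) \<and>
      smooth_on N (\<lambda>u. snd d (F (chart_inv c u)))"
    using T open_rep_dom[OF T(3) cd(1,2)] smooth_map_rep[OF T(3) cd(1,2)] rep_domI[of x T c F d]
    by (intro exI[of _ c] exI[of _ d] exI[of _ "rep_dom c d T F"]) (simp add: rep_dom_iff[OF A cd(1)] del: split_paired_Ex)
qed

lemma smooth_map_compose:
  assumes A: "smooth_atlas A" and B: "smooth_atlas B" and C: "smooth_atlas C"
    and F: "smooth_map A B S F" and G: "smooth_map B C T G" and ST: "\<And>x. x \<in> S \<Longrightarrow> F x \<in> T"
  shows "smooth_map A C S (\<lambda>x. G (F x))"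
proof (rule smooth_mapI_local[OF A C smooth_mapD_openin[OF F]])
  fix x assume x: "x \<in> S"
  from smooth_mapE[OF A F this] obtain c d where cd: "c \<in> A" "d \<in> B" "x \<in> fst c" "F x \<in> fst d" .
  from smooth_mapE[OF B G ST[OF x]] obtain e where e: "e \<in> C" "G (F x) \<in> fst e" by blast
  let ?N = "rep_dom c d S F \<inter> (\<lambda>u. snd d (F (chart_inv c u))) -` rep_dom d e T G"
  have N: "open ?N"
    by (intro continuous_open_preimage smooth_on_continuous smooth_map_rep[OF F cd(1,2)] open_rep_dom[OF F cd(1,2)]
        open_rep_dom[OF G cd(2) e(1)])
  have "smooth_on ?N (\<lambda>u. snd e (G (chart_inv d (snd d (F (chart_inv c u))))))"
    by (rule smooth_on_compose[OF N open_rep_dom[OF G cd(2) e(1)] smooth_map_rep[OF G cd(2) e(1)]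
          smooth_on_subset[OF smooth_map_rep[OF F cd(1,2)]]]) auto
  moreover have e1: "chart_inv d (snd d (F (chart_inv c u))) = F (chart_inv c u)" if "u \<in> rep_dom c d S F" for u
    using that by (auto simp: rep_dom_iff[OF A cd(1)] chart_inv_left[OF B cd(2)])
  ultimately have "smooth_on ?N (\<lambda>u. snd e (G (F (chart_inv c u))))"
    by (subst smooth_on_cong[OF N, where g = "\<lambda>u. snd e (G (chart_inv d (snd d (F (chart_inv c u)))))"]) auto
  moreover have "G (F (chart_inv c u)) \<in> fst e" if "u \<in> ?N" for u
    using that e1[of u] by (auto simp: rep_dom_iff[OF B cd(2)])
  moreover have "snd c x \<in> ?N"
    using x cd e ST[OF x] chart_inv_left[OF A cd(1,3)] by (auto intro!: rep_domI)
  ultimately show "\<exists>c d N. c \<in> A \<and> d \<in> C \<and> x \<in> fst c \<and> open N \<and> snd c x \<in> N \<and>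
      (\<forall>u\<in>N. u \<in> snd c ` fst c \<longrightarrow> chart_inv c u \<in> S \<longrightarrow> G (F (chart_inv c u)) \<in> fst d) \<and>
      smooth_on N (\<lambda>u. snd d (G (F (chart_inv c u))))"
    using cd e N by (intro exI[of _ c] exI[of _ e] exI[of _ ?N]) blast
qed

lemma smooth_map_ident:
  assumes A: "smooth_atlas A" and S: "openin (mtop A) S"
  shows "smooth_map A A S (\<lambda>x. x)"
proof (rule smooth_mapI_local[OF A A S])
  fix x assume "x \<in> S"
  then obtain c where c: "c \<in> A" "x \<in> fst c" using openin_mtop_subset[OF A S] by (meson carrierE subsetD)
  have "smooth_on (snd c ` fst c) (\<lambda>u. snd c (chart_inv c u))"
    using transition_smooth[OF A c(1) c(1)] by simp
  then show "\<exists>c d N. c \<in> A \<and> d \<in> A \<and> x \<in> fst c \<and> open N \<and> snd c x \<in> N \<and>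
      (\<forall>u\<in>N. u \<in> snd c ` fst c \<longrightarrow> chart_inv c u \<in> S \<longrightarrow> chart_inv c u \<in> fst d) \<and>
      smooth_on N (\<lambda>u. snd d (chart_inv c u))"
    using c atlas_open_dom[OF A c(1)] by (intro exI[of _ c] exI[of _ "snd c ` fst c"]) (auto simp: chart_inv_left[OF A])
qed

section \<open>Product manifolds\<close>

lemma fst_prod_chart [simp]: "fst (prod_chart c d) = fst c \<times> fst d"
  by (simp add: prod_chart_def)

lemma snd_prod_chart [simp]: "snd (prod_chart c d) p = (snd c (fst p), snd d (snd p))"
  by (simp add: prod_chart_def case_prod_unfold)

lemma prod_chart_in [simp]: "c \<in> A \<Longrightarrow> d \<in> B \<Longrightarrow> prod_chart c d \<in> prod_atlas A B"
  by (auto simp: prod_atlas_def)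

lemma prod_atlasE: "e \<in> prod_atlas A B \<Longrightarrow> (\<And>c d. c \<in> A \<Longrightarrow> d \<in> B \<Longrightarrow> e = prod_chart c d \<Longrightarrow> P) \<Longrightarrow> P"
  by (auto simp: prod_atlas_def)

lemma prod_chart_image: "snd (prod_chart c d) ` (S \<times> T) = snd c ` S \<times> snd d ` T"
  by (auto simp: prod_chart_def)

lemma carrier_prod_atlas [simp]: "carrier (prod_atlas A B) = carrier A \<times> carrier B"
  by (fastforce simp: carrier_def prod_atlas_def)

lemma chart_inv_prod:
  assumes "smooth_atlas A" "smooth_atlas B" "c \<in> A" "d \<in> B" "u \<in> snd c ` fst c" "v \<in> snd d ` fst d"
  shows "chart_inv (prod_chart c d) (u, v) = (chart_inv c u, chart_inv d v)"
proof -
  have "inj_on (snd (prod_chart c d)) (fst (prod_chart c d))"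
    using atlas_inj[OF assms(1,3)] atlas_inj[OF assms(2,4)] by (auto simp: inj_on_def)
  then have "inv_into (fst (prod_chart c d)) (snd (prod_chart c d)) (snd (prod_chart c d) (chart_inv c u, chart_inv d v)) =
      (chart_inv c u, chart_inv d v)"
    by (rule inv_into_f_f) (simp add: assms chart_inv_mem)
  then show ?thesis using assms by (simp add: chart_inv_def[of "prod_chart c d"] chart_inv_right)
qed

lemma smooth_atlas_prod:
  assumes A: "smooth_atlas A" and B: "smooth_atlas B"
  shows "smooth_atlas (prod_atlas A B)"
  unfolding smooth_atlas_def
proof (intro conjI ballI)
  fix e assume "e \<in> prod_atlas A B"
  then obtain c d where e: "c \<in> A" "d \<in> B" "e = prod_chart c d" by (rule prod_atlasE)
  then show "inj_on (snd e) (fst e)"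
    using atlas_inj[OF A e(1)] atlas_inj[OF B e(2)] by (auto simp: inj_on_def)
  fix e' assume "e' \<in> prod_atlas A B"
  then obtain c' d' where e': "c' \<in> A" "d' \<in> B" "e' = prod_chart c' d'" by (rule prod_atlasE)
  have eq: "snd e ` (fst e \<inter> fst e') = snd c ` (fst c \<inter> fst c') \<times> snd d ` (fst d \<inter> fst d')"
    unfolding e(3) e'(3) fst_prod_chart Times_Int_Times prod_chart_image ..
  let ?S1 = "snd c ` (fst c \<inter> fst c')" and ?S2 = "snd d ` (fst d \<inter> fst d')"
  have op: "open ?S1" "open ?S2" using atlas_open[OF A e(1) e'(1)] atlas_open[OF B e(2) e'(2)] by auto
  then show o: "open (snd e ` (fst e \<inter> fst e'))" unfolding eq by (rule open_Times)
  have o': "open (?S1 \<times> ?S2)" by (intro open_Times op)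
  have "smooth_on (?S1 \<times> ?S2) (\<lambda>p. (snd c' (chart_inv c (fst p)), snd d' (chart_inv d (snd p))))"
    by (intro smooth_on_Pair o' smooth_on_compose[OF o' op(1) transition_smooth[OF A e(1) e'(1)]]
        smooth_on_compose[OF o' op(2) transition_smooth[OF B e(2) e'(2)]] smooth_on_fst smooth_on_snd smooth_on_ident) auto
  moreover have "(snd e' \<circ> chart_inv e) p = (snd c' (chart_inv c (fst p)), snd d' (chart_inv d (snd p)))"
    if "p \<in> ?S1 \<times> ?S2" for p
    using that chart_inv_prod[OF A B e(1,2), of "fst p" "snd p"] unfolding e(3) e'(3) by auto
  ultimately show "smooth_on (snd e ` (fst e \<inter> fst e')) (snd e' \<circ> chart_inv e)"
    unfolding eq using smooth_on_cong[OF o'] by (metis (no_types, lifting))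
qed

lemma smooth_map_Pair:
  assumes A: "smooth_atlas A" and B: "smooth_atlas B" and C: "smooth_atlas C"
    and F: "smooth_map C A S F" and G: "smooth_map C B S G"
  shows "smooth_map C (prod_atlas A B) S (\<lambda>x. (F x, G x))"
proof (rule smooth_mapI_local[OF C smooth_atlas_prod[OF A B] smooth_mapD_openin[OF F]])
  fix x assume x: "x \<in> S"
  from smooth_mapE[OF C F this] obtain c d where cd: "c \<in> C" "d \<in> A" "x \<in> fst c" "F x \<in> fst d" .
  from smooth_mapE[OF C G x] obtain e where e: "e \<in> B" "G x \<in> fst e" by blast
  let ?N = "rep_dom c d S F \<inter> rep_dom c e S G"
  have N: "open ?N" using open_rep_dom[OF F cd(1,2)] open_rep_dom[OF G cd(1) e(1)] by auto
  have "smooth_on ?N (\<lambda>u. (snd d (F (chart_inv c u)), snd e (G (chart_inv c u))))"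
    by (intro smooth_on_Pair N smooth_on_subset[OF smooth_map_rep[OF F cd(1,2)]]
        smooth_on_subset[OF smooth_map_rep[OF G cd(1) e(1)]]) auto
  then show "\<exists>c d N. c \<in> C \<and> d \<in> prod_atlas A B \<and> x \<in> fst c \<and> open N \<and> snd c x \<in> N \<and>
      (\<forall>u\<in>N. u \<in> snd c ` fst c \<longrightarrow> chart_inv c u \<in> S \<longrightarrow> (F (chart_inv c u), G (chart_inv c u)) \<in> fst d) \<and>
      smooth_on N (\<lambda>u. snd d (F (chart_inv c u), G (chart_inv c u)))"
    using cd e N x
    by (intro exI[of _ c] exI[of _ "prod_chart d e"] exI[of _ ?N])
      (auto simp: rep_dom_iff[OF C cd(1)] chart_inv_left[OF C cd(1)])
qed

lemma smooth_map_fst_snd: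
  assumes A: "smooth_atlas A" and B: "smooth_atlas B"
  shows "smooth_map (prod_atlas A B) A (carrier (prod_atlas A B)) fst"
    and "smooth_map (prod_atlas A B) B (carrier (prod_atlas A B)) snd"
proof -
  note AB = smooth_atlas_prod[OF A B]
  have *: "\<exists>c d. c \<in> A \<and> d \<in> B \<and> x \<in> fst (prod_chart c d) \<and>
      open (snd (prod_chart c d) ` fst (prod_chart c d)) \<and>
      smooth_on (snd (prod_chart c d) ` fst (prod_chart c d)) (\<lambda>u. snd c (fst (chart_inv (prod_chart c d) u))) \<and>
      smooth_on (snd (prod_chart c d) ` fst (prod_chart c d)) (\<lambda>u. snd d (snd (chart_inv (prod_chart c d) u)))"
    if "x \<in> carrier (prod_atlas A B)" for x
  proof -
    from that obtain c d where cd: "c \<in> A" "d \<in> B" "fst x \<in> fst c" "snd x \<in> fst d"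
      by (auto elim!: carrierE)
    let ?e = "prod_chart c d"
    have e: "?e \<in> prod_atlas A B" using cd by simp
    have o: "open (snd ?e ` fst ?e)" by (rule atlas_open_dom[OF AB e])
    have "u = snd ?e (chart_inv ?e u)" if "u \<in> snd ?e ` fst ?e" for u
      by (rule chart_inv_right[OF that, symmetric])
    then have "fst u = snd c (fst (chart_inv ?e u))" "snd u = snd d (snd (chart_inv ?e u))"
      if "u \<in> snd ?e ` fst ?e" for u using that by (metis fst_conv snd_conv snd_prod_chart)+
    then have "smooth_on (snd ?e ` fst ?e) (\<lambda>u. snd c (fst (chart_inv ?e u)))"
      "smooth_on (snd ?e ` fst ?e) (\<lambda>u. snd d (snd (chart_inv ?e u)))"
      using smooth_on_fst[OF o smooth_on_ident[OF o]] smooth_on_snd[OF o smooth_on_ident[OF o]]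
        smooth_on_cong[OF o, of fst "\<lambda>u. snd c (fst (chart_inv ?e u))"]
        smooth_on_cong[OF o, of snd "\<lambda>u. snd d (snd (chart_inv ?e u))"] by auto
    then show ?thesis using cd o by (intro exI[of _ c] exI[of _ d]) (auto simp: mem_Times_iff)
  qed
  show "smooth_map (prod_atlas A B) A (carrier (prod_atlas A B)) fst"
  proof (rule smooth_mapI_local[OF AB A openin_carrier[OF AB]])
    fix x :: "'a \<times> 'c" assume "x \<in> carrier (prod_atlas A B)"
    from *[OF this] obtain c d where cd: "c \<in> A" "d \<in> B" "x \<in> fst (prod_chart c d)"
      "open (snd (prod_chart c d) ` fst (prod_chart c d))"
      "smooth_on (snd (prod_chart c d) ` fst (prod_chart c d)) (\<lambda>u. snd c (fst (chart_inv (prod_chart c d) u)))" by blast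
    then show "\<exists>e d N. e \<in> prod_atlas A B \<and> d \<in> A \<and> x \<in> fst e \<and> open N \<and> snd e x \<in> N \<and>
      (\<forall>u\<in>N. u \<in> snd e ` fst e \<longrightarrow> chart_inv e u \<in> carrier (prod_atlas A B) \<longrightarrow> fst (chart_inv e u) \<in> fst d) \<and>
      smooth_on N (\<lambda>u. snd d (fst (chart_inv e u)))"
      using chart_inv_mem[of _ "prod_chart c d"]
      by (intro exI[of _ "prod_chart c d"] exI[of _ c] exI[of _ "snd (prod_chart c d) ` fst (prod_chart c d)"])
        (fastforce simp del: snd_prod_chart)
  qed
  show "smooth_map (prod_atlas A B) B (carrier (prod_atlas A B)) snd"
  proof (rule smooth_mapI_local[OF AB B openin_carrier[OF AB]])
    fix x :: "'a \<times> 'c" assume "x \<in> carrier (prod_atlas A B)"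
    from *[OF this] obtain c d where cd: "c \<in> A" "d \<in> B" "x \<in> fst (prod_chart c d)"
      "open (snd (prod_chart c d) ` fst (prod_chart c d))"
      "smooth_on (snd (prod_chart c d) ` fst (prod_chart c d)) (\<lambda>u. snd d (snd (chart_inv (prod_chart c d) u)))" by blast
    then show "\<exists>e d N. e \<in> prod_atlas A B \<and> d \<in> B \<and> x \<in> fst e \<and> open N \<and> snd e x \<in> N \<and>
      (\<forall>u\<in>N. u \<in> snd e ` fst e \<longrightarrow> chart_inv e u \<in> carrier (prod_atlas A B) \<longrightarrow> snd (chart_inv e u) \<in> fst d) \<and>
      smooth_on N (\<lambda>u. snd d (snd (chart_inv e u)))"
      using chart_inv_mem[of _ "prod_chart c d"]
      by (intro exI[of _ "prod_chart c d"] exI[of _ d] exI[of _ "snd (prod_chart c d) ` fst (prod_chart c d)"])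
        (fastforce simp del: snd_prod_chart)
  qed
qed

lemma smooth_map_fst:
  assumes A: "smooth_atlas A" and B: "smooth_atlas B" and C: "smooth_atlas C"
    and F: "smooth_map C (prod_atlas A B) S F"
  shows "smooth_map C A S (\<lambda>x. fst (F x))"
  using smooth_map_compose[OF C smooth_atlas_prod[OF A B] A F smooth_map_fst_snd(1)[OF A B]]
    smooth_mapD_carrier[OF F] by auto

lemma smooth_map_snd:
  assumes A: "smooth_atlas A" and B: "smooth_atlas B" and C: "smooth_atlas C"
    and F: "smooth_map C (prod_atlas A B) S F"
  shows "smooth_map C B S (\<lambda>x. snd (F x))"
  using smooth_map_compose[OF C smooth_atlas_prod[OF A B] B F smooth_map_fst_snd(2)[OF A B]]
    smooth_mapD_carrier[OF F] by auto

text \<open>Boxes form a basis of the product topology. This will produce the neighbourhoods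
  \<open>W\<close> and \<open>W'\<close> of an implicit step inside the image of
  \<open>R\<close>.\<close>

lemma openin_prod_box:
  assumes A: "smooth_atlas A" and B: "smooth_atlas B" and S: "openin (mtop (prod_atlas A B)) S" "(x, y) \<in> S"
  obtains V W where "openin (mtop A) V" "openin (mtop B) W" "x \<in> V" "y \<in> W" "V \<times> W \<subseteq> S"
proof -
  note AB = smooth_atlas_prod[OF A B]
  have "(x, y) \<in> carrier (prod_atlas A B)" using S openin_mtop_subset[OF AB] by blast
  then obtain c d where cd: "c \<in> A" "d \<in> B" "x \<in> fst c" "y \<in> fst d" by (auto elim!: carrierE)
  let ?e = "prod_chart c d"
  have e: "?e \<in> prod_atlas A B" using cd by simp
  have "open (snd ?e ` (S \<inter> fst ?e))" by (rule openin_mtop_image[OF AB S(1) e])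
  moreover have "(snd c x, snd d y) \<in> snd ?e ` (S \<inter> fst ?e)" using S(2) cd by (auto simp: image_iff intro!: bexI[of _ "(x, y)"])
  ultimately obtain P Q where PQ: "open P" "open Q" "(snd c x, snd d y) \<in> P \<times> Q" "P \<times> Q \<subseteq> snd ?e ` (S \<inter> fst ?e)"
    by (rule open_prod_elim)
  show ?thesis
  proof (rule that)
    show "openin (mtop A) {x \<in> fst c. snd c x \<in> P}" by (rule openin_chart_preimage[OF A cd(1) PQ(1)])
    show "openin (mtop B) {x \<in> fst d. snd d x \<in> Q}" by (rule openin_chart_preimage[OF B cd(2) PQ(2)])
    show "{x \<in> fst c. snd c x \<in> P} \<times> {x \<in> fst d. snd d x \<in> Q} \<subseteq> S"
    proof clarify
      fix a b assume ab: "a \<in> fst c" "snd c a \<in> P" "b \<in> fst d" "snd d b \<in> Q"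
      then have "snd ?e (a, b) \<in> snd ?e ` (S \<inter> fst ?e)" using PQ(4) by auto
      then have "chart_inv ?e (snd ?e (a, b)) \<in> S" using chart_image_iff(1)[OF AB e] by blast
      then show "(a, b) \<in> S" using chart_inv_left[OF AB e, of "(a, b)"] ab by simp
    qed
  qed (use cd PQ in auto)
qed

section \<open>Tangent and cotangent bundles in charts\<close>

abbreviation rep :: "('m, 'e) chart \<Rightarrow> ('k, 'f) chart \<Rightarrow> ('m \<Rightarrow> 'k) \<Rightarrow> 'e \<Rightarrow> 'f" where
  "rep c d F \<equiv> \<lambda>u. snd d (F (chart_inv c u))"

abbreviation drep :: "('m, 'e::euclidean_space) chart \<Rightarrow> ('k, 'f::euclidean_space) chart \<Rightarrow> ('m \<Rightarrow> 'k) \<Rightarrow> 'm \<Rightarrow> 'e \<Rightarrow> 'f" where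
  "drep c d F x \<equiv> fderiv (rep c d F) (snd c x)"

abbreviation chart_of :: "('m, 'e) atlas \<Rightarrow> ('m, 'e) chart \<Rightarrow> 'm \<Rightarrow> bool" where
  "chart_of A c x \<equiv> c \<in> A \<and> x \<in> fst c"

lemma charts_at_iff: "c \<in> charts_at A x \<longleftrightarrow> chart_of A c x"
  by (simp add: charts_at_def)

lemma rep_has_derivative:
  assumes "smooth_map A B S F" "x \<in> S" "chart_of A c x" "chart_of B d (F x)"
  shows "(rep c d F has_derivative drep c d F x) (at (snd c x))"
  using assms by (intro smooth_on_has_derivative[OF smooth_map_rep]) (auto intro: rep_domI)

lemma drep_linear:
  assumes "smooth_map A B S F" "x \<in> S" "chart_of A c x" "chart_of B d (F x)"
  shows "linear (drep c d F x)"
  by (rule has_derivative_linear[OF rep_has_derivative[OF assms]])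

lemma drep_chain:
  assumes A: "smooth_atlas A" and B: "smooth_atlas B"
    and F: "smooth_map A B S F" and G: "smooth_map B C T G" and x: "x \<in> S" "F x \<in> T"
    and c: "chart_of A c x" and d: "chart_of B d (F x)" and e: "chart_of C e (G (F x))"
  shows "drep c e (\<lambda>x. G (F x)) x v = drep d e G (F x) (drep c d F x v)"
proof -
  have o: "open (rep_dom c d S F)" by (rule open_rep_dom[OF F]) (use c d in auto)
  have i: "snd c x \<in> rep_dom c d S F" using c d x by (auto intro: rep_domI)
  have "drep c e (\<lambda>x. G (F x)) x = fderiv (\<lambda>u. rep d e G (rep c d F u)) (snd c x)"
    by (rule fderiv_cong[OF o i]) (use c d in \<open>simp add: rep_dom_iff[OF A] chart_inv_left[OF B]\<close>)
  moreover have "fderiv (\<lambda>u. rep d e G (rep c d F u)) (snd c x) v =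
      fderiv (rep d e G) (rep c d F (snd c x)) (drep c d F x v)"
    by (rule fderiv_compose[OF smooth_map_rep[OF F] i smooth_map_rep[OF G]])
      (use c d e x in \<open>auto simp: chart_inv_left[OF A] intro: rep_domI\<close>)
  ultimately show ?thesis using c by (simp add: chart_inv_left[OF A])
qed

lemma trans_chain:
  assumes A: "smooth_atlas A" and "chart_of A c x" "chart_of A d x" "chart_of A e x"
  shows "drep d e (\<lambda>x. x) x (drep c d (\<lambda>x. x) x v) = drep c e (\<lambda>x. x) x v"
  using drep_chain[OF A A smooth_map_ident[OF A openin_carrier[OF A]] smooth_map_ident[OF A openin_carrier[OF A]],
      of x c d e v] assms carrierI[of c A x] by simp

lemma trans_self:
  assumes A: "smooth_atlas A" and c: "chart_of A c x"
  shows "drep c c (\<lambda>x. x) x v = v"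
proof -
  have "drep c c (\<lambda>x. x) x = fderiv (\<lambda>u. u) (snd c x)"
    by (rule fderiv_cong[OF atlas_open_dom[OF A]]) (use c in \<open>auto simp: chart_inv_right\<close>)
  then show ?thesis by simp
qed

lemma trans_linear:
  assumes A: "smooth_atlas A" and "chart_of A c x" "chart_of A d x"
  shows "linear (drep c d (\<lambda>x. x) x)"
  by (rule drep_linear[OF smooth_map_ident[OF A openin_carrier[OF A]]]) (use assms in \<open>auto intro: carrierI\<close>)

text \<open>Both sides are the derivative of the mixed representative from \<open>c\<close> to
  \<open>d'\<close>, computed through either of the two intermediate charts. Chart independence of
  notions written with \<open>chart_at\<close> rests on this.\<close>

lemma drep_change:
  assumes A: "smooth_atlas A" and B: "smooth_atlas B"
    and F: "smooth_map A B S F" and x: "x \<in> S"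
    and c: "chart_of A c x" "chart_of A c' x" and d: "chart_of B d (F x)" "chart_of B d' (F x)"
  shows "drep c' d' F x (drep c c' (\<lambda>x. x) x v) = drep d d' (\<lambda>x. x) (F x) (drep c d F x v)"
proof -
  have S: "openin (mtop A) S" by (rule smooth_mapD_openin[OF F])
  have "drep c d' F x v = drep c' d' F x (drep c c' (\<lambda>x. x) x v)"
    by (rule drep_chain[OF A A smooth_map_ident[OF A S] F]) (use x c d in auto)
  moreover have "drep c d' F x v = drep d d' (\<lambda>x. x) (F x) (drep c d F x v)"
    by (rule drep_chain[OF A B F smooth_map_ident[OF B openin_carrier[OF B]]])
      (use x c d in \<open>auto intro: carrierI\<close>)
  ultimately show ?thesis by simp
qed

section \<open>The tangent bundle as a manifold\<close>

lemma tspace_iff: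
  "\<xi> \<in> tspace A x \<longleftrightarrow>
     (\<forall>c d. chart_of A c x \<longrightarrow> chart_of A d x \<longrightarrow> \<xi> d = drep c d (\<lambda>x. x) x (\<xi> c)) \<and>
     (\<forall>c. \<not> chart_of A c x \<longrightarrow> \<xi> c = 0)"
  unfolding tspace_def Ball_def charts_at_iff o_def mem_Collect_eq by blast

lemma tspace_trans:
  "\<xi> \<in> tspace A x \<Longrightarrow> chart_of A c x \<Longrightarrow> chart_of A d x \<Longrightarrow> \<xi> d = drep c d (\<lambda>x. x) x (\<xi> c)"
  unfolding tspace_iff by blast

lemma tspace_off: "\<xi> \<in> tspace A x \<Longrightarrow> \<not> chart_of A c x \<Longrightarrow> \<xi> c = 0"
  unfolding tspace_iff by blast

lemma tspace_eqI:
  assumes "\<xi> \<in> tspace A x" "\<eta> \<in> tspace A x" "chart_of A c x" "\<xi> c = \<eta> c"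
  shows "\<xi> = \<eta>"
proof
  fix d
  show "\<xi> d = \<eta> d"
    using tspace_trans[OF assms(1,3)] tspace_trans[OF assms(2,3)] tspace_off[OF assms(1)] tspace_off[OF assms(2)] assms(4)
    by (cases "chart_of A d x") auto
qed

lemma tvec_of_apply: "tvec_of A c x u d = (if chart_of A d x then drep c d (\<lambda>x. x) x u else 0)"
  by (simp add: tvec_of_def charts_at_iff o_def)

lemma tvec_of_self [simp]: "smooth_atlas A \<Longrightarrow> chart_of A c x \<Longrightarrow> tvec_of A c x u c = u"
  by (simp add: tvec_of_apply trans_self)

lemma tvec_of_tspace [simp]: "smooth_atlas A \<Longrightarrow> chart_of A c x \<Longrightarrow> tvec_of A c x u \<in> tspace A x"
  unfolding tspace_iff by (auto simp: tvec_of_apply trans_chain)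

lemma tspace_lincomb:
  assumes "smooth_atlas A" "\<xi> \<in> tspace A x" "\<eta> \<in> tspace A x"
  shows "(\<lambda>c. a *\<^sub>R \<xi> c + b *\<^sub>R \<eta> c) \<in> tspace A x"
  unfolding tspace_iff
proof (intro conjI allI impI)
  fix c d assume cd: "chart_of A c x" "chart_of A d x"
  show "a *\<^sub>R \<xi> d + b *\<^sub>R \<eta> d = drep c d (\<lambda>x. x) x (a *\<^sub>R \<xi> c + b *\<^sub>R \<eta> c)"
    using tspace_trans[OF assms(2) cd] tspace_trans[OF assms(3) cd] trans_linear[OF assms(1) cd]
    by (simp add: linear_add linear_cmul)
qed (simp add: tspace_off[OF assms(2)] tspace_off[OF assms(3)])

lemma tspace_zero: "smooth_atlas A \<Longrightarrow> (\<lambda>_. 0) \<in> tspace A x"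
  unfolding tspace_iff by (simp add: linear_0[OF trans_linear])

lemma tspace_scale:
  assumes "smooth_atlas A" "\<xi> \<in> tspace A x"
  shows "(\<lambda>c. a *\<^sub>R \<xi> c) \<in> tspace A x"
  using tspace_lincomb[OF assms assms(2), of a 0] by simp

lemma tvec_of_zero: "smooth_atlas A \<Longrightarrow> chart_of A c x \<Longrightarrow> tvec_of A c x 0 = (\<lambda>_. 0)"
  by (rule tspace_eqI[of _ A x _ c]) (auto intro: tspace_zero)

lemma chart_inv_eqI: "inj_on (snd c) (fst c) \<Longrightarrow> x \<in> fst c \<Longrightarrow> snd c x = u \<Longrightarrow> chart_inv c u = x"
  by (auto simp: chart_inv_def)

lemma tcarrier_iff: "w \<in> tcarrier A \<longleftrightarrow> fst w \<in> carrier A \<and> snd w \<in> tspace A (fst w)"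
  by (cases w) (auto simp: tcarrier_def)

lemma fst_tchart: "w \<in> fst (tchart A c) \<longleftrightarrow> w \<in> tcarrier A \<and> fst w \<in> fst c"
  by (simp add: tchart_def)

lemma snd_tchart: "snd (tchart A c) w = (snd c (fst w), snd w c)"
  by (simp add: tchart_def case_prod_unfold)

lemma tchart_image:
  assumes "smooth_atlas A" "c \<in> A"
  shows "snd (tchart A c) ` {w \<in> fst (tchart A c). fst w \<in> S} = snd c ` (fst c \<inter> S) \<times> UNIV"
proof -
  have "(snd c x, u) \<in> snd (tchart A c) ` {w \<in> fst (tchart A c). fst w \<in> S}" if "x \<in> fst c" "x \<in> S" for x u
    by (rule image_eqI[of _ _ "(x, tvec_of A c x u)"])
      (use assms that in \<open>auto simp: snd_tchart fst_tchart tcarrier_iff intro: carrierI\<close>)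
  then show ?thesis by (auto simp: snd_tchart fst_tchart)
qed

lemma tchart_image_dom:
  "smooth_atlas A \<Longrightarrow> c \<in> A \<Longrightarrow> snd (tchart A c) ` fst (tchart A c) = snd c ` fst c \<times> UNIV"
  using tchart_image[of A c UNIV] by simp

lemma tchart_inj:
  assumes "smooth_atlas A" "c \<in> A"
  shows "inj_on (snd (tchart A c)) (fst (tchart A c))"
proof (rule inj_onI)
  fix w w' assume w: "w \<in> fst (tchart A c)" "w' \<in> fst (tchart A c)" "snd (tchart A c) w = snd (tchart A c) w'"
  then have "fst w = fst w'" using inj_onD[OF atlas_inj[OF assms]] by (auto simp: snd_tchart fst_tchart)
  moreover have "snd w = snd w'"
    by (rule tspace_eqI[of _ A "fst w" _ c])
      (use w assms calculation in \<open>auto simp: snd_tchart fst_tchart tcarrier_iff\<close>)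
  ultimately show "w = w'" by (simp add: prod_eq_iff)
qed

lemma chart_inv_tchart:
  assumes "smooth_atlas A" "c \<in> A" "q \<in> snd c ` fst c"
  shows "chart_inv (tchart A c) (q, u) = (chart_inv c q, tvec_of A c (chart_inv c q) u)"
  by (rule chart_inv_eqI[OF tchart_inj[OF assms(1,2)]])
    (use assms chart_inv_mem[OF assms(3)] in \<open>auto simp: fst_tchart snd_tchart tcarrier_iff chart_inv_right intro: carrierI\<close>)

lemma carrier_tan_atlas [simp]: "carrier (tan_atlas A) = tcarrier A"
  by (auto simp: carrier_def tan_atlas_def fst_tchart tcarrier_iff)

lemma tan_atlasE: "e \<in> tan_atlas A \<Longrightarrow> (\<And>c. c \<in> A \<Longrightarrow> e = tchart A c \<Longrightarrow> P) \<Longrightarrow> P"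
  by (auto simp: tan_atlas_def)

lemma tchart_in [simp]: "c \<in> A \<Longrightarrow> tchart A c \<in> tan_atlas A"
  by (simp add: tan_atlas_def)

lemma tchart_Int:
  "fst (tchart A c) \<inter> fst (tchart A d) = {w \<in> fst (tchart A c). fst w \<in> fst d}"
  by (auto simp: fst_tchart)

lemma tchart_trans:
  assumes "smooth_atlas A" "c \<in> A" "d \<in> A" "q \<in> snd c ` (fst c \<inter> fst d)"
  shows "snd (tchart A d) (chart_inv (tchart A c) (q, u)) = (rep c d (\<lambda>x. x) q, fderiv (rep c d (\<lambda>x. x)) q u)"
proof -
  have q: "q \<in> snd c ` fst c" "chart_inv c q \<in> fst d" using chart_image_iff(2)[OF assms(1,2)] assms(4) by blast+
  then show ?thesis using assms
    by (simp add: chart_inv_tchart snd_tchart tvec_of_apply chart_inv_right)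
qed

text \<open>With \<tau> a transition map of \<open>A\<close>, the transition map of the bundle is
  \<open>(q, u) \<mapsto> (\<tau> q, D\<tau>(q) u)\<close>, smooth by joint smoothness of a
  derivative in point and direction.\<close>

lemma smooth_atlas_tan:
  assumes A: "smooth_atlas A"
  shows "smooth_atlas (tan_atlas A)"
  unfolding smooth_atlas_def
proof (intro conjI ballI)
  fix e assume "e \<in> tan_atlas A"
  then obtain c where c: "c \<in> A" "e = tchart A c" by (rule tan_atlasE)
  then show "inj_on (snd e) (fst e)" using tchart_inj[OF A] by simp
  fix e' assume "e' \<in> tan_atlas A"
  then obtain d where d: "d \<in> A" "e' = tchart A d" by (rule tan_atlasE)
  let ?S = "snd c ` (fst c \<inter> fst d)"
  have eq: "snd e ` (fst e \<inter> fst e') = ?S \<times> UNIV"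
    unfolding c(2) d(2) tchart_Int by (rule tchart_image[OF A c(1)])
  have o: "open ?S" by (rule atlas_open[OF A c(1) d(1)])
  have o': "open (?S \<times> (UNIV :: 'b set))" by (intro open_Times o open_UNIV)
  show "open (snd e ` (fst e \<inter> fst e'))" unfolding eq by (rule o')
  note tr = transition_smooth[OF A c(1) d(1)]
  have "smooth_on (?S \<times> UNIV) (\<lambda>p. (rep c d (\<lambda>x. x) (fst p), fderiv (rep c d (\<lambda>x. x)) (fst p) (snd p)))"
    by (intro smooth_on_Pair o' smooth_on_compose[OF o' o tr] smooth_on_fderiv_apply[OF o' o tr]
        smooth_on_fst smooth_on_snd smooth_on_ident) auto
  then show "smooth_on (snd e ` (fst e \<inter> fst e')) (snd e' \<circ> chart_inv e)"
    unfolding eq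
    by (subst smooth_on_cong[OF o', where g = "\<lambda>p. (rep c d (\<lambda>x. x) (fst p), fderiv (rep c d (\<lambda>x. x)) (fst p) (snd p))"])
      (auto simp: c(2) d(2) tchart_trans[OF A c(1) d(1)])
qed

section \<open>The cotangent bundle as a manifold\<close>

text \<open>The inverse of the fibre part of \<open>cchart\<close>: the covector at \<open>x\<close>
  whose components in the chart \<open>c\<close> are \<open>p\<close>.\<close>

definition covec_of :: "('m, 'e::euclidean_space) atlas \<Rightarrow> ('m, 'e) chart \<Rightarrow> 'm \<Rightarrow> 'e \<Rightarrow> ('m, 'e) ctvec" where
  "covec_of A c x p = (\<lambda>\<xi>\<in>tspace A x. p \<bullet> \<xi> c)"

definition momentum :: "('m, 'e::euclidean_space) atlas \<Rightarrow> ('m, 'e) chart \<Rightarrow> ('m, 'e) ctbundle \<Rightarrow> 'e" where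
  "momentum A c w = (\<Sum>b\<in>Basis. snd w (tvec_of A c (fst w) b) *\<^sub>R b)"

lemma fst_cchart: "w \<in> fst (cchart A c) \<longleftrightarrow> w \<in> ccarrier A \<and> fst w \<in> fst c"
  by (simp add: cchart_def)

lemma snd_cchart: "snd (cchart A c) w = (snd c (fst w), momentum A c w)"
  by (simp add: cchart_def case_prod_unfold momentum_def)

lemma ccarrier_iff: "w \<in> ccarrier A \<longleftrightarrow> fst w \<in> carrier A \<and> snd w \<in> cspace A (fst w)"
  by (cases w) (auto simp: ccarrier_def)

lemma covec_of_cspace:
  assumes "smooth_atlas A"
  shows "covec_of A c x p \<in> cspace A x"
  unfolding cspace_def covec_of_def using tspace_lincomb[OF assms]
  by (auto simp: inner_add_right)

lemma momentum_covec_of [simp]: "smooth_atlas A \<Longrightarrow> chart_of A c x \<Longrightarrow> momentum A c (x, covec_of A c x p) = p"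
  by (simp add: momentum_def covec_of_def euclidean_representation)

lemma cspace_lincomb:
  "\<mu> \<in> cspace A x \<Longrightarrow> \<xi> \<in> tspace A x \<Longrightarrow> \<eta> \<in> tspace A x \<Longrightarrow>
    \<mu> (\<lambda>c. a *\<^sub>R \<xi> c + b *\<^sub>R \<eta> c) = a * \<mu> \<xi> + b * \<mu> \<eta>"
  by (simp add: cspace_def)

text \<open>Linearity of \<open>\<mu>\<close> is available only on \<open>tspace\<close>, so
  membership of the partial sums is carried along in the induction.\<close>

lemma cspace_sum:
  assumes A: "smooth_atlas A" and \<mu>: "\<mu> \<in> cspace A x" and \<xi>: "\<And>i. i \<in> I \<Longrightarrow> \<xi> i \<in> tspace A x" and I: "finite I"
  shows "\<mu> (\<lambda>c. \<Sum>i\<in>I. a i *\<^sub>R \<xi> i c) = (\<Sum>i\<in>I. a i * \<mu> (\<xi> i)) \<and> (\<lambda>c. \<Sum>i\<in>I. a i *\<^sub>R \<xi> i c) \<in> tspace A x"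
  using I \<xi>
proof (induction I rule: finite_induct)
  case empty
  have "\<mu> (\<lambda>c. 0 *\<^sub>R 0 + 0 *\<^sub>R 0) = 0 * \<mu> (\<lambda>_. 0) + 0 * \<mu> (\<lambda>_. 0)"
    by (rule cspace_lincomb[OF \<mu> tspace_zero[OF A] tspace_zero[OF A]])
  then show ?case using tspace_zero[OF A] by simp
next
  case (insert i I)
  then have IH: "\<mu> (\<lambda>c. \<Sum>i\<in>I. a i *\<^sub>R \<xi> i c) = (\<Sum>i\<in>I. a i * \<mu> (\<xi> i))"
    "(\<lambda>c. \<Sum>i\<in>I. a i *\<^sub>R \<xi> i c) \<in> tspace A x" "\<xi> i \<in> tspace A x" by auto
  have "\<mu> (\<lambda>c. a i *\<^sub>R \<xi> i c + 1 *\<^sub>R (\<Sum>i\<in>I. a i *\<^sub>R \<xi> i c)) =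
      a i * \<mu> (\<xi> i) + 1 * \<mu> (\<lambda>c. \<Sum>i\<in>I. a i *\<^sub>R \<xi> i c)"
    by (rule cspace_lincomb[OF \<mu> IH(3,2)])
  then show ?case using insert.hyps IH tspace_lincomb[OF A IH(3,2), of "a i" 1] by simp
qed

text \<open>The coordinate vectors \<open>tvec_of A c (fst w) b\<close> span the tangent space, and
  \<open>momentum\<close> collects the values of the covector on them.\<close>

lemma cspace_momentum:
  assumes A: "smooth_atlas A" and w: "w \<in> ccarrier A" and c: "chart_of A c (fst w)" and \<xi>: "\<xi> \<in> tspace A (fst w)"
  shows "snd w \<xi> = momentum A c w \<bullet> \<xi> c"
proof -
  have *: "snd w (\<lambda>d. \<Sum>b\<in>Basis. (\<xi> c \<bullet> b) *\<^sub>R tvec_of A c (fst w) b d) = (\<Sum>b\<in>Basis. (\<xi> c \<bullet> b) * snd w (tvec_of A c (fst w) b)) \<and>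
    (\<lambda>d. \<Sum>b\<in>Basis. (\<xi> c \<bullet> b) *\<^sub>R tvec_of A c (fst w) b d) \<in> tspace A (fst w)"
    by (rule cspace_sum[OF A]) (use A w c in \<open>auto simp: ccarrier_iff\<close>)
  have "(\<lambda>d. \<Sum>b\<in>Basis. (\<xi> c \<bullet> b) *\<^sub>R tvec_of A c (fst w) b d) = \<xi>"
    by (rule tspace_eqI[OF conjunct2[OF *] \<xi> c]) (use A c in \<open>simp add: euclidean_representation\<close>)
  with * have "snd w \<xi> = (\<Sum>b\<in>Basis. (\<xi> c \<bullet> b) * snd w (tvec_of A c (fst w) b))" by simp
  also have "\<dots> = \<xi> c \<bullet> momentum A c w" by (simp add: momentum_def inner_sum_right mult.commute)
  finally show ?thesis by (simp add: inner_commute)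
qed

text \<open>The pairing of a covector with a vector is the same number in both charts. In this form
  the change of momenta avoids the inverse transposed Jacobian.\<close>

lemma momentum_change:
  assumes A: "smooth_atlas A" and w: "w \<in> ccarrier A" and c: "chart_of A c (fst w)" and d: "chart_of A d (fst w)"
  shows "momentum A d w \<bullet> drep c d (\<lambda>x. x) (fst w) a = momentum A c w \<bullet> a"
  using cspace_momentum[OF A w c, of "tvec_of A c (fst w) a"] cspace_momentum[OF A w d, of "tvec_of A c (fst w) a"] A c d
  by (simp add: tvec_of_apply trans_self)

lemma ctbundle_eqI:
  assumes A: "smooth_atlas A" and w: "w \<in> ccarrier A" "w' \<in> ccarrier A" and c: "chart_of A c (fst w)"
    and eq: "fst w = fst w'" "momentum A c w = momentum A c w'"
  shows "w = w'"
proof (rule prod_eqI[OF eq(1)], rule extensionalityI)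
  show "snd w \<in> extensional (tspace A (fst w))" "snd w' \<in> extensional (tspace A (fst w))"
    using w eq(1) by (auto simp: ccarrier_iff cspace_def)
  show "snd w \<xi> = snd w' \<xi>" if "\<xi> \<in> tspace A (fst w)" for \<xi>
    using cspace_momentum[OF A w(1) c that] cspace_momentum[OF A w(2), of c \<xi>] that c eq by simp
qed

lemma cchart_image:
  assumes "smooth_atlas A" "c \<in> A"
  shows "snd (cchart A c) ` {w \<in> fst (cchart A c). fst w \<in> S} = snd c ` (fst c \<inter> S) \<times> UNIV"
proof -
  have "(snd c x, u) \<in> snd (cchart A c) ` {w \<in> fst (cchart A c). fst w \<in> S}" if "x \<in> fst c" "x \<in> S" for x u
    by (rule image_eqI[of _ _ "(x, covec_of A c x u)"])
      (use assms that in \<open>auto simp: snd_cchart fst_cchart ccarrier_iff covec_of_cspace intro: carrierI\<close>)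
  then show ?thesis by (auto simp: snd_cchart fst_cchart)
qed

lemma cchart_inj:
  assumes "smooth_atlas A" "c \<in> A"
  shows "inj_on (snd (cchart A c)) (fst (cchart A c))"
proof (rule inj_onI)
  fix w w' assume w: "w \<in> fst (cchart A c)" "w' \<in> fst (cchart A c)" "snd (cchart A c) w = snd (cchart A c) w'"
  then have "fst w = fst w'" using inj_onD[OF atlas_inj[OF assms]] by (auto simp: snd_cchart fst_cchart)
  then show "w = w'"
    using w assms by (intro ctbundle_eqI[of A w w' c]) (auto simp: snd_cchart fst_cchart)
qed

lemma chart_inv_cchart:
  assumes "smooth_atlas A" "c \<in> A" "q \<in> snd c ` fst c"
  shows "chart_inv (cchart A c) (q, p) = (chart_inv c q, covec_of A c (chart_inv c q) p)"
  by (rule chart_inv_eqI[OF cchart_inj[OF assms(1,2)]])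
    (use assms chart_inv_mem[OF assms(3)] in \<open>auto simp: fst_cchart snd_cchart ccarrier_iff chart_inv_right covec_of_cspace intro: carrierI\<close>)

lemma carrier_cot_atlas [simp]: "carrier (cot_atlas A) = ccarrier A"
  by (auto simp: carrier_def cot_atlas_def fst_cchart ccarrier_iff)

lemma cot_atlasE: "e \<in> cot_atlas A \<Longrightarrow> (\<And>c. c \<in> A \<Longrightarrow> e = cchart A c \<Longrightarrow> P) \<Longrightarrow> P"
  by (auto simp: cot_atlas_def)

lemma cchart_in [simp]: "c \<in> A \<Longrightarrow> cchart A c \<in> cot_atlas A"
  by (simp add: cot_atlas_def)

lemma cchart_Int:
  "fst (cchart A c) \<inter> fst (cchart A d) = {w \<in> fst (cchart A c). fst w \<in> fst d}"
  by (auto simp: fst_cchart)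

lemma cchart_trans:
  assumes "smooth_atlas A" "c \<in> A" "d \<in> A" "q \<in> snd c ` (fst c \<inter> fst d)"
  shows "snd (cchart A d) (chart_inv (cchart A c) (q, p)) =
    (rep c d (\<lambda>x. x) q, \<Sum>b\<in>Basis. (p \<bullet> fderiv (rep d c (\<lambda>x. x)) (rep c d (\<lambda>x. x) q) b) *\<^sub>R b)"
proof -
  have q: "q \<in> snd c ` fst c" "chart_inv c q \<in> fst d" "chart_inv c q \<in> fst c"
    using chart_image_iff(2)[OF assms(1,2)] assms(4) chart_inv_mem by blast+
  then show ?thesis using assms
    by (simp add: chart_inv_cchart snd_cchart momentum_def covec_of_def) (simp add: tvec_of_apply)
qed

text \<open>Momenta change by the transposed Jacobian of the inverse transition, taken at the image
  point; hence the two transition maps in opposite directions.\<close>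

lemma smooth_atlas_cot:
  assumes A: "smooth_atlas A"
  shows "smooth_atlas (cot_atlas A)"
  unfolding smooth_atlas_def
proof (intro conjI ballI)
  fix e assume "e \<in> cot_atlas A"
  then obtain c where c: "c \<in> A" "e = cchart A c" by (rule cot_atlasE)
  then show "inj_on (snd e) (fst e)" using cchart_inj[OF A] by simp
  fix e' assume "e' \<in> cot_atlas A"
  then obtain d where d: "d \<in> A" "e' = cchart A d" by (rule cot_atlasE)
  let ?S = "snd c ` (fst c \<inter> fst d)" and ?T = "snd d ` (fst d \<inter> fst c)"
  have eq: "snd e ` (fst e \<inter> fst e') = ?S \<times> UNIV"
    unfolding c(2) d(2) cchart_Int by (rule cchart_image[OF A c(1)])
  have o: "open ?S" "open ?T" by (rule atlas_open[OF A c(1) d(1)], rule atlas_open[OF A d(1) c(1)])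
  have o': "open (?S \<times> (UNIV :: 'b set))" by (intro open_Times o open_UNIV)
  show "open (snd e ` (fst e \<inter> fst e'))" unfolding eq by (rule o')
  note tr = transition_smooth[OF A c(1) d(1)] transition_smooth[OF A d(1) c(1)]
  let ?g = "\<lambda>p. (rep c d (\<lambda>x. x) (fst p),
      \<Sum>b\<in>Basis. (snd p \<bullet> fderiv (rep d c (\<lambda>x. x)) (rep c d (\<lambda>x. x) (fst p)) b) *\<^sub>R b)"
  have t: "rep c d (\<lambda>x. x) (fst p) \<in> ?T" if "p \<in> ?S \<times> UNIV" for p
    using that by (auto simp: chart_inv_left[OF A c(1)])
  have "smooth_on (?S \<times> UNIV) ?g"
    by (intro smooth_on_Pair o' smooth_on_sum smooth_on_scaleR smooth_on_inner smooth_on_const smooth_on_fst smooth_on_snd smooth_on_ident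
         smooth_on_fderiv_apply[OF o' o(2) tr(2)] smooth_on_compose[OF o' o(1) tr(1)] t) auto
  then show "smooth_on (snd e ` (fst e \<inter> fst e')) (snd e' \<circ> chart_inv e)"
    unfolding eq
    by (subst smooth_on_cong[OF o', where g = ?g]) (auto simp: c(2) d(2) cchart_trans[OF A c(1) d(1)])
qed

section \<open>Tangent maps\<close>

text \<open>\<open>tmap_at\<close> is written in \<open>chart_at A x\<close>; moving the source
  chart to \<open>c\<close> by \<open>drep_change\<close>, with \<open>d\<close> fixed, removes that
  choice.\<close>

lemma tmap_at_coord:
  assumes A: "smooth_atlas A" and B: "smooth_atlas B"
    and F: "smooth_map A B S F" and x: "x \<in> S" and c: "chart_of A c x" and d: "chart_of B d (F x)"
    and \<xi>: "\<xi> \<in> tspace A x"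
  shows "tmap_at A B F x \<xi> d = drep c d F x (\<xi> c)"
proof -
  have c0: "chart_of A (chart_at A x) x" using c by (intro chart_at_in) (auto intro: carrierI)
  have "tmap_at A B F x \<xi> d = drep (chart_at A x) d F x (\<xi> (chart_at A x))"
    using d by (simp add: tmap_at_def Let_def charts_at_iff o_def)
  also have "\<dots> = drep (chart_at A x) d F x (drep c (chart_at A x) (\<lambda>x. x) x (\<xi> c))"
    using tspace_trans[OF \<xi> c c0] by simp
  also have "\<dots> = drep d d (\<lambda>x. x) (F x) (drep c d F x (\<xi> c))"
    by (rule drep_change[OF A B F x c c0 d d])
  also have "\<dots> = drep c d F x (\<xi> c)" by (rule trans_self[OF B d])
  finally show ?thesis .
qed

lemma tmap_at_off: "\<not> chart_of B d (F x) \<Longrightarrow> tmap_at A B F x \<xi> d = 0"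
  by (auto simp: tmap_at_def Let_def charts_at_iff)

lemma tmap_at_tspace:
  assumes A: "smooth_atlas A" and B: "smooth_atlas B"
    and F: "smooth_map A B S F" and x: "x \<in> S" and \<xi>: "\<xi> \<in> tspace A x"
  shows "tmap_at A B F x \<xi> \<in> tspace B (F x)"
  unfolding tspace_iff
proof (intro conjI allI impI)
  fix d e assume d: "chart_of B d (F x)" and e: "chart_of B e (F x)"
  from smooth_mapE[OF A F x] obtain c where c: "chart_of A c x" by blast
  show "tmap_at A B F x \<xi> e = drep d e (\<lambda>x. x) (F x) (tmap_at A B F x \<xi> d)"
    using drep_change[OF A B F x c c d e, of "\<xi> c"]
    by (simp only: tmap_at_coord[OF A B F x c d \<xi>] tmap_at_coord[OF A B F x c e \<xi>] trans_self[OF A c])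
qed (rule tmap_at_off)

lemma tmap_at_eqI:
  assumes A: "smooth_atlas A" and B: "smooth_atlas B"
    and F: "smooth_map A B S F" and x: "x \<in> S" and c: "chart_of A c x" and d: "chart_of B d (F x)"
    and \<xi>: "\<xi> \<in> tspace A x" and \<eta>: "\<eta> \<in> tspace B (F x)" and eq: "\<eta> d = drep c d F x (\<xi> c)"
  shows "tmap_at A B F x \<xi> = \<eta>"
  by (rule tspace_eqI[OF tmap_at_tspace[OF A B F x \<xi>] \<eta> d]) (simp add: tmap_at_coord[OF A B F x c d \<xi>] eq)

lemma smooth_tmap:
  assumes A: "smooth_atlas A" and B: "smooth_atlas B" and F: "smooth_map A B S F"
  shows "smooth_map (tan_atlas A) (tan_atlas B) {w \<in> tcarrier A. fst w \<in> S} (tmap A B F)"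
proof (rule smooth_mapI_local[OF smooth_atlas_tan[OF A] smooth_atlas_tan[OF B]])
  have S: "openin (mtop A) S" by (rule smooth_mapD_openin[OF F])
  show "openin (mtop (tan_atlas A)) {w \<in> tcarrier A. fst w \<in> S}"
    unfolding openin_mtop[OF smooth_atlas_tan[OF A]]
  proof (intro conjI ballI)
    fix e assume "e \<in> tan_atlas A"
    then obtain c where c: "c \<in> A" "e = tchart A c" by (rule tan_atlasE)
    have "{w \<in> tcarrier A. fst w \<in> S} \<inter> fst (tchart A c) = {w \<in> fst (tchart A c). fst w \<in> S}"
      by (auto simp: fst_tchart)
    then have "snd e ` ({w \<in> tcarrier A. fst w \<in> S} \<inter> fst e) = snd c ` (S \<inter> fst c) \<times> UNIV"
      unfolding c(2) using tchart_image[OF A c(1), of S] by (simp add: Int_commute)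
    then show "open (snd e ` ({w \<in> tcarrier A. fst w \<in> S} \<inter> fst e))"
      using openin_mtop_image[OF A S c(1)] by (auto intro: open_Times)
  qed auto
  fix w assume w: "w \<in> {w \<in> tcarrier A. fst w \<in> S}"
  then have wS: "fst w \<in> S" by auto
  from smooth_mapE[OF A F wS] obtain c d where cd: "c \<in> A" "d \<in> B" "fst w \<in> fst c" "F (fst w) \<in> fst d" .
  let ?O = "rep_dom c d S F \<times> UNIV"
  have O1: "open (rep_dom c d S F)" by (rule open_rep_dom[OF F cd(1,2)])
  have o2: "open ?O" by (intro open_Times O1 open_UNIV)
  have eq: "chart_inv (tchart A c) u = (chart_inv c (fst u), tvec_of A c (chart_inv c (fst u)) (snd u)) \<and>
     chart_inv c (fst u) \<in> S \<and> chart_inv c (fst u) \<in> fst c \<and> F (chart_inv c (fst u)) \<in> fst d \<and> fst u \<in> snd c ` fst c"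
    if "u \<in> ?O" for u
    using that chart_inv_tchart[OF A cd(1), of "fst u" "snd u"] by (auto simp: rep_dom_iff[OF A cd(1)] chart_inv_mem)
  have "smooth_on ?O (\<lambda>u. (rep c d F (fst u), fderiv (rep c d F) (fst u) (snd u)))"
    by (intro smooth_on_Pair o2 smooth_on_compose[OF o2 O1 smooth_map_rep[OF F cd(1,2)]]
        smooth_on_fderiv_apply[OF o2 O1 smooth_map_rep[OF F cd(1,2)]]
        smooth_on_fst smooth_on_snd smooth_on_ident) auto
  moreover have "snd (tchart B d) (tmap A B F (chart_inv (tchart A c) u)) = (rep c d F (fst u), fderiv (rep c d F) (fst u) (snd u))"
    if "u \<in> ?O" for u
    using eq[OF that] cd A
    by (simp add: snd_tchart tmap_def tmap_at_coord[OF A B F, where c = c and d = d] chart_inv_right)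
  ultimately have "smooth_on ?O (\<lambda>u. snd (tchart B d) (tmap A B F (chart_inv (tchart A c) u)))"
    by (subst smooth_on_cong[OF o2, where g = "\<lambda>u. (rep c d F (fst u), fderiv (rep c d F) (fst u) (snd u))"]) auto
  moreover have "tmap A B F (chart_inv (tchart A c) u) \<in> fst (tchart B d)" if "u \<in> ?O" for u
    using eq[OF that] cd A by (auto simp: fst_tchart tcarrier_iff tmap_def smooth_mapD_carrier[OF F]
        intro!: tmap_at_tspace[OF A B F])
  moreover have "snd (tchart A c) w \<in> ?O" using w cd by (auto simp: snd_tchart intro: rep_domI)
  ultimately show "\<exists>e e' N. e \<in> tan_atlas A \<and> e' \<in> tan_atlas B \<and> w \<in> fst e \<and> open N \<and> snd e w \<in> N \<and>
      (\<forall>u\<in>N. u \<in> snd e ` fst e \<longrightarrow> chart_inv e u \<in> {w \<in> tcarrier A. fst w \<in> S} \<longrightarrow>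
        tmap A B F (chart_inv e u) \<in> fst e') \<and>
      smooth_on N (\<lambda>u. snd e' (tmap A B F (chart_inv e u)))"
    using cd o2 w by (intro exI[of _ "tchart A c"] exI[of _ "tchart B d"] exI[of _ ?O]) (simp add: fst_tchart)
qed

section \<open>Discretization maps and implicit one-step methods\<close>

lemma diffeo_onD:
  assumes "diffeo_on A B V F"
  shows "smooth_map A B V F" "inj_on F V" "smooth_map B A (F ` V) (inv_into V F)"
  using assms by (auto simp: diffeo_on_def)

text \<open>The Euclidean theorem is applied to a local representative, and its open sets are
  carried back by the two charts. The set \<open>T\<close> allows the neighbourhood to be taken
  small.\<close>

lemma smooth_map_local_diffeo:
  fixes A :: "('m, 'e::euclidean_space) atlas" and B :: "('k, 'e) atlas"
  assumes A: "smooth_atlas A" and B: "smooth_atlas B" and F: "smooth_map A B S F" and x: "x \<in> S"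
    and c: "chart_of A c x" and d: "chart_of B d (F x)" and inj: "inj (drep c d F x)"
    and T: "openin (mtop A) T" "x \<in> T"
  obtains V where "x \<in> V" "V \<subseteq> S" "V \<subseteq> T" "diffeo_on A B V F"
proof -
  note c' = conjunct1[OF c] conjunct2[OF c] and d' = conjunct1[OF d] conjunct2[OF d]
  define X where "X = rep_dom c d S F \<inter> snd c ` (T \<inter> fst c)"
  have X: "open X" unfolding X_def
    using open_rep_dom[OF F c'(1) d'(1)] openin_mtop_image[OF A T(1) c'(1)] by auto
  have xX: "snd c x \<in> X" using x c d T by (auto simp: X_def intro: rep_domI)
  have sm: "smooth_on X (rep c d F)"
    by (rule smooth_on_subset[OF smooth_map_rep[OF F c'(1) d'(1)]]) (simp add: X_def)
  obtain U V' g where U: "open U" "U \<subseteq> X" "snd c x \<in> U" and V': "open V'" "rep c d F (snd c x) \<in> V'"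
    and h: "homeomorphism U V' (rep c d F) g" and g: "smooth_on V' g"
    by (rule smooth_inverse_function[OF X sm xX inj])
  have X_iff: "u \<in> snd c ` fst c \<and> chart_inv c u \<in> S \<and> F (chart_inv c u) \<in> fst d \<and> chart_inv c u \<in> T"
    if "u \<in> X" for u
    using that by (auto simp: X_def rep_dom_iff[OF A c'(1)] chart_inv_left[OF A c'(1)])
  define V where "V = {y \<in> fst c. snd c y \<in> U}"
  have oV: "openin (mtop A) V" unfolding V_def by (rule openin_chart_preimage[OF A c'(1) U(1)])
  have VX: "y \<in> S \<and> y \<in> T \<and> F y \<in> fst d \<and> snd c y \<in> X" if "y \<in> V" for y
    using that U(2) X_iff[of "snd c y"] by (auto simp: V_def chart_inv_left[OF A c'(1)])
  have gF: "g (snd d (F y)) = snd c y" if "y \<in> V" for y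
    using h that chart_inv_left[OF A c'(1), of y] by (force simp: V_def homeomorphism_def)
  have inj: "inj_on F V"
  proof (rule inj_onI)
    fix y y' assume y: "y \<in> V" "y' \<in> V" "F y = F y'"
    then have "snd c y = snd c y'" using gF[of y] gF[of y'] by simp
    then show "y = y'" using y inj_onD[OF atlas_inj[OF A c'(1)]] by (auto simp: V_def)
  qed
  \<comment> \<open>The image of \<open>V\<close> is a chart preimage of the open set
    \<open>V'\<close>, hence open, and the inverse is read there through \<open>g\<close>.\<close>
  have FV: "F ` V = {y \<in> fst d. snd d y \<in> V'}"
  proof (intro set_eqI iffI)
    fix y assume "y \<in> F ` V"
    then obtain w where w: "w \<in> V" "y = F w" by auto
    then have "rep c d F (snd c w) \<in> V'" using h by (auto simp: V_def homeomorphism_def)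
    then show "y \<in> {y \<in> fst d. snd d y \<in> V'}"
      using w VX[OF w(1)] by (auto simp: V_def chart_inv_left[OF A c'(1)])
  next
    fix y assume y: "y \<in> {y \<in> fst d. snd d y \<in> V'}"
    define u where "u = g (snd d y)"
    have u: "u \<in> U" "rep c d F u = snd d y" using y h by (auto simp: u_def homeomorphism_def)
    have uX: "u \<in> X" using u U by auto
    have "F (chart_inv c u) = y"
      using u(2) y X_iff[OF uX] inj_onD[OF atlas_inj[OF B d'(1)]] by auto
    moreover have "chart_inv c u \<in> V" using X_iff[OF uX] u by (auto simp: V_def chart_inv_mem chart_inv_right)
    ultimately show "y \<in> F ` V" by blast
  qed
  have inv: "inv_into V F y = chart_inv c (g (snd d y))" if y: "y \<in> F ` V" for y
  proof -
    obtain w where w: "w \<in> V" "y = F w" using y by auto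
    then show ?thesis using inv_into_f_f[OF inj w(1)] gF[OF w(1)] by (simp add: V_def chart_inv_left[OF A c'(1)])
  qed
  have gU: "g u \<in> U" if "u \<in> V'" for u using that h by (auto simp: homeomorphism_def)
  have smF: "smooth_map A B V F" by (rule smooth_map_subset[OF A B F oV]) (use VX in auto)
  have oFV: "openin (mtop B) (F ` V)" unfolding FV by (rule openin_chart_preimage[OF B d'(1) V'(1)])
  have e: "chart_inv d u \<in> F ` V \<and> inv_into V F (chart_inv d u) = chart_inv c (g u)"
    if "u \<in> V'" "u \<in> snd d ` fst d" for u
  proof -
    have "chart_inv d u \<in> F ` V" using that unfolding FV by (simp add: chart_inv_mem chart_inv_right)
    then show ?thesis using inv that by (simp add: chart_inv_right)
  qed
  have V'd: "V' \<subseteq> snd d ` fst d"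
  proof
    fix u assume "u \<in> V'"
    then have "u = rep c d F (g u)" "g u \<in> X" using h gU U by (auto simp: homeomorphism_def)
    then show "u \<in> snd d ` fst d" using X_iff[of "g u"] by auto
  qed
  have smi: "smooth_map B A (F ` V) (inv_into V F)"
  proof (rule smooth_mapI_local[OF B A oFV])
    fix y assume y: "y \<in> F ` V"
    have "smooth_on V' (rep d c (inv_into V F))"
    proof (subst smooth_on_cong[OF V'(1)])
      show "rep d c (inv_into V F) u = g u" if "u \<in> V'" for u
        using e[OF that subsetD[OF V'd that]] X_iff[OF subsetD[OF U(2) gU[OF that]]] by (simp add: chart_inv_right)
    qed (rule g)
    then show "\<exists>d c N. d \<in> B \<and> c \<in> A \<and> y \<in> fst d \<and> open N \<and> snd d y \<in> N \<and>
        (\<forall>u\<in>N. u \<in> snd d ` fst d \<longrightarrow> chart_inv d u \<in> F ` V \<longrightarrow> inv_into V F (chart_inv d u) \<in> fst c) \<and>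
        smooth_on N (rep d c (inv_into V F))"
    proof (intro exI conjI ballI impI)
      show "inv_into V F (chart_inv d u) \<in> fst c" if "u \<in> V'" "u \<in> snd d ` fst d" for u
        using e[OF that] gU[OF that(1)] U(2) X_iff[of "g u"] by (auto simp: chart_inv_mem)
    qed (use c' d' V' y FV in auto)
  qed
  show ?thesis
  proof (rule that)
    show "x \<in> V" using c U by (simp add: V_def)
    show "diffeo_on A B V F" using smF inj smi by (simp add: diffeo_on_def)
  qed (use VX in auto)
qed

section \<open>Discretization maps near the zero section\<close>

lemma zero_at_tcarrier: "smooth_atlas A \<Longrightarrow> x \<in> carrier A \<Longrightarrow> zero_at x \<in> tcarrier A"
  by (simp add: zero_at_def tcarrier_iff tspace_zero)

lemma fst_zero_at [simp]: "fst (zero_at x) = x"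
  by (simp add: zero_at_def)

lemma snd_zero_at [simp]: "snd (zero_at x) c = 0"
  by (simp add: zero_at_def)

lemma zero_at_chart: "smooth_atlas A \<Longrightarrow> chart_of A c x \<Longrightarrow> chart_of (tan_atlas A) (tchart A c) (zero_at x)"
  by (auto simp: fst_tchart intro: zero_at_tcarrier carrierI)

lemma snd_tchart_zero: "snd (tchart A c) (zero_at x) = (snd c x, 0)"
  by (simp add: snd_tchart)

text \<open>To move in the fibre over \<open>x\<close> is to freeze the base coordinate, so the
  fibre derivative is the vertical part of the full derivative.\<close>

lemma fibre_deriv_coord:
  fixes A :: "('m, 'e::euclidean_space) atlas"
  assumes A: "smooth_atlas A" and F: "smooth_map (tan_atlas A) A D F" and x: "zero_at x \<in> D" "F (zero_at x) = x"
    and d: "chart_of A d x" and c: "c = chart_at A x"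
  shows "fibre_deriv A x (\<lambda>\<eta>. F (x, \<eta>)) \<xi> d = drep (tchart A c) d F (zero_at x) (0, \<xi> c)"
proof -
  have c': "chart_of A c x" unfolding c using d by (intro chart_at_in) (auto intro: carrierI)
  have "F (x, \<lambda>_. 0) = x" using x(2) by (simp add: zero_at_def)
  then have "fibre_deriv A x (\<lambda>\<eta>. F (x, \<eta>)) \<xi> d = fderiv (\<lambda>u. snd d (F (x, tvec_of A c x u))) 0 (\<xi> c)"
    using d by (simp add: fibre_deriv_def c[symmetric] Let_def charts_at_iff)
  also have "(\<lambda>u. snd d (F (x, tvec_of A c x u))) = (\<lambda>u. rep (tchart A c) d F (snd c x, u))"
    using c' by (simp add: chart_inv_tchart[OF A] chart_inv_left[OF A])
  also have "fderiv \<dots> 0 = (\<lambda>v. drep (tchart A c) d F (zero_at x) (0, v))"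
  proof (rule fderiv_eq, rule has_derivative_compose[of "\<lambda>u. (snd c x, u)" "\<lambda>v. (0, v)"])
    show "((\<lambda>u. (snd c x, u)) has_derivative (\<lambda>v. (0, v))) (at 0)"
      by (intro has_derivative_Pair has_derivative_const has_derivative_ident)
    show "(rep (tchart A c) d F has_derivative drep (tchart A c) d F (zero_at x)) (at (snd c x, 0))"
      using rep_has_derivative[OF F x(1) zero_at_chart[OF A c'], of d] d x(2) by (simp add: snd_tchart_zero)
  qed
  finally show ?thesis .
qed

text \<open>The identity \<open>F (zero_at q) = q\<close> holds along the whole zero section and may
  be differentiated in the base direction.\<close>

lemma drep_zero_section:
  fixes A :: "('m, 'e::euclidean_space) atlas"
  assumes A: "smooth_atlas A" and F: "smooth_map (tan_atlas A) A D F"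
    and z: "\<And>x. x \<in> carrier A \<Longrightarrow> zero_at x \<in> D \<and> F (zero_at x) = x" and c: "chart_of A c x"
  shows "drep (tchart A c) c F (zero_at x) (a, 0) = a"
proof -
  have x: "x \<in> carrier A" using c by (auto intro: carrierI)
  have "((\<lambda>q. rep (tchart A c) c F (q, 0)) has_derivative (\<lambda>a. drep (tchart A c) c F (zero_at x) (a, 0))) (at (snd c x))"
  proof (rule has_derivative_compose[of "\<lambda>u. (u, 0)" "\<lambda>v. (v, 0)"])
    show "((\<lambda>u. (u, 0)) has_derivative (\<lambda>v. (v, 0))) (at (snd c x))"
      by (intro has_derivative_Pair has_derivative_const has_derivative_ident)
    show "(rep (tchart A c) c F has_derivative drep (tchart A c) c F (zero_at x)) (at (snd c x, 0))"
      using rep_has_derivative[OF F _ zero_at_chart[OF A c], of c] z[OF x] c by (simp add: snd_tchart_zero)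
  qed
  from fderiv_eq[OF this] have "drep (tchart A c) c F (zero_at x) (a, 0) = fderiv (\<lambda>q. rep (tchart A c) c F (q, 0)) (snd c x) a"
    by simp
  also have "fderiv (\<lambda>q. rep (tchart A c) c F (q, 0)) (snd c x) = fderiv (\<lambda>q. q) (snd c x)"
  proof (rule fderiv_cong[OF atlas_open_dom[OF A]])
    show "rep (tchart A c) c F (q, 0) = q" if "q \<in> snd c ` fst c" for q
    proof -
      have m: "chart_of A c (chart_inv c q)" "chart_inv c q \<in> carrier A"
        using c that by (auto simp: chart_inv_mem intro: carrierI)
      have "chart_inv (tchart A c) (q, 0) = zero_at (chart_inv c q)"
        using that c m by (simp add: chart_inv_tchart[OF A] tvec_of_zero[OF A] zero_at_def)
      then show ?thesis using z[OF m(2)] that by (simp add: chart_inv_right)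
    qed
  qed (use c in auto)
  finally show ?thesis by simp
qed

lemma discretization_mapD:
  assumes A: "smooth_atlas A" and R: "discretization_map A D R"
  shows "openin (mtop (tan_atlas A)) D" "smooth_map (tan_atlas A) (prod_atlas A A) D R"
    "x \<in> carrier A \<Longrightarrow> zero_at x \<in> D" "x \<in> carrier A \<Longrightarrow> R (zero_at x) = (x, x)"
    "smooth_map (tan_atlas A) A D (\<lambda>w. fst (R w))" "smooth_map (tan_atlas A) A D (\<lambda>w. snd (R w))"
proof -
  show R: "smooth_map (tan_atlas A) (prod_atlas A A) D R"
    using assms by (simp add: discretization_map_def)
  show "smooth_map (tan_atlas A) A D (\<lambda>w. fst (R w))" "smooth_map (tan_atlas A) A D (\<lambda>w. snd (R w))"
    by (rule smooth_map_fst[OF A A smooth_atlas_tan[OF A] R], rule smooth_map_snd[OF A A smooth_atlas_tan[OF A] R])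
qed (use assms in \<open>auto simp: discretization_map_def\<close>)

text \<open>The fibre condition is an identity of tangent vectors, and a tangent vector is
  determined by its component in one chart.\<close>

lemma discretization_fibre:
  fixes A :: "('m, 'e::euclidean_space) atlas"
  assumes A: "smooth_atlas A" and R: "smooth_map (tan_atlas A) (prod_atlas A A) D R"
    and z: "zero_at x \<in> D" "R (zero_at x) = (x, x)" and x: "x \<in> carrier A" and c: "c = chart_at A x"
  shows "(\<forall>\<xi>\<in>tspace A x.
        (\<lambda>d. fibre_deriv A x (\<lambda>\<eta>. snd (R (x, \<eta>))) \<xi> d
            - fibre_deriv A x (\<lambda>\<eta>. fst (R (x, \<eta>))) \<xi> d) = \<xi>) \<longleftrightarrow>
     (\<forall>u. drep (tchart A c) c (\<lambda>w. snd (R w)) (zero_at x) (0, u)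
          - drep (tchart A c) c (\<lambda>w. fst (R w)) (zero_at x) (0, u) = u)" (is "?l \<longleftrightarrow> ?r")
proof -
  note TA = smooth_atlas_tan[OF A]
  have c': "chart_of A c x" unfolding c using x by (intro chart_at_in)
  note f = smooth_map_fst[OF A A TA R] smooth_map_snd[OF A A TA R]
  note fd = fibre_deriv_coord[OF A f(1) z(1) _ _ c] fibre_deriv_coord[OF A f(2) z(1) _ _ c]
  have D: "fibre_deriv A x (\<lambda>\<eta>. snd (R (x, \<eta>))) \<xi> d - fibre_deriv A x (\<lambda>\<eta>. fst (R (x, \<eta>))) \<xi> d =
      drep (tchart A c) d (\<lambda>w. snd (R w)) (zero_at x) (0, \<xi> c) - drep (tchart A c) d (\<lambda>w. fst (R w)) (zero_at x) (0, \<xi> c)"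
    if "chart_of A d x" for d \<xi> using fd[of d \<xi>] that z by simp
  show ?thesis
  proof
    assume l: ?l
    show ?r
    proof
      fix u
      have "tvec_of A c x u \<in> tspace A x" by (rule tvec_of_tspace[OF A c'])
      from bspec[OF l this, THEN fun_cong, of c] show "drep (tchart A c) c (\<lambda>w. snd (R w)) (zero_at x) (0, u)
          - drep (tchart A c) c (\<lambda>w. fst (R w)) (zero_at x) (0, u) = u"
        unfolding D[OF c'] tvec_of_self[OF A c'] .
    qed
  next
    assume r: ?r
    show ?l
    proof (intro ballI ext)
      fix \<xi> d assume \<xi>: "\<xi> \<in> tspace A x"
      show "fibre_deriv A x (\<lambda>\<eta>. snd (R (x, \<eta>))) \<xi> d - fibre_deriv A x (\<lambda>\<eta>. fst (R (x, \<eta>))) \<xi> d = \<xi> d"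
      proof (cases "chart_of A d x")
        case True
        \<comment> \<open>Only the target chart changes; the source stays the tangent chart over
          \<open>c\<close>. The change is thus a linear map, which passes through the
          difference.\<close>
        have ch: "drep (tchart A c) d F (zero_at x) w = drep c d (\<lambda>x. x) x (drep (tchart A c) c F (zero_at x) w)"
          if "smooth_map (tan_atlas A) A D F" "F (zero_at x) = x" for F w
          using drep_chain[OF TA A that(1) smooth_map_ident[OF A openin_carrier[OF A]], of "zero_at x" "tchart A c" c d w]
            that z c' True x zero_at_chart[OF A c'] by simp
        have "drep (tchart A c) d (\<lambda>w. snd (R w)) (zero_at x) (0, \<xi> c) - drep (tchart A c) d (\<lambda>w. fst (R w)) (zero_at x) (0, \<xi> c)
          = drep c d (\<lambda>x. x) x (\<xi> c)"
        proof -
          have "drep (tchart A c) d (\<lambda>w. snd (R w)) (zero_at x) (0, \<xi> c) =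
              drep c d (\<lambda>x. x) x (drep (tchart A c) c (\<lambda>w. snd (R w)) (zero_at x) (0, \<xi> c))"
            by (rule ch[OF f(2)]) (simp add: z)
          moreover have "drep (tchart A c) d (\<lambda>w. fst (R w)) (zero_at x) (0, \<xi> c) =
              drep c d (\<lambda>x. x) x (drep (tchart A c) c (\<lambda>w. fst (R w)) (zero_at x) (0, \<xi> c))"
            by (rule ch[OF f(1)]) (simp add: z)
          moreover have "drep c d (\<lambda>x. x) x p - drep c d (\<lambda>x. x) x q = drep c d (\<lambda>x. x) x (p - q)" for p q
            by (rule linear_diff[OF trans_linear[OF A c' True], symmetric])
          ultimately show ?thesis using spec[OF r, of "\<xi> c"] by (simp only:)
        qed
        then show ?thesis unfolding D[OF True] tspace_trans[OF \<xi> c' True] .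
      next
        case False
        then have "d \<notin> charts_at A x" by (simp add: charts_at_iff)
        then show ?thesis using tspace_off[OF \<xi> False] z by (simp add: fibre_deriv_def Let_def zero_at_def)
      qed
    qed
  qed
qed

lemma prod_rep:
  "rep c (prod_chart d e) F = (\<lambda>u. (rep c d (\<lambda>x. fst (F x)) u, rep c e (\<lambda>x. snd (F x)) u))"
  by simp

lemma drep_prod:
  assumes A: "smooth_atlas A" and B: "smooth_atlas B" and C: "smooth_atlas C"
    and F: "smooth_map C (prod_atlas A B) S F" and x: "x \<in> S" and c: "chart_of C c x"
    and d: "chart_of A d (fst (F x))" and e: "chart_of B e (snd (F x))"
  shows "drep c (prod_chart d e) F x v = (drep c d (\<lambda>x. fst (F x)) x v, drep c e (\<lambda>x. snd (F x)) x v)"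
  unfolding prod_rep
  using fderiv_eq[OF has_derivative_Pair[OF rep_has_derivative[OF smooth_map_fst[OF A B C F] x c d]
        rep_has_derivative[OF smooth_map_snd[OF A B C F] x c e]]] by simp

text \<open>At a zero vector the derivative of \<open>R\<close> is
  \<open>(a, b) \<mapsto> (a + f b, a + s b)\<close> with \<open>s b - f b = b\<close>. A vector in
  its kernel has \<open>b = 0\<close>, and then \<open>a = 0\<close>.\<close>

lemma discretization_invertible_near:
  fixes A :: "('m, 'e::euclidean_space) atlas"
  assumes A: "smooth_atlas A" and R: "discretization_map A D R" and x: "x \<in> carrier A"
  shows "\<exists>V. invertible_near A D R x V"
proof -
  note TA = smooth_atlas_tan[OF A] and AA = smooth_atlas_prod[OF A A]
  note RD = discretization_mapD[OF A R]
  define c where "c = chart_at A x"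
  have c: "chart_of A c x" unfolding c_def using x by (rule chart_at_in)
  note zc = zero_at_chart[OF A c]
  have pc: "chart_of (prod_atlas A A) (prod_chart c c) (R (zero_at x))" using c RD(4)[OF x] by simp
  let ?f = "drep (tchart A c) c (\<lambda>w. fst (R w)) (zero_at x)" and ?s = "drep (tchart A c) c (\<lambda>w. snd (R w)) (zero_at x)"
  have lin: "linear ?f" "linear ?s"
    using drep_linear[OF RD(5) RD(3)[OF x] zc, of c] drep_linear[OF RD(6) RD(3)[OF x] zc, of c] c RD(4)[OF x] by simp_all
  have d1: "?f (a, 0) = a" for a by (rule drep_zero_section[OF A RD(5) _ c]) (use RD(3,4) in simp)
  have d2: "?s (a, 0) = a" for a by (rule drep_zero_section[OF A RD(6) _ c]) (use RD(3,4) in simp)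
  have fib: "?s (0, u) - ?f (0, u) = u" for u
    using R discretization_fibre[OF A RD(2) RD(3)[OF x] RD(4)[OF x] x c_def] x by (auto simp: discretization_map_def)
  have "inj (drep (tchart A c) (prod_chart c c) R (zero_at x))"
  proof (subst linear_injective_0)
    show "linear (drep (tchart A c) (prod_chart c c) R (zero_at x))" by (rule drep_linear[OF RD(2) RD(3)[OF x] zc pc])
    show "\<forall>w. drep (tchart A c) (prod_chart c c) R (zero_at x) w = 0 \<longrightarrow> w = 0"
    proof (intro allI impI)
      fix w assume w0: "drep (tchart A c) (prod_chart c c) R (zero_at x) w = 0"
      obtain a b where w: "w = (a, b)" by (cases w)
      have "?f w = 0" "?s w = 0"
        using w0 drep_prod[OF A A TA RD(2) RD(3)[OF x] zc, of c c w] c RD(4)[OF x] by (simp_all add: zero_prod_def)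
      moreover have "?f w = a + ?f (0, b)" "?s w = a + ?s (0, b)"
        using linear_add[OF lin(1), of "(a, 0)" "(0, b)"] linear_add[OF lin(2), of "(a, 0)" "(0, b)"] d1 d2 by (simp_all add: w)
      ultimately have e: "a + ?f (0, b) = 0" "a + ?s (0, b) = 0" by simp_all
      then have "?s (0, b) - ?f (0, b) = 0" by (metis add_left_cancel diff_self)
      with fib[of b] have "b = 0" by simp
      with e linear_0[OF lin(1)] have "a = 0" by (simp add: zero_prod_def)
      with \<open>b = 0\<close> show "w = 0" by (simp add: w zero_prod_def)
    qed
  qed
  then obtain V where "zero_at x \<in> V" "V \<subseteq> D" "diffeo_on (tan_atlas A) (prod_atlas A A) V R"
    by (rule smooth_map_local_diffeo[OF TA AA RD(2) RD(3)[OF x] zc pc _ RD(1) RD(3)[OF x]])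
  then show ?thesis unfolding invertible_near_def by (intro exI[of _ V] conjI)
qed

section \<open>Solvability of the implicit step for small step sizes\<close>

lemma scale_tcarrier: "smooth_atlas A \<Longrightarrow> w \<in> tcarrier A \<Longrightarrow> scale h w \<in> tcarrier A"
  by (simp add: scale_def tcarrier_iff tspace_scale)

lemma fst_scale [simp]: "fst (scale h w) = fst w"
  by (simp add: scale_def)

lemma snd_scale [simp]: "snd (scale h w) c = h *\<^sub>R snd w c"
  by (simp add: scale_def)

lemma openin_fst_preimage:
  assumes A: "smooth_atlas A" and X: "openin (mtop A) X"
  shows "openin (mtop (tan_atlas A)) {w \<in> tcarrier A. fst w \<in> X}"
  by (rule smooth_mapD_openin[OF smooth_tmap[OF A A smooth_map_ident[OF A X]]])

text \<open>In a chart at \<open>z\<close> write \<open>\<gamma>\<close> for the principal part of \<open>\<Gamma>\<close>. The map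
  \<open>(h, u) \<mapsto> (h, R\<^sup>1(u, h \<gamma> u))\<close> is a diffeomorphism near \<open>(0, z)\<close>; the second component of its inverse
  recovers the base point \<open>\<psi> x\<^sub>0\<close> from the initial point \<open>x\<^sub>0\<close>, uniformly in \<open>h\<close>.\<close>
lemma implicit_step:
  fixes A :: "('m, 'e::euclidean_space) atlas"
  assumes A: "smooth_atlas A" and R: "discretization_map A D R"
    and \<Gamma>: "smooth_map A (tan_atlas A) (carrier A) \<Gamma>" "\<And>x. x \<in> carrier A \<Longrightarrow> fst (\<Gamma> x) = x"
    and z: "z \<in> carrier A" and V: "invertible_near A D R z V" and X: "openin (mtop A) X" "z \<in> X"
  obtains W W' h0 where "openin (mtop A) W" "openin (mtop A) W'" "z \<in> W" "z \<in> W'" "W \<times> W' \<subseteq> R ` V" "0 < h0"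
    "\<And>h. 0 < h \<Longrightarrow> h < h0 \<Longrightarrow> \<exists>\<psi>. smooth_map A A W \<psi> \<and> (\<forall>x0\<in>W. \<psi> x0 \<in> X \<and>
        scale h (\<Gamma> (\<psi> x0)) \<in> D \<and> fst (R (scale h (\<Gamma> (\<psi> x0)))) = x0 \<and> snd (R (scale h (\<Gamma> (\<psi> x0)))) \<in> W' \<and>
        (\<forall>x1\<in>W'. step_equation D R V \<Gamma> h x0 x1 \<longleftrightarrow> x1 = snd (R (scale h (\<Gamma> (\<psi> x0))))))"
proof -
  note TA = smooth_atlas_tan[OF A] and AA = smooth_atlas_prod[OF A A]
  note RD = discretization_mapD[OF A R]
  have VD: "V \<subseteq> D" "zero_at z \<in> V" and VR: "smooth_map (tan_atlas A) (prod_atlas A A) V R" "inj_on R V"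
    "smooth_map (prod_atlas A A) (tan_atlas A) (R ` V) (inv_into V R)"
    using V diffeo_onD[of "tan_atlas A" "prod_atlas A A" V R] by (auto simp: invertible_near_def)
  define c where "c = chart_at A z"
  have c: "chart_of A c z" unfolding c_def using z by (rule chart_at_in)
  note c' = conjunct1[OF c] conjunct2[OF c]
  let ?t = "tchart A c" and ?p = "prod_chart c c"
  have tc: "?t \<in> tan_atlas A" and pc: "?p \<in> prod_atlas A A" using c by auto
  define C where "C = snd c ` fst c"
  have C: "open C" unfolding C_def by (rule atlas_open_dom[OF A c'(1)])
  have Cm: "chart_inv c u \<in> fst c" "snd c (chart_inv c u) = u" "chart_inv c u \<in> carrier A" if "u \<in> C" for u
    using that c by (auto simp: C_def chart_inv_mem chart_inv_right intro: carrierI)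
  define \<gamma> where "\<gamma> u = snd (\<Gamma> (chart_inv c u)) c" for u
  have \<Gamma>t: "\<Gamma> x \<in> tcarrier A" if "x \<in> carrier A" for x
    using smooth_mapD_carrier[OF \<Gamma>(1) that] by simp
  have sm\<gamma>: "smooth_on C \<gamma>"
  proof -
    have "smooth_on (rep_dom c ?t (carrier A) \<Gamma>) (rep c ?t \<Gamma>)" by (rule smooth_map_rep[OF \<Gamma>(1) c'(1) tc])
    moreover have "C \<subseteq> rep_dom c ?t (carrier A) \<Gamma>"
      using \<Gamma>t Cm \<Gamma>(2) by (auto simp: rep_dom_iff[OF A c'(1)] fst_tchart C_def)
    ultimately have "smooth_on C (rep c ?t \<Gamma>)" by (rule smooth_on_subset)
    then have "smooth_on C (\<lambda>u. snd (rep c ?t \<Gamma> u))" by (rule smooth_on_snd[OF C])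
    then show ?thesis by (simp add: snd_tchart \<gamma>_def[abs_def])
  qed
  have ci: "chart_inv ?t (u, h *\<^sub>R \<gamma> u) = scale h (\<Gamma> (chart_inv c u))" if "u \<in> C" for h u
    by (rule chart_inv_eqI[OF tchart_inj[OF A c'(1)]])
      (use \<Gamma>t Cm[OF that] \<Gamma>(2) in \<open>auto simp: fst_tchart snd_tchart \<gamma>_def scale_tcarrier[OF A]\<close>)
  define Y where "Y = rep_dom ?t ?p V R"
  have Y: "open Y" unfolding Y_def by (rule open_rep_dom[OF VR(1) tc pc])
  define r where "r = rep ?t ?p R"
  have smr: "smooth_on Y r" unfolding Y_def r_def by (rule smooth_map_rep[OF VR(1) tc pc])
  have z0: "(snd c z, 0) \<in> Y"
    using VD(2) c RD(4)[OF z] zero_at_chart[OF A c] rep_domI[of "zero_at z" V ?t R ?p]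
    by (simp add: Y_def snd_tchart_zero)
  \<comment> \<open>The pairs \<open>(h, u)\<close> for which the vector \<open>h \<gamma> u\<close>
    at \<open>u\<close> lies in \<open>V\<close> and both of its end points lie in the chart
    \<open>c\<close>.\<close>
  define E where "E = (UNIV \<times> C) \<inter> (\<lambda>p. (snd p, fst p *\<^sub>R \<gamma> (snd p))) -` Y"
  have UC: "open ((UNIV :: real set) \<times> C)" by (intro open_Times open_UNIV C)
  have smy: "smooth_on (UNIV \<times> C) (\<lambda>p::real \<times> 'e. (snd p, fst p *\<^sub>R \<gamma> (snd p)))"
    by (intro smooth_on_Pair UC smooth_on_snd smooth_on_fst smooth_on_ident smooth_on_scaleR
        smooth_on_compose[OF UC C sm\<gamma>]) auto
  have E: "open E" unfolding E_def
    by (intro continuous_open_preimage smooth_on_continuous smy UC Y)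
  have smE: "smooth_on E (\<lambda>p. r (snd p, fst p *\<^sub>R \<gamma> (snd p)))"
    by (rule smooth_on_compose[OF E Y smr smooth_on_subset[OF smy]]) (auto simp: E_def)
  have Eiff: "u \<in> C \<and> scale h (\<Gamma> (chart_inv c u)) \<in> V \<and> fst (R (scale h (\<Gamma> (chart_inv c u)))) \<in> fst c \<and>
      snd (R (scale h (\<Gamma> (chart_inv c u)))) \<in> fst c \<and>
      r (u, h *\<^sub>R \<gamma> u) = (snd c (fst (R (scale h (\<Gamma> (chart_inv c u))))), snd c (snd (R (scale h (\<Gamma> (chart_inv c u))))))"
    if "(h, u) \<in> E" for h u
  proof -
    have "u \<in> C" "(u, h *\<^sub>R \<gamma> u) \<in> Y" using that by (auto simp: E_def)
    then show ?thesis by (simp add: Y_def rep_dom_iff[OF TA tc] ci r_def mem_Times_iff)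
  qed
  have zC: "snd c z \<in> C" using c by (auto simp: C_def)
  have rz: "r (u, 0) = (u, u)" if "u \<in> C" for u
    using ci[OF that, of 0] Cm[OF that] RD(4)[of "chart_inv c u"] \<Gamma>(2)
    by (simp add: r_def scale_def zero_at_def)
  define G where "G p = (fst p, fst (r (snd p, fst p *\<^sub>R \<gamma> (snd p))))" for p :: "real \<times> 'e"
  have smG: "smooth_on E G" unfolding G_def[abs_def]
    by (intro smooth_on_Pair E smooth_on_fst smooth_on_ident smE)
  have zE: "(0, snd c z) \<in> E" using zC z0 by (simp add: E_def)
  have Gz: "G (0, snd c z) = (0, snd c z)" using rz[OF zC] by (simp add: G_def)
  note DG = smooth_on_has_derivative[OF smG zE]
  have DG1: "fst (fderiv G (0, snd c z) v) = fst v" for v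
  proof -
    have "((\<lambda>p. fst (G p)) has_derivative (\<lambda>v. fst (fderiv G (0, snd c z) v))) (at (0, snd c z))"
      by (rule has_derivative_fst[OF DG])
    moreover have "((\<lambda>p. fst (G p)) has_derivative fst) (at (0, snd c z))"
      unfolding G_def fst_conv by (rule has_derivative_fst[OF has_derivative_ident])
    ultimately have "(\<lambda>v. fst (fderiv G (0, snd c z) v)) = fst" by (rule has_derivative_unique)
    then show ?thesis by metis
  qed
  \<comment> \<open>For \<open>h = 0\<close> the vector is zero and \<open>R\<close> sends it to the
    diagonal, so \<open>G\<close> is the identity on this slice. Together with \<open>DG1\<close>
    this makes the derivative block triangular and injective.\<close>
  have DG2: "fderiv G (0, snd c z) (0, a) = (0, a)" for a
  proof -
    have "((\<lambda>u. G (0, u)) has_derivative (\<lambda>a. fderiv G (0, snd c z) (0, a))) (at (snd c z))"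
      by (rule has_derivative_compose[of "\<lambda>u. (0, u)" "\<lambda>a. (0, a)", OF _ DG])
        (intro has_derivative_Pair has_derivative_const has_derivative_ident)
    moreover have "((\<lambda>u. G (0, u)) has_derivative (\<lambda>a. (0, a))) (at (snd c z))"
    proof (rule has_derivative_transform_within_open[OF _ C zC])
      show "((\<lambda>u::'e. (0::real, u)) has_derivative (\<lambda>a. (0, a))) (at (snd c z))"
        by (intro has_derivative_Pair has_derivative_const has_derivative_ident)
    qed (simp add: G_def rz)
    ultimately have "(\<lambda>a. fderiv G (0, snd c z) (0, a)) = (\<lambda>a. (0, a))" by (rule has_derivative_unique)
    then show ?thesis by metis
  qed
  have "inj (fderiv G (0, snd c z))"
  proof (subst linear_injective_0[OF has_derivative_linear[OF DG]], intro allI impI)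
    fix v assume v: "fderiv G (0, snd c z) v = 0"
    then have "fst v = 0" using DG1[of v] by simp
    then show "v = 0" using DG2[of "snd v"] v by (metis prod.collapse)
  qed
  from smooth_inverse_function[OF E smG zE this] obtain U' V' g where
    U': "open U'" "U' \<subseteq> E" "(0, snd c z) \<in> U'" and V': "open V'" "G (0, snd c z) \<in> V'"
    and hom: "homeomorphism U' V' G g" and g: "smooth_on V' g" by metis
  have gG: "\<And>p. p \<in> U' \<Longrightarrow> g (G p) = p \<and> G p \<in> V'" and Gg: "\<And>p. p \<in> V' \<Longrightarrow> G (g p) = p \<and> g p \<in> U'"
    using hom by (auto simp: homeomorphism_def)
  have gz: "g (0, snd c z) = (0, snd c z)" using gG[OF U'(3)] Gz by simp
  \<comment> \<open>A product inside \<open>U'\<close>: injectivity of \<open>G\<close> is available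
    for every time in \<open>P\<close> and every base point in \<open>Q0\<close>.\<close>
  obtain P Q0 where PQ: "open P" "open Q0" "(0, snd c z) \<in> P \<times> Q0" "P \<times> Q0 \<subseteq> U'"
    using open_prod_elim[OF U'(1,3)] by metis
  define Q where "Q = Q0 \<inter> snd c ` (X \<inter> fst c)"
  have Q: "open Q" "snd c z \<in> Q"
    unfolding Q_def using PQ openin_mtop_image[OF A X(1) c'(1)] X(2) c by auto
  define X0 where "X0 = {x \<in> fst c. snd c x \<in> Q}"
  have X0: "openin (mtop A) X0" unfolding X0_def by (rule openin_chart_preimage[OF A c'(1) Q(1)])
  \<comment> \<open>The step equation evaluates \<open>\<Gamma>\<close> at the base point of the
    preimage of \<open>(x0, x1)\<close> in \<open>V\<close>. Restricting to base points in
    \<open>X0\<close> keeps that point where \<open>G\<close> is injective.\<close>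
  define V2 where "V2 = V \<inter> {w \<in> tcarrier A. fst w \<in> X0}"
  have V2: "openin (mtop (tan_atlas A)) V2"
    unfolding V2_def by (intro openin_Int smooth_mapD_openin[OF VR(1)] openin_fst_preimage[OF A X0])
  have RV2: "R ` V2 = R ` V \<inter> inv_into V R -` V2"
    using VR(2) by (auto simp: V2_def inv_into_f_f image_iff)
  have oRV2: "openin (mtop (prod_atlas A A)) (R ` V2)"
    unfolding RV2 by (rule smooth_map_preimage_open[OF AA TA VR(3) V2])
  have zV2: "zero_at z \<in> V2"
    using VD(2) c Q zero_at_tcarrier[OF A z] by (auto simp: V2_def X0_def)
  then have "R (zero_at z) \<in> R ` V2" by (rule imageI)
  then have "(z, z) \<in> R ` V2" using RD(4)[OF z] by simp
  then obtain W1 W' where W1: "openin (mtop A) W1" "openin (mtop A) W'" "z \<in> W1" "z \<in> W'" "W1 \<times> W' \<subseteq> R ` V2"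
    by (rule openin_prod_box[OF A A oRV2])
  let ?s = "\<lambda>p. snd (r (snd (g p), fst (g p) *\<^sub>R \<gamma> (snd (g p))))"
  have sms: "smooth_on V' ?s"
    by (rule smooth_on_snd[OF V'(1)], rule smooth_on_compose[OF V'(1) E smE g]) (use Gg U' in auto)
  \<comment> \<open>The pairs \<open>(h, x0)\<close> whose recovered base point lies in
    \<open>Q\<close> and whose end point lies in \<open>W'\<close>. As \<open>K\<close> is an open
    neighbourhood of \<open>(0, z)\<close>, one interval of times serves all \<open>x0\<close> near
    \<open>z\<close>.\<close>
  define K where "K = (V' \<inter> g -` (P \<times> Q)) \<inter> (V' \<inter> ?s -` (snd c ` (W' \<inter> fst c)))"
  have K: "open K" unfolding K_def
    by (intro open_Int continuous_open_preimage smooth_on_continuous g sms V'(1) open_Times PQ Q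
        openin_mtop_image[OF A W1(2) c'(1)])
  have "(0, snd c z) \<in> K"
    using V'(2) PQ Q W1(4) c gz rz[OF zC] by (auto simp: K_def Gz)
  then obtain P2 Q2 where PQ2: "open P2" "open Q2" "(0, snd c z) \<in> P2 \<times> Q2" "P2 \<times> Q2 \<subseteq> K"
    using open_prod_elim[OF K] by metis
  have "open (P \<inter> P2)" "0 \<in> P \<inter> P2" using PQ PQ2 by auto
  then obtain h0 where h0: "h0 > 0" "ball 0 h0 \<subseteq> P \<inter> P2" by (rule openE)
  define W where "W = W1 \<inter> {x \<in> fst c. snd c x \<in> Q2}"
  have W: "openin (mtop A) W" unfolding W_def
    by (intro openin_Int W1 openin_chart_preimage[OF A c'(1) PQ2(2)])
  show ?thesis
  proof (rule that[OF W W1(2) _ W1(4) _ h0(1)])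
    show "z \<in> W" using W1(3) PQ2 c by (simp add: W_def)
    show "W \<times> W' \<subseteq> R ` V" using W1(5) by (auto simp: W_def V2_def)
    fix h :: real assume h: "0 < h" "h < h0"
    then have hP: "h \<in> P" "h \<in> P2" using h0 by (auto simp: subset_iff)
    define \<psi> where "\<psi> x = chart_inv c (snd (g (h, snd c x)))" for x
    have key: "snd (g (h, u)) \<in> Q" "(h, snd (g (h, u))) \<in> E" "g (h, u) = (h, snd (g (h, u)))"
      "fst (r (snd (g (h, u)), h *\<^sub>R \<gamma> (snd (g (h, u))))) = u" "?s (h, u) \<in> snd c ` (W' \<inter> fst c)" "(h, u) \<in> V'"
      if "u \<in> Q2" for u
    proof -
      have k: "(h, u) \<in> K" using that hP PQ2(4) by auto
      then have v: "(h, u) \<in> V'" by (simp add: K_def)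
      have e: "G (g (h, u)) = (h, u)" "g (h, u) \<in> E" using Gg[OF v] U' by auto
      then have e': "fst (g (h, u)) = h" by (simp add: G_def)
      then show eq: "g (h, u) = (h, snd (g (h, u)))" by (simp add: prod_eq_iff)
      show "snd (g (h, u)) \<in> Q" "?s (h, u) \<in> snd c ` (W' \<inter> fst c)" "(h, u) \<in> V'"
        using k by (auto simp: K_def)
      show "(h, snd (g (h, u))) \<in> E" using e(2) eq by simp
      show "fst (r (snd (g (h, u)), h *\<^sub>R \<gamma> (snd (g (h, u))))) = u" using e(1) e' by (simp add: G_def)
    qed
    have QX: "chart_inv c u \<in> X \<and> chart_inv c u \<in> fst c" if "u \<in> Q" for u
      using that chart_inv_left[OF A c'(1)] by (auto simp: Q_def)
    have smg: "smooth_on Q2 (\<lambda>u. snd (g (h, u)))"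
      by (intro smooth_on_snd PQ2 smooth_on_compose[OF PQ2(2) V'(1) g] smooth_on_Pair smooth_on_const smooth_on_ident key)
    have "smooth_map A A W \<psi>"
    proof (rule smooth_mapI_local[OF A A W])
      fix x assume x: "x \<in> W"
      have o: "open (Q2 \<inter> C)" using PQ2 C by auto
      have "rep c c \<psi> u = snd (g (h, u))" if "u \<in> Q2 \<inter> C" for u
        using key(2)[of u] Eiff[of h "snd (g (h, u))"] that Cm by (simp add: \<psi>_def)
      then have "smooth_on (Q2 \<inter> C) (rep c c \<psi>)"
        using smooth_on_cong[OF o, of "rep c c \<psi>" "\<lambda>u. snd (g (h, u))"] smooth_on_subset[OF smg, of "Q2 \<inter> C"] by simp
      moreover have "\<psi> (chart_inv c u) \<in> fst c" if "u \<in> Q2 \<inter> C" for u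
        using key(1)[of u] QX that Cm by (simp add: \<psi>_def)
      moreover have "snd c x \<in> Q2 \<inter> C" "x \<in> fst c" using x by (auto simp: W_def C_def)
      ultimately show "\<exists>c d N. c \<in> A \<and> d \<in> A \<and> x \<in> fst c \<and> open N \<and> snd c x \<in> N \<and>
          (\<forall>u\<in>N. u \<in> snd c ` fst c \<longrightarrow> chart_inv c u \<in> W \<longrightarrow> \<psi> (chart_inv c u) \<in> fst d) \<and> smooth_on N (rep c d \<psi>)"
        using c' o by (intro exI[of _ c] exI[of _ "Q2 \<inter> C"]) simp
    qed
    moreover have "\<psi> x0 \<in> X \<and>
        scale h (\<Gamma> (\<psi> x0)) \<in> D \<and> fst (R (scale h (\<Gamma> (\<psi> x0)))) = x0 \<and> snd (R (scale h (\<Gamma> (\<psi> x0)))) \<in> W' \<and>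
        (\<forall>x1\<in>W'. step_equation D R V \<Gamma> h x0 x1 \<longleftrightarrow> x1 = snd (R (scale h (\<Gamma> (\<psi> x0)))))"
      if x0: "x0 \<in> W" for x0
    proof -
      have u: "snd c x0 \<in> Q2" "x0 \<in> fst c" "x0 \<in> W1" using x0 by (auto simp: W_def)
      define u where "u = snd (g (h, snd c x0))"
      have \<psi>u: "\<psi> x0 = chart_inv c u" by (simp add: \<psi>_def u_def)
      note k = key[OF u(1), folded u_def]
      define y where "y = scale h (\<Gamma> (\<psi> x0))"
      note e = Eiff[OF k(2), folded \<psi>u, folded y_def]
      have f: "fst (R y) = x0"
        using e k(4) u(2) inj_onD[OF atlas_inj[OF A c'(1)], of "fst (R y)" x0] by (simp add: y_def)
      have "fst (g (h, snd c x0)) = h" by (subst k(3)) simp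
      with e k(5) have "snd c (snd (R y)) \<in> snd c ` (W' \<inter> fst c)" by (simp add: y_def)
      then obtain w where w: "w \<in> W'" "w \<in> fst c" "snd c (snd (R y)) = snd c w" by auto
      then have "snd (R y) = w"
        using e inj_onD[OF atlas_inj[OF A c'(1)], of "snd (R y)" w] by (simp add: y_def)
      with w have s: "snd (R y) \<in> W'" by simp
      have \<psi>c: "\<psi> x0 \<in> carrier A" using QX[OF k(1)] c by (auto simp: \<psi>u intro: carrierI)
      have fy: "fst y = \<psi> x0" using \<Gamma>(2)[OF \<psi>c] by (simp add: y_def)
      have "step_equation D R V \<Gamma> h x0 x1 \<longleftrightarrow> x1 = snd (R y)" if x1: "x1 \<in> W'" for x1
      proof
        assume x1': "x1 = snd (R y)"
        then have "R y = (x0, x1)" using f by (simp add: prod_eq_iff)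
        then have "inv_into V R (x0, x1) = y" using inv_into_f_f[OF VR(2), of y] e by simp
        then show "step_equation D R V \<Gamma> h x0 x1"
          using fy e VD \<open>R y = (x0, x1)\<close> by (auto simp: step_equation_def Let_def y_def)
      next
        \<comment> \<open>Uniqueness: the base point \<open>x'\<close> of the preimage satisfies
          \<open>G (h, x') = (h, x0)\<close> in coordinates, and injectivity of \<open>G\<close> on
          \<open>U'\<close> identifies it with \<open>\<psi> x0\<close>.\<close>
        assume st: "step_equation D R V \<Gamma> h x0 x1"
        have "(x0, x1) \<in> R ` V2" using W1(5) u(3) x1 by auto
        then obtain y' where y': "y' \<in> V2" "R y' = (x0, x1)" by auto
        then have iv: "inv_into V R (x0, x1) = y'" using inv_into_f_f[OF VR(2), of y'] by (simp add: V2_def)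
        define x' where "x' = fst y'"
        have x': "x' \<in> fst c" "snd c x' \<in> Q" using y' by (auto simp: V2_def X0_def x'_def)
        have w: "R (scale h (\<Gamma> x')) = (x0, x1)" using st by (simp add: step_equation_def Let_def iv x'_def)
        have hU: "(h, snd c x') \<in> U'" using PQ(4) hP x' by (auto simp: Q_def)
        then have hE: "(h, snd c x') \<in> E" using U' by auto
        note e' = Eiff[OF hE, unfolded chart_inv_left[OF A c'(1) x'(1)] w]
        have "G (h, snd c x') = (h, snd c x0)" using e' by (simp add: G_def)
        then have "g (h, snd c x0) = (h, snd c x')" using gG[OF hU] by simp
        then have "\<psi> x0 = x'" by (simp add: \<psi>_def chart_inv_left[OF A c'(1) x'(1)])
        then show "x1 = snd (R y)" using w by (simp add: y_def)
      qed
      then show ?thesis using QX[OF k(1)] e VD f s by (auto simp: \<psi>u[symmetric] y_def[symmetric])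
    qed
    ultimately show "\<exists>\<psi>. smooth_map A A W \<psi> \<and> (\<forall>x0\<in>W. \<psi> x0 \<in> X \<and>
        scale h (\<Gamma> (\<psi> x0)) \<in> D \<and> fst (R (scale h (\<Gamma> (\<psi> x0)))) = x0 \<and> snd (R (scale h (\<Gamma> (\<psi> x0)))) \<in> W' \<and>
        (\<forall>x1\<in>W'. step_equation D R V \<Gamma> h x0 x1 \<longleftrightarrow> x1 = snd (R (scale h (\<Gamma> (\<psi> x0))))))" by blast
  qed
qed

section \<open>The Legendre map and the cotangent lift in charts\<close>

abbreviation lag :: "('q, 'e::euclidean_space) atlas \<Rightarrow> (('q, 'e) tbundle \<Rightarrow> real) \<Rightarrow> ('q, 'e) chart \<Rightarrow> 'e \<times> 'e \<Rightarrow> real" where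
  "lag A L c \<equiv> \<lambda>u. L (chart_inv (tchart A c) u)"

text \<open>The classical momentum \<open>\<partial>L/\<partial>v\<close> in the chart, as a vector
  instead of a functional.\<close>

definition pmap :: "('q, 'e::euclidean_space) atlas \<Rightarrow> (('q, 'e) tbundle \<Rightarrow> real) \<Rightarrow> ('q, 'e) chart \<Rightarrow> 'e \<times> 'e \<Rightarrow> 'e" where
  "pmap A L c u = (\<Sum>b\<in>Basis. fderiv (lag A L c) u (0, b) *\<^sub>R b)"

abbreviation cdom :: "('m, 'e) chart \<Rightarrow> 'e set" where
  "cdom c \<equiv> snd c ` fst c"

lemma open_cdom_UNIV: "smooth_atlas A \<Longrightarrow> c \<in> A \<Longrightarrow> open (cdom c \<times> UNIV)"
  by (intro open_Times atlas_open_dom open_UNIV)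

lemma tchart_cdom: "smooth_atlas A \<Longrightarrow> c \<in> A \<Longrightarrow> fst w \<in> fst c \<Longrightarrow> snd (tchart A c) w \<in> cdom c \<times> UNIV"
  by (simp add: snd_tchart)

lemma tchart_chart: "w \<in> tcarrier A \<Longrightarrow> chart_of A c (fst w) \<Longrightarrow> chart_of (tan_atlas A) (tchart A c) w"
  by (simp add: fst_tchart)

lemma cchart_chart: "w \<in> ccarrier A \<Longrightarrow> chart_of A c (fst w) \<Longrightarrow> chart_of (cot_atlas A) (cchart A c) w"
  by (simp add: fst_cchart)

lemma chart_inv_tchart_mem:
  "smooth_atlas A \<Longrightarrow> c \<in> A \<Longrightarrow> u \<in> cdom c \<times> UNIV \<Longrightarrow>
    chart_inv (tchart A c) u \<in> tcarrier A \<and> fst (chart_inv (tchart A c) u) = chart_inv c (fst u) \<and>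
    chart_inv c (fst u) \<in> fst c \<and> snd (tchart A c) (chart_inv (tchart A c) u) = u"
  using chart_inv_mem[of u "tchart A c"] chart_inv_right[of u "tchart A c"] chart_inv_tchart[of A c "fst u" "snd u"]
  by (auto simp: tchart_image_dom fst_tchart chart_inv_mem)

lemma tchart_inv_left: "smooth_atlas A \<Longrightarrow> w \<in> tcarrier A \<Longrightarrow> chart_of A c (fst w) \<Longrightarrow> chart_inv (tchart A c) (snd (tchart A c) w) = w"
  using chart_inv_left[OF smooth_atlas_tan, of A "tchart A c" w] tchart_chart[of w A c] by auto

lemma lag_smooth:
  assumes A: "smooth_atlas A" and L: "smooth_function (tan_atlas A) L" and c: "c \<in> A"
  shows "smooth_on (cdom c \<times> UNIV) (lag A L c)"
proof -
  have "smooth_map (tan_atlas A) real_atlas (tcarrier A) L" using L by (simp add: smooth_function_def)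
  from smooth_map_rep[OF this, of "tchart A c" "(UNIV, id)"]
  have "smooth_on (rep_dom (tchart A c) (UNIV, id) (tcarrier A) L) (lag A L c)"
    using c by (simp add: real_atlas_def)
  then show ?thesis
    by (rule smooth_on_subset)
      (use chart_inv_tchart_mem[OF A c] in \<open>auto simp: rep_dom_iff[OF smooth_atlas_tan[OF A]] c tchart_image_dom[OF A c]\<close>)
qed

lemma pmap_smooth:
  assumes "smooth_atlas A" "smooth_function (tan_atlas A) L" "c \<in> A"
  shows "smooth_on (cdom c \<times> UNIV) (pmap A L c)"
  unfolding pmap_def[abs_def]
  by (intro smooth_on_sum smooth_on_scaleR smooth_on_const smooth_on_fderiv lag_smooth[OF assms]
      open_cdom_UNIV[OF assms(1,3)])

lemma pmap_inner:
  assumes "smooth_atlas A" "smooth_function (tan_atlas A) L" "c \<in> A" "u \<in> cdom c \<times> UNIV"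
  shows "pmap A L c u \<bullet> v = fderiv (lag A L c) u (0, v)"
proof -
  have "linear (fderiv (lag A L c) u)" by (rule smooth_on_linear[OF lag_smooth[OF assms(1-3)] assms(4)])
  then have "linear (\<lambda>v. fderiv (lag A L c) u (0, v))"
    using linear_compose[of "\<lambda>v. (0, v)" "fderiv (lag A L c) u"] by (auto simp: o_def linear_iff)
  from linear_expand[OF this, of v] have "fderiv (lag A L c) u (0, v) = v \<bullet> pmap A L c u"
    by (simp add: pmap_def inner_sum_right mult.commute)
  then show ?thesis by (simp add: inner_commute)
qed

lemma fibre_rep_derivative:
  assumes A: "smooth_atlas A" and L: "smooth_function (tan_atlas A) L" and c: "chart_of A c q"
  shows "(fibre_rep A L c q has_derivative (\<lambda>b. fderiv (lag A L c) (snd c q, v) (0, b))) (at v)"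
proof -
  have "fibre_rep A L c q = (\<lambda>u. lag A L c (snd c q, u))"
    using c by (auto simp: fibre_rep_def chart_inv_tchart[OF A] chart_inv_left[OF A])
  moreover have "((\<lambda>u. lag A L c (snd c q, u)) has_derivative (\<lambda>b. fderiv (lag A L c) (snd c q, v) (0, b))) (at v)"
  proof (rule has_derivative_compose[of "\<lambda>u. (snd c q, u)" "\<lambda>b. (0, b)"])
    show "(lag A L c has_derivative fderiv (lag A L c) (snd c q, v)) (at (snd c q, v))"
      by (rule smooth_on_has_derivative[OF lag_smooth[OF A L]]) (use c in auto)
  qed (intro has_derivative_Pair has_derivative_const has_derivative_ident)
  ultimately show ?thesis by simp
qed

lemma fst_legendre [simp]: "fst (legendre A L w) = fst w"
  by (simp add: legendre_def case_prod_unfold)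

text \<open>\<open>legendre\<close> differentiates along the fibre in \<open>chart_at\<close>.
  Transition maps are linear on fibres, so the representatives of \<open>L\<close> on a fibre differ
  by a linear change of variable, and the chain rule moves the derivative to
  \<open>c\<close>.\<close>

lemma legendre_apply:
  assumes A: "smooth_atlas A" and L: "smooth_function (tan_atlas A) L" and w: "w \<in> tcarrier A"
    and c: "chart_of A c (fst w)" and \<xi>: "\<xi> \<in> tspace A (fst w)"
  shows "snd (legendre A L w) \<xi> = pmap A L c (snd (tchart A c) w) \<bullet> \<xi> c"
proof -
  obtain q v where qv: "w = (q, v)" by (cases w)
  have c: "chart_of A c q" and v: "v \<in> tspace A q" and \<xi>: "\<xi> \<in> tspace A q" using c w \<xi> by (auto simp: qv tcarrier_iff)
  define e where "e = chart_at A q"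
  have e: "chart_of A e q" unfolding e_def using c by (intro chart_at_in) (auto intro: carrierI)
  let ?\<tau> = "drep c e (\<lambda>x. x) q"
  have lin: "linear ?\<tau>" by (rule trans_linear[OF A c e])
  have "fibre_rep A L c q = (\<lambda>u. fibre_rep A L e q (?\<tau> u))"
  proof
    fix u
    have "tvec_of A c q u = tvec_of A e q (?\<tau> u)"
      by (rule tspace_eqI[OF _ _ e]) (use A c e in \<open>auto simp: trans_self tvec_of_apply\<close>)
    then show "fibre_rep A L c q u = fibre_rep A L e q (?\<tau> u)" by (simp add: fibre_rep_def)
  qed
  moreover have "((\<lambda>u. fibre_rep A L e q (?\<tau> u)) has_derivative
      (\<lambda>b. fderiv (lag A L e) (snd e q, ?\<tau> (v c)) (0, ?\<tau> b))) (at (v c))"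
    by (rule has_derivative_compose[OF linear_imp_has_derivative[OF lin] fibre_rep_derivative[OF A L e]])
  ultimately have "(\<lambda>b. fderiv (lag A L e) (snd e q, ?\<tau> (v c)) (0, ?\<tau> b)) = (\<lambda>b. fderiv (lag A L c) (snd c q, v c) (0, b))"
    using has_derivative_unique[OF fibre_rep_derivative[OF A L c, of "v c"]] by metis
  from fun_cong[OF this, of "\<xi> c"]
  have "fderiv (lag A L e) (snd e q, v e) (0, \<xi> e) = fderiv (lag A L c) (snd c q, v c) (0, \<xi> c)"
    using tspace_trans[OF v c e] tspace_trans[OF \<xi> c e] by simp
  moreover have "fderiv (fibre_rep A L e q) (v e) (\<xi> e) = fderiv (lag A L e) (snd e q, v e) (0, \<xi> e)"
    using fderiv_eq[OF fibre_rep_derivative[OF A L e]] by metis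
  ultimately show ?thesis using \<xi> c
    by (simp add: legendre_def qv e_def[symmetric] Let_def pmap_inner[OF A L] snd_tchart)
qed

lemma legendre_ccarrier:
  assumes A: "smooth_atlas A" and L: "smooth_function (tan_atlas A) L" and w: "w \<in> tcarrier A"
  shows "legendre A L w \<in> ccarrier A"
proof -
  obtain c where c: "chart_of A c (fst w)" using w by (auto simp: tcarrier_iff elim: carrierE)
  have ex: "snd (legendre A L w) \<in> extensional (tspace A (fst w))" by (simp add: legendre_def case_prod_unfold Let_def)
  have "snd (legendre A L w) (\<lambda>d. a *\<^sub>R \<xi> d + b *\<^sub>R \<eta> d) = a * snd (legendre A L w) \<xi> + b * snd (legendre A L w) \<eta>"
    if "\<xi> \<in> tspace A (fst w)" "\<eta> \<in> tspace A (fst w)" for \<xi> \<eta> a b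
    using legendre_apply[OF A L w c that(1)] legendre_apply[OF A L w c that(2)]
      legendre_apply[OF A L w c tspace_lincomb[OF A that]] by (simp add: inner_add_right)
  then have "snd (legendre A L w) \<in> cspace A (fst w)" using ex unfolding cspace_def by simp
  then show ?thesis using w by (simp add: ccarrier_iff tcarrier_iff)
qed

lemma momentum_legendre:
  assumes A: "smooth_atlas A" and L: "smooth_function (tan_atlas A) L" and w: "w \<in> tcarrier A"
    and c: "chart_of A c (fst w)"
  shows "momentum A c (legendre A L w) = pmap A L c (snd (tchart A c) w)"
  using A c by (simp add: momentum_def legendre_apply[OF A L w c] euclidean_representation)

lemma rep_legendre:
  assumes A: "smooth_atlas A" and L: "smooth_function (tan_atlas A) L" and c: "c \<in> A" and u: "u \<in> cdom c \<times> UNIV"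
  shows "rep (tchart A c) (cchart A c) (legendre A L) u = (fst u, pmap A L c u)"
  using chart_inv_tchart_mem[OF A c u] c momentum_legendre[OF A L, of "chart_inv (tchart A c) u" c] u
  by (simp add: snd_cchart) (auto simp: chart_inv_right)

lemma smooth_legendre:
  assumes A: "smooth_atlas A" and L: "smooth_function (tan_atlas A) L"
  shows "smooth_map (tan_atlas A) (cot_atlas A) (tcarrier A) (legendre A L)"
proof (rule smooth_mapI_local[OF smooth_atlas_tan[OF A] smooth_atlas_cot[OF A]])
  show "openin (mtop (tan_atlas A)) (tcarrier A)" using openin_carrier[OF smooth_atlas_tan[OF A]] by simp
  fix w assume w: "w \<in> tcarrier A"
  then obtain c where c: "chart_of A c (fst w)" by (auto simp: tcarrier_iff elim: carrierE)
  then have c': "c \<in> A" by simp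
  note o = open_cdom_UNIV[OF A c']
  have "smooth_on (cdom c \<times> UNIV) (\<lambda>u. (fst u, pmap A L c u))"
    by (intro smooth_on_Pair smooth_on_fst smooth_on_ident pmap_smooth A L c' o)
  then have "smooth_on (cdom c \<times> UNIV) (rep (tchart A c) (cchart A c) (legendre A L))"
    by (subst smooth_on_cong[OF o, where g = "\<lambda>u. (fst u, pmap A L c u)"]) (rule rep_legendre[OF A L c'])
  moreover have "legendre A L (chart_inv (tchart A c) u) \<in> fst (cchart A c)" if "u \<in> cdom c \<times> UNIV" for u
    using chart_inv_tchart_mem[OF A c' that] legendre_ccarrier[OF A L] by (simp add: fst_cchart)
  moreover have "snd (tchart A c) w \<in> cdom c \<times> UNIV" using c by (simp add: snd_tchart)
  ultimately show "\<exists>e d N. e \<in> tan_atlas A \<and> d \<in> cot_atlas A \<and> w \<in> fst e \<and> open N \<and> snd e w \<in> N \<and>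
      (\<forall>u\<in>N. u \<in> snd e ` fst e \<longrightarrow> chart_inv e u \<in> tcarrier A \<longrightarrow> legendre A L (chart_inv e u) \<in> fst d) \<and>
      smooth_on N (rep e d (legendre A L))"
    using c o w by (intro exI[of _ "tchart A c"] exI[of _ "cchart A c"] exI[of _ "cdom c \<times> UNIV"]) (simp add: fst_tchart)
qed

lemma drep_legendre:
  assumes A: "smooth_atlas A" and L: "smooth_function (tan_atlas A) L" and w: "w \<in> tcarrier A"
    and c: "chart_of A c (fst w)"
  shows "drep (tchart A c) (cchart A c) (legendre A L) w v = (fst v, fderiv (pmap A L c) (snd (tchart A c) w) v)"
proof -
  have c': "c \<in> A" using c by simp
  have i: "snd (tchart A c) w \<in> cdom c \<times> UNIV" using c by (simp add: snd_tchart)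
  have "drep (tchart A c) (cchart A c) (legendre A L) w = fderiv (\<lambda>u. (fst u, pmap A L c u)) (snd (tchart A c) w)"
    by (rule fderiv_cong[OF open_cdom_UNIV[OF A c'] i rep_legendre[OF A L c']])
  also have "\<dots> = (\<lambda>v. (fst v, fderiv (pmap A L c) (snd (tchart A c) w) v))"
    by (rule fderiv_eq, intro has_derivative_Pair has_derivative_fst has_derivative_ident
        smooth_on_has_derivative[OF pmap_smooth[OF A L c'] i])
  finally show ?thesis by simp
qed

text \<open>The fibre Hessian of \<open>L\<close> is, up to transposition, the matrix of the
  vertical derivative of the momentum. Later arguments take regularity in this matrix-free
  form.\<close>

lemma regular_inj:
  fixes A :: "('q, real^'n) atlas"
  assumes A: "smooth_atlas A" and L: "smooth_function (tan_atlas A) L" and reg: "regular A L"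
    and w: "w \<in> tcarrier A" and c: "chart_of A c (fst w)"
    and b: "fderiv (pmap A L c) (snd (tchart A c) w) (0, b) = 0"
  shows "b = 0"
proof -
  let ?H = "fibre_hessian A L c w" and ?u = "snd (tchart A c) w"
  have c': "c \<in> A" using c by simp
  have u: "?u \<in> cdom c \<times> UNIV" using c by (simp add: snd_tchart)
  note sm = pmap_smooth[OF A L c']
  have H: "?H $ i $ j = fderiv (pmap A L c) ?u (0, axis i 1) $ j" for i j
  proof -
    have ax: "axis j (1::real) \<in> Basis" by (simp add: axis_in_Basis_iff)
    have "fderiv (fibre_rep A L c (fst w)) u (axis j 1) = fderiv (lag A L c) (snd c (fst w), u) (0, axis j 1)" for u
      using fderiv_eq[OF fibre_rep_derivative[OF A L c, of u]] by metis
    moreover have "fderiv (lag A L c) (snd c (fst w), u) (0, axis j 1) = pmap A L c (snd c (fst w), u) $ j" for u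
      using pmap_inner[OF A L c', of "(snd c (fst w), u)" "axis j 1"] c by (simp add: inner_axis)
    ultimately have "?H $ i $ j = fderiv (\<lambda>u. pmap A L c (snd c (fst w), u) $ j) (snd w c) (axis i 1)"
      by (simp add: fibre_hessian_def case_prod_unfold)
    also have "((\<lambda>u. pmap A L c (snd c (fst w), u) $ j) has_derivative
        (\<lambda>v. fderiv (pmap A L c) ?u (0, v) $ j)) (at (snd w c))"
    proof (rule bounded_linear.has_derivative[OF bounded_linear_vec_nth],
        rule has_derivative_compose[of "\<lambda>u. (snd c (fst w), u)" "\<lambda>b. (0, b)"])
      show "(pmap A L c has_derivative fderiv (pmap A L c) ?u) (at (snd c (fst w), snd w c))"
        using smooth_on_has_derivative[OF sm u] by (simp add: snd_tchart)
    qed (intro has_derivative_Pair has_derivative_const has_derivative_ident)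
    from fderiv_eq[OF this] have "fderiv (\<lambda>u. pmap A L c (snd c (fst w), u) $ j) (snd w c) (axis i 1) =
        fderiv (pmap A L c) ?u (0, axis i 1) $ j" by metis
    finally show ?thesis .
  qed
  have lin: "linear (fderiv (pmap A L c) ?u)" by (rule smooth_on_linear[OF sm u])
  have "transpose ?H *v b = fderiv (pmap A L c) ?u (0, b)"
  proof (subst vec_eq_iff, intro allI)
    fix j
    have b: "(0, b) = (\<Sum>i\<in>UNIV. b $ i *\<^sub>R ((0::real^'n), axis i (1::real)))"
      using basis_expansion[of b] by (simp add: prod_eq_iff fst_sum snd_sum scalar_mult_eq_scaleR)
    have "fderiv (pmap A L c) ?u (0, b) = (\<Sum>i\<in>UNIV. b $ i *\<^sub>R fderiv (pmap A L c) ?u (0, axis i 1))"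
      unfolding b by (simp add: linear_sum[OF lin] linear_cmul[OF lin] del: scaleR_Pair)
    then show "(transpose ?H *v b) $ j = fderiv (pmap A L c) ?u (0, b) $ j"
      by (simp add: matrix_vector_mult_def transpose_def H mult.commute)
  qed
  moreover have "invertible (transpose ?H)"
    using reg w c by (auto simp: regular_def charts_at_iff invertible_det_nz det_transpose)
  ultimately show "b = 0" using b inj_matrix_vector_mult[of "transpose ?H"]
    by (metis injD matrix_vector_mult_0_right)
qed

text \<open>The derivative of \<open>p a = \<sigma>(q, p) (D\<tau>(q) a)\<close>, where \<open>\<tau>\<close> is a transition map of \<open>A\<close> and \<open>(\<tau>, \<sigma>)\<close> the
  transition map of the cotangent bundle.\<close>
lemma cot_trans_deriv:
  assumes A: "smooth_atlas A" and w: "w \<in> ccarrier A" and c: "chart_of A c (fst w)" and d: "chart_of A d (fst w)"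
  shows "snd v \<bullet> a =
      momentum A d w \<bullet> fderiv (\<lambda>q. fderiv (rep c d (\<lambda>x. x)) q a) (snd c (fst w)) (fst v)
      + snd (drep (cchart A c) (cchart A d) (\<lambda>x. x) w v) \<bullet> drep c d (\<lambda>x. x) (fst w) a"
    and "fst (drep (cchart A c) (cchart A d) (\<lambda>x. x) w v) = drep c d (\<lambda>x. x) (fst w) (fst v)"
proof -
  note CA = smooth_atlas_cot[OF A]
  have c': "c \<in> A" "d \<in> A" using c d by auto
  let ?S = "snd c ` (fst c \<inter> fst d)"
  let ?S2 = "?S \<times> (UNIV :: 'b set)"
  have o: "open ?S" by (rule atlas_open[OF A c'])
  have o2: "open ?S2" by (intro open_Times o open_UNIV)
  let ?r = "rep (cchart A c) (cchart A d) (\<lambda>x. x)"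
  have eqS: "snd (cchart A c) ` (fst (cchart A c) \<inter> fst (cchart A d)) = ?S2"
    unfolding cchart_Int by (rule cchart_image[OF A c'(1)])
  have smr: "smooth_on ?S2 ?r"
    using transition_smooth[OF CA, of "cchart A c" "cchart A d"] c' unfolding eqS by simp
  have tr: "smooth_on ?S (rep c d (\<lambda>x. x))" by (rule transition_smooth[OF A c'])
  let ?p = "(snd c (fst w), momentum A c w)"
  have p: "?p \<in> ?S2" using c d by auto
  have p': "snd (cchart A c) w = ?p" by (simp add: snd_cchart)
  note T = transition_smooth[OF A c']
  have g1: "smooth_on ?S2 (\<lambda>u. snd (?r u))" by (rule smooth_on_snd[OF o2 smr])
  have g2: "smooth_on ?S2 (\<lambda>u. fderiv (rep c d (\<lambda>x. x)) (fst u) a)"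
    by (intro smooth_on_fderiv_apply[OF o2 o T] smooth_on_fst smooth_on_ident o2 smooth_on_const) auto
  have inv: "chart_inv (cchart A c) ?p = w"
    using chart_inv_left[OF CA, of "cchart A c" w] cchart_chart[OF w c] p' by auto
  have id: "snd (?r u) \<bullet> fderiv (rep c d (\<lambda>x. x)) (fst u) a = snd u \<bullet> a" if u: "u \<in> ?S2" for u
  proof -
    have q: "fst u \<in> cdom c" "chart_inv c (fst u) \<in> fst d" "chart_inv c (fst u) \<in> fst c"
      using u by (auto simp: chart_inv_left[OF A c'(1)])
    let ?w = "chart_inv (cchart A c) u"
    have w': "?w = (chart_inv c (fst u), covec_of A c (chart_inv c (fst u)) (snd u))"
      using chart_inv_cchart[OF A c'(1) q(1), of "snd u"] by simp
    have "?w \<in> ccarrier A" "chart_of A c (fst ?w)" "chart_of A d (fst ?w)"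
      using q c' by (auto simp: w' ccarrier_iff covec_of_cspace[OF A] intro: carrierI)
    from momentum_change[OF A this, of a] show ?thesis
      using q c' A by (simp add: snd_cchart) (simp add: w' chart_inv_right)
  qed
  have "fderiv (\<lambda>u. snd (?r u) \<bullet> fderiv (rep c d (\<lambda>x. x)) (fst u) a) ?p v = fderiv (\<lambda>u. snd u \<bullet> a) ?p v"
    using fderiv_cong[OF o2 p id] by simp
  also have "\<dots> = snd v \<bullet> a"
    by (subst fderiv_eq, rule has_derivative_inner_left, rule has_derivative_snd, rule has_derivative_ident) simp
  finally have "snd v \<bullet> a = snd (?r ?p) \<bullet> fderiv (\<lambda>u. fderiv (rep c d (\<lambda>x. x)) (fst u) a) ?p v
      + fderiv (\<lambda>u. snd (?r u)) ?p v \<bullet> fderiv (rep c d (\<lambda>x. x)) (fst ?p) a"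
    unfolding fderiv_inner[OF g1 g2 p] by simp
  moreover have "fderiv (\<lambda>u. snd (?r u)) ?p v = snd (fderiv ?r ?p v)"
    using fderiv_eq[OF has_derivative_snd[OF smooth_on_has_derivative[OF smr p]]] by metis
  moreover have "fderiv (\<lambda>u. fderiv (rep c d (\<lambda>x. x)) (fst u) a) ?p v =
      fderiv (\<lambda>q. fderiv (rep c d (\<lambda>x. x)) q a) (snd c (fst w)) (fst v)"
  proof -
    have "fderiv (\<lambda>u. fderiv (rep c d (\<lambda>x. x)) (fst u) a) ?p v =
        fderiv (\<lambda>q. fderiv (rep c d (\<lambda>x. x)) q a) (fst ?p) (fderiv fst ?p v)"
      by (rule fderiv_compose[OF smooth_on_fst[OF o2 smooth_on_ident[OF o2]] p smooth_on_fderiv[OF T]]) (use c d in auto)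
    moreover have "fderiv fst ?p = fst" by (rule fderiv_eq[OF has_derivative_fst[OF has_derivative_ident]])
    ultimately show ?thesis by simp
  qed
  ultimately show "snd v \<bullet> a =
      momentum A d w \<bullet> fderiv (\<lambda>q. fderiv (rep c d (\<lambda>x. x)) q a) (snd c (fst w)) (fst v)
      + snd (drep (cchart A c) (cchart A d) (\<lambda>x. x) w v) \<bullet> drep c d (\<lambda>x. x) (fst w) a"
    by (simp add: p' inv) (simp add: snd_cchart)
  have "fderiv (\<lambda>u. fst (?r u)) ?p v = fst (fderiv ?r ?p v)"
    using fderiv_eq[OF has_derivative_fst[OF smooth_on_has_derivative[OF smr p]]] by metis
  moreover have "fderiv (\<lambda>u. fst (?r u)) ?p = fderiv (\<lambda>u. rep c d (\<lambda>x. x) (fst u)) ?p"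
    by (rule fderiv_cong[OF o2 p]) (use cchart_trans[OF A c'] in auto)
  moreover have "fderiv (\<lambda>u. rep c d (\<lambda>x. x) (fst u)) ?p v = fderiv (rep c d (\<lambda>x. x)) (fst ?p) (fderiv fst ?p v)"
    by (rule fderiv_compose[OF smooth_on_fst[OF o2 smooth_on_ident[OF o2]] p T]) (use c d in auto)
  moreover have "fderiv fst ?p = fst" by (rule fderiv_eq[OF has_derivative_fst[OF has_derivative_ident]])
  ultimately show "fst (drep (cchart A c) (cchart A d) (\<lambda>x. x) w v) = drep c d (\<lambda>x. x) (fst w) (fst v)"
    by (simp add: p')
qed

section \<open>Chart independence of the symplectic form and of \<open>alpha\<close>\<close>

lemma trans_symmetric:
  assumes A: "smooth_atlas A" and c: "chart_of A c x" and d: "chart_of A d x"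
  shows "fderiv (\<lambda>q. fderiv (rep c d (\<lambda>x. x)) q a) (snd c x) b = fderiv (\<lambda>q. fderiv (rep c d (\<lambda>x. x)) q b) (snd c x) a"
  by (rule fderiv_symmetric[OF atlas_open[OF A] transition_smooth[OF A]]) (use c d in auto)

text \<open>In the new chart each of the two terms acquires a second derivative of the transition
  map; by symmetry the two contributions are equal and cancel.\<close>

lemma omega_coord:
  assumes A: "smooth_atlas A" and w: "w \<in> ccarrier A" and c: "chart_of A c (fst w)"
    and X: "X \<in> tspace (cot_atlas A) w" and Y: "Y \<in> tspace (cot_atlas A) w"
  shows "omega A w X Y = fst (X (cchart A c)) \<bullet> snd (Y (cchart A c)) - fst (Y (cchart A c)) \<bullet> snd (X (cchart A c))"
proof -
  define d where "d = chart_at A (fst w)"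
  have d: "chart_of A d (fst w)" unfolding d_def using w by (intro chart_at_in) (simp add: ccarrier_iff)
  let ?c = "cchart A c" and ?d = "cchart A d"
  have Xd: "X ?d = drep ?c ?d (\<lambda>x. x) w (X ?c)" "Y ?d = drep ?c ?d (\<lambda>x. x) w (Y ?c)"
    using tspace_trans[OF X cchart_chart[OF w c] cchart_chart[OF w d]]
      tspace_trans[OF Y cchart_chart[OF w c] cchart_chart[OF w d]] by auto
  note k = cot_trans_deriv[OF A w c d]
  have "omega A w X Y = fst (X ?d) \<bullet> snd (Y ?d) - fst (Y ?d) \<bullet> snd (X ?d)"
    by (simp add: omega_def d_def Let_def)
  also have "\<dots> = snd (Y ?d) \<bullet> drep c d (\<lambda>x. x) (fst w) (fst (X ?c)) - snd (X ?d) \<bullet> drep c d (\<lambda>x. x) (fst w) (fst (Y ?c))"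
    unfolding Xd k(2) by (simp add: inner_commute)
  also have "\<dots> = snd (Y ?c) \<bullet> fst (X ?c) - snd (X ?c) \<bullet> fst (Y ?c)"
    unfolding Xd k(1)[of "X ?c" "fst (Y ?c)"] k(1)[of "Y ?c" "fst (X ?c)"]
      trans_symmetric[OF A c d, of "fst (X ?c)" "fst (Y ?c)"] by simp
  finally show ?thesis by (simp add: inner_commute)
qed

text \<open>The Legendre map is the identity on base coordinates, so it pulls
  \<open>dq \<and> dp\<close> back to \<open>dq \<and> d(\<partial>L/\<partial>v)\<close>.\<close>

lemma Omega_L_coord:
  assumes A: "smooth_atlas A" and L: "smooth_function (tan_atlas A) L" and w: "w \<in> tcarrier A"
    and c: "chart_of A c (fst w)" and X: "X \<in> tspace (tan_atlas A) w" and Y: "Y \<in> tspace (tan_atlas A) w"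
  shows "Omega_L A L w X Y =
    fst (X (tchart A c)) \<bullet> fderiv (pmap A L c) (snd (tchart A c) w) (Y (tchart A c))
    - fst (Y (tchart A c)) \<bullet> fderiv (pmap A L c) (snd (tchart A c) w) (X (tchart A c))"
proof -
  note TA = smooth_atlas_tan[OF A] and CA = smooth_atlas_cot[OF A] and FL = smooth_legendre[OF A L]
  note t = tmap_at_tspace[OF TA CA FL w]
  have lc: "legendre A L w \<in> ccarrier A" "chart_of A c (fst (legendre A L w))"
    using legendre_ccarrier[OF A L w] c by auto
  have "Omega_L A L w X Y = omega A (legendre A L w) (tmap_at (tan_atlas A) (cot_atlas A) (legendre A L) w X)
      (tmap_at (tan_atlas A) (cot_atlas A) (legendre A L) w Y)"
    by (simp add: Omega_L_def pullback2_def)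
  also note omega_coord[OF A lc t[OF X] t[OF Y]]
  finally show ?thesis
    using tmap_at_coord[OF TA CA FL w tchart_chart[OF w c] cchart_chart[OF lc]] X Y
    by (simp add: drep_legendre[OF A L w c])
qed

text \<open>This differentiates \<open>(q, u) \<mapsto> (\<tau> q, D\<tau>(q) u)\<close>. The second
  derivative of \<tau> is paired with the vector part of \<open>w\<close>, so that term vanishes on
  the zero section.\<close>

lemma tan_trans_deriv:
  assumes A: "smooth_atlas A" and w: "w \<in> tcarrier A" and c: "chart_of A c (fst w)" and d: "chart_of A d (fst w)"
  shows "drep (tchart A c) (tchart A d) (\<lambda>x. x) w (a, b) =
    (drep c d (\<lambda>x. x) (fst w) a,
     fderiv (\<lambda>q. fderiv (rep c d (\<lambda>x. x)) q (snd w c)) (snd c (fst w)) a + drep c d (\<lambda>x. x) (fst w) b)"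
proof -
  have c': "c \<in> A" "d \<in> A" using c d by auto
  let ?S = "snd c ` (fst c \<inter> fst d)"
  let ?S2 = "?S \<times> (UNIV :: 'b set)"
  have o: "open ?S" by (rule atlas_open[OF A c'])
  have o2: "open ?S2" by (intro open_Times o open_UNIV)
  note T = transition_smooth[OF A c']
  have p: "snd (tchart A c) w \<in> ?S2" using c d by (auto simp: snd_tchart)
  have q: "snd c (fst w) \<in> ?S" using c d by auto
  let ?F = "\<lambda>u. fderiv (rep c d (\<lambda>x. x)) (fst u) (snd u)"
  have sm: "smooth_on ?S2 ?F" "smooth_on ?S2 (\<lambda>u. rep c d (\<lambda>x. x) (fst u))"
    by (intro smooth_on_fderiv_apply[OF o2 o T] smooth_on_compose[OF o2 o T] smooth_on_fst smooth_on_snd smooth_on_ident o2; auto)+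
  have "drep (tchart A c) (tchart A d) (\<lambda>x. x) w = fderiv (\<lambda>u. (rep c d (\<lambda>x. x) (fst u), ?F u)) (snd (tchart A c) w)"
    by (rule fderiv_cong[OF o2 p]) (use tchart_trans[OF A c'] in auto)
  then have "drep (tchart A c) (tchart A d) (\<lambda>x. x) w (a, b) =
      (fderiv (\<lambda>u. rep c d (\<lambda>x. x) (fst u)) (snd (tchart A c) w) (a, b), fderiv ?F (snd (tchart A c) w) (a, b))"
    using fderiv_Pair[OF sm(2,1) p] by simp
  moreover have "fderiv ?F (snd (tchart A c) w) (a, b) =
      fderiv (\<lambda>q. fderiv (rep c d (\<lambda>x. x)) q (snd w c)) (snd c (fst w)) a + drep c d (\<lambda>x. x) (fst w) b"
    unfolding snd_tchart by (rule fderiv_apply_derivative[OF o T q])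
  moreover have "fderiv (\<lambda>u. rep c d (\<lambda>x. x) (fst u)) (snd (tchart A c) w) (a, b) =
      fderiv (rep c d (\<lambda>x. x)) (fst (snd (tchart A c) w)) (fderiv fst (snd (tchart A c) w) (a, b))"
    by (rule fderiv_compose[OF smooth_on_fst[OF o2 smooth_on_ident[OF o2]] p T]) (use q in \<open>simp add: snd_tchart\<close>)
  moreover have "fderiv fst (snd (tchart A c) w) = fst" by (rule fderiv_eq[OF has_derivative_fst[OF has_derivative_ident]])
  ultimately show ?thesis by (simp add: snd_tchart)
qed

text \<open>\<open>alpha\<close> permutes coordinates in one chart. It is canonical because the
  second-derivative terms in the transition maps of \<open>TT*Q\<close> and of \<open>T*TQ\<close>
  match.\<close>

lemma alpha_coord:
  assumes A: "smooth_atlas A" and t: "t \<in> tcarrier (cot_atlas A)" and c: "chart_of A c (fst (fst t))"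
  shows "alpha A t \<in> ccarrier (tan_atlas A)"
    and "fst (alpha A t) = (fst (fst t), tvec_of A c (fst (fst t)) (fst (snd t (cchart A c))))"
    and "momentum (tan_atlas A) (tchart A c) (alpha A t) = (snd (snd t (cchart A c)), momentum A c (fst t))"
proof -
  note TA = smooth_atlas_tan[OF A] and CA = smooth_atlas_cot[OF A]
  obtain w X where wX: "t = (w, X)" by (cases t)
  have w: "w \<in> ccarrier A" and X: "X \<in> tspace (cot_atlas A) w" using t by (auto simp: wX tcarrier_iff)
  define q where "q = fst w"
  have q: "fst w = q" by (simp add: q_def)
  define d where "d = chart_at A q"
  have c: "chart_of A c q" using c by (simp add: wX q)
  have d: "chart_of A d q" unfolding d_def using w by (intro chart_at_in) (simp add: ccarrier_iff q)
  let ?c = "cchart A c" and ?d = "cchart A d"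
  define u where "u = (q, tvec_of A d q (fst (X ?d)))"
  have u: "u \<in> tcarrier A" using A d by (auto simp: u_def tcarrier_iff intro: carrierI)
  have fu: "fst u = q" by (simp add: u_def)
  have im: "(snd d q, fst (X ?d)) \<in> snd (tchart A d) ` fst (tchart A d)"
    using d by (auto simp: tchart_image_dom[OF A])
  have "alpha A t = chart_inv (cchart (tan_atlas A) (tchart A d)) ((snd d q, fst (X ?d)), (snd (X ?d), momentum A d w))"
    by (simp add: alpha_def wX q d_def[symmetric] snd_tchart snd_cchart Let_def case_prod_unfold)
  also have "\<dots> = (u, covec_of (tan_atlas A) (tchart A d) u (snd (X ?d), momentum A d w))"
    using chart_inv_cchart[OF TA tchart_in im] d
    by (simp add: u_def chart_inv_tchart[OF A] chart_inv_left[OF A])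
  finally have al: "alpha A t = (u, covec_of (tan_atlas A) (tchart A d) u (snd (X ?d), momentum A d w))" .
  show ac: "alpha A t \<in> ccarrier (tan_atlas A)" using u by (simp add: al ccarrier_iff covec_of_cspace[OF TA])
  have Xd: "X ?d = drep ?c ?d (\<lambda>x. x) w (X ?c)"
    by (rule tspace_trans[OF X]) (use cchart_chart[OF w] c d q in auto)
  note k = cot_trans_deriv[OF A w, of c d, unfolded q, OF c d]
  have fX: "fst (X ?d) = drep c d (\<lambda>x. x) q (fst (X ?c))" unfolding Xd k(2) ..
  have tv: "tvec_of A d q (fst (X ?d)) = tvec_of A c q (fst (X ?c))"
    by (rule tspace_eqI[OF _ _ d]) (use A c d fX in \<open>auto simp: tvec_of_apply trans_self\<close>)
  show "fst (alpha A t) = (fst (fst t), tvec_of A c (fst (fst t)) (fst (snd t (cchart A c))))"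
    unfolding al by (simp add: u_def wX q tv)
  have uc: "chart_of A c (fst u)" "chart_of A d (fst u)" using c d by (simp_all add: u_def)
  have suc: "snd u c = fst (X ?c)" using tv A c by (simp add: u_def)
  have md: "momentum (tan_atlas A) (tchart A d) (alpha A t) = (snd (X ?d), momentum A d w)"
    using momentum_covec_of[OF TA, of "tchart A d" u] tchart_chart[OF u uc(2)] by (simp add: al)
  \<comment> \<open>Tested against \<open>(a, b)\<close>, the passage to the chart over
    \<open>d\<close> brings in a second derivative of the transition, which
    \<open>cot_trans_deriv\<close> and symmetry absorb into
    \<open>snd (X ?c) \<bullet> a\<close>.\<close>
  have "momentum (tan_atlas A) (tchart A c) (alpha A t) \<bullet> (a, b) = (snd (X ?c), momentum A c w) \<bullet> (a, b)" for a b
  proof -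
    have "momentum (tan_atlas A) (tchart A c) (alpha A t) \<bullet> (a, b) =
        momentum (tan_atlas A) (tchart A d) (alpha A t) \<bullet> drep (tchart A c) (tchart A d) (\<lambda>x. x) u (a, b)"
      using momentum_change[OF TA ac, of "tchart A c" "tchart A d" "(a, b)"] tchart_chart[OF u] uc by (simp add: al)
    also have "\<dots> = snd (X ?d) \<bullet> drep c d (\<lambda>x. x) q a +
        (momentum A d w \<bullet> fderiv (\<lambda>x. fderiv (rep c d (\<lambda>x. x)) x (fst (X ?c))) (snd c q) a
         + momentum A d w \<bullet> drep c d (\<lambda>x. x) q b)"
      unfolding md tan_trans_deriv[OF A u uc] fu suc by (simp add: inner_add_right)
    also have "momentum A d w \<bullet> drep c d (\<lambda>x. x) q b = momentum A c w \<bullet> b"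
      using momentum_change[OF A w, of c d b] c d q by simp
    also have "snd (X ?d) \<bullet> drep c d (\<lambda>x. x) q a +
        (momentum A d w \<bullet> fderiv (\<lambda>x. fderiv (rep c d (\<lambda>x. x)) x (fst (X ?c))) (snd c q) a + momentum A c w \<bullet> b) =
        snd (X ?c) \<bullet> a + momentum A c w \<bullet> b"
      unfolding k(1)[of "X ?c" a] Xd trans_symmetric[OF A c d, of a "fst (X ?c)"] by simp
    finally show ?thesis by simp
  qed
  then have "\<forall>ab. momentum (tan_atlas A) (tchart A c) (alpha A t) \<bullet> ab = (snd (X ?c), momentum A c w) \<bullet> ab" by auto
  then show "momentum (tan_atlas A) (tchart A c) (alpha A t) = (snd (snd t (cchart A c)), momentum A c (fst t))"
    unfolding vector_eq_rdot by (simp add: wX)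
qed

section \<open>The cotangent lift in charts\<close>

text \<open>This turns the condition in \<open>cot_lift_dom\<close> into one on a Euclidean
  derivative, where \<open>open_inj_fderiv\<close> applies.\<close>

lemma tinvertible_iff:
  fixes A :: "('m, 'e::euclidean_space) atlas" and B :: "('k, 'e) atlas"
  assumes A: "smooth_atlas A" and B: "smooth_atlas B" and F: "smooth_map A B S F" and x: "x \<in> S"
    and c: "chart_of A c x" and d: "chart_of B d (F x)"
  shows "tinvertible A B F x \<longleftrightarrow> inj (drep c d F x)"
proof
  have lin: "linear (drep c d F x)" by (rule drep_linear[OF F x c d])
  note t = tmap_at_coord[OF A B F x c d]
  assume i: "tinvertible A B F x"
  show "inj (drep c d F x)"
  proof (rule injI)
    fix u v assume uv: "drep c d F x u = drep c d F x v"
    have ts: "tvec_of A c x u \<in> tspace A x" "tvec_of A c x v \<in> tspace A x" using A c by auto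
    have "tmap_at A B F x (tvec_of A c x u) = tmap_at A B F x (tvec_of A c x v)"
      by (rule tspace_eqI[OF tmap_at_tspace[OF A B F x ts(1)] tmap_at_tspace[OF A B F x ts(2)] d])
        (use uv A c in \<open>simp add: t[OF ts(1)] t[OF ts(2)]\<close>)
    then have "tvec_of A c x u = tvec_of A c x v"
      using i ts unfolding tinvertible_def bij_betw_def by (blast dest: inj_onD)
    then show "u = v" using tvec_of_self[OF A c] by metis
  qed
next
  have lin: "linear (drep c d F x)" by (rule drep_linear[OF F x c d])
  note t = tmap_at_coord[OF A B F x c d]
  assume i: "inj (drep c d F x)"
  then have s: "surj (drep c d F x)" by (rule linear_inj_imp_surj_self[OF lin])
  show "tinvertible A B F x" unfolding tinvertible_def
  proof (rule bij_betw_imageI)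
    show "inj_on (tmap_at A B F x) (tspace A x)"
    proof (rule inj_onI)
      fix \<xi> \<eta> assume xy: "\<xi> \<in> tspace A x" "\<eta> \<in> tspace A x" "tmap_at A B F x \<xi> = tmap_at A B F x \<eta>"
      then have "drep c d F x (\<xi> c) = drep c d F x (\<eta> c)" using t by metis
      then have "\<xi> c = \<eta> c" using i by (auto dest: injD)
      then show "\<xi> = \<eta>" by (rule tspace_eqI[OF xy(1,2) c])
    qed
    show "tmap_at A B F x ` tspace A x = tspace B (F x)"
    proof
      show "tmap_at A B F x ` tspace A x \<subseteq> tspace B (F x)" using tmap_at_tspace[OF A B F x] by auto
      show "tspace B (F x) \<subseteq> tmap_at A B F x ` tspace A x"
      proof
        fix \<eta> assume \<eta>: "\<eta> \<in> tspace B (F x)"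
        obtain u where u: "\<eta> d = drep c d F x u" using s by (metis surjD)
        have "tmap_at A B F x (tvec_of A c x u) = \<eta>"
          by (rule tmap_at_eqI[OF A B F x c d _ \<eta>]) (use A c u in auto)
        then show "\<eta> \<in> tmap_at A B F x ` tspace A x" using A c by force
      qed
    qed
  qed
qed

lemma Phi_apply:
  assumes A: "smooth_atlas A" and m: "m0 \<in> ccarrier A" "m1 \<in> ccarrier A"
    and d: "chart_of A d0 (fst m0)" "chart_of A d1 (fst m1)"
    and \<zeta>: "\<zeta> \<in> tspace (prod_atlas A A) (fst m0, fst m1)"
  shows "snd (Phi A (m0, m1)) \<zeta> =
    - (momentum A d0 m0 \<bullet> fst (\<zeta> (prod_chart d0 d1))) + momentum A d1 m1 \<bullet> snd (\<zeta> (prod_chart d0 d1))"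
proof -
  note AA = smooth_atlas_prod[OF A A]
  let ?e = "prod_chart d0 d1" and ?x = "(fst m0, fst m1)"
  have e: "chart_of (prod_atlas A A) ?e ?x" using d by simp
  have x: "?x \<in> carrier (prod_atlas A A)" using m by (simp add: ccarrier_iff)
  note fs = smooth_map_fst_snd[OF A A]
  have e': "?e \<in> prod_atlas A A" using e by simp
  have r: "chart_inv ?e u \<in> fst ?e \<and> snd ?e (chart_inv ?e u) = u" if "u \<in> snd ?e ` fst ?e" for u
    using that by (simp add: chart_inv_mem chart_inv_right del: snd_prod_chart fst_prod_chart)
  have i: "snd ?e ?x \<in> snd ?e ` fst ?e" using e by blast
  have "drep ?e d0 fst ?x = fderiv fst (snd ?e ?x)"
    by (rule fderiv_cong[OF atlas_open_dom[OF AA e'] i]) (use r in \<open>metis fst_conv snd_prod_chart\<close>)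
  also have "\<dots> = fst" by (rule fderiv_eq[OF has_derivative_fst[OF has_derivative_ident]])
  finally have 1: "tmap_at (prod_atlas A A) A fst ?x \<zeta> d0 = fst (\<zeta> ?e)"
    using tmap_at_coord[OF AA A fs(1) x e _ \<zeta>, of d0] d by simp
  have "drep ?e d1 snd ?x = fderiv snd (snd ?e ?x)"
    by (rule fderiv_cong[OF atlas_open_dom[OF AA e'] i]) (use r in \<open>metis snd_conv snd_prod_chart\<close>)
  also have "\<dots> = snd" by (rule fderiv_eq[OF has_derivative_snd[OF has_derivative_ident]])
  finally have 2: "tmap_at (prod_atlas A A) A snd ?x \<zeta> d1 = snd (\<zeta> ?e)"
    using tmap_at_coord[OF AA A fs(2) x e _ \<zeta>, of d1] d by simp
  have 3: "tmap_at (prod_atlas A A) A fst ?x \<zeta> \<in> tspace A (fst m0)"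
    "tmap_at (prod_atlas A A) A snd ?x \<zeta> \<in> tspace A (fst m1)"
    using tmap_at_tspace[OF AA A fs(1) x \<zeta>] tmap_at_tspace[OF AA A fs(2) x \<zeta>] by simp_all
  have "snd (Phi A (m0, m1)) \<zeta> = - snd m0 (tmap_at (prod_atlas A A) A fst ?x \<zeta>) + snd m1 (tmap_at (prod_atlas A A) A snd ?x \<zeta>)"
    using \<zeta> by (simp add: Phi_def case_prod_unfold)
  then show ?thesis
    unfolding cspace_momentum[OF A m(1) d(1) 3(1)] cspace_momentum[OF A m(2) d(2) 3(2)] 1 2 .
qed

lemma fst_Phi [simp]: "fst (Phi A m) = (fst (fst m), fst (snd m))"
  by (simp add: Phi_def case_prod_unfold)

text \<open>\<open>cot_lift\<close> picks a preimage under \<open>Phi\<close>, so injectivity is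
  what determines its value. Vectors \<open>(a, 0)\<close> and \<open>(0, b)\<close> separate the
  two momenta.\<close>

lemma Phi_inj:
  assumes A: "smooth_atlas A"
  shows "inj_on (Phi A) (ccarrier A \<times> ccarrier A)"
proof (rule inj_onI)
  note AA = smooth_atlas_prod[OF A A]
  fix m m' assume m: "m \<in> ccarrier A \<times> ccarrier A" "m' \<in> ccarrier A \<times> ccarrier A" and eq: "Phi A m = Phi A m'"
  obtain m0 m1 m0' m1' where mm: "m = (m0, m1)" "m' = (m0', m1')" by (cases m, cases m')
  have c: "m0 \<in> ccarrier A" "m1 \<in> ccarrier A" "m0' \<in> ccarrier A" "m1' \<in> ccarrier A" using m mm by auto
  have f: "fst m0 = fst m0'" "fst m1 = fst m1'" using arg_cong[OF eq, of fst] by (simp_all add: mm)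
  obtain d0 d1 where d: "chart_of A d0 (fst m0)" "chart_of A d1 (fst m1)"
    using c(1,2) by (auto simp: ccarrier_iff elim!: carrierE)
  then have e: "chart_of (prod_atlas A A) (prod_chart d0 d1) (fst m0, fst m1)" by simp
  have *: "- (momentum A d0 m0 \<bullet> a) + momentum A d1 m1 \<bullet> b = - (momentum A d0 m0' \<bullet> a) + momentum A d1 m1' \<bullet> b" for a b
  proof -
    have ts: "tvec_of (prod_atlas A A) (prod_chart d0 d1) (fst m0, fst m1) (a, b) \<in> tspace (prod_atlas A A) (fst m0, fst m1)"
      by (rule tvec_of_tspace[OF AA e])
    show ?thesis
      using Phi_apply[OF A c(1,2) d ts] Phi_apply[OF A c(3,4), of d0 d1, OF _ _ ts[unfolded f]] d eq
      by (simp add: tvec_of_self[OF AA e[unfolded f]] f mm)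
  qed
  have "momentum A d0 m0 = momentum A d0 m0'" using *[of _ 0] vector_eq_rdot[of "momentum A d0 m0" "momentum A d0 m0'"] by simp
  moreover have "momentum A d1 m1 = momentum A d1 m1'" using *[of 0] vector_eq_rdot[of "momentum A d1 m1" "momentum A d1 m1'"] by simp
  ultimately show "m = m'"
    using ctbundle_eqI[OF A c(1,3) d(1) f(1)] ctbundle_eqI[OF A c(2,4) d(2) f(2)] mm by simp
qed

lemma cot_lift_domD:
  "t \<in> cot_lift_dom A U R \<Longrightarrow> t \<in> tcarrier (cot_atlas A)"
  "t \<in> cot_lift_dom A U R \<Longrightarrow> fst (alpha A t) \<in> U"
  "t \<in> cot_lift_dom A U R \<Longrightarrow> tinvertible (tan_atlas A) (prod_atlas A A) R (fst (alpha A t))"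
  by (auto simp: cot_lift_dom_def)

text \<open>\<open>hat\<close> asks for the covector \<open>pm\<close> whose composition with the
  derivative of \<open>R\<close> is \<open>(p', p)\<close>, so \<open>pm\<close> is the inverse
  adjoint applied to \<open>(p', p)\<close>. Inverting \<open>Phi\<close> then flips the sign of its
  first half.\<close>

lemma cot_lift_eq:
  fixes A :: "('m, 'e::euclidean_space) atlas"
  assumes A: "smooth_atlas A" and R: "smooth_map (tan_atlas A) (prod_atlas A A) U R"
    and t: "t \<in> cot_lift_dom A U R" and c: "chart_of A c (fst (fst t))"
    and d: "chart_of A d0 (fst (R (fst (alpha A t))))" "chart_of A d1 (snd (R (fst (alpha A t))))"
    and pm: "pm = inv (adjoint (drep (tchart A c) (prod_chart d0 d1) R (fst (alpha A t)))) (snd (snd t (cchart A c)), momentum A c (fst t))"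
  shows "cot_lift A R t =
    ((fst (R (fst (alpha A t))), covec_of A d0 (fst (R (fst (alpha A t)))) (- fst pm)),
     (snd (R (fst (alpha A t))), covec_of A d1 (snd (R (fst (alpha A t)))) (snd pm)))" (is "_ = (?m0, ?m1)")
    and "pm \<bullet> drep (tchart A c) (prod_chart d0 d1) R (fst (alpha A t)) v = (snd (snd t (cchart A c)), momentum A c (fst t)) \<bullet> v"
proof -
  note TA = smooth_atlas_tan[OF A] and AA = smooth_atlas_prod[OF A A]
  define u where "u = fst (alpha A t)"
  have uU: "u \<in> U" and inv: "tinvertible (tan_atlas A) (prod_atlas A A) R u"
    using cot_lift_domD[OF t] by (auto simp: u_def)
  note al = alpha_coord[OF A cot_lift_domD(1)[OF t] c]
  have uc: "u \<in> tcarrier A" "chart_of A c (fst u)" using al c by (simp_all add: u_def ccarrier_iff)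
  let ?c = "tchart A c" and ?e = "prod_chart d0 d1"
  have tc: "chart_of (tan_atlas A) ?c u" by (rule tchart_chart[OF uc])
  have e: "chart_of (prod_atlas A A) ?e (R u)" using d by (simp add: mem_Times_iff u_def)
  let ?M = "drep ?c ?e R u" and ?pp = "(snd (snd t (cchart A c)), momentum A c (fst t))"
  have lin: "linear ?M" by (rule drep_linear[OF R uU tc e])
  have inj: "inj ?M" using inv tinvertible_iff[OF TA AA R uU tc e] by simp
  \<comment> \<open>\<open>inv\<close> yields a solution only where the adjoint is onto, which holds
    because \<open>R\<close> has an invertible derivative at \<open>u\<close>.\<close>
  have surj: "surj (adjoint ?M)"
    by (rule linear_inj_imp_surj_self[OF adjoint_linear[OF lin] inj_adjoint[OF lin inj]])
  have pm: "pm = inv (adjoint ?M) ?pp" unfolding pm u_def ..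
  then have "adjoint ?M pm = ?pp" using surj by (simp add: surj_f_inv_f)
  then have key: "pm \<bullet> ?M v = ?pp \<bullet> v" for v using adjoint_works[OF lin, of v pm] by (metis inner_commute)
  then show "pm \<bullet> drep (tchart A c) (prod_chart d0 d1) R (fst (alpha A t)) v = ?pp \<bullet> v" by (simp add: u_def)
  have m: "?m0 \<in> ccarrier A" "?m1 \<in> ccarrier A" using d by (auto simp: ccarrier_iff covec_of_cspace[OF A] intro: carrierI)
  have d': "chart_of A d0 (fst ?m0)" "chart_of A d1 (fst ?m1)" using d by auto
  have Ru: "(fst ?m0, fst ?m1) = R u" by (simp add: u_def)
  have "Phi A (?m0, ?m1) = hat (tan_atlas A) (prod_atlas A A) R (alpha A t)"
  proof (rule prod_eqI)
    show "fst (Phi A (?m0, ?m1)) = fst (hat (tan_atlas A) (prod_atlas A A) R (alpha A t))"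
      by (simp add: hat_def)
    show "snd (Phi A (?m0, ?m1)) = snd (hat (tan_atlas A) (prod_atlas A A) R (alpha A t))"
    proof (rule extensionalityI)
      show "snd (Phi A (?m0, ?m1)) \<in> extensional (tspace (prod_atlas A A) (R u))"
        by (simp add: Phi_def u_def)
      show "snd (hat (tan_atlas A) (prod_atlas A A) R (alpha A t)) \<in> extensional (tspace (prod_atlas A A) (R u))"
        by (simp add: hat_def u_def)
      fix \<eta> assume \<eta>: "\<eta> \<in> tspace (prod_atlas A A) (R u)"
      define \<xi> where "\<xi> = inv_into (tspace (tan_atlas A) u) (tmap_at (tan_atlas A) (prod_atlas A A) R u) \<eta>"
      have im: "\<eta> \<in> tmap_at (tan_atlas A) (prod_atlas A A) R u ` tspace (tan_atlas A) u"
        using inv \<eta> by (simp add: tinvertible_def bij_betw_def)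
      then have \<xi>: "\<xi> \<in> tspace (tan_atlas A) u" "tmap_at (tan_atlas A) (prod_atlas A A) R u \<xi> = \<eta>"
        unfolding \<xi>_def by (rule inv_into_into, rule f_inv_into_f)
      have \<eta>M: "\<eta> ?e = ?M (\<xi> ?c)" using tmap_at_coord[OF TA AA R uU tc e \<xi>(1)] \<xi>(2) by simp
      have "snd (Phi A (?m0, ?m1)) \<eta> = - (- fst pm \<bullet> fst (\<eta> ?e)) + snd pm \<bullet> snd (\<eta> ?e)"
        using Phi_apply[OF A m d', of \<eta>] \<eta> Ru d A by simp
      also have "\<dots> = pm \<bullet> \<eta> ?e" by (cases pm) (simp add: inner_prod_def)
      also have "\<dots> = ?pp \<bullet> \<xi> ?c" unfolding \<eta>M by (rule key)
      also have "\<dots> = momentum (tan_atlas A) ?c (alpha A t) \<bullet> \<xi> ?c" unfolding al(3) ..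
      also have "\<dots> = snd (alpha A t) \<xi>"
        using cspace_momentum[OF TA al(1), of ?c \<xi>] tc \<xi>(1) by (simp add: u_def)
      also have "\<dots> = snd (hat (tan_atlas A) (prod_atlas A A) R (alpha A t)) \<eta>"
        using \<eta> by (simp add: hat_def u_def[symmetric] \<xi>_def)
      finally show "snd (Phi A (?m0, ?m1)) \<eta> = snd (hat (tan_atlas A) (prod_atlas A A) R (alpha A t)) \<eta>" .
    qed
  qed
  then have "cot_lift A R t = inv_into (ccarrier A \<times> ccarrier A) (Phi A) (Phi A (?m0, ?m1))"
    by (simp add: cot_lift_def)
  also have "\<dots> = (?m0, ?m1)" by (rule inv_into_f_f[OF Phi_inj[OF A]]) (use m in auto)
  finally show "cot_lift A R t = (?m0, ?m1)" .
qed

text \<open>With the inverse adjoint eliminated, \<open>cot_lift_eq\<close> becomes a balance of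
  momenta that can be differentiated directly. The charts \<open>d0\<close> and \<open>d1\<close>
  are chosen independently at the two end points.\<close>

lemma cot_lift_equation:
  fixes A :: "('m, 'e::euclidean_space) atlas"
  assumes A: "smooth_atlas A" and R: "smooth_map (tan_atlas A) (prod_atlas A A) U R"
    and t: "t \<in> cot_lift_dom A U R" and c: "chart_of A c (fst (fst t))" and u: "u = fst (alpha A t)"
    and d: "chart_of A d0 (fst (R u))" "chart_of A d1 (snd (R u))"
  shows "fst (cot_lift A R t) \<in> ccarrier A" "snd (cot_lift A R t) \<in> ccarrier A"
    "fst (fst (cot_lift A R t)) = fst (R u)" "fst (snd (cot_lift A R t)) = snd (R u)"
    "- (momentum A d0 (fst (cot_lift A R t)) \<bullet> drep (tchart A c) d0 (\<lambda>w. fst (R w)) u v)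
     + momentum A d1 (snd (cot_lift A R t)) \<bullet> drep (tchart A c) d1 (\<lambda>w. snd (R w)) u v =
     snd (snd t (cchart A c)) \<bullet> fst v + momentum A c (fst t) \<bullet> snd v"
proof -
  note TA = smooth_atlas_tan[OF A] and AA = smooth_atlas_prod[OF A A]
  note al = alpha_coord[OF A cot_lift_domD(1)[OF t] c]
  have uU: "u \<in> U" using cot_lift_domD[OF t] by (simp add: u)
  have uc: "u \<in> tcarrier A" "chart_of A c (fst u)" using al c by (simp_all add: u ccarrier_iff)
  note eq = cot_lift_eq[OF A R t c d[unfolded u] refl, folded u]
  show "fst (cot_lift A R t) \<in> ccarrier A" "snd (cot_lift A R t) \<in> ccarrier A"
    "fst (fst (cot_lift A R t)) = fst (R u)" "fst (snd (cot_lift A R t)) = snd (R u)"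
    unfolding eq(1) using d by (auto simp: ccarrier_iff covec_of_cspace[OF A] intro: carrierI)
  show "- (momentum A d0 (fst (cot_lift A R t)) \<bullet> drep (tchart A c) d0 (\<lambda>w. fst (R w)) u v)
     + momentum A d1 (snd (cot_lift A R t)) \<bullet> drep (tchart A c) d1 (\<lambda>w. snd (R w)) u v =
     snd (snd t (cchart A c)) \<bullet> fst v + momentum A c (fst t) \<bullet> snd v"
    using eq(2)[of v] d A
    unfolding eq(1) drep_prod[OF A A TA R uU tchart_chart[OF uc] d]
    by (simp add: inner_prod_def)
qed

text \<open>In coordinates the lift consists of \<open>R\<close> and of the inverse adjoint of its
  derivative applied to \<open>(p', p)\<close>; both are smooth on the open set where the derivative
  is invertible.\<close>

lemma smooth_cot_lift:
  fixes A :: "('m, 'e::euclidean_space) atlas"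
  assumes A: "smooth_atlas A" and R: "smooth_map (tan_atlas A) (prod_atlas A A) U R"
  shows "smooth_map (tan_atlas (cot_atlas A)) (prod_atlas (cot_atlas A) (cot_atlas A)) (cot_lift_dom A U R) (cot_lift A R)"
proof -
  note TA = smooth_atlas_tan[OF A] and AA = smooth_atlas_prod[OF A A] and CA = smooth_atlas_cot[OF A]
  note TCA = smooth_atlas_tan[OF CA] and CCA = smooth_atlas_prod[OF CA CA]
  have main: "\<exists>c d0 d1 N. c \<in> A \<and> d0 \<in> A \<and> d1 \<in> A \<and> t \<in> fst (tchart (cot_atlas A) (cchart A c)) \<and> open N \<and>
      snd (tchart (cot_atlas A) (cchart A c)) t \<in> N \<and>
      (\<forall>y\<in>N. y \<in> snd (tchart (cot_atlas A) (cchart A c)) ` fst (tchart (cot_atlas A) (cchart A c)) \<and>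
        chart_inv (tchart (cot_atlas A) (cchart A c)) y \<in> cot_lift_dom A U R \<and>
        cot_lift A R (chart_inv (tchart (cot_atlas A) (cchart A c)) y) \<in> fst (prod_chart (cchart A d0) (cchart A d1))) \<and>
      smooth_on N (rep (tchart (cot_atlas A) (cchart A c)) (prod_chart (cchart A d0) (cchart A d1)) (cot_lift A R))"
    if t: "t \<in> cot_lift_dom A U R" for t
  proof -
    note t' = cot_lift_domD[OF t]
    have ft: "fst t \<in> ccarrier A" using t'(1) by (simp add: tcarrier_iff)
    obtain c where c: "chart_of A c (fst (fst t))" using ft by (auto simp: ccarrier_iff elim: carrierE)
    have c': "c \<in> A" using c by simp
    note al = alpha_coord[OF A t'(1) c]
    define u where "u = fst (alpha A t)"
    have uc: "u \<in> tcarrier A" "chart_of A c (fst u)" using al c by (simp_all add: u_def ccarrier_iff)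
    have "R u \<in> carrier (prod_atlas A A)" using smooth_mapD_carrier[OF R] t'(2) by (simp add: u_def)
    then obtain d0 d1 where d: "chart_of A d0 (fst (R u))" "chart_of A d1 (snd (R u))"
      by (auto elim!: carrierE)
    let ?c = "tchart A c" and ?e = "prod_chart d0 d1" and ?k = "tchart (cot_atlas A) (cchart A c)"
    have tc: "chart_of (tan_atlas A) ?c u" by (rule tchart_chart[OF uc])
    have e: "chart_of (prod_atlas A A) ?e (R u)" using d by (simp add: mem_Times_iff)
    have in': "?c \<in> tan_atlas A" "?e \<in> prod_atlas A A" "cchart A c \<in> cot_atlas A" "?k \<in> tan_atlas (cot_atlas A)"
      "d0 \<in> A" "d1 \<in> A" using c d by auto
    define r where "r = rep ?c ?e R"
    define Z where "Z = rep_dom ?c ?e U R"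
    have Z: "open Z" unfolding Z_def by (rule open_rep_dom[OF R in'(1,2)])
    have smr: "smooth_on Z r" unfolding Z_def r_def by (rule smooth_map_rep[OF R in'(1,2)])
    define J where "J = {y \<in> Z. inj (fderiv r y)}"
    have J: "open J" unfolding J_def by (rule open_inj_fderiv[OF Z smr])
    have smJ: "smooth_on J r" by (rule smooth_on_subset[OF smr]) (auto simp: J_def)
    \<comment> \<open>In coordinates \<open>((q, p), (q', p'))\<close> the base point of
      \<open>alpha\<close> is \<open>(q, q')\<close>.\<close>
    let ?bp = "\<lambda>y::('e \<times> 'e) \<times> 'e \<times> 'e. (fst (fst y), fst (snd y))"
    define N where "N = ?bp -` J"
    have smbp: "smooth_on UNIV ?bp"
      by (intro smooth_on_Pair smooth_on_fst smooth_on_snd smooth_on_ident open_UNIV)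
    have N: "open N" using continuous_open_preimage[OF smooth_on_continuous[OF smbp] open_UNIV J] by (simp add: N_def)
    have smbN: "smooth_on N ?bp" by (rule smooth_on_subset[OF smbp]) auto
    define Ad where "Ad y = adjoint (fderiv r (?bp y))" for y
    define pm where "pm y = inv (Ad y) (snd (snd y), snd (fst y))" for y
    have linr: "linear (fderiv r (?bp y))" if "y \<in> N" for y
      by (rule smooth_on_linear[OF smJ]) (use that in \<open>simp add: N_def\<close>)
    \<comment> \<open>Inversion of a smooth family of linear maps, here the adjoints, applied to the
      moving covector \<open>(p', p)\<close>.\<close>
    have smpm: "smooth_on N pm" unfolding pm_def[abs_def]
    proof (rule smooth_on_inv_apply[OF N])
      show "linear (Ad y)" if "y \<in> N" for y unfolding Ad_def by (rule adjoint_linear[OF linr[OF that]])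
      show "inj (Ad y)" if "y \<in> N" for y unfolding Ad_def
        by (rule inj_adjoint[OF linr[OF that]]) (use that in \<open>simp add: N_def J_def\<close>)
      show "smooth_on N (\<lambda>y. (snd (snd y), snd (fst y)))"
        by (intro smooth_on_Pair smooth_on_fst smooth_on_snd smooth_on_ident N)
      fix w
      have "smooth_on N (\<lambda>y. \<Sum>b\<in>Basis. (w \<bullet> fderiv r (?bp y) b) *\<^sub>R b)"
        by (intro smooth_on_sum smooth_on_scaleR smooth_on_inner smooth_on_const N smooth_on_fderiv_apply[OF N J smJ smbN])
          (auto simp: N_def)
      then show "smooth_on N (\<lambda>y. Ad y w)"
        by (subst smooth_on_cong[OF N, where g = "\<lambda>y. \<Sum>b\<in>Basis. (w \<bullet> fderiv r (?bp y) b) *\<^sub>R b"])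
          (auto simp: Ad_def adjoint_expand[OF linr])
    qed
    have smrN: "smooth_on N (\<lambda>y. r (?bp y))"
      by (rule smooth_on_compose[OF N J smJ smbN]) (auto simp: N_def)
    have im: "snd ?k ` fst ?k = (cdom c \<times> UNIV) \<times> UNIV"
      using tchart_image_dom[OF CA in'(3)] cchart_image[OF A c', of UNIV] by simp
    have pt: "y \<in> snd ?k ` fst ?k \<and> chart_inv ?k y \<in> cot_lift_dom A U R \<and>
        cot_lift A R (chart_inv ?k y) \<in> fst (prod_chart (cchart A d0) (cchart A d1)) \<and>
        rep ?k (prod_chart (cchart A d0) (cchart A d1)) (cot_lift A R) y =
          ((fst (r (?bp y)), - fst (pm y)), (snd (r (?bp y)), snd (pm y)))"
      if y: "y \<in> N" for y
    proof -
      have bJ: "?bp y \<in> Z" "inj (fderiv r (?bp y))" using y by (auto simp: N_def J_def)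
      then have Z': "?bp y \<in> snd ?c ` fst ?c" "chart_inv ?c (?bp y) \<in> U" "R (chart_inv ?c (?bp y)) \<in> fst ?e"
        by (auto simp: Z_def rep_dom_iff[OF TA in'(1)] simp del: fst_prod_chart)
      have q: "fst (fst y) \<in> cdom c" using Z'(1) by (simp add: tchart_image_dom[OF A c'])
      then have yi: "y \<in> snd ?k ` fst ?k" unfolding im by (simp add: mem_Times_iff)
      define t' where "t' = chart_inv ?k y"
      have tk: "t' \<in> fst ?k" "snd ?k t' = y" unfolding t'_def using yi by (rule chart_inv_mem, rule chart_inv_right)
      have tt: "t' \<in> tcarrier (cot_atlas A)" "chart_of A c (fst (fst t'))"
        using tk(1) c' by (auto simp: fst_tchart fst_cchart)
      have y1: "fst (fst y) = snd c (fst (fst t'))" "snd (fst y) = momentum A c (fst t')" "snd y = snd t' (cchart A c)"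
        using tk(2) by (auto simp: snd_tchart snd_cchart)
      note al' = alpha_coord[OF A tt]
      define u' where "u' = fst (alpha A t')"
      have u': "u' = chart_inv ?c (?bp y)"
        using chart_inv_tchart[OF A c' q, of "fst (snd y)"] chart_inv_left[OF A tt(2)[THEN conjunct1] tt(2)[THEN conjunct2]]
        by (simp add: u'_def al'(2) y1)
      have uc': "u' \<in> tcarrier A" "chart_of A c (fst u')" using al' tt by (simp_all add: u'_def ccarrier_iff)
      have su: "snd ?c u' = ?bp y" unfolding u' by (rule chart_inv_right[OF Z'(1)])
      have tc': "chart_of (tan_atlas A) ?c u'" by (rule tchart_chart[OF uc'])
      have e': "chart_of (prod_atlas A A) ?e (R u')" using Z'(3) in'(2) by (simp add: u')
      have inv: "tinvertible (tan_atlas A) (prod_atlas A A) R u'"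
        using tinvertible_iff[OF TA AA R _ tc' e'] Z'(2) bJ(2) by (simp add: u'[symmetric] su r_def)
      have dom: "t' \<in> cot_lift_dom A U R"
        using tt(1) inv Z'(2) by (simp add: cot_lift_dom_def u'_def[symmetric] u'[symmetric])
      have d': "chart_of A d0 (fst (R u'))" "chart_of A d1 (snd (R u'))" using e' in' by (auto simp: mem_Times_iff)
      have "pm y = inv (adjoint (drep ?c ?e R (fst (alpha A t')))) (snd (snd t' (cchart A c)), momentum A c (fst t'))"
        unfolding pm_def Ad_def r_def u'_def[symmetric] su y1(2,3)[symmetric] ..
      note eq = cot_lift_eq(1)[OF A R dom tt(2) d'[unfolded u'_def] this, folded u'_def]
      have r': "r (?bp y) = (snd d0 (fst (R u')), snd d1 (snd (R u')))" by (simp add: r_def u')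
      show ?thesis
        using yi dom d' A unfolding t'_def[symmetric] r'
        by (auto simp: eq fst_cchart snd_cchart ccarrier_iff covec_of_cspace[OF A] intro: carrierI)
    qed
    have "smooth_on N (rep ?k (prod_chart (cchart A d0) (cchart A d1)) (cot_lift A R))"
    proof (subst smooth_on_cong[OF N])
      show "smooth_on N (\<lambda>y. ((fst (r (?bp y)), - fst (pm y)), (snd (r (?bp y)), snd (pm y))))"
        by (intro smooth_on_Pair smooth_on_fst smooth_on_snd smooth_on_minus N smrN smpm)
    qed (use pt in blast)
    moreover have "snd ?k t \<in> N"
    proof -
      have "?bp (snd ?k t) = snd ?c u"
        using c' A c by (simp add: snd_tchart snd_cchart u_def al(2))
      moreover have "snd ?c u \<in> J"
        using t'(2,3) tc e tinvertible_iff[OF TA AA R _ tc e] tchart_inv_left[OF A uc]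
        by (auto simp: J_def Z_def r_def u_def[symmetric] intro!: rep_domI simp del: fst_prod_chart)
      ultimately show ?thesis by (simp add: N_def)
    qed
    ultimately show ?thesis
      using c' in' N pt c ft t'(1) by (intro exI[of _ c] exI[of _ d0] exI[of _ d1] exI[of _ N]) (simp add: fst_tchart fst_cchart)
  qed
  \<comment> \<open>\<open>main\<close> places a whole coordinate neighbourhood of each point of
    \<open>cot_lift_dom\<close> inside it.\<close>
  have op: "openin (mtop (tan_atlas (cot_atlas A))) (cot_lift_dom A U R)"
  proof (subst openin_subopen, intro ballI)
    fix t assume t: "t \<in> cot_lift_dom A U R"
    from main[OF t] obtain c N where *: "c \<in> A" "t \<in> fst (tchart (cot_atlas A) (cchart A c))" "open N"
      "snd (tchart (cot_atlas A) (cchart A c)) t \<in> N"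
      "\<And>y. y \<in> N \<Longrightarrow> chart_inv (tchart (cot_atlas A) (cchart A c)) y \<in> cot_lift_dom A U R" by blast
    have k: "tchart (cot_atlas A) (cchart A c) \<in> tan_atlas (cot_atlas A)" using *(1) by simp
    show "\<exists>T. openin (mtop (tan_atlas (cot_atlas A))) T \<and> t \<in> T \<and> T \<subseteq> cot_lift_dom A U R"
    proof (intro exI conjI subsetI)
      show "openin (mtop (tan_atlas (cot_atlas A)))
          {x \<in> fst (tchart (cot_atlas A) (cchart A c)). snd (tchart (cot_atlas A) (cchart A c)) x \<in> N}"
        by (rule openin_chart_preimage[OF TCA k *(3)])
      fix x assume "x \<in> {x \<in> fst (tchart (cot_atlas A) (cchart A c)). snd (tchart (cot_atlas A) (cchart A c)) x \<in> N}"
      then show "x \<in> cot_lift_dom A U R"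
        using *(5)[of "snd (tchart (cot_atlas A) (cchart A c)) x"] chart_inv_left[OF TCA k, of x] by simp
    qed (use * in simp)
  qed
  show ?thesis
  proof (rule smooth_mapI_local[OF TCA CCA op])
    fix t assume t: "t \<in> cot_lift_dom A U R"
    from main[OF t] obtain c d0 d1 N where *: "c \<in> A" "d0 \<in> A" "d1 \<in> A" "t \<in> fst (tchart (cot_atlas A) (cchart A c))" "open N"
      "snd (tchart (cot_atlas A) (cchart A c)) t \<in> N"
      "\<And>y. y \<in> N \<Longrightarrow> cot_lift A R (chart_inv (tchart (cot_atlas A) (cchart A c)) y) \<in> fst (prod_chart (cchart A d0) (cchart A d1))"
      "smooth_on N (rep (tchart (cot_atlas A) (cchart A c)) (prod_chart (cchart A d0) (cchart A d1)) (cot_lift A R))"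
      by blast
    show "\<exists>c d N. c \<in> tan_atlas (cot_atlas A) \<and> d \<in> prod_atlas (cot_atlas A) (cot_atlas A) \<and> t \<in> fst c \<and> open N \<and> snd c t \<in> N \<and>
        (\<forall>u\<in>N. u \<in> snd c ` fst c \<longrightarrow> chart_inv c u \<in> cot_lift_dom A U R \<longrightarrow> cot_lift A R (chart_inv c u) \<in> fst d) \<and>
        smooth_on N (rep c d (cot_lift A R))"
      by (rule exI[of _ "tchart (cot_atlas A) (cchart A c)"], rule exI[of _ "prod_chart (cchart A d0) (cchart A d1)"], rule exI[of _ N])
        (use * in \<open>simp del: fst_prod_chart snd_prod_chart\<close>)
  qed
qed

text \<open>The fibre condition moves from \<open>chart_at A x\<close> to any chart because at a
  zero vector the second-derivative term of the tangent transition vanishes: vertical vectors are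
  carried by the linear transition alone.\<close>

lemma discretization_chart:
  fixes A :: "('m, 'e::euclidean_space) atlas"
  assumes A: "smooth_atlas A" and R: "discretization_map A D R" and c: "chart_of A c x"
  shows "drep (tchart A c) c (\<lambda>w. snd (R w)) (zero_at x) (0, u)
          - drep (tchart A c) c (\<lambda>w. fst (R w)) (zero_at x) (0, u) = u"
proof -
  note TA = smooth_atlas_tan[OF A] and RD = discretization_mapD[OF A R]
  have x: "x \<in> carrier A" using c by (auto intro: carrierI)
  define d where "d = chart_at A x"
  have d: "chart_of A d x" unfolding d_def using x by (rule chart_at_in)
  let ?\<tau> = "drep c d (\<lambda>x. x) x"
  have fib: "drep (tchart A d) d (\<lambda>w. snd (R w)) (zero_at x) (0, u) - drep (tchart A d) d (\<lambda>w. fst (R w)) (zero_at x) (0, u) = u" for u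
    using R discretization_fibre[OF A RD(2) RD(3)[OF x] RD(4)[OF x] x d_def] x by (auto simp: discretization_map_def)
  have z: "zero_at x \<in> tcarrier A" "chart_of A c (fst (zero_at x))" "chart_of A d (fst (zero_at x))"
    using zero_at_tcarrier[OF A x] c d by auto
  have o: "open (snd c ` (fst c \<inter> fst d))" "snd c x \<in> snd c ` (fst c \<inter> fst d)" using atlas_open[OF A] c d by auto
  have lin\<tau>: "linear ?\<tau>" by (rule trans_linear[OF A c d])
  have "fderiv (rep c d (\<lambda>x. x)) q 0 = 0" if "q \<in> snd c ` (fst c \<inter> fst d)" for q
    using linear_0[OF smooth_on_linear[OF transition_smooth[OF A] that]] c d by simp
  then have "fderiv (\<lambda>q. fderiv (rep c d (\<lambda>x. x)) q 0) (snd c x) = fderiv (\<lambda>q. 0) (snd c x)"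
    by (rule fderiv_cong[OF o])
  then have tz: "drep (tchart A c) (tchart A d) (\<lambda>x. x) (zero_at x) (0, u) = (0, ?\<tau> u)" for u
    using tan_trans_deriv[OF A z, of 0 u] linear_0[OF lin\<tau>] by simp
  have ch: "drep (tchart A d) d F (zero_at x) (0, ?\<tau> u) = ?\<tau> (drep (tchart A c) c F (zero_at x) (0, u))"
    if "smooth_map (tan_atlas A) A D F" "F (zero_at x) = x" for F u
    using drep_change[OF TA A that(1) RD(3)[OF x] zero_at_chart[OF A c] zero_at_chart[OF A d], of c d "(0, u)"] that(2) c d
    unfolding tz by simp
  have "?\<tau> (drep (tchart A c) c (\<lambda>w. snd (R w)) (zero_at x) (0, u) - drep (tchart A c) c (\<lambda>w. fst (R w)) (zero_at x) (0, u)) = ?\<tau> u"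
    unfolding linear_diff[OF lin\<tau>]
    using ch[OF RD(5), of u] ch[OF RD(6), of u] fib[of "?\<tau> u"] RD(4)[OF x] by simp
  from arg_cong[OF this, of "drep d c (\<lambda>x. x) x"] show ?thesis
    by (simp only: trans_chain[OF A c d c] trans_self[OF A c])
qed

section \<open>The lift of a discretization map along the Legendre map\<close>

text \<open>Regularity enters as injectivity of the vertical derivative of the momentum in place of
  an invertible matrix; this lets the model space be any Euclidean space.\<close>

locale lagrangian_discretization =
  fixes A :: "('q, 'e::euclidean_space) atlas" and U :: "('q, 'e) tbundle set"
    and R :: "('q, 'e) tbundle \<Rightarrow> 'q \<times> 'q" and L :: "('q, 'e) tbundle \<Rightarrow> real"
  assumes A: "smooth_atlas A" and R: "discretization_map A U R" and L: "smooth_function (tan_atlas A) L"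
    and reg: "\<And>w c b. w \<in> tcarrier A \<Longrightarrow> chart_of A c (fst w) \<Longrightarrow>
      fderiv (pmap A L c) (snd (tchart A c) w) (0, b) = 0 \<Longrightarrow> b = 0"
begin

abbreviation "TQ \<equiv> tan_atlas A"
abbreviation "TTQ \<equiv> tan_atlas TQ"
abbreviation "CQ \<equiv> cot_atlas A"
abbreviation "FL \<equiv> legendre A L"
abbreviation "TFL \<equiv> tmap TQ CQ FL"

lemmas TA = smooth_atlas_tan[OF A]
lemmas AA = smooth_atlas_prod[OF A A]
lemmas CA = smooth_atlas_cot[OF A]
lemmas TTA = smooth_atlas_tan[OF TA]
lemmas TCA = smooth_atlas_tan[OF CA]
lemmas TATA = smooth_atlas_prod[OF TA TA]
lemmas CACA = smooth_atlas_prod[OF CA CA]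
lemmas RD = discretization_mapD[OF A R]
lemmas smFL = smooth_legendre[OF A L]

section \<open>The tangent Legendre map and the zero section\<close>

lemma smooth_TFL: "smooth_map TTQ (tan_atlas CQ) (tcarrier TQ) TFL"
proof -
  have "{w \<in> tcarrier TQ. fst w \<in> tcarrier A} = tcarrier TQ" by (auto simp: tcarrier_iff)
  then show ?thesis using smooth_tmap[OF TA CA smFL] by simp
qed

lemma TFL_coord:
  assumes y: "y \<in> tcarrier TQ" and c: "chart_of A c (fst (fst y))"
  shows "TFL y \<in> tcarrier CQ" "fst (TFL y) = FL (fst y)"
    "snd (TFL y) (cchart A c) =
      (fst (snd y (tchart A c)), fderiv (pmap A L c) (snd (tchart A c) (fst y)) (snd y (tchart A c)))"
    "momentum A c (fst (TFL y)) = pmap A L c (snd (tchart A c) (fst y))"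
proof -
  have w: "fst y \<in> tcarrier A" "snd y \<in> tspace TQ (fst y)" using y by (auto simp: tcarrier_iff)
  show "TFL y \<in> tcarrier CQ" using smooth_mapD_carrier[OF smooth_TFL y] by simp
  show f: "fst (TFL y) = FL (fst y)" by (simp add: tmap_def)
  have lc: "chart_of CQ (cchart A c) (FL (fst y))"
    using cchart_chart[OF legendre_ccarrier[OF A L w(1)]] c by simp
  show "snd (TFL y) (cchart A c) =
      (fst (snd y (tchart A c)), fderiv (pmap A L c) (snd (tchart A c) (fst y)) (snd y (tchart A c)))"
    using tmap_at_coord[OF TA CA smFL w(1) tchart_chart[OF w(1) c] lc w(2)]
    by (simp add: tmap_def drep_legendre[OF A L w(1) c])
  show "momentum A c (fst (TFL y)) = pmap A L c (snd (tchart A c) (fst y))"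
    unfolding f by (rule momentum_legendre[OF A L w(1) c])
qed

text \<open>The base of \<open>alpha (q, p, q', p')\<close> is \<open>(q, q')\<close>, so
  \<open>TFL y\<close> leads to the image of \<open>y\<close> under the tangent of the bundle
  projection. For \<open>y = h \<Gamma>(q, v)\<close> this is \<open>(q, h v)\<close>, the vector to
  which \<open>R\<close> is applied.\<close>

lemma fst_alpha_TFL:
  assumes y: "y \<in> tcarrier TQ" and c: "chart_of A c (fst (fst y))"
  shows "fst (alpha A (TFL y)) = (fst (fst y), tvec_of A c (fst (fst y)) (fst (snd y (tchart A c))))"
    and "fst (alpha A (TFL y)) \<in> tcarrier A"
    and "snd (tchart A c) (fst (alpha A (TFL y))) = (snd c (fst (fst y)), fst (snd y (tchart A c)))"
proof -
  note T = TFL_coord[OF y c]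
  have c2: "chart_of A c (fst (fst (TFL y)))" using c T(2) by simp
  note al = alpha_coord[OF A T(1) c2]
  show 1: "fst (alpha A (TFL y)) = (fst (fst y), tvec_of A c (fst (fst y)) (fst (snd y (tchart A c))))"
    unfolding al(2) T(2,3) by simp
  show "fst (alpha A (TFL y)) \<in> tcarrier A" using al(1) by (simp add: ccarrier_iff)
  show "snd (tchart A c) (fst (alpha A (TFL y))) = (snd c (fst (fst y)), fst (snd y (tchart A c)))"
    unfolding 1 using A c by (simp add: snd_tchart)
qed

lemma TFL_zero:
  assumes v: "v \<in> tcarrier A"
  shows "TFL (zero_at v) = zero_at (FL v)"
proof -
  have v': "v \<in> carrier TQ" using v by simp
  obtain c where c: "chart_of A c (fst v)" using v by (auto simp: tcarrier_iff elim: carrierE)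
  have lc: "chart_of CQ (cchart A c) (FL v)"
    using cchart_chart[OF legendre_ccarrier[OF A L v]] c by simp
  have "tmap_at TQ CQ FL v (\<lambda>_. 0) = (\<lambda>_. 0)"
    by (rule tmap_at_eqI[OF TA CA smFL v tchart_chart[OF v c] lc tspace_zero[OF TA] tspace_zero[OF CA]])
      (use linear_0[OF drep_linear[OF smFL v tchart_chart[OF v c] lc]] in simp)
  then show ?thesis by (simp add: tmap_def zero_at_def)
qed

lemma zero_section_drep:
  assumes q: "chart_of A c q"
  shows "drep (tchart A c) (prod_chart c c) R (zero_at q) (a, b) =
      (a + drep (tchart A c) c (\<lambda>w. fst (R w)) (zero_at q) (0, b),
       a + drep (tchart A c) c (\<lambda>w. snd (R w)) (zero_at q) (0, b))"
proof -
  have x: "q \<in> carrier A" using q by (auto intro: carrierI)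
  have d: "chart_of A c (fst (R (zero_at q)))" "chart_of A c (snd (R (zero_at q)))" using RD(4)[OF x] q by simp_all
  note z = RD(3)[OF x] zero_at_chart[OF A q]
  have "drep (tchart A c) c F (zero_at q) (a, b) = a + drep (tchart A c) c F (zero_at q) (0, b)"
    if "smooth_map TQ A U F" "\<And>x. x \<in> carrier A \<Longrightarrow> F (zero_at x) = x" for F
  proof -
    have "linear (drep (tchart A c) c F (zero_at q))"
      by (rule drep_linear[OF that(1) z]) (use q that(2)[OF x] in simp)
    moreover have "drep (tchart A c) c F (zero_at q) (a, 0) = a"
      by (rule drep_zero_section[OF A that(1) _ q]) (use RD(3) that(2) in simp)
    ultimately show ?thesis using linear_add[of "drep (tchart A c) c F (zero_at q)" "(a, 0)" "(0, b)"] by simp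
  qed
  from this[OF RD(5)] this[OF RD(6)] show ?thesis
    unfolding drep_prod[OF A A TA RD(2) z d] using RD(4) by simp
qed

text \<open>Over a zero vector the momentum balance reads
  \<open>p1 (a + s b) - p0 (a + f b) = p b\<close>, with \<open>s - f\<close> the identity by the
  fibre condition; it is solved by \<open>p0 = p1 = p\<close>.\<close>

lemma zero_in_cot_lift_dom:
  assumes m: "m \<in> ccarrier A"
  shows "zero_at m \<in> cot_lift_dom A U R" "cot_lift A R (zero_at m) = (m, m)"
proof -
  have m': "m \<in> carrier CQ" using m by simp
  obtain c where c: "chart_of A c (fst m)" using m by (auto simp: ccarrier_iff elim: carrierE)
  have x: "fst m \<in> carrier A" using m by (simp add: ccarrier_iff)
  have t: "zero_at m \<in> tcarrier CQ" by (rule zero_at_tcarrier[OF CA m'])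
  have c2: "chart_of A c (fst (fst (zero_at m)))" using c by simp
  have al: "fst (alpha A (zero_at m)) = zero_at (fst m)"
    using alpha_coord(2)[OF A t c2] tvec_of_zero[OF A c] by (simp add: zero_at_def)
  note z = RD(3)[OF x] zero_at_chart[OF A c]
  have e: "chart_of (prod_atlas A A) (prod_chart c c) (R (zero_at (fst m)))" using c RD(4)[OF x] by simp
  let ?M = "drep (tchart A c) (prod_chart c c) R (zero_at (fst m))"
  let ?f = "\<lambda>b. drep (tchart A c) c (\<lambda>w. fst (R w)) (zero_at (fst m)) (0, b)"
  let ?s = "\<lambda>b. drep (tchart A c) c (\<lambda>w. snd (R w)) (zero_at (fst m)) (0, b)"
  have lin: "linear ?M" by (rule drep_linear[OF RD(2) z e])
  have M: "?M (a, b) = (a + ?f b, a + ?s b)" for a b by (rule zero_section_drep[OF c])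
  have fs: "?s b - ?f b = b" for b by (rule discretization_chart[OF A R c])
  have inj: "inj ?M"
  proof (subst linear_injective_0[OF lin], intro allI impI)
    fix w assume w: "?M w = 0"
    obtain a b where ab: "w = (a, b)" by (cases w)
    have e: "a + ?f b = 0" "a + ?s b = 0" using w unfolding ab M by (simp_all add: zero_prod_def)
    then have "?s b - ?f b = 0" by (metis add_left_cancel diff_self)
    with fs have b: "b = 0" by simp
    have "?f 0 = 0" using linear_0[OF lin] M[of 0 0] by (simp add: zero_prod_def)
    with e b show "w = 0" by (simp add: ab zero_prod_def)
  qed
  show dom: "zero_at m \<in> cot_lift_dom A U R"
    using t inj z(1) tinvertible_iff[OF TA AA RD(2) z e] by (simp add: cot_lift_dom_def al)
  let ?p = "momentum A c m"
  \<comment> \<open>The minus sign in the first half is the one introduced by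
    \<open>Phi\<close>.\<close>
  have ad: "(- ?p, ?p) \<bullet> ?M v = (0, ?p) \<bullet> v" for v
  proof (cases v)
    case (Pair a b)
    have "(- ?p, ?p) \<bullet> ?M v = ?p \<bullet> (?s b - ?f b)" unfolding Pair M by (simp add: inner_add_right inner_diff_right)
    then show ?thesis unfolding fs by (simp add: Pair)
  qed
  have "\<forall>v. adjoint ?M (- ?p, ?p) \<bullet> v = (0, ?p) \<bullet> v" using ad adjoint_works[OF lin] by (metis inner_commute)
  then have "adjoint ?M (- ?p, ?p) = (0, ?p)" unfolding vector_eq_rdot .
  then have pm: "(- ?p, ?p) = inv (adjoint ?M) (0, ?p)"
    using inv_f_f[OF inj_adjoint[OF lin inj], of "(- ?p, ?p)"] by simp
  have pm': "(- ?p, ?p) = inv (adjoint (drep (tchart A c) (prod_chart c c) R (fst (alpha A (zero_at m)))))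
      (snd (snd (zero_at m) (cchart A c)), momentum A c (fst (zero_at m)))"
    unfolding al using pm by simp
  have d: "chart_of A c (fst (R (fst (alpha A (zero_at m)))))" "chart_of A c (snd (R (fst (alpha A (zero_at m)))))"
    using c RD(4)[OF x] by (simp_all add: al)
  have "m = (fst m, covec_of A c (fst m) ?p)"
    by (rule ctbundle_eqI[OF A m _ c]) (use A c m in \<open>auto simp: ccarrier_iff covec_of_cspace\<close>)
  then show "cot_lift A R (zero_at m) = (m, m)"
    unfolding cot_lift_eq(1)[OF A RD(2) dom c2 d pm'] al RD(4)[OF x] by simp
qed

end

section \<open>The lift as a discretization map\<close>

text \<open>\<open>D\<close> and \<open>S\<close> are arbitrary data satisfying
  \<open>lagrangian_lift\<close>, since the theorem speaks of all of them.\<close>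

locale lifted_discretization = lagrangian_discretization +
  fixes D :: "(('a, 'b) tbundle, 'b \<times> 'b) tbundle set"
    and S :: "(('a, 'b) tbundle, 'b \<times> 'b) tbundle \<Rightarrow> ('a, 'b) tbundle \<times> ('a, 'b) tbundle"
  assumes lift: "lagrangian_lift A U R L D S"
begin

lemma D_open: "openin (mtop TTQ) D"
  using lift by (simp add: lagrangian_lift_def)

lemma D_tcarrier: "y \<in> D \<Longrightarrow> y \<in> tcarrier TQ"
  using openin_mtop_subset[OF TTA D_open] by auto

lemma zero_in_D: "v \<in> tcarrier A \<Longrightarrow> zero_at v \<in> D"
  using lift by (auto simp: lagrangian_lift_def)

lemma lift_local:
  assumes "w \<in> D"
  shows "\<exists>N P. diffeo_on TQ CQ N FL \<and>
    openin (mtop TTQ) P \<and> w \<in> P \<and> P \<subseteq> D \<and> fst ` P \<subseteq> N \<and>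
    (\<forall>y\<in>P. TFL y \<in> cot_lift_dom A U R \<and> cot_lift A R (TFL y) \<in> FL ` N \<times> FL ` N \<and>
      S y = map_prod (inv_into N FL) (inv_into N FL) (cot_lift A R (TFL y)))"
  using bspec[OF conjunct2[OF conjunct2[OF lift[unfolded lagrangian_lift_def]]] assms] unfolding Let_def .

text \<open>The branch \<open>N\<close> is eliminated here: what remains is that both components of
  \<open>S y\<close> are preimages under \<open>FL\<close> of those of the cotangent lift.\<close>

lemma lift_point:
  assumes y: "y \<in> D"
  shows "TFL y \<in> cot_lift_dom A U R" "fst (S y) \<in> tcarrier A" "snd (S y) \<in> tcarrier A"
    "FL (fst (S y)) = fst (cot_lift A R (TFL y))" "FL (snd (S y)) = snd (cot_lift A R (TFL y))"
proof -
  obtain N P where *: "diffeo_on TQ CQ N FL"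
    "openin (mtop TTQ) P" "y \<in> P" "P \<subseteq> D" "fst ` P \<subseteq> N"
    "\<And>y. y \<in> P \<Longrightarrow> TFL y \<in> cot_lift_dom A U R \<and> cot_lift A R (TFL y) \<in> FL ` N \<times> FL ` N \<and>
      S y = map_prod (inv_into N FL) (inv_into N FL) (cot_lift A R (TFL y))"
    using lift_local[OF y] by auto
  have N: "N \<subseteq> tcarrier A"
    using openin_mtop_subset[OF TA smooth_mapD_openin[OF diffeo_onD(1)[OF *(1)]]] by simp
  note y' = *(6)[OF *(3)]
  have m: "fst (cot_lift A R (TFL y)) \<in> FL ` N" "snd (cot_lift A R (TFL y)) \<in> FL ` N"
    using y' by (auto simp: mem_Times_iff)
  have S: "fst (S y) = inv_into N FL (fst (cot_lift A R (TFL y)))" "snd (S y) = inv_into N FL (snd (cot_lift A R (TFL y)))"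
    using y' by (simp_all add: map_prod_def case_prod_unfold)
  show "TFL y \<in> cot_lift_dom A U R" using y' by blast
  show "fst (S y) \<in> tcarrier A" "snd (S y) \<in> tcarrier A"
    unfolding S by (rule subsetD[OF N inv_into_into[OF m(1)]], rule subsetD[OF N inv_into_into[OF m(2)]])
  show "FL (fst (S y)) = fst (cot_lift A R (TFL y))" "FL (snd (S y)) = snd (cot_lift A R (TFL y))"
    unfolding S using m by (auto intro: f_inv_into_f)
qed

lemma lift_smooth: "smooth_map TTQ (prod_atlas TQ TQ) D S"
proof (rule smooth_mapI_cover[OF TTA TATA])
  fix y assume y: "y \<in> D"
  obtain N P where *: "diffeo_on TQ CQ N FL"
    "openin (mtop TTQ) P" "y \<in> P" "P \<subseteq> D" "fst ` P \<subseteq> N"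
    "\<And>y. y \<in> P \<Longrightarrow> TFL y \<in> cot_lift_dom A U R \<and> cot_lift A R (TFL y) \<in> FL ` N \<times> FL ` N \<and>
      S y = map_prod (inv_into N FL) (inv_into N FL) (cot_lift A R (TFL y))"
    using lift_local[OF y] by auto
  have T: "smooth_map TTQ (tan_atlas CQ) P TFL"
    by (rule smooth_map_subset[OF TTA TCA smooth_TFL *(2)]) (use *(4) D_tcarrier in blast)
  have C: "smooth_map TTQ (prod_atlas CQ CQ) P (\<lambda>y. cot_lift A R (TFL y))"
    by (rule smooth_map_compose[OF TTA TCA CACA T smooth_cot_lift[OF A RD(2)]]) (use *(6) in blast)
  have mem: "fst (cot_lift A R (TFL y)) \<in> FL ` N" "snd (cot_lift A R (TFL y)) \<in> FL ` N" if "y \<in> P" for y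
    using *(6)[OF that] by (auto simp: mem_Times_iff)
  have "smooth_map TTQ (prod_atlas TQ TQ) P
      (\<lambda>y. (inv_into N FL (fst (cot_lift A R (TFL y))), inv_into N FL (snd (cot_lift A R (TFL y)))))"
    by (intro smooth_map_Pair[OF TA TA TTA] smooth_map_compose[OF TTA CA TA _ diffeo_onD(3)[OF *(1)]]
        smooth_map_fst[OF CA CA TTA C] smooth_map_snd[OF CA CA TTA C] mem)
  then have "smooth_map TTQ (prod_atlas TQ TQ) P S"
    by (rule smooth_map_cong[OF TTA TATA]) (use *(6) in \<open>simp add: map_prod_def case_prod_unfold\<close>)
  then show "\<exists>T\<subseteq>D. y \<in> T \<and> smooth_map TTQ (prod_atlas TQ TQ) T S"
    using *(3,4) by blast
qed

text \<open>Both components of the cotangent lift at \<open>zero_at (FL v)\<close> are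
  \<open>FL v\<close>. The branch brings them back to \<open>v\<close> itself because its set
  \<open>N\<close> contains the base points of the vectors in \<open>P\<close>.\<close>

lemma lift_zero:
  assumes v: "v \<in> tcarrier A"
  shows "S (zero_at v) = (v, v)"
proof -
  obtain N P where *: "diffeo_on TQ CQ N FL"
    "openin (mtop TTQ) P" "zero_at v \<in> P" "P \<subseteq> D" "fst ` P \<subseteq> N"
    "\<And>y. y \<in> P \<Longrightarrow> TFL y \<in> cot_lift_dom A U R \<and> cot_lift A R (TFL y) \<in> FL ` N \<times> FL ` N \<and>
      S y = map_prod (inv_into N FL) (inv_into N FL) (cot_lift A R (TFL y))"
    using lift_local[OF zero_in_D[OF v]] by auto
  have "v \<in> N" using imageI[OF *(3), of fst] *(5) by auto
  then have "inv_into N FL (FL v) = v" by (rule inv_into_f_f[OF diffeo_onD(2)[OF *(1)]])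
  then show ?thesis
    using *(6)[OF *(3)] zero_in_cot_lift_dom(2)[OF legendre_ccarrier[OF A L v]] by (simp add: TFL_zero[OF v])
qed

text \<open>The balance of \<open>cot_lift_equation\<close> with every momentum written as
  \<open>\<partial>L/\<partial>v\<close>. Symplecticity and the fibre condition both start from
  it.\<close>

lemma lift_equation:
  assumes y: "y \<in> D" and c: "chart_of A c (fst (fst y))" and u: "u = fst (alpha A (TFL y))"
    and d: "chart_of A d0 (fst (fst (S y)))" "chart_of A d1 (fst (snd (S y)))"
  shows "u \<in> U" "fst (R u) = fst (fst (S y))" "snd (R u) = fst (snd (S y))"
    "- (pmap A L d0 (snd (tchart A d0) (fst (S y))) \<bullet> drep (tchart A c) d0 (\<lambda>w. fst (R w)) u v)
     + pmap A L d1 (snd (tchart A d1) (snd (S y))) \<bullet> drep (tchart A c) d1 (\<lambda>w. snd (R w)) u v =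
     fderiv (pmap A L c) (snd (tchart A c) (fst y)) (snd y (tchart A c)) \<bullet> fst v
     + pmap A L c (snd (tchart A c) (fst y)) \<bullet> snd v"
proof -
  note T = TFL_coord[OF D_tcarrier[OF y] c] and P = lift_point[OF y]
  have c2: "chart_of A c (fst (fst (TFL y)))" using c T(2) by simp
  show uU: "u \<in> U" using cot_lift_domD(2)[OF P(1)] by (simp add: u)
  have "R u \<in> carrier (prod_atlas A A)" using smooth_mapD_carrier[OF RD(2) uU] .
  then obtain e0 e1 where e: "chart_of A e0 (fst (R u))" "chart_of A e1 (snd (R u))" by (auto elim!: carrierE)
  note E = cot_lift_equation[OF A RD(2) P(1) c2 u]
  show f: "fst (R u) = fst (fst (S y))" "snd (R u) = fst (snd (S y))"
    using E(3,4)[OF e] arg_cong[OF P(4), of fst] arg_cong[OF P(5), of fst] by simp_all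
  have d': "chart_of A d0 (fst (R u))" "chart_of A d1 (snd (R u))" using d f by simp_all
  show "- (pmap A L d0 (snd (tchart A d0) (fst (S y))) \<bullet> drep (tchart A c) d0 (\<lambda>w. fst (R w)) u v)
     + pmap A L d1 (snd (tchart A d1) (snd (S y))) \<bullet> drep (tchart A c) d1 (\<lambda>w. snd (R w)) u v =
     fderiv (pmap A L c) (snd (tchart A c) (fst y)) (snd y (tchart A c)) \<bullet> fst v
     + pmap A L c (snd (tchart A c) (fst y)) \<bullet> snd v"
    using E(5)[OF d', of v]
    unfolding P(4,5)[symmetric] momentum_legendre[OF A L P(2) d(1)] momentum_legendre[OF A L P(3) d(2)] T(3,4) by simp
qed

text \<open>The base part of the identity is the fibre condition for \<open>R\<close>. For the rest,
  the differentiated balance says that the derivative of the momentum annihilates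
  \<open>\<sigma>1 - \<sigma>0 - \<xi>\<close>; this vector is vertical, so regularity makes it
  zero.\<close>

lemma lift_fibre_derivative:
  assumes v: "v \<in> tcarrier A" and c: "chart_of A c (fst v)"
  shows "drep (tchart TQ (tchart A c)) (tchart A c) (\<lambda>w. snd (S w)) (zero_at v) (0, \<xi>)
    - drep (tchart TQ (tchart A c)) (tchart A c) (\<lambda>w. fst (S w)) (zero_at v) (0, \<xi>) = \<xi>"
proof -
  have c': "c \<in> A" using c by simp
  let ?c = "tchart A c" and ?k = "tchart TQ (tchart A c)"
  have in': "?c \<in> TQ" "?k \<in> TTQ" using c' by auto
  have vc: "chart_of TQ ?c v" by (rule tchart_chart[OF v c])
  define x where "x = snd ?c v"
  define k where "k = snd c (fst v)"
  have xk: "fst x = k" by (simp add: x_def k_def snd_tchart)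
  have kc: "k \<in> cdom c" using c by (simp add: k_def)
  have xU: "x \<in> cdom c \<times> UNIV" using kc xk by (simp add: mem_Times_iff)
  have xim: "x \<in> snd ?c ` fst ?c" unfolding x_def using vc by blast
  have cix: "chart_inv ?c x = v" unfolding x_def by (rule tchart_inv_left[OF A v c])
  have \<Theta>: "chart_inv ?k (x, \<xi>) = (v, tvec_of TQ ?c v \<xi>)" for \<xi>
    using chart_inv_tchart[OF TA in'(1) xim] by (simp add: cix)
  have sm: "smooth_map TTQ TQ D (\<lambda>w. fst (S w))"
    "smooth_map TTQ TQ D (\<lambda>w. snd (S w))"
    by (rule smooth_map_fst[OF TA TA TTA lift_smooth], rule smooth_map_snd[OF TA TA TTA lift_smooth])
  \<comment> \<open>The two end points as functions of the fibre coordinate, with the base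
    coordinate \<open>x\<close> frozen.\<close>
  define s0 s1 where "s0 \<xi> = rep ?k ?c (\<lambda>w. fst (S w)) (x, \<xi>)" and "s1 \<xi> = rep ?k ?c (\<lambda>w. snd (S w)) (x, \<xi>)" for \<xi>
  define \<sigma>0 \<sigma>1 where "\<sigma>0 = drep ?k ?c (\<lambda>w. fst (S w)) (zero_at v) (0, \<xi>)" and "\<sigma>1 = drep ?k ?c (\<lambda>w. snd (S w)) (zero_at v) (0, \<xi>)"
  let ?ZZ = "rep_dom ?k ?c D (\<lambda>w. fst (S w)) \<inter> rep_dom ?k ?c D (\<lambda>w. snd (S w))"
  define T where "T = (\<lambda>\<xi>. (x, \<xi>)) -` ?ZZ"
  have oZ: "open ?ZZ" using open_rep_dom[OF sm(1) in'(2,1)] open_rep_dom[OF sm(2) in'(2,1)] by auto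
  have T: "open T" unfolding T_def by (intro open_vimage oZ continuous_intros)
  have ck: "snd ?k (zero_at v) = (x, 0)" by (simp add: snd_tchart_zero x_def)
  have zk: "chart_of TTQ ?k (zero_at v)" by (rule zero_at_chart[OF TA vc])
  have T0: "0 \<in> T"
    using rep_domI[of "zero_at v" D ?k "\<lambda>w. fst (S w)" ?c] rep_domI[of "zero_at v" D ?k "\<lambda>w. snd (S w)" ?c]
      zero_in_D[OF v] zk vc lift_zero[OF v] by (simp add: T_def ck)
  have ds: "(s0 has_derivative (\<lambda>\<xi>. drep ?k ?c (\<lambda>w. fst (S w)) (zero_at v) (0, \<xi>))) (at 0)"
    "(s1 has_derivative (\<lambda>\<xi>. drep ?k ?c (\<lambda>w. snd (S w)) (zero_at v) (0, \<xi>))) (at 0)"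
    unfolding s0_def[abs_def] s1_def[abs_def]
    by (rule has_derivative_compose[of "\<lambda>\<xi>. (x, \<xi>)" "\<lambda>\<xi>. (0, \<xi>)"],
        intro has_derivative_Pair has_derivative_const has_derivative_ident,
        use rep_has_derivative[OF sm(1) zero_in_D[OF v] zk] rep_has_derivative[OF sm(2) zero_in_D[OF v] zk] lift_zero[OF v] vc in \<open>simp add: ck\<close>)+
  have s00: "s0 0 = x" "s1 0 = x"
    using \<Theta>[of 0] lift_zero[OF v] tvec_of_zero[OF TA vc] by (simp_all add: s0_def s1_def zero_at_def x_def)
  let ?r0 = "rep ?c c (\<lambda>w. fst (R w))" and ?r1 = "rep ?c c (\<lambda>w. snd (R w))"
  let ?Z0 = "rep_dom ?c c U (\<lambda>w. fst (R w))" and ?Z1 = "rep_dom ?c c U (\<lambda>w. snd (R w))"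
  have qx: "fst v \<in> carrier A" using v by (simp add: tcarrier_iff)
  have smr: "smooth_on ?Z0 ?r0" "smooth_on ?Z1 ?r1"
    by (rule smooth_map_rep[OF RD(5) in'(1) c'], rule smooth_map_rep[OF RD(6) in'(1) c'])
  have oZ01: "open ?Z0" "open ?Z1" by (rule open_rep_dom[OF RD(5) in'(1) c'], rule open_rep_dom[OF RD(6) in'(1) c'])
  have zs: "(q, 0) \<in> ?Z0" "(q, 0) \<in> ?Z1" "snd ?c (zero_at (chart_inv c q)) = (q, 0)" "chart_of A c (chart_inv c q)" if "q \<in> cdom c" for q
  proof -
    have m: "chart_of A c (chart_inv c q)" "chart_inv c q \<in> carrier A"
      using c' that by (auto simp: chart_inv_mem intro: carrierI)
    then show s: "snd ?c (zero_at (chart_inv c q)) = (q, 0)" "chart_of A c (chart_inv c q)"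
      using that by (simp_all add: snd_tchart_zero chart_inv_right)
    show "(q, 0) \<in> ?Z0" "(q, 0) \<in> ?Z1"
      using rep_domI[of "zero_at (chart_inv c q)" U ?c "\<lambda>w. fst (R w)" c] rep_domI[of "zero_at (chart_inv c q)" U ?c "\<lambda>w. snd (R w)" c]
        RD(3,4)[OF m(2)] zero_at_chart[OF A m(1)] m(1) by (simp_all add: s)
  qed
  \<comment> \<open>A horizontal test vector \<open>(a, 0)\<close> removes the term with the
    momentum at \<open>x\<close>. The base components of the end points depend on
    \<open>\<xi>\<close> only through its first half.\<close>
  have E: "fst (s0 \<xi>) = ?r0 (k, fst \<xi>)" "fst (s1 \<xi>) = ?r1 (k, fst \<xi>)"
    "- (pmap A L c (s0 \<xi>) \<bullet> fderiv ?r0 (k, fst \<xi>) (a, 0)) + pmap A L c (s1 \<xi>) \<bullet> fderiv ?r1 (k, fst \<xi>) (a, 0) =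
     fderiv (pmap A L c) x \<xi> \<bullet> a" if \<xi>: "\<xi> \<in> T" for \<xi> a
  proof -
    define y where "y = chart_inv ?k (x, \<xi>)"
    have "(x, \<xi>) \<in> ?ZZ" using \<xi> by (simp add: T_def)
    then have y: "y \<in> D" "fst (S y) \<in> fst ?c" "snd (S y) \<in> fst ?c"
      by (auto simp: rep_dom_iff[OF TTA in'(2)] y_def)
    have fy: "fst y = v" "snd y ?c = \<xi>" using \<Theta>[of \<xi>] tvec_of_self[OF TA vc] by (simp_all add: y_def)
    have cy: "chart_of A c (fst (fst y))" using c fy by simp
    define u where "u = fst (alpha A (TFL y))"
    note u = fst_alpha_TFL[OF D_tcarrier[OF y(1)] cy, folded u_def]
    have su: "snd ?c u = (k, fst \<xi>)" using u(3) by (simp add: fy k_def)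
    have uc: "chart_of A c (fst u)" using u(1) cy by simp
    have iu: "chart_inv ?c (k, fst \<xi>) = u" using tchart_inv_left[OF A u(2) uc] su by simp
    have dd: "chart_of A c (fst (fst (S y)))" "chart_of A c (fst (snd (S y)))" using y c' by (auto simp: fst_tchart)
    note eq = lift_equation[OF y(1) cy u_def dd]
    have ss: "s0 \<xi> = snd ?c (fst (S y))" "s1 \<xi> = snd ?c (snd (S y))" by (simp_all add: s0_def s1_def y_def)
    show "fst (s0 \<xi>) = ?r0 (k, fst \<xi>)" "fst (s1 \<xi>) = ?r1 (k, fst \<xi>)"
      using eq(2,3) by (simp_all add: iu ss snd_tchart)
    show "- (pmap A L c (s0 \<xi>) \<bullet> fderiv ?r0 (k, fst \<xi>) (a, 0)) + pmap A L c (s1 \<xi>) \<bullet> fderiv ?r1 (k, fst \<xi>) (a, 0) =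
       fderiv (pmap A L c) x \<xi> \<bullet> a"
      using eq(4)[of "(a, 0)"] by (simp add: su ss fy x_def)
  qed
  have d0: "((\<lambda>\<xi>. (k, fst \<xi>)) has_derivative (\<lambda>\<xi>. (0, fst \<xi>))) (at (0 :: 'b \<times> 'b))"
    by (intro has_derivative_Pair has_derivative_const has_derivative_fst has_derivative_ident)
  have k0: "(k, fst (0 :: 'b \<times> 'b)) = (k, 0)" by simp
  have fst\<sigma>: "fst \<sigma>0 = fderiv ?r0 (k, 0) (0, fst \<xi>)" "fst \<sigma>1 = fderiv ?r1 (k, 0) (0, fst \<xi>)"
  proof -
    have "((\<lambda>\<xi>. ?r0 (k, fst \<xi>)) has_derivative (\<lambda>\<xi>. fderiv ?r0 (k, 0) (0, fst \<xi>))) (at (0 :: 'b \<times> 'b))"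
      by (rule has_derivative_compose[where g = ?r0 and g' = "fderiv ?r0 (k, 0)", OF d0]) (use smooth_on_has_derivative[OF smr(1) zs(1)[OF kc]] in simp)
    moreover have "((\<lambda>\<xi>. ?r0 (k, fst \<xi>)) has_derivative (\<lambda>\<xi>. fst (drep ?k ?c (\<lambda>w. fst (S w)) (zero_at v) (0, \<xi>)))) (at 0)"
      by (rule has_derivative_transform_within_open[OF has_derivative_fst[OF ds(1)] T T0]) (rule E(1))
    ultimately show "fst \<sigma>0 = fderiv ?r0 (k, 0) (0, fst \<xi>)"
      unfolding \<sigma>0_def by (rule has_derivative_unique[THEN fun_cong, symmetric])
    have "((\<lambda>\<xi>. ?r1 (k, fst \<xi>)) has_derivative (\<lambda>\<xi>. fderiv ?r1 (k, 0) (0, fst \<xi>))) (at (0 :: 'b \<times> 'b))"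
      by (rule has_derivative_compose[where g = ?r1 and g' = "fderiv ?r1 (k, 0)", OF d0]) (use smooth_on_has_derivative[OF smr(2) zs(2)[OF kc]] in simp)
    moreover have "((\<lambda>\<xi>. ?r1 (k, fst \<xi>)) has_derivative (\<lambda>\<xi>. fst (drep ?k ?c (\<lambda>w. snd (S w)) (zero_at v) (0, \<xi>)))) (at 0)"
      by (rule has_derivative_transform_within_open[OF has_derivative_fst[OF ds(2)] T T0]) (rule E(2))
    ultimately show "fst \<sigma>1 = fderiv ?r1 (k, 0) (0, fst \<xi>)"
      unfolding \<sigma>1_def by (rule has_derivative_unique[THEN fun_cong, symmetric])
  qed
  have zk': "zero_at (fst v) = zero_at (chart_inv c k)" using c by (simp add: k_def chart_inv_left[OF A])
  have fib: "fderiv ?r1 (q, 0) (0, b) - fderiv ?r0 (q, 0) (0, b) = b" if "q \<in> cdom c" for q b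
    using discretization_chart[OF A R zs(4)[OF that], of b] unfolding zs(3)[OF that] .
  have hor: "fderiv ?r0 (k, 0) (a, 0) = a" "fderiv ?r1 (k, 0) (a, 0) = a" for a
    using drep_zero_section[OF A RD(5) _ zs(4)[OF kc], of a] drep_zero_section[OF A RD(6) _ zs(4)[OF kc], of a] RD(3,4)
    unfolding zs(3)[OF kc] by simp_all
  have f\<xi>: "fst (\<sigma>1 - \<sigma>0 - \<xi>) = 0" using fib[OF kc, of "fst \<xi>"] by (simp add: fst\<sigma>)
  have smp: "smooth_on (cdom c \<times> UNIV) (pmap A L c)" by (rule pmap_smooth[OF A L c'])
  note Dp = smooth_on_has_derivative[OF smp xU]
  \<comment> \<open>Differentiate \<open>fib\<close>, whose value is constant in \<open>q\<close>,
    along the base; \<open>fderiv_symmetric\<close> then exchanges the two directions.\<close>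
  have mixed: "fderiv (\<lambda>p. fderiv ?r1 p (a, 0)) (k, 0) (0, b) = fderiv (\<lambda>p. fderiv ?r0 p (a, 0)) (k, 0) (0, b)" for a b
  proof -
    have h: "((\<lambda>q. fderiv r (q, 0) (0, b)) has_derivative (\<lambda>a. fderiv (\<lambda>p. fderiv r p (0, b)) (k, 0) (a, 0))) (at k)"
      if "smooth_on Z r" "(k, 0) \<in> Z" for r :: "'b \<times> 'b \<Rightarrow> 'b" and Z
      by (rule has_derivative_compose[of "\<lambda>q. (q, 0)" "\<lambda>a. (a, 0)", OF _ smooth_on_has_derivative[OF smooth_on_fderiv[OF that(1)] that(2)]])
        (intro has_derivative_Pair has_derivative_const has_derivative_ident)
    have "((\<lambda>q. fderiv ?r1 (q, 0) (0, b) - fderiv ?r0 (q, 0) (0, b)) has_derivative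
        (\<lambda>a. fderiv (\<lambda>p. fderiv ?r1 p (0, b)) (k, 0) (a, 0) - fderiv (\<lambda>p. fderiv ?r0 p (0, b)) (k, 0) (a, 0))) (at k)"
      by (intro has_derivative_diff h[OF smr(1) zs(1)[OF kc]] h[OF smr(2) zs(2)[OF kc]])
    moreover have "((\<lambda>q. fderiv ?r1 (q, 0) (0, b) - fderiv ?r0 (q, 0) (0, b)) has_derivative (\<lambda>a. 0)) (at k)"
      by (rule has_derivative_transform_within_open[OF has_derivative_const[of b] atlas_open_dom[OF A c'] kc]) (use fib in simp)
    ultimately have "(\<lambda>a. fderiv (\<lambda>p. fderiv ?r1 p (0, b)) (k, 0) (a, 0) - fderiv (\<lambda>p. fderiv ?r0 p (0, b)) (k, 0) (a, 0)) = (\<lambda>a. 0)"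
      by (rule has_derivative_unique)
    from fun_cong[OF this, of a] show ?thesis
      unfolding fderiv_symmetric[OF oZ01(1) smr(1) zs(1)[OF kc], of "(a, 0)" "(0, b)"]
        fderiv_symmetric[OF oZ01(2) smr(2) zs(2)[OF kc], of "(a, 0)" "(0, b)"] by simp
  qed
  \<comment> \<open>Differentiate \<open>E(3)\<close> at \<open>\<xi> = 0\<close>. Both end points
    are \<open>x\<close> there, so the two mixed terms carry the same momentum and cancel by
    \<open>mixed\<close>.\<close>
  have "fderiv (pmap A L c) x (\<sigma>1 - \<sigma>0 - \<xi>) \<bullet> a = 0" for a
  proof -
    let ?D = "fderiv (pmap A L c) x"
    have p: "((\<lambda>\<xi>. pmap A L c (s0 \<xi>)) has_derivative (\<lambda>\<xi>. ?D (drep ?k ?c (\<lambda>w. fst (S w)) (zero_at v) (0, \<xi>)))) (at 0)"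
      "((\<lambda>\<xi>. pmap A L c (s1 \<xi>)) has_derivative (\<lambda>\<xi>. ?D (drep ?k ?c (\<lambda>w. snd (S w)) (zero_at v) (0, \<xi>)))) (at 0)"
      by (rule has_derivative_compose[where g = "pmap A L c" and g' = ?D, OF ds(1)], use Dp s00 in simp,
          rule has_derivative_compose[where g = "pmap A L c" and g' = ?D, OF ds(2)], use Dp s00 in simp)
    have g: "((\<lambda>\<xi>. fderiv ?r0 (k, fst \<xi>) (a, 0)) has_derivative (\<lambda>\<xi>. fderiv (\<lambda>p. fderiv ?r0 p (a, 0)) (k, 0) (0, fst \<xi>))) (at (0 :: 'b \<times> 'b))"
      "((\<lambda>\<xi>. fderiv ?r1 (k, fst \<xi>) (a, 0)) has_derivative (\<lambda>\<xi>. fderiv (\<lambda>p. fderiv ?r1 p (a, 0)) (k, 0) (0, fst \<xi>))) (at (0 :: 'b \<times> 'b))"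
      by (rule has_derivative_compose[where g = "\<lambda>p. fderiv ?r0 p (a, 0)"
            and g' = "fderiv (\<lambda>p. fderiv ?r0 p (a, 0)) (k, 0)", OF d0],
          use smooth_on_has_derivative[OF smooth_on_fderiv[OF smr(1)] zs(1)[OF kc]] in simp,
          rule has_derivative_compose[where g = "\<lambda>p. fderiv ?r1 p (a, 0)"
            and g' = "fderiv (\<lambda>p. fderiv ?r1 p (a, 0)) (k, 0)", OF d0], use smooth_on_has_derivative[OF smooth_on_fderiv[OF smr(2)] zs(2)[OF kc]] in simp)
    note h = has_derivative_add[OF has_derivative_minus[OF has_derivative_inner[OF p(1) g(1)]] has_derivative_inner[OF p(2) g(2)]]
    have "((\<lambda>\<xi>. ?D \<xi> \<bullet> a) has_derivative (\<lambda>\<xi>. ?D \<xi> \<bullet> a)) (at 0)"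
      by (rule has_derivative_inner_left, rule linear_imp_has_derivative, rule smooth_on_linear[OF smp xU])
    moreover have "((\<lambda>\<xi>. ?D \<xi> \<bullet> a) has_derivative
        (\<lambda>\<xi>. - (pmap A L c (s0 0) \<bullet> fderiv (\<lambda>p. fderiv ?r0 p (a, 0)) (k, 0) (0, fst \<xi>)
            + ?D (drep ?k ?c (\<lambda>w. fst (S w)) (zero_at v) (0, \<xi>)) \<bullet> fderiv ?r0 (k, fst (0 :: 'b \<times> 'b)) (a, 0))
          + (pmap A L c (s1 0) \<bullet> fderiv (\<lambda>p. fderiv ?r1 p (a, 0)) (k, 0) (0, fst \<xi>)
            + ?D (drep ?k ?c (\<lambda>w. snd (S w)) (zero_at v) (0, \<xi>)) \<bullet> fderiv ?r1 (k, fst (0 :: 'b \<times> 'b)) (a, 0)))) (at 0)"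
      by (rule has_derivative_transform_within_open[OF h T T0]) (rule E(3))
    ultimately have "?D \<xi> \<bullet> a = - (pmap A L c x \<bullet> fderiv (\<lambda>p. fderiv ?r0 p (a, 0)) (k, 0) (0, fst \<xi>) + ?D \<sigma>0 \<bullet> a)
          + (pmap A L c x \<bullet> fderiv (\<lambda>p. fderiv ?r1 p (a, 0)) (k, 0) (0, fst \<xi>) + ?D \<sigma>1 \<bullet> a)"
      unfolding s00 k0 hor \<sigma>0_def \<sigma>1_def by (rule has_derivative_unique[THEN fun_cong])
    then have "?D \<xi> \<bullet> a = ?D \<sigma>1 \<bullet> a - ?D \<sigma>0 \<bullet> a" unfolding mixed by simp
    then show ?thesis
      by (simp add: linear_diff[OF smooth_on_linear[OF smp xU]] inner_diff_left)
  qed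
  then have "fderiv (pmap A L c) x (\<sigma>1 - \<sigma>0 - \<xi>) = 0"
    using inner_eq_zero_iff by blast
  moreover have "\<sigma>1 - \<sigma>0 - \<xi> = (0, snd (\<sigma>1 - \<sigma>0 - \<xi>))" using f\<xi> by (simp add: prod_eq_iff)
  ultimately have "snd (\<sigma>1 - \<sigma>0 - \<xi>) = 0" using reg[OF v c] unfolding x_def[symmetric] by metis
  with f\<xi> have "\<sigma>1 - \<sigma>0 - \<xi> = 0" by (simp add: prod_eq_iff)
  then show ?thesis unfolding \<sigma>0_def \<sigma>1_def by simp
qed

lemma lift_discretization: "discretization_map TQ D S"
  unfolding discretization_map_def
proof (intro conjI D_open lift_smooth)
  show "zero_at ` carrier TQ \<subseteq> D" using zero_in_D by auto
  show "\<forall>x\<in>carrier TQ. S (zero_at x) = (x, x)" using lift_zero by simp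
  show "\<forall>x\<in>carrier TQ. \<forall>\<xi>\<in>tspace TQ x.
      (\<lambda>d. fibre_deriv TQ x (\<lambda>\<eta>. snd (S (x, \<eta>))) \<xi> d - fibre_deriv TQ x (\<lambda>\<eta>. fst (S (x, \<eta>))) \<xi> d) = \<xi>"
  proof
    fix v assume v': "v \<in> carrier TQ"
    then have v: "v \<in> tcarrier A" by simp
    have ch: "chart_of TQ (chart_at TQ v) v" by (rule chart_at_in[OF v'])
    then obtain c where c: "c \<in> A" "chart_at TQ v = tchart A c" by (auto elim: tan_atlasE)
    have cv: "chart_of A c (fst v)" using ch c by (simp add: fst_tchart)
    show "\<forall>\<xi>\<in>tspace TQ v.
      (\<lambda>d. fibre_deriv TQ v (\<lambda>\<eta>. snd (S (v, \<eta>))) \<xi> d - fibre_deriv TQ v (\<lambda>\<eta>. fst (S (v, \<eta>))) \<xi> d) = \<xi>"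
      unfolding discretization_fibre[OF TA lift_smooth zero_in_D[OF v] lift_zero[OF v] v' c(2)[symmetric]]
      using lift_fibre_derivative[OF v cv] by blast
  qed
qed

end

section \<open>The Euler--Lagrange vector field\<close>

lemma smooth_atlas_real: "smooth_atlas real_atlas"
proof -
  have "chart_inv (UNIV, id) = (id :: real \<Rightarrow> real)" by (auto simp: chart_inv_def inv_id)
  then show ?thesis
    using smooth_on_ident[of "UNIV :: real set"] by (simp add: smooth_atlas_def real_atlas_def id_def o_def)
qed

lemma chart_of_real: "chart_of real_atlas (UNIV, id) x"
  by (simp add: real_atlas_def)

lemma smooth_scale:
  assumes A: "smooth_atlas A"
  shows "smooth_map (tan_atlas A) (tan_atlas A) (tcarrier A) (scale h)"
proof (rule smooth_mapI_local[OF smooth_atlas_tan[OF A] smooth_atlas_tan[OF A]])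
  show "openin (mtop (tan_atlas A)) (tcarrier A)" using openin_carrier[OF smooth_atlas_tan[OF A]] by simp
  fix w assume w: "w \<in> tcarrier A"
  then obtain c where c: "chart_of A c (fst w)" by (auto simp: tcarrier_iff elim: carrierE)
  then have c': "c \<in> A" by simp
  note o = open_cdom_UNIV[OF A c']
  have eq: "snd (tchart A c) (scale h (chart_inv (tchart A c) u)) = (fst u, h *\<^sub>R snd u) \<and>
      scale h (chart_inv (tchart A c) u) \<in> fst (tchart A c)" if "u \<in> cdom c \<times> UNIV" for u
  proof -
    note m = chart_inv_tchart_mem[OF A c' that]
    have "snd (tchart A c) (chart_inv (tchart A c) u) = u" using m by simp
    then have "snd c (fst (chart_inv (tchart A c) u)) = fst u" "snd (chart_inv (tchart A c) u) c = snd u"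
      by (metis fst_conv snd_tchart, metis snd_conv snd_tchart)
    then show ?thesis using m by (simp add: snd_tchart fst_tchart scale_tcarrier[OF A])
  qed
  have "smooth_on (cdom c \<times> UNIV) (\<lambda>u. (fst u, h *\<^sub>R snd u))"
    by (intro smooth_on_Pair smooth_on_fst smooth_on_snd smooth_on_scaleR smooth_on_const smooth_on_ident o)
  then have "smooth_on (cdom c \<times> UNIV) (rep (tchart A c) (tchart A c) (scale h))"
    by (subst smooth_on_cong[OF o, where g = "\<lambda>u. (fst u, h *\<^sub>R snd u)"]) (use eq in auto)
  then show "\<exists>e d N. e \<in> tan_atlas A \<and> d \<in> tan_atlas A \<and> w \<in> fst e \<and> open N \<and> snd e w \<in> N \<and>
      (\<forall>u\<in>N. u \<in> snd e ` fst e \<longrightarrow> chart_inv e u \<in> tcarrier A \<longrightarrow> scale h (chart_inv e u) \<in> fst d) \<and>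
      smooth_on N (rep e d (scale h))"
    using c o w eq tchart_cdom[OF A c', of w]
    by (intro exI[of _ "tchart A c"] exI[of _ "cdom c \<times> UNIV"]) (simp add: fst_tchart)
qed

text \<open>The exterior derivative of \<open>p\<^sub>1 dq\<^sub>1 - p\<^sub>0 dq\<^sub>0 = dG\<close>, where \<open>q\<^sub>0\<close> is the first coordinate.\<close>
lemma exact_difference_symplectic:
  fixes P0 P1 q1 :: "'e::euclidean_space \<times> 'e \<Rightarrow> 'e" and G :: "'e \<times> 'e \<Rightarrow> real"
  assumes T: "open T" "p \<in> T" and sm: "smooth_on T P0" "smooth_on T P1" "smooth_on T q1" "smooth_on T G"
    and ex: "\<And>u \<delta>. u \<in> T \<Longrightarrow> - (P0 u \<bullet> fst \<delta>) + P1 u \<bullet> fderiv q1 u \<delta> = fderiv G u \<delta>"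
  shows "fderiv q1 p \<delta> \<bullet> fderiv P1 p \<epsilon> - fderiv q1 p \<epsilon> \<bullet> fderiv P1 p \<delta> = fst \<delta> \<bullet> fderiv P0 p \<epsilon> - fst \<epsilon> \<bullet> fderiv P0 p \<delta>"
proof -
  \<comment> \<open>The identity \<open>ex\<close> of one-forms, with \<open>\<delta>\<close> held
    constant, differentiated along \<open>\<epsilon>\<close>. Antisymmetrising in the two directions
    removes the second derivatives of \<open>q1\<close> and \<open>G\<close>.\<close>
  have key: "- (fderiv P0 p \<epsilon> \<bullet> fst \<delta>) + (P1 p \<bullet> fderiv (\<lambda>u. fderiv q1 u \<delta>) p \<epsilon> + fderiv P1 p \<epsilon> \<bullet> fderiv q1 p \<delta>) =
      fderiv (\<lambda>u. fderiv G u \<delta>) p \<epsilon>" for \<delta> \<epsilon>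
  proof -
    note D = smooth_on_has_derivative[OF _ T(2)]
    have "((\<lambda>u. - (P0 u \<bullet> fst \<delta>) + P1 u \<bullet> fderiv q1 u \<delta>) has_derivative
        (\<lambda>\<epsilon>. - (fderiv P0 p \<epsilon> \<bullet> fst \<delta>) + (P1 p \<bullet> fderiv (\<lambda>u. fderiv q1 u \<delta>) p \<epsilon> + fderiv P1 p \<epsilon> \<bullet> fderiv q1 p \<delta>))) (at p)"
      by (intro has_derivative_add has_derivative_minus has_derivative_inner_left has_derivative_inner
          D[OF sm(1)] D[OF sm(2)] D[OF smooth_on_fderiv[OF sm(3)]])
    from has_derivative_transform_within_open[OF this T ex]
    have "((\<lambda>u. fderiv G u \<delta>) has_derivative
        (\<lambda>\<epsilon>. - (fderiv P0 p \<epsilon> \<bullet> fst \<delta>) + (P1 p \<bullet> fderiv (\<lambda>u. fderiv q1 u \<delta>) p \<epsilon> + fderiv P1 p \<epsilon> \<bullet> fderiv q1 p \<delta>))) (at p)" .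
    from fderiv_eq[OF this] show ?thesis by simp
  qed
  have "fderiv (\<lambda>u. fderiv G u \<delta>) p \<epsilon> = fderiv (\<lambda>u. fderiv G u \<epsilon>) p \<delta>"
    by (rule fderiv_symmetric[OF T(1) sm(4) T(2)])
  moreover have "fderiv (\<lambda>u. fderiv q1 u \<delta>) p \<epsilon> = fderiv (\<lambda>u. fderiv q1 u \<epsilon>) p \<delta>"
    by (rule fderiv_symmetric[OF T(1) sm(3) T(2)])
  ultimately show ?thesis
    using key[of \<epsilon> \<delta>] key[of \<delta> \<epsilon>] by (simp add: inner_commute)
qed

section \<open>Energy and the Euler--Lagrange field in charts\<close>

context lagrangian_discretization
begin

abbreviation "\<Gamma> \<equiv> Gamma_L A L"

lemma energy_rep:
  assumes c: "c \<in> A" and u: "u \<in> cdom c \<times> UNIV"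
  shows "energy A L (chart_inv (tchart A c) u) = pmap A L c u \<bullet> snd u - lag A L c u"
proof -
  note m = chart_inv_tchart_mem[OF A c u]
  let ?w = "chart_inv (tchart A c) u"
  have w: "?w \<in> tcarrier A" "chart_of A c (fst ?w)" "snd ?w \<in> tspace A (fst ?w)" using m c by (auto simp: tcarrier_iff)
  have s: "snd (tchart A c) ?w = u" using m by simp
  then have "snd ?w c = snd u" by (metis snd_conv snd_tchart)
  then show ?thesis unfolding energy_def legendre_apply[OF A L w] s by simp
qed

lemma smooth_energy_rep:
  assumes c: "c \<in> A"
  shows "smooth_on (cdom c \<times> UNIV) (\<lambda>u. pmap A L c u \<bullet> snd u - lag A L c u)"
  by (intro smooth_on_diff smooth_on_inner pmap_smooth[OF A L c] lag_smooth[OF A L c] smooth_on_snd smooth_on_ident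
      open_cdom_UNIV[OF A c])

lemma smooth_energy: "smooth_map TQ real_atlas (tcarrier A) (energy A L)"
proof (rule smooth_mapI_local[OF TA smooth_atlas_real])
  show "openin (mtop TQ) (tcarrier A)" using openin_carrier[OF TA] by simp
  fix w assume w: "w \<in> tcarrier A"
  then obtain c where c: "chart_of A c (fst w)" by (auto simp: tcarrier_iff elim: carrierE)
  then have c': "c \<in> A" by simp
  note o = open_cdom_UNIV[OF A c']
  have "smooth_on (cdom c \<times> UNIV) (\<lambda>u. snd (UNIV :: real set, id) (energy A L (chart_inv (tchart A c) u)))"
    by (subst smooth_on_cong[OF o, where g = "\<lambda>u. pmap A L c u \<bullet> snd u - lag A L c u"])
      (simp_all add: energy_rep[OF c'] smooth_energy_rep[OF c'])
  then show "\<exists>e d N. e \<in> TQ \<and> d \<in> real_atlas \<and> w \<in> fst e \<and> open N \<and> snd e w \<in> N \<and>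
      (\<forall>u\<in>N. u \<in> snd e ` fst e \<longrightarrow> chart_inv e u \<in> tcarrier A \<longrightarrow> energy A L (chart_inv e u) \<in> fst d) \<and>
      smooth_on N (rep e d (energy A L))"
    using c o w tchart_cdom[OF A c', of w]
    by (intro exI[of _ "tchart A c"] exI[of _ "(UNIV :: real set, id)"] exI[of _ "cdom c \<times> UNIV"])
      (simp add: fst_tchart real_atlas_def)
qed

lemma differential_energy:
  assumes w: "w \<in> tcarrier A" and c: "chart_of A c (fst w)" and Y: "Y \<in> tspace TQ w"
  shows "differential TQ (energy A L) w Y =
    pmap A L c (snd (tchart A c) w) \<bullet> snd (Y (tchart A c))
    + fderiv (pmap A L c) (snd (tchart A c) w) (Y (tchart A c)) \<bullet> snd w c
    - fderiv (lag A L c) (snd (tchart A c) w) (Y (tchart A c))"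
proof -
  have w': "w \<in> carrier TQ" using w by simp
  have c': "c \<in> A" using c by simp
  let ?e = "chart_at TQ w" and ?c = "tchart A c" and ?r = "(UNIV :: real set, id)"
  have e: "chart_of TQ ?e w" by (rule chart_at_in[OF w'])
  have tc: "chart_of TQ ?c w" by (rule tchart_chart[OF w c])
  have u: "snd ?c w \<in> cdom c \<times> UNIV" by (rule tchart_cdom[OF A c']) (use c in simp)
  have "differential TQ (energy A L) w Y = drep ?e ?r (energy A L) w (Y ?e)"
    by (simp add: differential_def Let_def o_def)
  also have "\<dots> = drep ?e ?r (energy A L) w (drep ?c ?e (\<lambda>x. x) w (Y ?c))"
    using tspace_trans[OF Y tc e] by simp
  also have "\<dots> = drep ?r ?r (\<lambda>x. x) (energy A L w) (drep ?c ?r (energy A L) w (Y ?c))"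
    by (rule drep_change[OF TA smooth_atlas_real smooth_energy w tc e chart_of_real chart_of_real])
  also have "\<dots> = drep ?c ?r (energy A L) w (Y ?c)" by (rule trans_self[OF smooth_atlas_real chart_of_real])
  also have "drep ?c ?r (energy A L) w = fderiv (\<lambda>u. pmap A L c u \<bullet> snd u - lag A L c u) (snd ?c w)"
    by (rule fderiv_cong[OF open_cdom_UNIV[OF A c'] u]) (simp add: energy_rep[OF c'])
  also have "\<dots> = (\<lambda>v. (pmap A L c (snd ?c w) \<bullet> snd v + fderiv (pmap A L c) (snd ?c w) v \<bullet> snd (snd ?c w)) - fderiv (lag A L c) (snd ?c w) v)"
    by (rule fderiv_eq, intro has_derivative_diff has_derivative_inner has_derivative_snd has_derivative_ident
        smooth_on_has_derivative[OF pmap_smooth[OF A L c'] u] smooth_on_has_derivative[OF lag_smooth[OF A L c'] u])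
  finally show ?thesis by (simp add: snd_tchart)
qed

lemma fderiv_lag_split:
  assumes c: "c \<in> A" and u: "u \<in> cdom c \<times> UNIV"
  shows "fderiv (lag A L c) u v = fderiv (lag A L c) u (fst v, 0) + pmap A L c u \<bullet> snd v"
  using linear_add[OF smooth_on_linear[OF lag_smooth[OF A L c] u], of "(fst v, 0)" "(0, snd v)"]
  by (simp add: pmap_inner[OF A L c u])

lemma pmap_vertical:
  assumes w: "w \<in> tcarrier A" and c: "chart_of A c (fst w)"
  shows "linear (\<lambda>b. fderiv (pmap A L c) (snd (tchart A c) w) (0, b))"
    "inj (\<lambda>b. fderiv (pmap A L c) (snd (tchart A c) w) (0, b))"
    "surj (\<lambda>b. fderiv (pmap A L c) (snd (tchart A c) w) (0, b))"
proof -
  have c': "c \<in> A" using c by simp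
  have u: "snd (tchart A c) w \<in> cdom c \<times> UNIV" by (rule tchart_cdom[OF A c']) (use c in simp)
  let ?D = "fderiv (pmap A L c) (snd (tchart A c) w)"
  have l: "linear ?D" by (rule smooth_on_linear[OF pmap_smooth[OF A L c'] u])
  show lin: "linear (\<lambda>b. ?D (0, b))"
    using linear_compose[of "\<lambda>b. (0, b)" ?D] l by (auto simp: o_def linear_iff)
  show inj: "inj (\<lambda>b. ?D (0, b))"
    unfolding linear_injective_0[OF lin] using reg[OF w c] by blast
  show "surj (\<lambda>b. ?D (0, b))" by (rule linear_inj_imp_surj_self[OF lin inj])
qed

text \<open>In the differential of the energy the terms in which \<partial>L/\<partial>v meets the
  fibre increment cancel. What is left splits into the second-order condition and the
  Euler--Lagrange equation
  \<open>d/dt \<partial>L/\<partial>v = \<partial>L/\<partial>q\<close>.\<close>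

lemma Gamma_equation_iff:
  assumes w: "w \<in> tcarrier A" and c: "chart_of A c (fst w)" and X: "X \<in> tspace TQ w"
  shows "(\<forall>Y\<in>tspace TQ w. Omega_L A L w X Y = differential TQ (energy A L) w Y) \<longleftrightarrow>
    fst (X (tchart A c)) = snd w c \<and>
    (\<forall>b. fderiv (pmap A L c) (snd (tchart A c) w) (X (tchart A c)) \<bullet> b = fderiv (lag A L c) (snd (tchart A c) w) (b, 0))"
    (is "?l \<longleftrightarrow> ?r")
proof -
  have c': "c \<in> A" using c by simp
  let ?c = "tchart A c" and ?x = "snd (tchart A c) w"
  let ?D = "fderiv (pmap A L c) ?x"
  have tc: "chart_of TQ ?c w" by (rule tchart_chart[OF w c])
  have u: "?x \<in> cdom c \<times> UNIV" by (rule tchart_cdom[OF A c']) (use c in simp)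
  have eq: "Omega_L A L w X Y = differential TQ (energy A L) w Y \<longleftrightarrow>
      (fst (X ?c) - snd w c) \<bullet> ?D (Y ?c) = ?D (X ?c) \<bullet> fst (Y ?c) - fderiv (lag A L c) ?x (fst (Y ?c), 0)"
    if Y: "Y \<in> tspace TQ w" for Y
    unfolding Omega_L_coord[OF A L w c X Y] differential_energy[OF w c Y] fderiv_lag_split[OF c' u, of "Y ?c"]
    by (auto simp: inner_diff_left inner_commute)
  have all: "?l \<longleftrightarrow> (\<forall>y. (fst (X ?c) - snd w c) \<bullet> ?D y = ?D (X ?c) \<bullet> fst y - fderiv (lag A L c) ?x (fst y, 0))"
  proof
    assume l: ?l
    show "\<forall>y. (fst (X ?c) - snd w c) \<bullet> ?D y = ?D (X ?c) \<bullet> fst y - fderiv (lag A L c) ?x (fst y, 0)"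
    proof
      fix y
      have t: "tvec_of TQ ?c w y \<in> tspace TQ w" by (rule tvec_of_tspace[OF TA tc])
      show "(fst (X ?c) - snd w c) \<bullet> ?D y = ?D (X ?c) \<bullet> fst y - fderiv (lag A L c) ?x (fst y, 0)"
        using bspec[OF l t] unfolding eq[OF t] tvec_of_self[OF TA tc] .
    qed
  qed (use eq in blast)
  have l0: "fderiv (lag A L c) ?x (0, 0) = 0"
    using linear_0[OF smooth_on_linear[OF lag_smooth[OF A L c'] u]] by (simp add: zero_prod_def)
  show ?thesis unfolding all
  proof
    assume h: "\<forall>y. (fst (X ?c) - snd w c) \<bullet> ?D y = ?D (X ?c) \<bullet> fst y - fderiv (lag A L c) ?x (fst y, 0)"
    \<comment> \<open>Vertical vectors make the right-hand side vanish. By regularity the momentum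
      derivative maps one of them to \<open>fst (X ?c) - snd w c\<close>, whose inner product with
      itself is therefore zero.\<close>
    obtain b where "fst (X ?c) - snd w c = ?D (0, b)" using pmap_vertical(3)[OF w c] by (metis surjD)
    then have "fst (X ?c) - snd w c = 0" using spec[OF h, of "(0, b)"] l0 by simp
    then show ?r using h by (metis eq_iff_diff_eq_0 fst_conv inner_zero_left)
  qed auto
qed

text \<open>\<open>Gamma_L\<close> is a definite description, so existence and uniqueness come
  first; afterwards its properties are read in any chart by
  \<open>Gamma_equation_iff\<close>.\<close>

lemma Gamma_L_props:
  assumes w: "w \<in> tcarrier A"
  shows "fst (\<Gamma> w) = w" "snd (\<Gamma> w) \<in> tspace TQ w"
    "chart_of A c (fst w) \<Longrightarrow> fst (snd (\<Gamma> w) (tchart A c)) = snd w c"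
    "chart_of A c (fst w) \<Longrightarrow> fderiv (pmap A L c) (snd (tchart A c) w) (snd (\<Gamma> w) (tchart A c)) \<bullet> b =
       fderiv (lag A L c) (snd (tchart A c) w) (b, 0)"
proof -
  obtain d where d: "chart_of A d (fst w)" using w by (auto simp: tcarrier_iff elim: carrierE)
  then have d': "d \<in> A" by simp
  let ?x = "snd (tchart A d) w" and ?d = "tchart A d"
  let ?D = "fderiv (pmap A L d) ?x"
  have u: "?x \<in> cdom d \<times> UNIV" by (rule tchart_cdom[OF A d']) (use d in simp)
  have td: "chart_of TQ ?d w" by (rule tchart_chart[OF w d])
  let ?P = "\<lambda>X. X \<in> tspace TQ w \<and>
     (\<forall>Y\<in>tspace TQ w. Omega_L A L w X Y = differential TQ (energy A L) w Y)"
  have linD: "linear ?D" by (rule smooth_on_linear[OF pmap_smooth[OF A L d'] u])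
  have linl: "linear (\<lambda>b. fderiv (lag A L d) ?x (b, 0))"
    using smooth_on_linear[OF lag_smooth[OF A L d'] u] linear_compose[of "\<lambda>b. (b, 0)" "fderiv (lag A L d) ?x"]
    by (auto simp: o_def linear_iff)
  have "\<exists>!X. ?P X"
  proof (rule ex_ex1I)
    \<comment> \<open>The vector \<open>\<partial>L/\<partial>q\<close>. With
      \<open>p = \<partial>L/\<partial>v\<close>, the acceleration \<open>a\<close> below solves
      \<open>D\<^sub>v p a = \<partial>L/\<partial>q - D\<^sub>q p v\<close>.\<close>
    define g where "g = (\<Sum>b\<in>Basis. fderiv (lag A L d) ?x (b, 0) *\<^sub>R b)"
    have g: "g \<bullet> b = fderiv (lag A L d) ?x (b, 0)" for b
    proof -
      have "fderiv (lag A L d) ?x (b, 0) = b \<bullet> g"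
        using linear_expand[OF linl, of b] by (simp add: g_def inner_sum_right mult.commute)
      then show ?thesis by (simp add: inner_commute)
    qed
    obtain a where "g - ?D (snd w d, 0) = ?D (0, a)" using pmap_vertical(3)[OF w d] by (metis surjD)
    then have "g = ?D (snd w d, 0) + ?D (0, a)" by (metis add.commute diff_add_cancel)
    then have a: "?D (snd w d, a) = g" using linear_add[OF linD, of "(snd w d, 0)" "(0, a)"] by simp
    have t: "tvec_of TQ ?d w (snd w d, a) \<in> tspace TQ w" by (rule tvec_of_tspace[OF TA td])
    have "?P (tvec_of TQ ?d w (snd w d, a))"
      unfolding Gamma_equation_iff[OF w d t] tvec_of_self[OF TA td] a using t g by simp
    then show "\<exists>X. ?P X" by blast
    fix X Y assume P: "?P X" "?P Y"
    then have t: "X \<in> tspace TQ w" "Y \<in> tspace TQ w" by auto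
    have X: "fst (X ?d) = snd w d" "\<forall>b. ?D (X ?d) \<bullet> b = fderiv (lag A L d) ?x (b, 0)"
      using P(1) Gamma_equation_iff[OF w d t(1)] by auto
    have Y: "fst (Y ?d) = snd w d" "\<forall>b. ?D (Y ?d) \<bullet> b = fderiv (lag A L d) ?x (b, 0)"
      using P(2) Gamma_equation_iff[OF w d t(2)] by auto
    have "\<forall>b. ?D (X ?d) \<bullet> b = ?D (Y ?d) \<bullet> b" using X(2) Y(2) by simp
    then have "?D (X ?d) = ?D (Y ?d)" unfolding vector_eq_rdot .
    then have "?D (X ?d - Y ?d) = 0" using linear_diff[OF linD] by simp
    moreover have "X ?d - Y ?d = (0, snd (X ?d) - snd (Y ?d))" using X(1) Y(1) by (simp add: prod_eq_iff)
    ultimately have "snd (X ?d) - snd (Y ?d) = 0" using reg[OF w d] by metis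
    then have "X ?d = Y ?d" using X(1) Y(1) by (simp add: prod_eq_iff)
    then show "X = Y" by (rule tspace_eqI[OF t td])
  qed
  from theI'[OF this] have P: "?P (snd (\<Gamma> w))" by (simp add: Gamma_L_def)
  show "fst (\<Gamma> w) = w" by (simp add: Gamma_L_def)
  show t: "snd (\<Gamma> w) \<in> tspace TQ w" using P by simp
  assume c: "chart_of A c (fst w)"
  show "fst (snd (\<Gamma> w) (tchart A c)) = snd w c" using P Gamma_equation_iff[OF w c t] by auto
  show "fderiv (pmap A L c) (snd (tchart A c) w) (snd (\<Gamma> w) (tchart A c)) \<bullet> b =
       fderiv (lag A L c) (snd (tchart A c) w) (b, 0)" using P Gamma_equation_iff[OF w c t] by auto
qed

text \<open>The acceleration is obtained by inverting the vertical derivative of the momentum, a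
  smooth family of injective linear maps, on a smooth right-hand side.\<close>

lemma smooth_Gamma_L: "smooth_map TQ TTQ (tcarrier A) \<Gamma>"
proof (rule smooth_mapI_local[OF TA TTA])
  show "openin (mtop TQ) (tcarrier A)" using openin_carrier[OF TA] by simp
  fix w assume w: "w \<in> tcarrier A"
  then obtain c where c: "chart_of A c (fst w)" by (auto simp: tcarrier_iff elim: carrierE)
  then have c': "c \<in> A" by simp
  let ?c = "tchart A c" and ?k = "tchart TQ (tchart A c)"
  let ?S = "cdom c \<times> (UNIV :: 'b set)"
  note o = open_cdom_UNIV[OF A c']
  note smp = pmap_smooth[OF A L c'] and sml = lag_smooth[OF A L c']
  define V where "V u b = fderiv (pmap A L c) u (0, b)" for u b
  define g where "g u = (\<Sum>b\<in>Basis. fderiv (lag A L c) u (b, 0) *\<^sub>R b)" for u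
  define a where "a u = inv (V u) (g u - fderiv (pmap A L c) u (snd u, 0))" for u
  have pt: "chart_inv ?c u \<in> tcarrier A" "chart_of A c (fst (chart_inv ?c u))" "snd ?c (chart_inv ?c u) = u" if "u \<in> ?S" for u
    using chart_inv_tchart_mem[OF A c' that] c' by auto
  have V: "linear (V u)" "inj (V u)" if "u \<in> ?S" for u
    using pmap_vertical(1,2)[OF pt(1,2)[OF that]] unfolding pt(3)[OF that] V_def[abs_def] .
  have sma: "smooth_on ?S a" unfolding a_def[abs_def]
    by (rule smooth_on_inv_apply[OF o V])
      (auto simp: V_def g_def intro!: smooth_on_diff smooth_on_sum smooth_on_scaleR smooth_on_const smooth_on_fderiv smp sml o
        smooth_on_fderiv_apply[OF o o smp] smooth_on_Pair smooth_on_snd smooth_on_ident)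
  have eq: "rep ?c ?k \<Gamma> u = (u, (snd u, a u)) \<and> \<Gamma> (chart_inv ?c u) \<in> fst ?k" if u: "u \<in> ?S" for u
  proof -
    let ?w = "chart_inv ?c u"
    note G = Gamma_L_props[OF pt(1)[OF u]] and s = pt(3)[OF u]
    have t: "\<Gamma> ?w \<in> tcarrier TQ" using G(1,2) pt(1)[OF u] by (simp add: tcarrier_iff)
    have sw: "snd ?w c = snd u" using s by (metis snd_conv snd_tchart)
    let ?X = "snd (\<Gamma> ?w) ?c"
    have X: "fst ?X = snd u" using G(3)[OF pt(2)[OF u]] sw by simp
    have linl: "linear (\<lambda>b. fderiv (lag A L c) u (b, 0))"
      using smooth_on_linear[OF sml u] linear_compose[of "\<lambda>b. (b, 0)" "fderiv (lag A L c) u"] by (auto simp: o_def linear_iff)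
    have "\<forall>b. fderiv (pmap A L c) u ?X \<bullet> b = g u \<bullet> b"
    proof
      fix b
      have "fderiv (lag A L c) u (b, 0) = b \<bullet> g u"
        using linear_expand[OF linl, of b] by (simp add: g_def inner_sum_right mult.commute)
      then show "fderiv (pmap A L c) u ?X \<bullet> b = g u \<bullet> b" using G(4)[OF pt(2)[OF u], of b] unfolding s by (simp add: inner_commute)
    qed
    then have "fderiv (pmap A L c) u ?X = g u" unfolding vector_eq_rdot .
    moreover have "fderiv (pmap A L c) u ?X = fderiv (pmap A L c) u (snd u, 0) + V u (snd ?X)"
    proof -
      have "?X = (snd u, 0) + (0, snd ?X)" using X by (simp add: prod_eq_iff)
      then show ?thesis
        using linear_add[OF smooth_on_linear[OF smp u], of "(snd u, 0)" "(0, snd ?X)"] by (simp add: V_def)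
    qed
    ultimately have "V u (snd ?X) = g u - fderiv (pmap A L c) u (snd u, 0)" by (simp add: algebra_simps)
    then have "snd ?X = a u" unfolding a_def using inv_f_f[OF V(2)[OF u]] by metis
    then have "?X = (snd u, a u)" using X by (simp add: prod_eq_iff)
    then show ?thesis using t s G(1) pt(1,2)[OF u] c'
      by (simp add: snd_tchart[of "TQ"] fst_tchart[of _ "TQ"]) (simp add: fst_tchart)
  qed
  have "smooth_on ?S (\<lambda>u. (u, (snd u, a u)))"
    by (intro smooth_on_Pair smooth_on_snd smooth_on_ident sma o)
  then have "smooth_on ?S (rep ?c ?k \<Gamma>)"
    by (subst smooth_on_cong[OF o, where g = "\<lambda>u. (u, (snd u, a u))"]) (use eq in auto)
  then show "\<exists>e d N. e \<in> TQ \<and> d \<in> TTQ \<and> w \<in> fst e \<and> open N \<and> snd e w \<in> N \<and>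
      (\<forall>u\<in>N. u \<in> snd e ` fst e \<longrightarrow> chart_inv e u \<in> tcarrier A \<longrightarrow> \<Gamma> (chart_inv e u) \<in> fst d) \<and>
      smooth_on N (rep e d \<Gamma>)"
    using c o w eq tchart_cdom[OF A c', of w]
    by (intro exI[of _ ?c] exI[of _ ?k] exI[of _ ?S]) (simp add: fst_tchart)
qed

end

section \<open>Symplecticity of the step\<close>

context lifted_discretization
begin

text \<open>The start \<open>x\<close>, the end \<open>\<phi> x\<close> and the base point
  \<open>\<psi> x\<close> are each read in a chart of their own; everything is then a function of
  the coordinates of \<open>x\<close>, as \<open>exact_difference_symplectic\<close>
  requires.\<close>

lemma step_symplectic:
  assumes \<psi>: "smooth_map TQ TQ W \<psi>" and \<phi>: "smooth_map TQ TQ W \<phi>"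
    and step: "\<And>x. x \<in> W \<Longrightarrow> scale h (\<Gamma> (\<psi> x)) \<in> D \<and> S (scale h (\<Gamma> (\<psi> x))) = (x, \<phi> x)"
    and x: "x \<in> W" and X: "X \<in> tspace TQ x" and Y: "Y \<in> tspace TQ x"
  shows "pullback2 TQ TQ \<phi> (Omega_L A L) x X Y = Omega_L A L x X Y"
proof -
  have W: "W \<subseteq> tcarrier A" using openin_mtop_subset[OF TA smooth_mapD_openin[OF \<psi>]] by simp
  have xt: "x \<in> tcarrier A" "\<psi> x \<in> tcarrier A" "\<phi> x \<in> tcarrier A"
    using W x smooth_mapD_carrier[OF \<psi> x] smooth_mapD_carrier[OF \<phi> x] by auto
  obtain d0 where d0: "chart_of A d0 (fst x)" using xt(1) by (auto simp: tcarrier_iff elim: carrierE)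
  obtain d1 where d1: "chart_of A d1 (fst (\<phi> x))" using xt(3) by (auto simp: tcarrier_iff elim: carrierE)
  obtain c where c: "chart_of A c (fst (\<psi> x))" using xt(2) by (auto simp: tcarrier_iff elim: carrierE)
  have in': "d0 \<in> A" "d1 \<in> A" "c \<in> A" using d0 d1 c by auto
  let ?d0 = "tchart A d0" and ?d1 = "tchart A d1" and ?c = "tchart A c"
  have td: "?d0 \<in> TQ" "?d1 \<in> TQ" "?c \<in> TQ" using in' by auto
  note td0 = tchart_chart[OF xt(1) d0] and td1 = tchart_chart[OF xt(3) d1] and tc = tchart_chart[OF xt(2) c]
  define f g where "f = rep ?d0 ?d1 \<phi>" and "g = rep ?d0 ?c \<psi>"
  define T where "T = rep_dom ?d0 ?d1 W \<phi> \<inter> rep_dom ?d0 ?c W \<psi>"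
  have T: "open T" unfolding T_def using open_rep_dom[OF \<phi> td(1,2)] open_rep_dom[OF \<psi> td(1,3)] by auto
  define p where "p = snd ?d0 x"
  have p: "p \<in> T" using td0 td1 tc x by (auto simp: T_def p_def intro: rep_domI)
  have smf: "smooth_on T f" and smg: "smooth_on T g"
    unfolding f_def g_def T_def
    by (rule smooth_on_subset[OF smooth_map_rep[OF \<phi> td(1,2)]], simp, rule smooth_on_subset[OF smooth_map_rep[OF \<psi> td(1,3)]], simp)
  have smp: "smooth_on (cdom d0 \<times> UNIV) (pmap A L d0)" "smooth_on (cdom d1 \<times> UNIV) (pmap A L d1)" "smooth_on (cdom c \<times> UNIV) (lag A L c)"
    by (rule pmap_smooth[OF A L in'(1)], rule pmap_smooth[OF A L in'(2)], rule lag_smooth[OF A L in'(3)])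
  note o = open_cdom_UNIV[OF A in'(1)] open_cdom_UNIV[OF A in'(2)] open_cdom_UNIV[OF A in'(3)]
  have pt: "u \<in> snd ?d0 ` fst ?d0" "chart_inv ?d0 u \<in> W" "\<phi> (chart_inv ?d0 u) \<in> fst ?d1" "\<psi> (chart_inv ?d0 u) \<in> fst ?c"
    if "u \<in> T" for u
    using that by (auto simp: T_def rep_dom_iff[OF TA td(1)])
  have im: "u \<in> cdom d0 \<times> UNIV" "f u \<in> cdom d1 \<times> UNIV" "g u \<in> cdom c \<times> UNIV" if "u \<in> T" for u
  proof -
    show "u \<in> cdom d0 \<times> UNIV" using pt(1)[OF that] tchart_image_dom[OF A in'(1)] by simp
    show "f u \<in> cdom d1 \<times> UNIV" "g u \<in> cdom c \<times> UNIV"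
      unfolding f_def g_def by (rule tchart_cdom[OF A], use in' pt(3,4)[OF that] in \<open>auto simp: fst_tchart\<close>)+
  qed
  let ?r0 = "rep ?c c (\<lambda>w. fst (R w))" and ?r1 = "rep ?c c (\<lambda>w. snd (R w))"
  let ?R0 = "rep ?c d0 (\<lambda>w. fst (R w))" and ?R1 = "rep ?c d1 (\<lambda>w. snd (R w))"
  \<comment> \<open>The momentum balance for the vector \<open>h \<Gamma>(\<psi> w)\<close>. The
    Euler--Lagrange equation replaces the derivative of the momentum along \<open>h \<Gamma>\<close>
    by \<open>h \<partial>L/\<partial>q\<close>.\<close>
  have E: "fst u = ?R0 (fst (g u), h *\<^sub>R snd (g u))" "fst (f u) = ?R1 (fst (g u), h *\<^sub>R snd (g u))"
    "(fst (g u), h *\<^sub>R snd (g u)) \<in> rep_dom ?c d0 U (\<lambda>w. fst (R w))"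
    "(fst (g u), h *\<^sub>R snd (g u)) \<in> rep_dom ?c d1 U (\<lambda>w. snd (R w))"
    "- (pmap A L d0 u \<bullet> fderiv ?R0 (fst (g u), h *\<^sub>R snd (g u)) v) + pmap A L d1 (f u) \<bullet> fderiv ?R1 (fst (g u), h *\<^sub>R snd (g u)) v =
      h * fderiv (lag A L c) (g u) (fst v, 0) + pmap A L c (g u) \<bullet> snd v" if u: "u \<in> T" for u v
  proof -
    define w where "w = chart_inv ?d0 u"
    have w: "w \<in> W" "\<phi> w \<in> fst ?d1" "\<psi> w \<in> fst ?c" "snd ?d0 w = u" "w \<in> fst ?d0"
      using pt[OF u] by (auto simp: w_def chart_inv_right chart_inv_mem)
    have fg: "f u = snd ?d1 (\<phi> w)" "g u = snd ?c (\<psi> w)" by (simp_all add: f_def g_def w_def)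
    have \<psi>w: "\<psi> w \<in> tcarrier A" "chart_of A c (fst (\<psi> w))" using w(3) in' by (auto simp: fst_tchart)
    define y where "y = scale h (\<Gamma> (\<psi> w))"
    have y: "y \<in> D" "S y = (w, \<phi> w)" using step[OF w(1)] by (simp_all add: y_def)
    note G = Gamma_L_props[OF \<psi>w(1)]
    have fy: "fst y = \<psi> w" "snd y ?c = h *\<^sub>R snd (\<Gamma> (\<psi> w)) ?c" using G(1) by (simp_all add: y_def)
    have cy: "chart_of A c (fst (fst y))" using \<psi>w fy by simp
    define b where "b = fst (alpha A (TFL y))"
    note B = fst_alpha_TFL[OF D_tcarrier[OF y(1)] cy, folded b_def]
    have sb: "snd ?c b = (fst (g u), h *\<^sub>R snd (g u))"
      using B(3) G(3)[OF \<psi>w(2)] by (simp add: fy fg snd_tchart)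
    have bc: "chart_of A c (fst b)" using B(1) cy by simp
    have ib: "chart_inv ?c (fst (g u), h *\<^sub>R snd (g u)) = b" using tchart_inv_left[OF A B(2) bc] sb by simp
    have dd: "chart_of A d0 (fst (fst (S y)))" "chart_of A d1 (fst (snd (S y)))" using y w in' by (auto simp: fst_tchart)
    note eq = lift_equation[OF y(1) cy b_def dd]
    have fu: "fst u = snd d0 (fst w)" "fst (f u) = snd d1 (fst (\<phi> w))" using w(4) fg(1) by (auto simp: snd_tchart)
    show "fst u = ?R0 (fst (g u), h *\<^sub>R snd (g u))" "fst (f u) = ?R1 (fst (g u), h *\<^sub>R snd (g u))"
      unfolding ib fu using eq(2,3) by (simp_all add: y)
    have bt: "chart_of TQ ?c b" by (rule tchart_chart[OF B(2) bc])
    show "(fst (g u), h *\<^sub>R snd (g u)) \<in> rep_dom ?c d0 U (\<lambda>w. fst (R w))"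
      "(fst (g u), h *\<^sub>R snd (g u)) \<in> rep_dom ?c d1 U (\<lambda>w. snd (R w))"
      unfolding sb[symmetric] using eq(1-3) dd bt by (auto intro!: rep_domI)
    have lin: "linear (fderiv (pmap A L c) (g u))"
      by (rule smooth_on_linear[OF pmap_smooth[OF A L in'(3)] im(3)[OF u]])
    show "- (pmap A L d0 u \<bullet> fderiv ?R0 (fst (g u), h *\<^sub>R snd (g u)) v) + pmap A L d1 (f u) \<bullet> fderiv ?R1 (fst (g u), h *\<^sub>R snd (g u)) v =
      h * fderiv (lag A L c) (g u) (fst v, 0) + pmap A L c (g u) \<bullet> snd v"
      using eq(4)[of v] G(4)[OF \<psi>w(2), of "fst v"] w(4)
      by (simp add: sb y fy fg(1)[symmetric] fg(2)[symmetric] linear_cmul[OF lin])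
  qed
  define P1 where "P1 u = pmap A L d1 (f u)" for u
  define q1 where "q1 u = fst (f u)" for u
  \<comment> \<open>The step size times the Lagrangian at the base point: a discrete action that
    generates the step.\<close>
  define G where "G u = h * lag A L c (g u)" for u
  have smP0: "smooth_on T (pmap A L d0)" by (rule smooth_on_subset[OF smp(1)]) (use im in blast)
  have smP1: "smooth_on T P1" unfolding P1_def[abs_def] by (rule smooth_on_compose[OF T o(2) smp(2) smf]) (rule im)
  have smq1: "smooth_on T q1" unfolding q1_def[abs_def] by (rule smooth_on_fst[OF T smf])
  have smlg: "smooth_on T (\<lambda>u. lag A L c (g u))" by (rule smooth_on_compose[OF T o(3) smp(3) smg]) (rule im)
  have smG: "smooth_on T G" unfolding G_def[abs_def]
    using smooth_on_scaleR[OF T smooth_on_const[OF T, of h] smlg] by simp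
  have dGg: "((\<lambda>u. (fst (g u), h *\<^sub>R snd (g u))) has_derivative (\<lambda>\<delta>. (fst (fderiv g u \<delta>), h *\<^sub>R snd (fderiv g u \<delta>)))) (at u)" if "u \<in> T" for u
    by (intro has_derivative_Pair has_derivative_scaleR_right has_derivative_fst has_derivative_snd smooth_on_has_derivative[OF smg that])
  \<comment> \<open>The balance is tested on the derivative of \<open>(q, h v)\<close> along
    \<open>\<delta>\<close>. Its right-hand side becomes \<open>h\<close> times the full
    differential of \<open>L\<close>; on the left stand the derivatives of the two end points, the
    first being \<open>fst \<delta>\<close> because \<open>u\<close> is the start.\<close>
  have ex: "- (pmap A L d0 u \<bullet> fst \<delta>) + P1 u \<bullet> fderiv q1 u \<delta> = fderiv G u \<delta>" if u: "u \<in> T" for u \<delta>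
  proof -
    let ?b = "(fst (g u), h *\<^sub>R snd (g u))" and ?v = "(fst (fderiv g u \<delta>), h *\<^sub>R snd (fderiv g u \<delta>))"
    have "((\<lambda>u. ?R0 (fst (g u), h *\<^sub>R snd (g u))) has_derivative
        (\<lambda>\<delta>. fderiv ?R0 ?b (fst (fderiv g u \<delta>), h *\<^sub>R snd (fderiv g u \<delta>)))) (at u)"
      by (rule has_derivative_compose[where g = ?R0 and g' = "fderiv ?R0 ?b", OF dGg[OF u]
            smooth_on_has_derivative[OF smooth_map_rep[OF RD(5) td(3) in'(1)] E(3)[OF u]]])
    then have "((\<lambda>u. fst u) has_derivative (\<lambda>\<delta>. fderiv ?R0 ?b (fst (fderiv g u \<delta>), h *\<^sub>R snd (fderiv g u \<delta>)))) (at u)"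
      by (rule has_derivative_transform_within_open[OF _ T u]) (rule E(1)[symmetric])
    from has_derivative_unique[OF this has_derivative_fst[OF has_derivative_ident]]
    have 0: "fderiv ?R0 ?b ?v = fst \<delta>" by (rule fun_cong)
    have "((\<lambda>u. ?R1 (fst (g u), h *\<^sub>R snd (g u))) has_derivative
        (\<lambda>\<delta>. fderiv ?R1 ?b (fst (fderiv g u \<delta>), h *\<^sub>R snd (fderiv g u \<delta>)))) (at u)"
      by (rule has_derivative_compose[where g = ?R1 and g' = "fderiv ?R1 ?b", OF dGg[OF u]
            smooth_on_has_derivative[OF smooth_map_rep[OF RD(6) td(3) in'(2)] E(4)[OF u]]])
    then have "(q1 has_derivative (\<lambda>\<delta>. fderiv ?R1 ?b (fst (fderiv g u \<delta>), h *\<^sub>R snd (fderiv g u \<delta>)))) (at u)"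
      unfolding q1_def[abs_def] by (rule has_derivative_transform_within_open[OF _ T u]) (rule E(2)[symmetric])
    from fderiv_eq[OF this] have 1: "fderiv ?R1 ?b ?v = fderiv q1 u \<delta>" by simp
    have "fderiv G u \<delta> = h * fderiv (lag A L c) (g u) (fderiv g u \<delta>)"
      unfolding G_def[abs_def]
      by (subst fderiv_eq[OF has_derivative_mult_right[OF smooth_on_has_derivative[OF smlg u]]])
        (simp add: fderiv_compose[OF smg u smp(3) im(3)[OF u]])
    also have "\<dots> = h * fderiv (lag A L c) (g u) (fst ?v, 0) + pmap A L c (g u) \<bullet> snd ?v"
      unfolding fderiv_lag_split[OF in'(3) im(3)[OF u], of "fderiv g u \<delta>"] by (simp add: algebra_simps)
    also have "\<dots> = - (pmap A L d0 u \<bullet> fderiv ?R0 ?b ?v) + pmap A L d1 (f u) \<bullet> fderiv ?R1 ?b ?v"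
      by (rule E(5)[OF u, symmetric])
    finally show ?thesis unfolding 0 1 P1_def by simp
  qed
  have f\<phi>: "f p = snd ?d1 (\<phi> x)" using chart_inv_left[OF TA td(1), of x] td0 by (simp add: f_def p_def)
  let ?X = "X ?d0" and ?Y = "Y ?d0"
  have q1': "fderiv q1 p v = fst (fderiv f p v)" for v
    unfolding q1_def[abs_def] using fderiv_eq[OF has_derivative_fst[OF smooth_on_has_derivative[OF smf p]]] by simp
  have P1': "fderiv P1 p v = fderiv (pmap A L d1) (f p) (fderiv f p v)" for v
    unfolding P1_def[abs_def] by (rule fderiv_compose[OF smf p smp(2) im(2)[OF p]])
  have t: "tmap_at TQ TQ \<phi> x Z \<in> tspace TQ (\<phi> x)"
    "tmap_at TQ TQ \<phi> x Z ?d1 = fderiv f p (Z ?d0)" if "Z \<in> tspace TQ x" for Z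
    using tmap_at_tspace[OF TA TA \<phi> x that] tmap_at_coord[OF TA TA \<phi> x td0 td1 that] by (simp_all add: f_def p_def)
  have "pullback2 TQ TQ \<phi> (Omega_L A L) x X Y =
      fst (fderiv f p ?X) \<bullet> fderiv (pmap A L d1) (f p) (fderiv f p ?Y) - fst (fderiv f p ?Y) \<bullet> fderiv (pmap A L d1) (f p) (fderiv f p ?X)"
    unfolding pullback2_def Omega_L_coord[OF A L xt(3) d1 t(1)[OF X] t(1)[OF Y]] t(2)[OF X] t(2)[OF Y] f\<phi> ..
  also have "\<dots> = fst ?X \<bullet> fderiv (pmap A L d0) p ?Y - fst ?Y \<bullet> fderiv (pmap A L d0) p ?X"
    using exact_difference_symplectic[OF T p smP0 smP1 smq1 smG ex, of ?X ?Y] by (simp add: q1' P1')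
  also have "\<dots> = Omega_L A L x X Y"
    unfolding Omega_L_coord[OF A L xt(1) d0 X Y] p_def ..
  finally show ?thesis .
qed

lemma lift_symplectic_integrator: "symplectic_integrator TQ (Omega_L A L) \<Gamma> D S"
  unfolding symplectic_integrator_def
proof (intro ballI conjI allI impI)
  fix z assume z: "z \<in> carrier TQ"
  note SD = discretization_mapD[OF TA lift_discretization]
  show "\<exists>V. invertible_near TQ D S z V"
    by (rule discretization_invertible_near[OF TA lift_discretization z])
  fix V assume V: "invertible_near TQ D S z V"
  have \<Gamma>: "smooth_map TQ TTQ (carrier TQ) \<Gamma>"
    using smooth_Gamma_L by simp
  have \<Gamma>': "fst (\<Gamma> x) = x" if "x \<in> carrier TQ" for x using Gamma_L_props(1) that by simp
  show "\<exists>W W' h0. openin (mtop TQ) W \<and> openin (mtop TQ) W' \<and> z \<in> W \<and> z \<in> W' \<and>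
      W \<times> W' \<subseteq> S ` V \<and> 0 < h0 \<and>
      (\<forall>h. 0 < h \<and> h < h0 \<longrightarrow>
        (\<forall>x0\<in>W. \<exists>!x1. x1 \<in> W' \<and> step_equation D S V \<Gamma> h x0 x1) \<and>
        (let \<phi> = \<lambda>x0. THE x1. x1 \<in> W' \<and> step_equation D S V \<Gamma> h x0 x1 in
          smooth_map TQ TQ W \<phi> \<and>
          (\<forall>x\<in>W. \<forall>X\<in>tspace TQ x. \<forall>Y\<in>tspace TQ x.
             pullback2 TQ TQ \<phi> (Omega_L A L) x X Y = Omega_L A L x X Y)))"
  \<comment> \<open>The whole carrier is taken for \<open>X\<close>, since base points are only
    required to lie on the manifold.\<close>
  proof (rule implicit_step[OF TA lift_discretization \<Gamma> \<Gamma>' z V openin_carrier[OF TA] z])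
    fix W W' h0
    assume W: "openin (mtop TQ) W" "openin (mtop TQ) W'" "z \<in> W" "z \<in> W'" "W \<times> W' \<subseteq> S ` V" "0 < h0"
      and st: "\<And>h. 0 < h \<Longrightarrow> h < h0 \<Longrightarrow> \<exists>\<psi>. smooth_map TQ TQ W \<psi> \<and> (\<forall>x0\<in>W. \<psi> x0 \<in> carrier TQ \<and>
        scale h (\<Gamma> (\<psi> x0)) \<in> D \<and> fst (S (scale h (\<Gamma> (\<psi> x0)))) = x0 \<and> snd (S (scale h (\<Gamma> (\<psi> x0)))) \<in> W' \<and>
        (\<forall>x1\<in>W'. step_equation D S V \<Gamma> h x0 x1 \<longleftrightarrow> x1 = snd (S (scale h (\<Gamma> (\<psi> x0))))))"
    have steps: "(\<forall>x0\<in>W. \<exists>!x1. x1 \<in> W' \<and> step_equation D S V \<Gamma> h x0 x1) \<and>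
        (let \<phi> = \<lambda>x0. THE x1. x1 \<in> W' \<and> step_equation D S V \<Gamma> h x0 x1 in
          smooth_map TQ TQ W \<phi> \<and>
          (\<forall>x\<in>W. \<forall>X\<in>tspace TQ x. \<forall>Y\<in>tspace TQ x.
             pullback2 TQ TQ \<phi> (Omega_L A L) x X Y = Omega_L A L x X Y))"
      if h: "0 < h" "h < h0" for h
    proof -
      obtain \<psi> where \<psi>: "smooth_map TQ TQ W \<psi>"
        and s: "\<forall>x0\<in>W. \<psi> x0 \<in> carrier TQ \<and>
        scale h (\<Gamma> (\<psi> x0)) \<in> D \<and> fst (S (scale h (\<Gamma> (\<psi> x0)))) = x0 \<and> snd (S (scale h (\<Gamma> (\<psi> x0)))) \<in> W' \<and>
        (\<forall>x1\<in>W'. step_equation D S V \<Gamma> h x0 x1 \<longleftrightarrow> x1 = snd (S (scale h (\<Gamma> (\<psi> x0)))))"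
        using st[OF h] by blast
      define \<phi> where "\<phi> x0 = (THE x1. x1 \<in> W' \<and> step_equation D S V \<Gamma> h x0 x1)" for x0
      have iff: "x1 \<in> W' \<and> step_equation D S V \<Gamma> h x0 x1 \<longleftrightarrow> x1 = snd (S (scale h (\<Gamma> (\<psi> x0))))" if "x0 \<in> W" for x0 x1
        using bspec[OF s that] by auto
      have ex1: "\<exists>!x1. x1 \<in> W' \<and> step_equation D S V \<Gamma> h x0 x1" if "x0 \<in> W" for x0
        unfolding iff[OF that] by blast
      have \<phi>eq: "\<phi> x0 = snd (S (scale h (\<Gamma> (\<psi> x0))))" if "x0 \<in> W" for x0
        unfolding \<phi>_def iff[OF that] by blast
      have "smooth_map TQ TQ W (\<lambda>x0. snd (S (scale h (\<Gamma> (\<psi> x0)))))"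
      proof (rule smooth_map_compose[OF TA TTA TA _ SD(6)])
        show "scale h (\<Gamma> (\<psi> x)) \<in> D" if "x \<in> W" for x using s that by blast
        show "smooth_map TQ TTQ W (\<lambda>x. scale h (\<Gamma> (\<psi> x)))"
        proof (rule smooth_map_compose[OF TA TTA TTA _ smooth_scale[OF TA]])
          show g: "smooth_map TQ TTQ W (\<lambda>x. \<Gamma> (\<psi> x))"
            by (rule smooth_map_compose[OF TA TA TTA \<psi> \<Gamma>]) (use s in blast)
          show "\<Gamma> (\<psi> x) \<in> tcarrier TQ" if "x \<in> W" for x
            using smooth_mapD_carrier[OF g that] by simp
        qed
      qed
      then have sm\<phi>: "smooth_map TQ TQ W \<phi>"
        by (rule smooth_map_cong[OF TA TA]) (simp add: \<phi>eq)
      have step: "scale h (\<Gamma> (\<psi> x)) \<in> D \<and> S (scale h (\<Gamma> (\<psi> x))) = (x, \<phi> x)" if "x \<in> W" for x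
        using bspec[OF s that] \<phi>eq[OF that] by (simp add: prod_eq_iff)
      show ?thesis
        unfolding Let_def \<phi>_def[symmetric]
        using ex1 sm\<phi> step_symplectic[OF \<psi> sm\<phi> step] by blast
    qed
    show ?thesis
      by (rule exI[of _ W], rule exI[of _ W'], rule exI[of _ h0], rule conjI[OF W(1)], rule conjI[OF W(2)],
          rule conjI[OF W(3)], rule conjI[OF W(4)], rule conjI[OF W(5)], rule conjI[OF W(6)],
          intro allI impI, elim conjE, rule steps)
  qed
qed

end

section \<open>Existence of the lift\<close>

text \<open>Two vectors over one point are separated inside a tangent chart, all others through
  their base points. Path lifts will be compared in the tangent bundle, so the separation property
  is needed there.\<close>

lemma Hausdorff_tan:
  assumes A: "smooth_atlas A" and H: "Hausdorff_space (mtop A)"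
  shows "Hausdorff_space (mtop (tan_atlas A))"
  unfolding Hausdorff_space_def topspace_mtop[OF smooth_atlas_tan[OF A]] carrier_tan_atlas
proof (intro allI impI, elim conjE)
  note TA = smooth_atlas_tan[OF A]
  fix w w' assume w: "w \<in> tcarrier A" "w' \<in> tcarrier A" "w \<noteq> w'"
  show "\<exists>V V'. openin (mtop (tan_atlas A)) V \<and> openin (mtop (tan_atlas A)) V' \<and> w \<in> V \<and> w' \<in> V' \<and> disjnt V V'"
  proof (cases "fst w = fst w'")
    case True
    obtain c where c: "chart_of A c (fst w)" using w(1) by (auto simp: tcarrier_iff elim: carrierE)
    have tc: "chart_of (tan_atlas A) (tchart A c) w" "chart_of (tan_atlas A) (tchart A c) w'"
      using tchart_chart[OF w(1) c] tchart_chart[OF w(2)] c True by auto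
    have "snd (tchart A c) w \<noteq> snd (tchart A c) w'"
      using tc w(3) inj_onD[OF atlas_inj[OF TA]] by blast
    then obtain O1 O2 where O: "open O1" "open O2" "snd (tchart A c) w \<in> O1" "snd (tchart A c) w' \<in> O2" "O1 \<inter> O2 = {}"
      by (rule hausdorff[elim_format]) blast
    show ?thesis
    proof (intro exI conjI)
      show "openin (mtop (tan_atlas A)) {x \<in> fst (tchart A c). snd (tchart A c) x \<in> O1}"
        "openin (mtop (tan_atlas A)) {x \<in> fst (tchart A c). snd (tchart A c) x \<in> O2}"
        by (rule openin_chart_preimage[OF TA _ O(1)], use tc in simp, rule openin_chart_preimage[OF TA _ O(2)], use tc in simp)
      show "disjnt {x \<in> fst (tchart A c). snd (tchart A c) x \<in> O1} {x \<in> fst (tchart A c). snd (tchart A c) x \<in> O2}"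
        using O(5) by (auto simp: disjnt_def)
    qed (use tc O in auto)
  next
    case False
    have "fst w \<in> topspace (mtop A)" "fst w' \<in> topspace (mtop A)" using w by (auto simp: topspace_mtop[OF A] tcarrier_iff)
    with H False obtain O1 O2 where O: "openin (mtop A) O1" "openin (mtop A) O2" "fst w \<in> O1" "fst w' \<in> O2" "disjnt O1 O2"
      unfolding Hausdorff_space_def by blast
    show ?thesis
      using openin_fst_preimage[OF A O(1)] openin_fst_preimage[OF A O(2)] w O
      by (intro exI[of _ "{w \<in> tcarrier A. fst w \<in> O1}"] exI[of _ "{w \<in> tcarrier A. fst w \<in> O2}"]) (auto simp: disjnt_def)
  qed
qed

text \<open>The path \<open>s \<mapsto> scale s y\<close> stays in one tangent chart, where it is
  affine; hence it is continuous for the atlas topology.\<close>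

lemma continuous_scale:
  assumes A: "smooth_atlas A" and y: "y \<in> tcarrier A" and X: "openin (mtop (tan_atlas A)) X"
  shows "openin (top_of_set {0..1::real}) {s \<in> {0..1}. scale s y \<in> X}"
proof -
  note TA = smooth_atlas_tan[OF A]
  obtain c where c: "chart_of A c (fst y)" using y by (auto simp: tcarrier_iff elim: carrierE)
  have tc: "tchart A c \<in> tan_atlas A" using c by simp
  let ?f = "\<lambda>s. (snd c (fst y), s *\<^sub>R snd y c)"
  have sm: "snd (tchart A c) (scale s y) = ?f s" "scale s y \<in> fst (tchart A c)" for s
    using scale_tcarrier[OF A y] c by (auto simp: snd_tchart fst_tchart)
  have "scale s y \<in> X \<longleftrightarrow> ?f s \<in> snd (tchart A c) ` (X \<inter> fst (tchart A c))" for s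
  proof -
    have "?f s \<in> snd (tchart A c) ` fst (tchart A c)" using sm[of s] by (metis imageI)
    moreover have "chart_inv (tchart A c) (?f s) = scale s y"
      using chart_inv_left[OF TA tc sm(2)] sm(1) by metis
    ultimately show ?thesis unfolding chart_image_iff[OF TA tc] by simp
  qed
  then have "{s \<in> {0..1}. scale s y \<in> X} = {0..1} \<inter> ?f -` (snd (tchart A c) ` (X \<inter> fst (tchart A c)))" by auto
  moreover have "open (?f -` (snd (tchart A c) ` (X \<inter> fst (tchart A c))))"
    by (intro open_vimage openin_mtop_image[OF TA X tc] continuous_intros)
  ultimately show ?thesis by (auto simp: openin_open)
qed

section \<open>Gluing the local branches of the lift\<close>

context lagrangian_discretization
begin

text \<open>The derivative of the Legendre map keeps the base component, so its kernel is vertical,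
  and regularity makes it trivial.\<close>

lemma FL_local_diffeo:
  assumes v: "v \<in> tcarrier A"
  obtains N where "v \<in> N" "diffeo_on TQ CQ N FL"
proof -
  obtain c where c: "chart_of A c (fst v)" using v by (auto simp: tcarrier_iff elim: carrierE)
  note tc = tchart_chart[OF v c]
  have lc: "chart_of CQ (cchart A c) (FL v)"
    using cchart_chart[OF legendre_ccarrier[OF A L v]] c by simp
  have o: "openin (mtop TQ) (tcarrier A)" using openin_carrier[OF TA] by simp
  have "inj (drep (tchart A c) (cchart A c) FL v)"
  proof (subst linear_injective_0[OF drep_linear[OF smFL v tc lc]], intro allI impI)
    fix u assume u: "drep (tchart A c) (cchart A c) FL v u = 0"
    then have "fst u = 0" "fderiv (pmap A L c) (snd (tchart A c) v) u = 0"
      unfolding drep_legendre[OF A L v c] by (simp_all add: zero_prod_def)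
    moreover have "u = (fst u, snd u)" by simp
    ultimately show "u = 0" using reg[OF v c, of "snd u"] by (metis zero_prod_def)
  qed
  then show ?thesis
    by (rule smooth_map_local_diffeo[OF TA CA smFL v tc lc _ o v]) (use that in blast)
qed

text \<open>The last clause, star-shapedness in the fibres, keeps the path from a zero vector to
  \<open>y\<close> inside \<open>P\<close>, where both components of the cotangent lift stay in
  \<open>FL\<close> of \<open>N\<close>; comparison of branches is based on that path.\<close>

definition lift_nbhd where
  "lift_nbhd N P \<longleftrightarrow> diffeo_on TQ CQ N FL \<and> openin (mtop TTQ) P \<and>
     fst ` P \<subseteq> N \<and> (\<forall>y\<in>P. TFL y \<in> cot_lift_dom A U R \<and> cot_lift A R (TFL y) \<in> FL ` N \<times> FL ` N) \<and>
     (\<forall>y\<in>P. \<forall>s\<in>{0..1}. scale s y \<in> P)"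

lemma lift_nbhdD:
  assumes "lift_nbhd N P"
  shows "diffeo_on TQ CQ N FL" "openin (mtop TTQ) P"
    "y \<in> P \<Longrightarrow> fst y \<in> N" "y \<in> P \<Longrightarrow> TFL y \<in> cot_lift_dom A U R"
    "y \<in> P \<Longrightarrow> fst (cot_lift A R (TFL y)) \<in> FL ` N" "y \<in> P \<Longrightarrow> snd (cot_lift A R (TFL y)) \<in> FL ` N"
    "y \<in> P \<Longrightarrow> 0 \<le> s \<Longrightarrow> s \<le> 1 \<Longrightarrow> scale s y \<in> P"
    "y \<in> P \<Longrightarrow> y \<in> tcarrier TQ"
  using assms openin_mtop_subset[OF TTA, of P] by (auto simp: lift_nbhd_def mem_Times_iff)

lemma smooth_cot_lift_TFL:
  assumes "openin (mtop TTQ) P" "\<And>y. y \<in> P \<Longrightarrow> TFL y \<in> cot_lift_dom A U R"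
  shows "smooth_map TTQ CQ P (\<lambda>y. fst (cot_lift A R (TFL y)))"
    and "smooth_map TTQ CQ P (\<lambda>y. snd (cot_lift A R (TFL y)))"
proof -
  have "P \<subseteq> tcarrier TQ" using openin_mtop_subset[OF TTA assms(1)] by simp
  then have "smooth_map TTQ (tan_atlas CQ) P TFL"
    by (rule smooth_map_subset[OF TTA TCA smooth_TFL assms(1)])
  then have C: "smooth_map TTQ (prod_atlas CQ CQ) P (\<lambda>y. cot_lift A R (TFL y))"
    by (rule smooth_map_compose[OF TTA TCA CACA _ smooth_cot_lift[OF A RD(2)] assms(2)])
  show "smooth_map TTQ CQ P (\<lambda>y. fst (cot_lift A R (TFL y)))"
    "smooth_map TTQ CQ P (\<lambda>y. snd (cot_lift A R (TFL y)))"
    by (rule smooth_map_fst[OF CA CA TTA C], rule smooth_map_snd[OF CA CA TTA C])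
qed

text \<open>Apart from star-shapedness, the conditions are open and hold at the zero vector; a small
  box in a chart then supplies the star shape.\<close>

lemma lift_nbhd_exists:
  assumes v: "v \<in> tcarrier A"
  shows "\<exists>N P. lift_nbhd N P \<and> zero_at v \<in> P"
proof -
  obtain N where N: "v \<in> N" "diffeo_on TQ CQ N FL" by (rule FL_local_diffeo[OF v])
  have oN: "openin (mtop TQ) N" "openin (mtop CQ) (FL ` N)"
    using smooth_mapD_openin[OF diffeo_onD(1)[OF N(2)]] smooth_mapD_openin[OF diffeo_onD(3)[OF N(2)]] by auto
  have v': "v \<in> carrier TQ" using v by simp
  define P1 where "P1 = {y \<in> tcarrier TQ. fst y \<in> N} \<inter> (tcarrier TQ \<inter> TFL -` cot_lift_dom A U R)"
  have P1: "openin (mtop TTQ) P1" unfolding P1_def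
    by (intro openin_Int openin_fst_preimage[OF TA oN(1)]
        smooth_map_preimage_open[OF TTA TCA smooth_TFL smooth_mapD_openin[OF smooth_cot_lift[OF A RD(2)]]])
  note sm = smooth_cot_lift_TFL[OF P1]
  define P0 where "P0 = (P1 \<inter> (\<lambda>y. fst (cot_lift A R (TFL y))) -` (FL ` N)) \<inter> (P1 \<inter> (\<lambda>y. snd (cot_lift A R (TFL y))) -` (FL ` N))"
  have P0: "openin (mtop TTQ) P0" unfolding P0_def
    by (intro openin_Int smooth_map_preimage_open[OF TTA CA sm(1) oN(2)] smooth_map_preimage_open[OF TTA CA sm(2) oN(2)])
      (auto simp: P1_def)
  note zm = zero_in_cot_lift_dom[OF legendre_ccarrier[OF A L v]]
  have z0: "zero_at v \<in> P0"
    using zero_at_tcarrier[OF TA v'] N(1) zm by (auto simp: P0_def P1_def TFL_zero[OF v])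
  obtain c where c: "chart_of A c (fst v)" using v by (auto simp: tcarrier_iff elim: carrierE)
  let ?c = "tchart A c" and ?k = "tchart TQ (tchart A c)"
  have tc: "chart_of TQ ?c v" by (rule tchart_chart[OF v c])
  have zk: "chart_of TTQ ?k (zero_at v)" by (rule zero_at_chart[OF TA tc])
  then have k: "?k \<in> TTQ" by simp
  have ok: "open (snd ?k ` (P0 \<inter> fst ?k))" by (rule openin_mtop_image[OF TTA P0 k])
  have "snd ?k (zero_at v) \<in> snd ?k ` (P0 \<inter> fst ?k)" using z0 zk by blast
  then have "(snd ?c v, 0) \<in> snd ?k ` (P0 \<inter> fst ?k)" by (simp add: snd_tchart_zero)
  then obtain B1 B2 where B: "open B1" "open B2" "(snd ?c v, 0) \<in> B1 \<times> B2" "B1 \<times> B2 \<subseteq> snd ?k ` (P0 \<inter> fst ?k)"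
    by (rule open_prod_elim[OF ok])
  from B(2,3) obtain e where e: "e > 0" "ball 0 e \<subseteq> B2" by (auto elim: openE)
  \<comment> \<open>A ball about 0 in the fibre coordinate, unlike a general open set
    \<open>B2\<close>, is preserved under scaling by numbers in the unit interval.\<close>
  define P where "P = {y \<in> fst ?k. snd ?k y \<in> B1 \<times> ball 0 e}"
  have P: "openin (mtop TTQ) P" unfolding P_def
    by (rule openin_chart_preimage[OF TTA k]) (intro open_Times B open_ball)
  have PP0: "y \<in> P0" if "y \<in> P" for y
  proof -
    have y: "snd ?k y \<in> B1 \<times> ball 0 e" "y \<in> fst ?k" using that by (simp_all only: P_def mem_Collect_eq)
    have "B1 \<times> ball 0 e \<subseteq> snd ?k ` (P0 \<inter> fst ?k)" using Sigma_mono[OF subset_refl e(2), of B1] B(4) by (rule subset_trans)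
    then have "snd ?k y \<in> snd ?k ` (P0 \<inter> fst ?k)" using y(1) by (rule subsetD)
    then have "chart_inv ?k (snd ?k y) \<in> P0" unfolding chart_image_iff(1)[OF TTA k] by (rule conjunct2)
    then show "y \<in> P0" unfolding chart_inv_left[OF TTA k y(2)] .
  qed
  have star: "scale s y \<in> P" if "y \<in> P" "s \<in> {0..1}" for y s
  proof -
    have y: "y \<in> tcarrier TQ" "fst y \<in> fst ?c" "snd ?c (fst y) \<in> B1" "norm (snd y ?c) < e"
      using that(1) by (auto simp: P_def fst_tchart[of _ "TQ"] snd_tchart[of "TQ"])
    have "norm (s *\<^sub>R snd y ?c) \<le> norm (snd y ?c)" using that(2) by (simp add: mult_left_le_one_le)
    then show ?thesis
      using y scale_tcarrier[OF TA y(1), of s]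
      by (auto simp: P_def fst_tchart[of _ "TQ"] snd_tchart[of "TQ"])
  qed
  have "lift_nbhd N P" unfolding lift_nbhd_def
  proof (intro conjI ballI N(2) P)
    show "fst ` P \<subseteq> N" using PP0 by (auto simp: P0_def P1_def)
    show "TFL y \<in> cot_lift_dom A U R" "cot_lift A R (TFL y) \<in> FL ` N \<times> FL ` N" if "y \<in> P" for y
      using PP0[OF that] by (auto simp: P0_def P1_def mem_Times_iff)
  qed (rule star)
  moreover have "zero_at v \<in> P" using zk B(3) e by (simp add: P_def snd_tchart_zero)
  ultimately show ?thesis by blast
qed

text \<open>\<open>M\<close> stands for either component of \<open>cot_lift A R \<circ> TFL\<close>.\<close>
lemma lift_nbhd_unique:
  assumes H: "Hausdorff_space (mtop TQ)" and NP: "lift_nbhd N P" "lift_nbhd N' P'" and y: "y \<in> P" "y \<in> P'"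
    and M: "\<And>Q. openin (mtop TTQ) Q \<Longrightarrow> (\<And>y. y \<in> Q \<Longrightarrow> TFL y \<in> cot_lift_dom A U R) \<Longrightarrow>
        smooth_map TTQ CQ Q M"
      "\<And>N P y. lift_nbhd N P \<Longrightarrow> y \<in> P \<Longrightarrow> M y \<in> FL ` N"
      "\<And>v. v \<in> tcarrier A \<Longrightarrow> M (zero_at v) = FL v"
  shows "inv_into N FL (M y) = inv_into N' FL (M y)"
proof -
  let ?I = "top_of_set {0..1::real}"
  have yt: "y \<in> tcarrier TQ" by (rule lift_nbhdD(8)[OF NP(1) y(1)])
  have path: "continuous_map ?I (mtop TQ) (\<lambda>s. inv_into N FL (M (scale s y)))"
    if NP: "lift_nbhd N P" "y \<in> P" for N P
  proof -
    note d = lift_nbhdD[OF NP(1)]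
    have "smooth_map TTQ CQ P M" by (rule M(1)[OF d(2,4)])
    then have sm: "smooth_map TTQ TQ P (\<lambda>y. inv_into N FL (M y))"
      by (rule smooth_map_compose[OF TTA CA TA _ diffeo_onD(3)[OF d(1)] M(2)[OF NP(1)]])
    show ?thesis unfolding continuous_map_def
    proof (intro conjI allI impI)
      show "(\<lambda>s. inv_into N FL (M (scale s y))) \<in> topspace ?I \<rightarrow> topspace (mtop TQ)"
        using smooth_mapD_carrier[OF sm d(7)[OF NP(2)]] by (auto simp: topspace_mtop[OF TA])
      fix X assume X: "openin (mtop TQ) X"
      have "{s \<in> topspace ?I. inv_into N FL (M (scale s y)) \<in> X} =
          {s \<in> {0..1}. scale s y \<in> P \<inter> (\<lambda>y. inv_into N FL (M y)) -` X}"
        using d(7)[OF NP(2)] by auto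
      then show "openin ?I {s \<in> topspace ?I. inv_into N FL (M (scale s y)) \<in> X}"
        using continuous_scale[OF TA yt smooth_map_preimage_open[OF TTA TA sm X]] by simp
    qed
  qed
  note p = path[OF NP(1) y(1)] path[OF NP(2) y(2)]
  let ?g = "\<lambda>s. inv_into N FL (M (scale s y))" and ?g' = "\<lambda>s. inv_into N' FL (M (scale s y))"
  have g: "?g s \<in> N \<and> FL (?g s) = M (scale s y) \<and> ?g' s \<in> N' \<and> FL (?g' s) = M (scale s y)" if "s \<in> {0..1}" for s
  proof -
    have "M (scale s y) \<in> FL ` N" "M (scale s y) \<in> FL ` N'"
      using that by (auto intro!: M(2)[OF NP(1)] M(2)[OF NP(2)] lift_nbhdD(7)[OF NP(1) y(1)] lift_nbhdD(7)[OF NP(2) y(2)])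
    then show ?thesis by (simp add: inv_into_into f_inv_into_f)
  qed
  \<comment> \<open>The times at which the two lifted paths agree; it will be open and closed in the
    unit interval and contain 0.\<close>
  define J where "J = {s \<in> {0..1}. ?g s = ?g' s}"
  have oNN: "openin (mtop TQ) (N \<inter> N')"
    by (intro openin_Int smooth_mapD_openin[OF diffeo_onD(1)[OF lift_nbhdD(1)[OF NP(1)]]]
        smooth_mapD_openin[OF diffeo_onD(1)[OF lift_nbhdD(1)[OF NP(2)]]])
  \<comment> \<open>Equal lifts lie in both \<open>N\<close> and \<open>N'\<close>. Conversely,
    lifts lying in both sets have the same image under \<open>FL\<close>, which is injective on
    \<open>N\<close>. Agreement is thus an open condition.\<close>
  have J: "J = {s \<in> {0..1}. ?g s \<in> N \<inter> N'} \<inter> {s \<in> {0..1}. ?g' s \<in> N \<inter> N'}"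
  proof (intro set_eqI iffI)
    fix s assume "s \<in> J"
    then show "s \<in> {s \<in> {0..1}. ?g s \<in> N \<inter> N'} \<inter> {s \<in> {0..1}. ?g' s \<in> N \<inter> N'}"
      using g[of s] by (auto simp: J_def)
  next
    fix s assume s: "s \<in> {s \<in> {0..1}. ?g s \<in> N \<inter> N'} \<inter> {s \<in> {0..1}. ?g' s \<in> N \<inter> N'}"
    then have "?g s = ?g' s"
      using g[of s] by (intro inj_onD[OF diffeo_onD(2)[OF lift_nbhdD(1)[OF NP(1)]]]) auto
    then show "s \<in> J" using s by (auto simp: J_def)
  qed
  have "openin ?I J" unfolding J
    using openin_continuous_map_preimage[OF p(1) oNN] openin_continuous_map_preimage[OF p(2) oNN] by (auto intro!: openin_Int)
  moreover have "closedin ?I J"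
    using closedin_continuous_maps_eq[OF H p] by (simp add: J_def)
  \<comment> \<open>At time 0 the path is at the zero vector, and each branch returns the base point
    of \<open>y\<close>, which lies in \<open>N\<close> and in \<open>N'\<close>.\<close>
  moreover have "0 \<in> J"
  proof -
    have fy: "fst y \<in> tcarrier A" using yt by (simp add: tcarrier_iff)
    have z: "scale 0 y = zero_at (fst y)" by (simp add: scale_def zero_at_def)
    have "inv_into N FL (FL (fst y)) = fst y" "inv_into N' FL (FL (fst y)) = fst y"
      by (rule inv_into_f_f[OF diffeo_onD(2)[OF lift_nbhdD(1)[OF NP(1)]] lift_nbhdD(3)[OF NP(1) y(1)]],
          rule inv_into_f_f[OF diffeo_onD(2)[OF lift_nbhdD(1)[OF NP(2)]] lift_nbhdD(3)[OF NP(2) y(2)]])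
    then show ?thesis by (simp add: J_def z M(3)[OF fy])
  qed
  moreover have "connected {0..1::real}" by simp
  ultimately have "J = {0..1}" unfolding connected_clopen by blast
  then have "1 \<in> J" by simp
  moreover have "scale 1 y = y" by (simp add: scale_def)
  ultimately show ?thesis by (simp add: J_def)
qed

lemma lagrangian_lift_exists:
  assumes "Hausdorff_space (mtop A)"
  shows "\<exists>D S. lagrangian_lift A U R L D S"
proof -
  note H = Hausdorff_tan[OF A assms]
  define F where "F N y = map_prod (inv_into N FL) (inv_into N FL) (cot_lift A R (TFL y))" for N y
  have uniq: "F N y = F N' y" if "lift_nbhd N P" "lift_nbhd N' P'" "y \<in> P" "y \<in> P'" for N N' P P' y
  proof -
    have z: "cot_lift A R (TFL (zero_at v)) = (FL v, FL v)" if "v \<in> tcarrier A" for v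
      using zero_in_cot_lift_dom(2)[OF legendre_ccarrier[OF A L that]] by (simp add: TFL_zero[OF that])
    have "inv_into N FL (fst (cot_lift A R (TFL y))) = inv_into N' FL (fst (cot_lift A R (TFL y)))"
      by (rule lift_nbhd_unique[OF H that smooth_cot_lift_TFL(1)]) (auto simp: z lift_nbhdD)
    moreover have "inv_into N FL (snd (cot_lift A R (TFL y))) = inv_into N' FL (snd (cot_lift A R (TFL y)))"
      by (rule lift_nbhd_unique[OF H that smooth_cot_lift_TFL(2)]) (auto simp: z lift_nbhdD)
    ultimately show ?thesis by (simp add: F_def map_prod_def case_prod_unfold)
  qed
  define D where "D = \<Union>{P. \<exists>N. lift_nbhd N P}"
  \<comment> \<open>Any admissible branch may be picked, because \<open>uniq\<close> makes the value
    independent of it.\<close>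
  define S where "S y = F (SOME N. \<exists>P. lift_nbhd N P \<and> y \<in> P) y" for y
  have S: "S y = F N y" if "lift_nbhd N P" "y \<in> P" for N P y
  proof -
    have "\<exists>N. \<exists>P. lift_nbhd N P \<and> y \<in> P" using that by blast
    from someI_ex[OF this] obtain P' where "lift_nbhd (SOME N. \<exists>P. lift_nbhd N P \<and> y \<in> P) P'" "y \<in> P'" by blast
    from uniq[OF this(1) that(1) this(2) that(2)] show ?thesis by (simp add: S_def)
  qed
  have "lagrangian_lift A U R L D S"
    unfolding lagrangian_lift_def Let_def
  proof (intro conjI ballI)
    show "openin (mtop TTQ) D"
      unfolding D_def by (rule openin_Union) (auto dest: lift_nbhdD(2))
    show "zero_at ` tcarrier A \<subseteq> D"
    proof (rule image_subsetI)
      fix v assume "v \<in> tcarrier A"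
      from lift_nbhd_exists[OF this] show "zero_at v \<in> D" unfolding D_def by blast
    qed
    fix w assume "w \<in> D"
    then obtain N P where NP: "lift_nbhd N P" "w \<in> P" by (auto simp: D_def)
    note d = lift_nbhdD[OF NP(1)]
    show "\<exists>N P. diffeo_on TQ CQ N FL \<and>
      openin (mtop TTQ) P \<and> w \<in> P \<and> P \<subseteq> D \<and> fst ` P \<subseteq> N \<and>
      (\<forall>y\<in>P. TFL y \<in> cot_lift_dom A U R \<and> cot_lift A R (TFL y) \<in> FL ` N \<times> FL ` N \<and>
        S y = map_prod (inv_into N FL) (inv_into N FL) (cot_lift A R (TFL y)))"
    proof (intro exI conjI ballI)
      show "diffeo_on TQ CQ N FL" "openin (mtop TTQ) P" "w \<in> P"
        by (fact d(1), fact d(2), fact NP(2))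
      show "P \<subseteq> D" using NP(1) by (auto simp: D_def)
      show "fst ` P \<subseteq> N" using d(3) by auto
      fix y assume y: "y \<in> P"
      show "TFL y \<in> cot_lift_dom A U R" by (rule d(4)[OF y])
      show "cot_lift A R (TFL y) \<in> FL ` N \<times> FL ` N" using d(5,6)[OF y] by (simp add: mem_Times_iff)
      show "S y = map_prod (inv_into N FL) (inv_into N FL) (cot_lift A R (TFL y))"
        unfolding S[OF NP(1) y] F_def ..
    qed
  qed
  then show ?thesis by blast
qed

end

theorem proposition5p7:
  fixes A :: "('q, real^'n) atlas"
    and U :: "('q, real^'n) tbundle set"
    and R :: "('q, real^'n) tbundle \<Rightarrow> 'q \<times> 'q"
    and L :: "('q, real^'n) tbundle \<Rightarrow> real"
  assumes "smooth_manifold A"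
    and "discretization_map A U R"
    and "smooth_function (tan_atlas A) L"
    and "regular A L"
  shows "(\<exists>D S. lagrangian_lift A U R L D S) \<and>
    (\<forall>D S. lagrangian_lift A U R L D S \<longrightarrow>
       symplectic_integrator (tan_atlas A) (Omega_L A L) (Gamma_L A L) D S \<and>
       discretization_map (tan_atlas A) D S)"
proof -
  have A: "smooth_atlas A" and H: "Hausdorff_space (mtop A)"
    using assms(1) by (auto simp: smooth_manifold_def)
  interpret lagrangian_discretization A U R L
    by unfold_locales (use A assms regular_inj in blast)+
  have "symplectic_integrator (tan_atlas A) (Omega_L A L) (Gamma_L A L) D S \<and> discretization_map (tan_atlas A) D S"
    if "lagrangian_lift A U R L D S" for D S
  proof -
    interpret lifted_discretization A U R L D S by unfold_locales (rule that)
    show ?thesis using lift_symplectic_integrator lift_discretization by blast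
  qed
  then show ?thesis using lagrangian_lift_exists[OF H] by blast
qed

end
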